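(* Let $\mathbb{K}$ be a field, let $n\ge 1$, and let $H$ be a Hopf algebra over $\mathbb{K}$ coacting faithfully on the diagonal algebra $\mathbb{K}^n$. Assume that at least one of the following holds: (1) the linear map $\psi:\mathbb{K}^n\to\mathbb{K}$, $\psi(e_i)=1$ for all $i$, is $H$-colinear (with $\mathbb{K}$ the trivial comodule); (2) the antipode of $H$ satisfies $S^2=\mathrm{id}_H$; (3) $\mathbb{K}$ has characteristic zero or characteristic $p>n$, and $H$ is cosemisimple. Then there exists a sequence of positive integers $m_1\ge\cdots\ge m_k>0$, with $m_1+\cdots+m_k=n$ and $k=\dim\big((\mathbb{K}^n)^{\mathrm{co}\,H}\big)$, together with ergodic coactions of $H$ on each algebra $\mathbb{K}^{m_i}$, and a surjective Hopf algebra morphism $$A_s(m_1,\mathbb{K})*\cdots*A_s(m_k,\mathbb{K})\longrightarrow H.$$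
   Context: $\mathbb{K}^n$ is the diagonal algebra with canonical basis $e_1,\dots,e_n$, $e_ie_j=\delta_{ij}e_i$, $1=\sum_i e_i$. A coaction of a Hopf algebra $H$ on an algebra $A$ is a unital algebra map $\alpha:A\to A\otimes H$ that makes $A$ a right $H$-comodule. Its fixed point subalgebra is $A^{\mathrm{co}\,H}=\{a\in A:\alpha(a)=a\otimes 1\}$; the coaction is ergodic if $A^{\mathrm{co}\,H}=\mathbb{K}1$; it is faithful if $H$ is generated as an algebra by the space of coefficients $\{(\phi\otimes\mathrm{id}_H)(\alpha(a)) : a\in A,\ \phi\in A^*\}$. A Hopf algebra is cosemisimple if its category of comodules is semisimple. The symbol $*$ denotes the free product (coproduct) of Hopf algebras, whose underlying algebra is the free product of unital algebras. $A_s(m,\mathbb{K})$ is the $\mathbb{K}$-algebra presented by generators $u_{ij}$, $1\le i,j\le m$, and relations, for all $i,j,k$: $u_{ki}u_{kj}=\delta_{ij}u_{ki}$, $\sum_{l=1}^m u_{il}=1$, $u_{ik}u_{jk}=\delta_{ij}u_{ik}$, $\sum_{l=1}^m u_{li}=1$. It is a Hopf algebra with $\Delta(u_{ij})=\sum_k u_{ik}\otimes u_{kj}$, $\varepsilon(u_{ij})=\delta_{ij}$, $S(u_{ij})=u_{ji}$. *)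

theory Defs
  imports
    "Jordan_Normal_Form.VS_Connect"
    "HOL-Algebra.QuotRing"
    "HOL-Library.Poly_Mapping"
begin

text \<open>
  The ground field is a type \<open>'k\<close> of class \<open>field\<close>, seen as a ring record through \<open>class_ring\<close>.
  Vector spaces and algebras over it are \<open>module\<close> records with explicit carriers; for a mere vector
  space the multiplicative fields of the record are irrelevant.
\<close>


section \<open>Algebras\<close>

locale unital_algebra = ring A + vectorspace "class_ring :: 'k ring" A
  for A :: "('k::field, 'a, 'm) module_scheme" (structure) +
  assumes smult_mult_left:
      "\<lbrakk>a \<in> carrier A; b \<in> carrier A\<rbrakk> \<Longrightarrow> (c \<odot> a) \<otimes> b = c \<odot> (a \<otimes> b)"
    and smult_mult_right:
      "\<lbrakk>a \<in> carrier A; b \<in> carrier A\<rbrakk> \<Longrightarrow> a \<otimes> (c \<odot> b) = c \<odot> (a \<otimes> b)"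

definition algebra_hom ::
  "('k::field, 'a, 'm) module_scheme \<Rightarrow> ('k, 'b, 'l) module_scheme \<Rightarrow> ('a \<Rightarrow> 'b) set"
  where "algebra_hom A B = Ring.ring_hom A B \<inter> LinearCombinations.module_hom class_ring A B"

definition base_algebra :: "('k::field, 'k) module"
  where "base_algebra = \<lparr>carrier = UNIV, mult = (*), one = 1, zero = 0, add = (+), smult = (*)\<rparr>"

definition opposite_algebra :: "('k, 'a, 'm) module_scheme \<Rightarrow> ('k, 'a, 'm) module_scheme"
  where "opposite_algebra A = A\<lparr>mult := \<lambda>x y. y \<otimes>\<^bsub>A\<^esub> x\<rparr>"

text \<open>The diagonal algebra on the canonical basis \<open>unit_vec n i\<close>, \<open>i < n\<close>.\<close>

definition diag_algebra :: "nat \<Rightarrow> ('k::field, 'k vec) module"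
  where "diag_algebra n =
    \<lparr>carrier = carrier_vec n, mult = (\<lambda>v w. vec n (\<lambda>i. v $ i * w $ i)), one = vec n (\<lambda>i. 1),
     zero = 0\<^sub>v n, add = (+), smult = (\<cdot>\<^sub>v)\<rparr>"

inductive_set generated_subalgebra :: "('k, 'a, 'm) module_scheme \<Rightarrow> 'a set \<Rightarrow> 'a set"
  for A :: "('k, 'a, 'm) module_scheme" and S :: "'a set"
  where
    one: "\<one>\<^bsub>A\<^esub> \<in> generated_subalgebra A S"
  | incl: "a \<in> S \<Longrightarrow> a \<in> generated_subalgebra A S"
  | add: "\<lbrakk>a \<in> generated_subalgebra A S; b \<in> generated_subalgebra A S\<rbrakk>
      \<Longrightarrow> a \<oplus>\<^bsub>A\<^esub> b \<in> generated_subalgebra A S"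
  | mult: "\<lbrakk>a \<in> generated_subalgebra A S; b \<in> generated_subalgebra A S\<rbrakk>
      \<Longrightarrow> a \<otimes>\<^bsub>A\<^esub> b \<in> generated_subalgebra A S"
  | smult: "a \<in> generated_subalgebra A S \<Longrightarrow> c \<odot>\<^bsub>A\<^esub> a \<in> generated_subalgebra A S"

text \<open>The library quotient ring, with the scalar action \<open>c (p + N) = c p + N\<close>.\<close>

definition quotient_algebra :: "('k, 'a) module \<Rightarrow> 'a set \<Rightarrow> ('k, 'a set) module"
  where "quotient_algebra F N =
    ring.extend (F Quot N) (module.fields (\<lambda>c t. N +>\<^bsub>F\<^esub> (c \<odot>\<^bsub>F\<^esub> (SOME p. p \<in> t))))"


section \<open>Tensor products\<close>

text \<open>
  The free vector space on \<open>carrier A \<times> carrier B\<close>, with the product that extends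
  \<open>(a, b) (a', b') = (a a', b b')\<close> bilinearly. The tensor product is its quotient by the bilinearity
  relations, which span an ideal when \<open>A\<close> and \<open>B\<close> are algebras.
\<close>

definition formal_tensors ::
  "('k::field, 'a, 'm) module_scheme \<Rightarrow> ('k, 'b, 'l) module_scheme \<Rightarrow> ('k, 'a \<times> 'b \<Rightarrow>\<^sub>0 'k) module"
  where "formal_tensors A B =
    \<lparr>carrier = {p. Poly_Mapping.keys p \<subseteq> carrier A \<times> carrier B},
     mult = (\<lambda>p q. \<Sum>(a, b)\<in>Poly_Mapping.keys p. \<Sum>(a', b')\<in>Poly_Mapping.keys q.
       Poly_Mapping.single (a \<otimes>\<^bsub>A\<^esub> a', b \<otimes>\<^bsub>B\<^esub> b')
         (Poly_Mapping.lookup p (a, b) * Poly_Mapping.lookup q (a', b'))),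
     one = Poly_Mapping.single (\<one>\<^bsub>A\<^esub>, \<one>\<^bsub>B\<^esub>) 1,
     zero = 0, add = (+), smult = (\<lambda>c. Poly_Mapping.map ((*) c))\<rparr>"

definition tensor_relators ::
  "('k::field, 'a, 'm) module_scheme \<Rightarrow> ('k, 'b, 'l) module_scheme \<Rightarrow> ('a \<times> 'b \<Rightarrow>\<^sub>0 'k) set"
  where "tensor_relators A B =
    {Poly_Mapping.single (a \<oplus>\<^bsub>A\<^esub> a', b) 1 - Poly_Mapping.single (a, b) 1 - Poly_Mapping.single (a', b) 1
      | a a' b. a \<in> carrier A \<and> a' \<in> carrier A \<and> b \<in> carrier B} \<union>
    {Poly_Mapping.single (a, b \<oplus>\<^bsub>B\<^esub> b') 1 - Poly_Mapping.single (a, b) 1 - Poly_Mapping.single (a, b') 1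
      | a b b'. a \<in> carrier A \<and> b \<in> carrier B \<and> b' \<in> carrier B} \<union>
    {Poly_Mapping.single (c \<odot>\<^bsub>A\<^esub> a, b) 1 - Poly_Mapping.single (a, b) c
      | c a b. a \<in> carrier A \<and> b \<in> carrier B} \<union>
    {Poly_Mapping.single (a, c \<odot>\<^bsub>B\<^esub> b) 1 - Poly_Mapping.single (a, b) c
      | c a b. a \<in> carrier A \<and> b \<in> carrier B}"

definition tensor_null ::
  "('k::field, 'a, 'm) module_scheme \<Rightarrow> ('k, 'b, 'l) module_scheme \<Rightarrow> ('a \<times> 'b \<Rightarrow>\<^sub>0 'k) set"
  where "tensor_null A B = LinearCombinations.module.span class_ring (formal_tensors A B) (tensor_relators A B)"

definition tensor ::
  "('k::field, 'a, 'm) module_scheme \<Rightarrow> ('k, 'b, 'l) module_scheme \<Rightarrow>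
    ('k, ('a \<times> 'b \<Rightarrow>\<^sub>0 'k) set) module"
  where "tensor A B = quotient_algebra (formal_tensors A B) (tensor_null A B)"

definition tens ::
  "('k::field, 'a, 'm) module_scheme \<Rightarrow> ('k, 'b, 'l) module_scheme \<Rightarrow>
    'a \<Rightarrow> 'b \<Rightarrow> ('a \<times> 'b \<Rightarrow>\<^sub>0 'k) set"
  where "tens A B a b = tensor_null A B +>\<^bsub>formal_tensors A B\<^esub> Poly_Mapping.single (a, b) 1"

text \<open>
  The linear map into \<open>C\<close> induced by \<open>\<beta>\<close>. It is only used for bilinear \<open>\<beta>\<close>, where the choice of the
  representative is immaterial.
\<close>

definition tensor_lift ::
  "('k::field, 'c, 'm) module_scheme \<Rightarrow> ('a \<Rightarrow> 'b \<Rightarrow> 'c) \<Rightarrow> ('a \<times> 'b \<Rightarrow>\<^sub>0 'k) set \<Rightarrow> 'c"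
  where "tensor_lift C \<beta> t = (let p = (SOME p. p \<in> t) in
    \<Oplus>\<^bsub>C\<^esub>x\<in>Poly_Mapping.keys p. Poly_Mapping.lookup p x \<odot>\<^bsub>C\<^esub> \<beta> (fst x) (snd x))"

text \<open>\<open>f \<otimes> g\<close> with values in \<open>A' \<otimes> B'\<close>.\<close>

definition tensor_map ::
  "('k::field, 'c, 'm) module_scheme \<Rightarrow> ('k, 'd, 'l) module_scheme \<Rightarrow> ('a \<Rightarrow> 'c) \<Rightarrow> ('b \<Rightarrow> 'd) \<Rightarrow>
    ('a \<times> 'b \<Rightarrow>\<^sub>0 'k) set \<Rightarrow> ('c \<times> 'd \<Rightarrow>\<^sub>0 'k) set"
  where "tensor_map A' B' f g = tensor_lift (tensor A' B') (\<lambda>a b. tens A' B' (f a) (g b))"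

text \<open>The associator \<open>(A \<otimes> B) \<otimes> C \<rightarrow> A \<otimes> (B \<otimes> C)\<close>.\<close>

definition tensor_assoc where
  "tensor_assoc A B C =
    tensor_lift (tensor A (tensor B C)) (\<lambda>t c.
      tensor_lift (tensor A (tensor B C)) (\<lambda>a b. tens A (tensor B C) a (tens B C b c)) t)"


section \<open>Hopf algebras\<close>

record (overloaded) ('k, 'a) hopf = "('k, 'a) module" +
  comult :: "'a \<Rightarrow> ('a \<times> 'a \<Rightarrow>\<^sub>0 'k) set"
  counit :: "'a \<Rightarrow> 'k"
  antipode :: "'a \<Rightarrow> 'a"

locale hopf_algebra = unital_algebra H
  for H :: "('k::field, 'a, 'm) hopf_scheme" (structure) +
  assumes comult_hom: "comult H \<in> algebra_hom H (tensor H H)"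
    and counit_hom: "counit H \<in> algebra_hom H base_algebra"
    and coassoc: "h \<in> carrier H \<Longrightarrow>
      tensor_assoc H H H (tensor_map (tensor H H) H (comult H) id (comult H h)) =
      tensor_map H (tensor H H) id (comult H) (comult H h)"
    and counit_left: "h \<in> carrier H \<Longrightarrow> tensor_lift H (\<lambda>a b. counit H a \<odot> b) (comult H h) = h"
    and counit_right: "h \<in> carrier H \<Longrightarrow> tensor_lift H (\<lambda>a b. counit H b \<odot> a) (comult H h) = h"
    and antipode_linear: "antipode H \<in> LinearCombinations.module_hom class_ring H H"
    and antipode_left: "h \<in> carrier H \<Longrightarrow>
      tensor_lift H (\<lambda>a b. antipode H a \<otimes> b) (comult H h) = counit H h \<odot> \<one>"
    and antipode_right: "h \<in> carrier H \<Longrightarrow>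
      tensor_lift H (\<lambda>a b. a \<otimes> antipode H b) (comult H h) = counit H h \<odot> \<one>"

text \<open>Between Hopf algebras, compatibility with the antipodes follows from the other conditions.\<close>

definition hopf_hom ::
  "('k::field, 'a, 'm) hopf_scheme \<Rightarrow> ('k, 'b, 'l) hopf_scheme \<Rightarrow> ('a \<Rightarrow> 'b) set"
  where "hopf_hom H L = {f \<in> algebra_hom H L. \<forall>h\<in>carrier H.
    comult L (f h) = tensor_map L L f f (comult H h) \<and>
    counit L (f h) = counit H h \<and>
    antipode L (f h) = f (antipode H h)}"


section \<open>Comodules and coactions\<close>

locale comodule = vectorspace "class_ring :: 'k ring" V
  for H :: "('k::field, 'a, 'm) hopf_scheme"
    and V :: "('k, 'v, 'l) module_scheme" (structure)
    and \<rho> :: "'v \<Rightarrow> ('v \<times> 'a \<Rightarrow>\<^sub>0 'k) set" +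
  assumes coact_linear: "\<rho> \<in> LinearCombinations.module_hom class_ring V (tensor V H)"
    and coact_coassoc: "v \<in> carrier V \<Longrightarrow>
      tensor_assoc V H H (tensor_map (tensor V H) H \<rho> id (\<rho> v)) =
      tensor_map V (tensor H H) id (comult H) (\<rho> v)"
    and coact_counit: "v \<in> carrier V \<Longrightarrow> tensor_lift V (\<lambda>w h. counit H h \<odot> w) (\<rho> v) = v"

definition colinear where
  "colinear H V \<rho> W \<sigma> f \<longleftrightarrow> f \<in> LinearCombinations.module_hom class_ring V W \<and>
    (\<forall>v\<in>carrier V. tensor_map W H f id (\<rho> v) = \<sigma> (f v))"

definition trivial_coaction ::
  "('k::field, 'a, 'm) hopf_scheme \<Rightarrow> 'k \<Rightarrow> ('k \<times> 'a \<Rightarrow>\<^sub>0 'k) set"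
  where "trivial_coaction H c = tens base_algebra H c \<one>\<^bsub>H\<^esub>"

locale coaction = unital_algebra A + comodule H A \<alpha>
  for H :: "('k::field, 'a, 'm) hopf_scheme"
    and A :: "('k, 'b, 'l) module_scheme" (structure)
    and \<alpha> :: "'b \<Rightarrow> ('b \<times> 'a \<Rightarrow>\<^sub>0 'k) set" +
  assumes coaction_hom: "\<alpha> \<in> algebra_hom A (tensor A H)"

definition coinvariants where
  "coinvariants H A \<alpha> = {a \<in> carrier A. \<alpha> a = tens A H a \<one>\<^bsub>H\<^esub>}"

definition ergodic where
  "ergodic H A \<alpha> \<longleftrightarrow> coinvariants H A \<alpha> = {c \<odot>\<^bsub>A\<^esub> \<one>\<^bsub>A\<^esub> | c. True}"

definition coefficients where
  "coefficients H A \<alpha> = {tensor_lift H (\<lambda>b h. \<phi> b \<odot>\<^bsub>H\<^esub> h) (\<alpha> a) | a \<phi>.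
    a \<in> carrier A \<and> \<phi> \<in> LinearCombinations.module_hom class_ring A base_algebra}"

definition faithful_coaction where
  "faithful_coaction H A \<alpha> \<longleftrightarrow> coaction H A \<alpha> \<and>
    generated_subalgebra H (coefficients H A \<alpha>) = carrier H"


section \<open>Cosemisimplicity\<close>

definition subcomodule where
  "subcomodule H V \<rho> W \<longleftrightarrow> VectorSpace.subspace class_ring W V \<and>
    (\<forall>w\<in>W. \<rho> w \<in> LinearCombinations.module.span class_ring (tensor V H) {tens V H w' h | w' h. w' \<in> W \<and> h \<in> carrier H})"

definition simple_subcomodule where
  "simple_subcomodule H V \<rho> W \<longleftrightarrow> subcomodule H V \<rho> W \<and> W \<noteq> {\<zero>\<^bsub>V\<^esub>} \<and>
    (\<forall>U. subcomodule H V \<rho> U \<longrightarrow> U \<subseteq> W \<longrightarrow> U = {\<zero>\<^bsub>V\<^esub>} \<or> U = W)"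

text \<open>\<open>V\<close> is the direct sum of a family of simple subcomodules.\<close>

definition semisimple_comodule where
  "semisimple_comodule H V \<rho> \<longleftrightarrow> (\<exists>\<F>. (\<forall>W\<in>\<F>. simple_subcomodule H V \<rho> W) \<and>
    LinearCombinations.module.span class_ring V (\<Union>\<F>) = carrier V \<and>
    (\<forall>W\<in>\<F>. W \<inter> LinearCombinations.module.span class_ring V (\<Union>(\<F> - {W})) = {\<zero>\<^bsub>V\<^esub>}))"

text \<open>
  The comodules quantified over have carriers inside the type \<open>nat \<Rightarrow> 'a\<close>, where \<open>'a\<close> is the type of
  elements of \<open>H\<close>. As \<open>H \<noteq> 0\<close>, this type has at least as many elements as any vector space of
  dimension at most \<open>max \<aleph>\<^sub>0 |H|\<close>, so that every comodule of such a dimension (in particular every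
  finite-dimensional one, and \<open>H\<close> itself) occurs up to isomorphism. Every comodule is the sum of its
  finite-dimensional subcomodules, hence larger comodules are then semisimple as well.
\<close>

definition cosemisimple :: "('k::field, 'a, 'm) hopf_scheme \<Rightarrow> bool"
  where "cosemisimple H \<longleftrightarrow>
    (\<forall>(V :: ('k, nat \<Rightarrow> 'a) module) \<rho>. comodule H V \<rho> \<longrightarrow> semisimple_comodule H V \<rho>)"


section \<open>Algebras given by generators and relations\<close>

datatype 'x free_monoid = Word (letters: "'x list")

instantiation free_monoid :: (type) monoid_add
begin

definition "0 = Word []"

definition "v + w = Word (letters v @ letters w)"

instance
  by standard (simp_all add: zero_free_monoid_def plus_free_monoid_def)

end

text \<open>By the monoid structure above, the library product of finitely supported functions on words
  is the one of noncommutative polynomials.\<close>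

definition free_algebra :: "'x set \<Rightarrow> ('k::field, 'x free_monoid \<Rightarrow>\<^sub>0 'k) module"
  where "free_algebra X =
    \<lparr>carrier = {p. \<forall>w\<in>Poly_Mapping.keys p. set (letters w) \<subseteq> X},
     mult = (*), one = 1, zero = 0, add = (+), smult = (\<lambda>c. Poly_Mapping.map ((*) c))\<rparr>"

abbreviation letter :: "'x \<Rightarrow> 'x free_monoid \<Rightarrow>\<^sub>0 'k::field"
  where "letter x \<equiv> Poly_Mapping.single (Word [x]) 1"

definition presented_algebra ::
  "'x set \<Rightarrow> ('x free_monoid \<Rightarrow>\<^sub>0 'k::field) set \<Rightarrow> ('k, ('x free_monoid \<Rightarrow>\<^sub>0 'k) set) module"
  where "presented_algebra X R =
    quotient_algebra (free_algebra X) (genideal (free_algebra X) R)"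

definition presented_gen ::
  "'x set \<Rightarrow> ('x free_monoid \<Rightarrow>\<^sub>0 'k::field) set \<Rightarrow> 'x \<Rightarrow> ('x free_monoid \<Rightarrow>\<^sub>0 'k) set"
  where "presented_gen X R x = genideal (free_algebra X) R +>\<^bsub>free_algebra X\<^esub> letter x"

text \<open>
  The algebra map into \<open>B\<close> with value \<open>\<phi> x\<close> on the generator \<open>x\<close>. It is only used when \<open>\<phi>\<close>
  respects the defining relations, where the choice of the representative is immaterial.
\<close>

definition presented_lift ::
  "('k::field, 'b, 'm) module_scheme \<Rightarrow> ('x \<Rightarrow> 'b) \<Rightarrow> ('x free_monoid \<Rightarrow>\<^sub>0 'k) set \<Rightarrow> 'b"
  where "presented_lift B \<phi> t = (let p = (SOME p. p \<in> t) in
    \<Oplus>\<^bsub>B\<^esub>w\<in>Poly_Mapping.keys p.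
      Poly_Mapping.lookup p w \<odot>\<^bsub>B\<^esub> foldr (\<lambda>x b. \<phi> x \<otimes>\<^bsub>B\<^esub> b) (letters w) \<one>\<^bsub>B\<^esub>)"


section \<open>The algebras \<open>A\<^sub>s(m)\<close>\<close>

text \<open>The generator \<open>u\<^sub>i\<^sub>j\<close> is the letter \<open>(i, j)\<close>; indices start at \<open>0\<close>.\<close>

definition As_generators :: "nat \<Rightarrow> (nat \<times> nat) set"
  where "As_generators m = {..<m} \<times> {..<m}"

definition As_relators :: "nat \<Rightarrow> ((nat \<times> nat) free_monoid \<Rightarrow>\<^sub>0 'k::field) set"
  where "As_relators m =
    {letter (k, i) * letter (k, j) - (if i = j then letter (k, i) else 0)
      | i j k. i < m \<and> j < m \<and> k < m} \<union>
    {(\<Sum>l<m. letter (i, l)) - 1 | i. i < m} \<union>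
    {letter (i, k) * letter (j, k) - (if i = j then letter (i, k) else 0)
      | i j k. i < m \<and> j < m \<and> k < m} \<union>
    {(\<Sum>l<m. letter (l, i)) - 1 | i. i < m}"

definition As :: "nat \<Rightarrow> ('k::field, ((nat \<times> nat) free_monoid \<Rightarrow>\<^sub>0 'k) set) hopf"
  where "As m =
    (let P = presented_algebra (As_generators m) (As_relators m);
         u = (\<lambda>i j. presented_gen (As_generators m) (As_relators m) (i, j))
     in module.extend P (hopf.fields
       (presented_lift (tensor P P) (\<lambda>(i, j). \<Oplus>\<^bsub>tensor P P\<^esub>k\<in>{..<m}. tens P P (u i k) (u k j)))
       (presented_lift base_algebra (\<lambda>(i, j). if i = j then 1 else 0))
       (presented_lift (opposite_algebra P) (\<lambda>(i, j). u j i))))"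


section \<open>Free products of Hopf algebras\<close>

text \<open>
  The free product of a family of algebras is generated by the disjoint union of the carriers; the
  relators make each map \<open>a \<mapsto> (i, a)\<close> a unital algebra map. The Hopf algebra structure is the one for
  which these maps are Hopf algebra morphisms.
\<close>

definition free_product_relators ::
  "'i set \<Rightarrow> ('i \<Rightarrow> ('k::field, 'a, 'm) module_scheme) \<Rightarrow> (('i \<times> 'a) free_monoid \<Rightarrow>\<^sub>0 'k) set"
  where "free_product_relators I A =
    {letter (i, a \<oplus>\<^bsub>A i\<^esub> b) - letter (i, a) - letter (i, b)
      | i a b. i \<in> I \<and> a \<in> carrier (A i) \<and> b \<in> carrier (A i)} \<union>
    {letter (i, c \<odot>\<^bsub>A i\<^esub> a) - Poly_Mapping.single (Word [(i, a)]) c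
      | i c a. i \<in> I \<and> a \<in> carrier (A i)} \<union>
    {letter (i, a \<otimes>\<^bsub>A i\<^esub> b) - letter (i, a) * letter (i, b)
      | i a b. i \<in> I \<and> a \<in> carrier (A i) \<and> b \<in> carrier (A i)} \<union>
    {letter (i, \<one>\<^bsub>A i\<^esub>) - 1 | i. i \<in> I}"

definition free_product ::
  "'i set \<Rightarrow> ('i \<Rightarrow> ('k::field, 'a, 'm) hopf_scheme) \<Rightarrow>
    ('k, (('i \<times> 'a) free_monoid \<Rightarrow>\<^sub>0 'k) set) hopf"
  where "free_product I A =
    (let X = Sigma I (\<lambda>i. carrier (A i));
         P = presented_algebra X (free_product_relators I A);
         \<iota> = (\<lambda>i a. presented_gen X (free_product_relators I A) (i, a))
     in module.extend P (hopf.fields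
       (presented_lift (tensor P P) (\<lambda>(i, a). tensor_map P P (\<iota> i) (\<iota> i) (comult (A i) a)))
       (presented_lift base_algebra (\<lambda>(i, a). counit (A i) a))
       (presented_lift (opposite_algebra P) (\<lambda>(i, a). \<iota> i (antipode (A i) a)))))"

end

theory Submission
  imports Defs "HOL-Library.Nat_Bijection"
begin

text \<open>
  Write \<open>\<alpha>(e\<^sub>i) = \<Sum>\<^sub>j e\<^sub>j \<otimes> a\<^sub>j\<^sub>i\<close>. The matrix \<open>(a\<^sub>i\<^sub>j)\<close> is comultiplicative, so its inverse is \<open>b\<^sub>i\<^sub>j = S(a\<^sub>i\<^sub>j)\<close>,
  and its rows consist of orthogonal idempotents with sum \<open>1\<close>, whence \<open>a\<^sub>i\<^sub>l b\<^sub>l\<^sub>j = \<delta>\<^sub>i\<^sub>j a\<^sub>i\<^sub>l\<close>. The point is to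
  show \<open>b\<^sub>i\<^sub>j = a\<^sub>j\<^sub>i\<close>: then the columns are orthogonal idempotents with sum \<open>1\<close> as well. If \<open>S\<^sup>2 = id\<close>, this
  follows by applying \<open>S\<close> to the relation \<open>\<Sum>\<^sub>k b\<^sub>i\<^sub>k a\<^sub>k\<^sub>j = \<delta>\<^sub>i\<^sub>j\<close>. If \<open>\<kappa>\<close> is a colinear functional, with
  \<open>\<kappa>\<^sub>i = \<kappa>(e\<^sub>i)\<close>, then \<open>\<kappa>\<^sub>i b\<^sub>i\<^sub>j = (\<Sum>\<^sub>k \<kappa>\<^sub>k a\<^sub>k\<^sub>i) b\<^sub>i\<^sub>j = \<kappa>\<^sub>j a\<^sub>j\<^sub>i\<close>, and multiplying by \<open>a\<^sub>j\<^sub>i\<close> gives \<open>\<kappa>\<^sub>i a\<^sub>j\<^sub>i = \<kappa>\<^sub>j a\<^sub>j\<^sub>i\<close>,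
  so that \<open>b\<^sub>i\<^sub>j = a\<^sub>j\<^sub>i\<close> as soon as \<open>\<kappa>\<^sub>i \<noteq> 0\<close>. Under (1) one takes \<open>\<kappa> = \<psi>\<close>; if \<open>H\<close> is cosemisimple, there are
  enough colinear functionals, since they separate the coinvariants from \<open>0\<close>.

  A vector \<open>v\<close> is coinvariant iff \<open>v\<^sub>i = v\<^sub>j\<close> whenever \<open>a\<^sub>j\<^sub>i \<noteq> 0\<close>. So the coinvariants are the vectors that are
  constant on the blocks of a partition of \<open>{0..<n}\<close>, the matrix is block diagonal, and every block of
  size \<open>m\<close> gives an ergodic coaction on \<open>\<K>\<^sup>m\<close> and a morphism \<open>A\<^sub>s(m) \<rightarrow> H\<close>.
\<close>

text \<open>The axioms give the antipode only as a linear convolution inverse, yet morphisms out of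
  \<open>As\<close> and out of free products are tested on generators, which requires it to be
  anti-multiplicative. This is obtained from matrices: products of entries of comultiplicative
  matrices are entries of Kronecker products, uniqueness of inverse matrices determines the antipode
  on them, and faithfulness makes such entries span \<open>H\<close>.

  Tensors are classes of formal sums, so their equality is hard to see directly. A finite basis of
  the left factor turns a tensor into a vector over \<open>H\<close> whose coordinates are its
  slices, and every axiom of a coaction on K^n becomes an equation between matrix entries.

  Colinear functionals separate coinvariants from 0 for the following reason. When the comodule is
  split into simple ones, a nonzero coinvariant c has a nonzero component w, again coinvariant. The
  line through w is a subcomodule, hence the whole simple summand, and a suitable coordinate of the
  projection onto it is a colinear functional that does not vanish at c.\<close>

abbreviation vspace :: "('k::field, 'a, 'm) module_scheme \<Rightarrow> bool"
  where "vspace V \<equiv> vectorspace (class_ring :: 'k ring) V"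

abbreviation lin :: "('k::field, 'a, 'm) module_scheme \<Rightarrow> ('k, 'b, 'l) module_scheme \<Rightarrow> ('a \<Rightarrow> 'b) set"
  where "lin V W \<equiv> LinearCombinations.module_hom class_ring V W"

subsection \<open>Vector spaces and linear maps\<close>

lemma vspaceI:
  fixes V :: "('k::field, 'a, 'm) module_scheme" (structure)
  assumes "abelian_group V"
    and "\<And>c v. v \<in> carrier V \<Longrightarrow> c \<odot> v \<in> carrier V"
    and "\<And>c d v. v \<in> carrier V \<Longrightarrow> (c + d) \<odot> v = c \<odot> v \<oplus> d \<odot> v"
    and "\<And>c v w. v \<in> carrier V \<Longrightarrow> w \<in> carrier V \<Longrightarrow> c \<odot> (v \<oplus> w) = c \<odot> v \<oplus> c \<odot> w"
    and "\<And>c d v. v \<in> carrier V \<Longrightarrow> (c * d) \<odot> v = c \<odot> (d \<odot> v)"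
    and "\<And>v. v \<in> carrier V \<Longrightarrow> 1 \<odot> v = v"
  shows "vspace V"
  unfolding vectorspace_def
  using assms class_cring.is_cring class_field by (auto intro!: moduleI)

lemma vspaceD:
  fixes V :: "('k::field, 'a, 'm) module_scheme" (structure)
  assumes "vspace V"
  shows "abelian_group V" "Module.module class_ring V"
    and "\<And>c v. v \<in> carrier V \<Longrightarrow> c \<odot> v \<in> carrier V"
    and "\<And>c d v. v \<in> carrier V \<Longrightarrow> (c + d) \<odot> v = c \<odot> v \<oplus> d \<odot> v"
    and "\<And>c v w. v \<in> carrier V \<Longrightarrow> w \<in> carrier V \<Longrightarrow> c \<odot> (v \<oplus> w) = c \<odot> v \<oplus> c \<odot> w"
    and "\<And>c d v. v \<in> carrier V \<Longrightarrow> (c * d) \<odot> v = c \<odot> (d \<odot> v)"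
    and "\<And>v. v \<in> carrier V \<Longrightarrow> 1 \<odot> v = v"
    and "\<And>v. v \<in> carrier V \<Longrightarrow> 0 \<odot> v = \<zero>"
    and "\<And>c. c \<odot> \<zero> = \<zero>"
    and "\<And>v w. v \<in> carrier V \<Longrightarrow> w \<in> carrier V \<Longrightarrow> v \<oplus> w \<in> carrier V"
    and "\<And>v w. v \<in> carrier V \<Longrightarrow> w \<in> carrier V \<Longrightarrow> v \<oplus> w = w \<oplus> v"
    and "\<zero> \<in> carrier V"
    and "\<And>v. v \<in> carrier V \<Longrightarrow> (- 1) \<odot> v = \<ominus> v"
proof -
  interpret vectorspace class_ring V by fact
  show "abelian_group V" "Module.module class_ring V" by unfold_locales
  show "\<And>c v. v \<in> carrier V \<Longrightarrow> c \<odot> v \<in> carrier V"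
    "\<And>c d v. v \<in> carrier V \<Longrightarrow> (c + d) \<odot> v = c \<odot> v \<oplus> d \<odot> v"
    "\<And>c v w. v \<in> carrier V \<Longrightarrow> w \<in> carrier V \<Longrightarrow> c \<odot> (v \<oplus> w) = c \<odot> v \<oplus> c \<odot> w"
    "\<And>c d v. v \<in> carrier V \<Longrightarrow> (c * d) \<odot> v = c \<odot> (d \<odot> v)"
    "\<And>v. v \<in> carrier V \<Longrightarrow> 1 \<odot> v = v"
    using smult_closed smult_l_distr smult_r_distr smult_assoc1 smult_one by auto
  show "\<And>v. v \<in> carrier V \<Longrightarrow> 0 \<odot> v = \<zero>" "\<And>c. c \<odot> \<zero> = \<zero>"
    using smult_l_null smult_r_null by auto
  show "\<And>v w. v \<in> carrier V \<Longrightarrow> w \<in> carrier V \<Longrightarrow> v \<oplus> w \<in> carrier V" "\<zero> \<in> carrier V"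
    "\<And>v w. v \<in> carrier V \<Longrightarrow> w \<in> carrier V \<Longrightarrow> v \<oplus> w = w \<oplus> v"
    by (auto simp: M.add.m_comm)
  show "\<And>v. v \<in> carrier V \<Longrightarrow> (- 1) \<odot> v = \<ominus> v"
    using smult_minus_1 by (simp add: class_ring_simps)
qed

lemma linI:
  assumes "\<And>v. v \<in> carrier V \<Longrightarrow> f v \<in> carrier W"
    and "\<And>v w. v \<in> carrier V \<Longrightarrow> w \<in> carrier V \<Longrightarrow> f (v \<oplus>\<^bsub>V\<^esub> w) = f v \<oplus>\<^bsub>W\<^esub> f w"
    and "\<And>c v. v \<in> carrier V \<Longrightarrow> f (c \<odot>\<^bsub>V\<^esub> v) = c \<odot>\<^bsub>W\<^esub> f v"
  shows "f \<in> lin V W"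
  using assms by (auto simp: LinearCombinations.module_hom_def)

lemma linD:
  assumes "f \<in> lin V W"
  shows "\<And>v. v \<in> carrier V \<Longrightarrow> f v \<in> carrier W"
    and "\<And>v w. v \<in> carrier V \<Longrightarrow> w \<in> carrier V \<Longrightarrow> f (v \<oplus>\<^bsub>V\<^esub> w) = f v \<oplus>\<^bsub>W\<^esub> f w"
    and "\<And>c v. v \<in> carrier V \<Longrightarrow> f (c \<odot>\<^bsub>V\<^esub> v) = c \<odot>\<^bsub>W\<^esub> f v"
  using assms by (auto simp: LinearCombinations.module_hom_def)

lemma lin_zero:
  assumes "vspace V" "vspace W" "f \<in> lin V W"
  shows "f \<zero>\<^bsub>V\<^esub> = \<zero>\<^bsub>W\<^esub>"
  using assms by (metis linD(1,3) vspaceD(8,12))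

lemma lin_finsum:
  assumes "vspace V" "vspace W" "f \<in> lin V W" "finite I" "\<And>i. i \<in> I \<Longrightarrow> g i \<in> carrier V"
  shows "f (finsum V g I) = (\<Oplus>\<^bsub>W\<^esub>i\<in>I. f (g i))"
  using assms(4,5)
proof (induction I)
  case empty
  interpret V: abelian_group V using assms vspaceD by blast
  interpret W: abelian_group W using assms vspaceD by blast
  show ?case by (simp add: lin_zero assms)
next
  case (insert i I)
  interpret V: abelian_group V using assms vspaceD by blast
  interpret W: abelian_group W using assms vspaceD by blast
  have "finsum V g (insert i I) = g i \<oplus>\<^bsub>V\<^esub> finsum V g I"
    by (rule V.finsum_insert) (use insert in auto)
  moreover have "(\<Oplus>\<^bsub>W\<^esub>i\<in>insert i I. f (g i)) = f (g i) \<oplus>\<^bsub>W\<^esub> (\<Oplus>\<^bsub>W\<^esub>i\<in>I. f (g i))"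
    by (rule W.finsum_insert) (use insert linD(1)[OF assms(3)] in auto)
  moreover have "finsum V g I \<in> carrier V" by (rule V.finsum_closed) (use insert in auto)
  ultimately show ?case using insert linD(2)[OF assms(3)] by simp
qed

lemma lin_comp: "f \<in> lin U V \<Longrightarrow> g \<in> lin V W \<Longrightarrow> (\<lambda>x. g (f x)) \<in> lin U W"
  by (auto intro!: linI simp: linD)

lemma finsum_smult_right:
  assumes "vspace V" "finite I" "\<And>i. i \<in> I \<Longrightarrow> g i \<in> carrier V"
  shows "c \<odot>\<^bsub>V\<^esub> finsum V g I = (\<Oplus>\<^bsub>V\<^esub>i\<in>I. c \<odot>\<^bsub>V\<^esub> g i)"
proof -
  \<comment> \<open>Scaling by \<open>c\<close> is itself a linear map, because scalars
    commute.\<close>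
  have "(\<lambda>v. c \<odot>\<^bsub>V\<^esub> v) \<in> lin V V"
    by (rule linI) (use assms(1) vspaceD in \<open>auto simp: mult.commute simp flip: vspaceD(6)[OF assms(1)]\<close>)
  from lin_finsum[OF assms(1,1) this assms(2,3)] show ?thesis by auto
qed

subsection \<open>Spaces of finitely supported functions\<close>

lemma poly_mapping_sum_single:
  fixes p :: "'x \<Rightarrow>\<^sub>0 'k::comm_monoid_add"
  shows "(\<Sum>x\<in>Poly_Mapping.keys p. Poly_Mapping.single x (Poly_Mapping.lookup p x)) = p"
  by (rule poly_mapping_eqI)
    (auto simp: lookup_sum lookup_single when_def in_keys_iff sum.delta)

text \<open>The bound on the support travels with the induction, because only functions supported in
  \<open>X\<close> belong to the spaces concerned. Adding one monomial at a time fits properties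
  that are additive in \<open>p\<close>.\<close>

lemma poly_mapping_induct_on [consumes 1, case_names zero add]:
  fixes p :: "'x \<Rightarrow>\<^sub>0 'k::comm_monoid_add"
  assumes "Poly_Mapping.keys p \<subseteq> X" and "P 0"
    and step: "\<And>p x c. Poly_Mapping.keys p \<subseteq> X \<Longrightarrow> P p \<Longrightarrow> x \<in> X \<Longrightarrow> P (Poly_Mapping.single x c + p)"
  shows "P p"
proof -
  let ?q = "\<lambda>S. \<Sum>x\<in>S. Poly_Mapping.single x (Poly_Mapping.lookup p x)"
  have "finite S \<Longrightarrow> S \<subseteq> X \<Longrightarrow> Poly_Mapping.keys (?q S) \<subseteq> X \<and> P (?q S)" for S
  proof (induction S rule: finite_induct)
    case (insert x S)
    have "Poly_Mapping.keys (?q (insert x S))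
      \<subseteq> Poly_Mapping.keys (Poly_Mapping.single x (Poly_Mapping.lookup p x)) \<union> Poly_Mapping.keys (?q S)"
      unfolding sum.insert[OF insert(1,2)] by (rule keys_add)
    then show ?case using insert step by (auto split: if_splits)
  qed (simp add: assms)
  from this[of "Poly_Mapping.keys p"] show ?thesis using assms(1) by (simp add: poly_mapping_sum_single)
qed

lemma lookup_map_mult [simp]:
  "Poly_Mapping.lookup (Poly_Mapping.map ((*) (c::'k::mult_zero)) p) x = c * Poly_Mapping.lookup p x"
  by (cases "Poly_Mapping.lookup p x = 0") (auto simp: Poly_Mapping.map.rep_eq when_def)

lemma map_mult_single [simp]:
  "Poly_Mapping.map ((*) (c::'k::mult_zero)) (Poly_Mapping.single x d) = Poly_Mapping.single x (c * d)"
  by (rule poly_mapping_eqI) (auto simp: lookup_single when_def)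

lemma map_mult_plus:
  "Poly_Mapping.map ((*) (c::'k::semiring_0)) (p + q) = Poly_Mapping.map ((*) c) p + Poly_Mapping.map ((*) c) q"
  by (rule poly_mapping_eqI) (auto simp: lookup_add distrib_left)

lemma keys_map_mult: "Poly_Mapping.keys (Poly_Mapping.map ((*) (c::'k::mult_zero)) p) \<subseteq> Poly_Mapping.keys p"
  by (auto simp: in_keys_iff)

text \<open>Linear extension of \<beta> from monomials. \<open>tensor_lift\<close> and
  \<open>presented_lift\<close> are this map evaluated at a chosen representative of a
  class.\<close>

definition lin_ext :: "('k::field, 'c, 'm) module_scheme \<Rightarrow> ('x \<Rightarrow> 'c) \<Rightarrow> ('x \<Rightarrow>\<^sub>0 'k) \<Rightarrow> 'c"
  where "lin_ext C \<beta> p = (\<Oplus>\<^bsub>C\<^esub>x\<in>Poly_Mapping.keys p. Poly_Mapping.lookup p x \<odot>\<^bsub>C\<^esub> \<beta> x)"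

text \<open>Cancellation can make the support of a sum smaller than the union of the supports. Over
  a fixed larger index set the value is visibly linear in \<open>p\<close>.\<close>

lemma lin_ext_superset:
  assumes "vspace C" "finite S" "Poly_Mapping.keys p \<subseteq> S" "\<And>x. x \<in> S \<Longrightarrow> \<beta> x \<in> carrier C"
  shows "lin_ext C \<beta> p = (\<Oplus>\<^bsub>C\<^esub>x\<in>S. Poly_Mapping.lookup p x \<odot>\<^bsub>C\<^esub> \<beta> x)"
proof -
  interpret C: abelian_group C using assms vspaceD by blast
  show ?thesis unfolding lin_ext_def
    by (rule C.add.finprod_mono_neutral_cong_left)
      (use assms vspaceD[OF assms(1)] in \<open>auto simp: in_keys_iff\<close>)
qed

text \<open>The common shape of \<open>formal_tensors\<close> and \<open>free_algebra\<close> as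
  vector spaces: finitely supported functions on a set of monomials. The product is left open here
  and enters with \<open>free_alg\<close>.\<close>

locale free_space =
  fixes F :: "('k::field, 'x \<Rightarrow>\<^sub>0 'k) module" and X :: "'x set"
  assumes carrier_F: "carrier F = {p. Poly_Mapping.keys p \<subseteq> X}"
    and zero_F: "\<zero>\<^bsub>F\<^esub> = 0" and add_F: "add F = (+)"
    and smult_F: "smult F = (\<lambda>c. Poly_Mapping.map ((*) c))"
begin

lemma single_in: "x \<in> X \<Longrightarrow> Poly_Mapping.single x c \<in> carrier F"
  by (auto simp: carrier_F split: if_splits)

lemma vspace_F: "vspace F"
proof (rule vspaceI)
  show "abelian_group F"
  proof (rule abelian_groupI)
    fix p assume "p \<in> carrier F"
    then show "\<exists>q\<in>carrier F. q \<oplus>\<^bsub>F\<^esub> p = \<zero>\<^bsub>F\<^esub>"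
      by (intro bexI[of _ "- p"]) (auto simp: carrier_F add_F zero_F in_keys_iff)
  qed (use keys_add in \<open>fastforce simp: carrier_F zero_F add_F ac_simps\<close>)+
qed (use keys_map_mult keys_add in \<open>fastforce intro!: poly_mapping_eqI
      simp: carrier_F smult_F add_F lookup_add distrib_right distrib_left mult.assoc\<close>)+

lemma minus_F: "p \<in> carrier F \<Longrightarrow> q \<in> carrier F \<Longrightarrow> p \<ominus>\<^bsub>F\<^esub> q = p - q"
proof -
  interpret abelian_group F using vspace_F vspaceD by blast
  assume "p \<in> carrier F" "q \<in> carrier F"
  moreover from this have "- q \<in> carrier F" by (auto simp: carrier_F in_keys_iff)
  moreover have "\<ominus>\<^bsub>F\<^esub> q = - q"
    by (rule minus_equality) (use calculation in \<open>auto simp: add_F zero_F\<close>)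
  ultimately show ?thesis by (simp add: a_minus_def add_F)
qed

lemma lin_ext_in:
  assumes C: "vspace C" and \<beta>: "\<And>x. x \<in> X \<Longrightarrow> \<beta> x \<in> carrier C"
  shows "lin_ext C \<beta> \<in> lin F C"
proof (rule linI)
  interpret C: abelian_group C using assms vspaceD by blast
  fix p assume p: "p \<in> carrier F"
  then show "lin_ext C \<beta> p \<in> carrier C"
    unfolding lin_ext_def carrier_F using vspaceD(3)[OF C] \<beta> by (auto intro!: C.finsum_closed)
  show "lin_ext C \<beta> (c \<odot>\<^bsub>F\<^esub> p) = c \<odot>\<^bsub>C\<^esub> lin_ext C \<beta> p" for c
  proof -
    have "lin_ext C \<beta> (c \<odot>\<^bsub>F\<^esub> p) = (\<Oplus>\<^bsub>C\<^esub>x\<in>Poly_Mapping.keys p. (c * Poly_Mapping.lookup p x) \<odot>\<^bsub>C\<^esub> \<beta> x)"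
      by (subst lin_ext_superset[OF C, of "Poly_Mapping.keys p"])
        (use p \<beta> keys_map_mult in \<open>force simp: smult_F carrier_F\<close>)+
    also have "\<dots> = (\<Oplus>\<^bsub>C\<^esub>x\<in>Poly_Mapping.keys p. c \<odot>\<^bsub>C\<^esub> (Poly_Mapping.lookup p x \<odot>\<^bsub>C\<^esub> \<beta> x))"
      by (rule C.add.finprod_cong') (use p \<beta> vspaceD(3,6)[OF C] in \<open>auto simp: carrier_F\<close>)
    also have "\<dots> = c \<odot>\<^bsub>C\<^esub> lin_ext C \<beta> p"
      unfolding lin_ext_def
      by (rule finsum_smult_right[symmetric]) (use p \<beta> vspaceD(3)[OF C] C in \<open>auto simp: carrier_F\<close>)
    finally show ?thesis .
  qed
  fix q assume q: "q \<in> carrier F"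
  let ?S = "Poly_Mapping.keys p \<union> Poly_Mapping.keys q"
  have \<beta>': "x \<in> ?S \<Longrightarrow> \<beta> x \<in> carrier C" for x using p q \<beta> by (auto simp: carrier_F)
  have "lin_ext C \<beta> (p \<oplus>\<^bsub>F\<^esub> q) =
    (\<Oplus>\<^bsub>C\<^esub>x\<in>?S. (Poly_Mapping.lookup p x + Poly_Mapping.lookup q x) \<odot>\<^bsub>C\<^esub> \<beta> x)"
    by (subst lin_ext_superset[OF C, of ?S]) (use \<beta>' keys_add[of p q] in \<open>auto simp: add_F lookup_add\<close>)
  also have "\<dots> = (\<Oplus>\<^bsub>C\<^esub>x\<in>?S. Poly_Mapping.lookup p x \<odot>\<^bsub>C\<^esub> \<beta> x \<oplus>\<^bsub>C\<^esub> Poly_Mapping.lookup q x \<odot>\<^bsub>C\<^esub> \<beta> x)"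
    by (rule C.add.finprod_cong') (use \<beta>' vspaceD(3,4)[OF C] in auto)
  also have "\<dots> = (\<Oplus>\<^bsub>C\<^esub>x\<in>?S. Poly_Mapping.lookup p x \<odot>\<^bsub>C\<^esub> \<beta> x) \<oplus>\<^bsub>C\<^esub> (\<Oplus>\<^bsub>C\<^esub>x\<in>?S. Poly_Mapping.lookup q x \<odot>\<^bsub>C\<^esub> \<beta> x)"
    by (rule C.finsum_addf) (use \<beta>' vspaceD(3)[OF C] in auto)
  finally show "lin_ext C \<beta> (p \<oplus>\<^bsub>F\<^esub> q) = lin_ext C \<beta> p \<oplus>\<^bsub>C\<^esub> lin_ext C \<beta> q"
    using \<beta>' lin_ext_superset[OF C, of ?S p \<beta>] lin_ext_superset[OF C, of ?S q \<beta>] by simp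
qed

lemma lin_ext_single:
  assumes C: "vspace C" and \<beta>: "\<beta> x \<in> carrier C"
  shows "lin_ext C \<beta> (Poly_Mapping.single x c) = c \<odot>\<^bsub>C\<^esub> \<beta> x"
proof -
  interpret C: abelian_group C using assms vspaceD by blast
  show ?thesis using vspaceD(3,8)[OF C \<beta>] by (simp add: lin_ext_def)
qed

lemma lin_eqI:
  assumes C: "vspace C" and f: "f \<in> lin F C" and g: "g \<in> lin F C"
    and eq: "\<And>x. x \<in> X \<Longrightarrow> f (Poly_Mapping.single x 1) = g (Poly_Mapping.single x 1)"
    and p: "p \<in> carrier F"
  shows "f p = g p"
proof -
  have single: "Poly_Mapping.single x c = c \<odot>\<^bsub>F\<^esub> Poly_Mapping.single x 1" for x c by (simp add: smult_F)
  have "Poly_Mapping.keys p \<subseteq> X" using p by (simp add: carrier_F)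
  then show ?thesis
  proof (induction rule: poly_mapping_induct_on)
    case zero
    show ?case using lin_zero[OF vspace_F C f] lin_zero[OF vspace_F C g] by (simp add: zero_F)
  next
    case (add p x c)
    have "f (Poly_Mapping.single x c) = g (Poly_Mapping.single x c)"
      by (subst (1 2) single, subst linD(3)[OF f], simp add: single_in add,
          subst linD(3)[OF g], simp add: single_in add, simp add: eq add)
    moreover have "f (Poly_Mapping.single x c \<oplus>\<^bsub>F\<^esub> p) = f (Poly_Mapping.single x c) \<oplus>\<^bsub>C\<^esub> f p"
      by (rule linD(2)[OF f]) (use add single_in in \<open>auto simp: carrier_F\<close>)
    moreover have "g (Poly_Mapping.single x c \<oplus>\<^bsub>F\<^esub> p) = g (Poly_Mapping.single x c) \<oplus>\<^bsub>C\<^esub> g p"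
      by (rule linD(2)[OF g]) (use add single_in in \<open>auto simp: carrier_F\<close>)
    ultimately show ?case using add by (simp add: add_F)
  qed
qed

end

subsection \<open>Quotients\<close>

lemma quotient_algebra_simps:
  "carrier (quotient_algebra F N) = a_rcosets\<^bsub>F\<^esub> N"
  "add (quotient_algebra F N) = set_add F"
  "zero (quotient_algebra F N) = N"
  "one (quotient_algebra F N) = N +>\<^bsub>F\<^esub> \<one>\<^bsub>F\<^esub>"
  "mult (quotient_algebra F N) = rcoset_mult F N"
  "smult (quotient_algebra F N) = (\<lambda>c t. N +>\<^bsub>F\<^esub> (c \<odot>\<^bsub>F\<^esub> (SOME p. p \<in> t)))"
  by (simp_all add: quotient_algebra_def ring.extend_def module.fields_def FactRing_def)

locale quotient_space =
  fixes F :: "('k::field, 'a) module" and N :: "'a set"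
  assumes vF: "vspace F" and N: "submodule class_ring N F"
begin

abbreviation "\<pi> p \<equiv> N +>\<^bsub>F\<^esub> p"

sublocale F: abelian_group F using vF vspaceD by blast

sublocale N: abelian_subgroup N F
proof (rule abelian_subgroupI3)
  have "subgroup N (add_monoid F)"
  proof
    show "N \<subseteq> carrier (add_monoid F)" "\<one>\<^bsub>add_monoid F\<^esub> \<in> N"
      "x \<in> N \<Longrightarrow> y \<in> N \<Longrightarrow> x \<otimes>\<^bsub>add_monoid F\<^esub> y \<in> N" for x y
      using N by (auto simp: submodule_def)
    \<comment> \<open>Closure under negatives comes from the scalar -1.\<close>
    fix x assume x: "x \<in> N"
    then have "x \<in> carrier F" "(- 1) \<odot>\<^bsub>F\<^esub> x \<in> N" using N by (auto simp: submodule_def)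
    then have "\<ominus>\<^bsub>F\<^esub> x \<in> N" using vspaceD(13)[OF vF] by simp
    then show "inv\<^bsub>add_monoid F\<^esub> x \<in> N" by (simp add: a_inv_def)
  qed
  then show "additive_subgroup N F" by (rule additive_subgroup.intro)
qed (rule F.abelian_group_axioms)

lemma N_smult: "p \<in> N \<Longrightarrow> c \<odot>\<^bsub>F\<^esub> p \<in> N"
  using N by (auto simp: submodule_def)

lemma carrier_Q: "carrier (quotient_algebra F N) = \<pi> ` carrier F"
  by (auto simp: quotient_algebra_simps A_RCOSETS_defs a_r_coset_def[symmetric])

lemma \<pi>_eq_iff:
  assumes "p \<in> carrier F" "q \<in> carrier F"
  shows "\<pi> p = \<pi> q \<longleftrightarrow> p \<ominus>\<^bsub>F\<^esub> q \<in> N"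
proof
  assume "\<pi> p = \<pi> q"
  then have "p \<in> \<pi> q" using N.a_rcos_self[OF assms(1)] by simp
  then show "p \<ominus>\<^bsub>F\<^esub> q \<in> N"
    using N.a_rcos_module[OF assms(2,1)] by (simp add: a_minus_def)
next
  assume "p \<ominus>\<^bsub>F\<^esub> q \<in> N"
  then have "p \<in> \<pi> q"
    using N.a_rcos_module[OF assms(2,1)] by (simp add: a_minus_def)
  then show "\<pi> p = \<pi> q"
    using N.a_repr_independence'[OF _ assms(2)] by simp
qed

lemma \<pi>_zero: "p \<in> N \<Longrightarrow> \<pi> p = \<zero>\<^bsub>quotient_algebra F N\<^esub>"
  by (simp add: quotient_algebra_simps N.a_rcos_const)

lemma \<pi>_add:
  "p \<in> carrier F \<Longrightarrow> q \<in> carrier F \<Longrightarrow> \<pi> (p \<oplus>\<^bsub>F\<^esub> q) = \<pi> p \<oplus>\<^bsub>quotient_algebra F N\<^esub> \<pi> q"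
  by (simp add: quotient_algebra_simps N.a_rcos_sum)

lemma some_rep:
  assumes "p \<in> carrier F"
  shows "(SOME q. q \<in> \<pi> p) \<in> carrier F" "\<pi> (SOME q. q \<in> \<pi> p) = \<pi> p"
proof -
  have *: "(SOME q. q \<in> \<pi> p) \<in> \<pi> p" using N.a_rcos_self[OF assms] by (rule someI)
  then show "(SOME q. q \<in> \<pi> p) \<in> carrier F" using assms N.a_elemrcos_carrier by blast
  show "\<pi> (SOME q. q \<in> \<pi> p) = \<pi> p"
    using N.a_repr_independence'[OF * assms] by simp
qed

text \<open>The scalar action on classes is defined through a chosen representative; two
  representatives differ by an element of \<open>N\<close>, and \<open>N\<close> is closed under
  scalars.\<close>

lemma \<pi>_smult:
  assumes p: "p \<in> carrier F"
  shows "\<pi> (c \<odot>\<^bsub>F\<^esub> p) = c \<odot>\<^bsub>quotient_algebra F N\<^esub> \<pi> p"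
proof -
  let ?q = "SOME q. q \<in> \<pi> p"
  have q: "?q \<in> carrier F" "p \<ominus>\<^bsub>F\<^esub> ?q \<in> N"
    using some_rep[OF p] \<pi>_eq_iff[OF p] by auto
  have "c \<odot>\<^bsub>F\<^esub> p \<ominus>\<^bsub>F\<^esub> c \<odot>\<^bsub>F\<^esub> ?q = c \<odot>\<^bsub>F\<^esub> (p \<ominus>\<^bsub>F\<^esub> ?q)"
    using p q vspaceD(3,5)[OF vF] Module.module.smult_r_minus[OF vspaceD(2)[OF vF], of c ?q]
    by (simp add: a_minus_def)
  then have "c \<odot>\<^bsub>F\<^esub> p \<ominus>\<^bsub>F\<^esub> c \<odot>\<^bsub>F\<^esub> ?q \<in> N" using N_smult q by simp
  then show ?thesis using p q vspaceD(3)[OF vF] by (simp add: quotient_algebra_simps \<pi>_eq_iff)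
qed

lemma vspace_Q: "vspace (quotient_algebra F N)"
proof (rule vspaceI)
  show "abelian_group (quotient_algebra F N)"
  proof -
    have zero: "\<zero>\<^bsub>quotient_algebra F N\<^esub> = \<pi> \<zero>\<^bsub>F\<^esub>"
      by (rule \<pi>_zero[symmetric]) simp
    show ?thesis
    proof (rule abelian_groupI)
      fix s assume "s \<in> carrier (quotient_algebra F N)"
      then obtain p where p: "p \<in> carrier F" "s = \<pi> p" by (auto simp: carrier_Q)
      then show "\<exists>t\<in>carrier (quotient_algebra F N). t \<oplus>\<^bsub>quotient_algebra F N\<^esub> s = \<zero>\<^bsub>quotient_algebra F N\<^esub>"
        by (intro bexI[of _ "\<pi> (\<ominus>\<^bsub>F\<^esub> p)"]) (auto simp: carrier_Q \<pi>_add[symmetric] zero F.l_neg)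
    qed (auto simp: carrier_Q \<pi>_add[symmetric] zero F.a_ac)
  qed
qed (use vspaceD(3-7)[OF vF] in \<open>auto simp: carrier_Q \<pi>_add[symmetric] \<pi>_smult[symmetric]\<close>)

lemma \<pi>_lin: "\<pi> \<in> lin F (quotient_algebra F N)"
  by (rule linI) (auto simp: carrier_Q \<pi>_add \<pi>_smult)

text \<open>A linear map that vanishes on \<open>N\<close> takes the same value at \<open>p\<close>
  and at whatever representative \<open>SOME\<close> picks. The good behaviour of
  \<open>tensor_lift\<close> and \<open>presented_lift\<close> rests on this fact.\<close>

lemma induced_apply:
  assumes C: "vspace C" and f: "f \<in> lin F C" and ker: "\<And>p. p \<in> N \<Longrightarrow> f p = \<zero>\<^bsub>C\<^esub>" and p: "p \<in> carrier F"
  shows "f (SOME q. q \<in> \<pi> p) = f p"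
proof -
  interpret C: abelian_group C using assms vspaceD by blast
  let ?q = "SOME q. q \<in> \<pi> p"
  have q: "?q \<in> carrier F" "p \<ominus>\<^bsub>F\<^esub> ?q \<in> N"
    using some_rep[OF p] \<pi>_eq_iff[OF p] by auto
  have "p = (p \<ominus>\<^bsub>F\<^esub> ?q) \<oplus>\<^bsub>F\<^esub> ?q" using p q
    by (simp add: a_minus_def F.a_assoc F.l_neg)
  then have "f p = f (p \<ominus>\<^bsub>F\<^esub> ?q) \<oplus>\<^bsub>C\<^esub> f ?q"
    using linD(2)[OF f F.minus_closed[OF p q(1)] q(1)] by simp
  then show ?thesis using ker q linD(1)[OF f] by simp
qed

lemma induced_lin:
  assumes C: "vspace C" and f: "f \<in> lin F C" and ker: "\<And>p. p \<in> N \<Longrightarrow> f p = \<zero>\<^bsub>C\<^esub>"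
  shows "(\<lambda>t. f (SOME q. q \<in> t)) \<in> lin (quotient_algebra F N) C"
  by (rule linI)
    (use linD[OF f] vspaceD(3)[OF vF] in \<open>auto simp: carrier_Q \<pi>_add[symmetric] \<pi>_smult[symmetric]
      induced_apply[OF C f ker]\<close>)

end

subsection \<open>Algebras\<close>

lemma unital_algebraI:
  fixes A :: "('k::field, 'a, 'm) module_scheme" (structure)
  assumes "vspace A" and "Group.monoid A"
    and "\<And>a b c. a \<in> carrier A \<Longrightarrow> b \<in> carrier A \<Longrightarrow> c \<in> carrier A \<Longrightarrow> (a \<oplus> b) \<otimes> c = a \<otimes> c \<oplus> b \<otimes> c"
    and "\<And>a b c. a \<in> carrier A \<Longrightarrow> b \<in> carrier A \<Longrightarrow> c \<in> carrier A \<Longrightarrow> c \<otimes> (a \<oplus> b) = c \<otimes> a \<oplus> c \<otimes> b"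
    and "\<And>a b c. a \<in> carrier A \<Longrightarrow> b \<in> carrier A \<Longrightarrow> (c \<odot> a) \<otimes> b = c \<odot> (a \<otimes> b)"
    and "\<And>a b c. a \<in> carrier A \<Longrightarrow> b \<in> carrier A \<Longrightarrow> a \<otimes> (c \<odot> b) = c \<odot> (a \<otimes> b)"
  shows "unital_algebra A"
proof -
  interpret vectorspace class_ring A by fact
  show ?thesis
    by (intro unital_algebra.intro ringI assms unital_algebra_axioms.intro vspaceD[OF assms(1)])
qed

lemma unital_algebraD:
  fixes A :: "('k::field, 'a, 'm) module_scheme" (structure)
  assumes "unital_algebra A"
  shows "ring A" "vspace A" "\<one> \<in> carrier A"
    "\<And>a b. a \<in> carrier A \<Longrightarrow> b \<in> carrier A \<Longrightarrow> a \<otimes> b \<in> carrier A"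
    "\<And>a b c. a \<in> carrier A \<Longrightarrow> b \<in> carrier A \<Longrightarrow> c \<in> carrier A \<Longrightarrow> (a \<otimes> b) \<otimes> c = a \<otimes> (b \<otimes> c)"
    "\<And>a. a \<in> carrier A \<Longrightarrow> \<one> \<otimes> a = a" "\<And>a. a \<in> carrier A \<Longrightarrow> a \<otimes> \<one> = a"
    "\<And>a b c. a \<in> carrier A \<Longrightarrow> b \<in> carrier A \<Longrightarrow> c \<in> carrier A \<Longrightarrow> (a \<oplus> b) \<otimes> c = a \<otimes> c \<oplus> b \<otimes> c"
    "\<And>a b c. a \<in> carrier A \<Longrightarrow> b \<in> carrier A \<Longrightarrow> c \<in> carrier A \<Longrightarrow> c \<otimes> (a \<oplus> b) = c \<otimes> a \<oplus> c \<otimes> b"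
    "\<And>a b c. a \<in> carrier A \<Longrightarrow> b \<in> carrier A \<Longrightarrow> (c \<odot> a) \<otimes> b = c \<odot> (a \<otimes> b)"
    "\<And>a b c. a \<in> carrier A \<Longrightarrow> b \<in> carrier A \<Longrightarrow> a \<otimes> (c \<odot> b) = c \<odot> (a \<otimes> b)"
    "\<And>a. a \<in> carrier A \<Longrightarrow> \<zero> \<otimes> a = \<zero>" "\<And>a. a \<in> carrier A \<Longrightarrow> a \<otimes> \<zero> = \<zero>"
proof -
  show "ring A" using assms by (simp add: unital_algebra_def)
  then interpret ring A .
  show "vspace A" using assms by (simp add: unital_algebra_def)
  show "\<And>a b c. a \<in> carrier A \<Longrightarrow> b \<in> carrier A \<Longrightarrow> (c \<odot> a) \<otimes> b = c \<odot> (a \<otimes> b)"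
    "\<And>a b c. a \<in> carrier A \<Longrightarrow> b \<in> carrier A \<Longrightarrow> a \<otimes> (c \<odot> b) = c \<odot> (a \<otimes> b)"
    using assms by (auto simp: unital_algebra_def unital_algebra_axioms_def)
  show "\<one> \<in> carrier A"
    "\<And>a b. a \<in> carrier A \<Longrightarrow> b \<in> carrier A \<Longrightarrow> a \<otimes> b \<in> carrier A"
    "\<And>a b c. a \<in> carrier A \<Longrightarrow> b \<in> carrier A \<Longrightarrow> c \<in> carrier A \<Longrightarrow> (a \<otimes> b) \<otimes> c = a \<otimes> (b \<otimes> c)"
    "\<And>a. a \<in> carrier A \<Longrightarrow> \<one> \<otimes> a = a" "\<And>a. a \<in> carrier A \<Longrightarrow> a \<otimes> \<one> = a"
    "\<And>a b c. a \<in> carrier A \<Longrightarrow> b \<in> carrier A \<Longrightarrow> c \<in> carrier A \<Longrightarrow> (a \<oplus> b) \<otimes> c = a \<otimes> c \<oplus> b \<otimes> c"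
    "\<And>a b c. a \<in> carrier A \<Longrightarrow> b \<in> carrier A \<Longrightarrow> c \<in> carrier A \<Longrightarrow> c \<otimes> (a \<oplus> b) = c \<otimes> a \<oplus> c \<otimes> b"
    "\<And>a. a \<in> carrier A \<Longrightarrow> \<zero> \<otimes> a = \<zero>" "\<And>a. a \<in> carrier A \<Longrightarrow> a \<otimes> \<zero> = \<zero>"
    by (auto simp: m_assoc l_distr r_distr)
qed

lemma algebra_homI:
  assumes "f \<in> lin A B" "f \<one>\<^bsub>A\<^esub> = \<one>\<^bsub>B\<^esub>"
    "\<And>a b. a \<in> carrier A \<Longrightarrow> b \<in> carrier A \<Longrightarrow> f (a \<otimes>\<^bsub>A\<^esub> b) = f a \<otimes>\<^bsub>B\<^esub> f b"
  shows "f \<in> algebra_hom A B"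
  using assms by (auto simp: algebra_hom_def linD intro!: ring_hom_memI)

lemma algebra_homD:
  assumes "f \<in> algebra_hom A B"
  shows "f \<in> lin A B" "f \<one>\<^bsub>A\<^esub> = \<one>\<^bsub>B\<^esub>"
    "\<And>a b. a \<in> carrier A \<Longrightarrow> b \<in> carrier A \<Longrightarrow> f (a \<otimes>\<^bsub>A\<^esub> b) = f a \<otimes>\<^bsub>B\<^esub> f b"
    "\<And>a. a \<in> carrier A \<Longrightarrow> f a \<in> carrier B"
    "\<And>a b. a \<in> carrier A \<Longrightarrow> b \<in> carrier A \<Longrightarrow> f (a \<oplus>\<^bsub>A\<^esub> b) = f a \<oplus>\<^bsub>B\<^esub> f b"
    "\<And>c a. a \<in> carrier A \<Longrightarrow> f (c \<odot>\<^bsub>A\<^esub> a) = c \<odot>\<^bsub>B\<^esub> f a"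
  using assms by (auto simp: algebra_hom_def linD ring_hom_one ring_hom_mult)

lemma algebra_hom_comp:
  "f \<in> algebra_hom A B \<Longrightarrow> g \<in> algebra_hom B C \<Longrightarrow> (\<lambda>x. g (f x)) \<in> algebra_hom A C"
  by (rule algebra_homI) (auto simp: algebra_homD intro: lin_comp algebra_homD(1))

locale quotient_alg = F: unital_algebra F for F :: "('k::field, 'a) module" +
  fixes N :: "'a set"
  assumes ideal: "ideal N F" and N_smult': "\<And>c p. p \<in> N \<Longrightarrow> c \<odot>\<^bsub>F\<^esub> p \<in> N"
begin

sublocale I: ideal N F by (rule ideal)

sublocale quotient_space F N
proof (rule quotient_space.intro)
  show "vspace F" by (rule unital_algebraD(2)[OF F.unital_algebra_axioms])
  show "submodule class_ring N F"
    using N_smult' I.a_subset I.a_closed I.zero_closed F.module_axioms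
    by (auto simp: submodule_def)
qed

lemma \<pi>_mult:
  "p \<in> carrier F \<Longrightarrow> q \<in> carrier F \<Longrightarrow> \<pi> (p \<otimes>\<^bsub>F\<^esub> q) = \<pi> p \<otimes>\<^bsub>quotient_algebra F N\<^esub> \<pi> q"
  by (simp add: quotient_algebra_simps I.rcoset_mult_add)

lemma unital_algebra_Q: "unital_algebra (quotient_algebra F N)"
proof (rule unital_algebraI[OF vspace_Q])
  have one: "\<one>\<^bsub>quotient_algebra F N\<^esub> = \<pi> \<one>\<^bsub>F\<^esub>" by (simp add: quotient_algebra_simps)
  show "Group.monoid (quotient_algebra F N)"
    by (rule monoidI) (auto simp: carrier_Q \<pi>_mult[symmetric] unital_algebraD(5)[OF F.unital_algebra_axioms] one)
qed (use vspaceD(3)[OF vF] in \<open>auto simp: carrier_Q \<pi>_mult[symmetric] \<pi>_add[symmetric] \<pi>_smult[symmetric]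
    unital_algebraD(8,9)[OF F.unital_algebra_axioms] F.smult_mult_left F.smult_mult_right\<close>)

lemma \<pi>_hom: "\<pi> \<in> algebra_hom F (quotient_algebra F N)"
  by (intro algebra_homI \<pi>_lin) (auto simp: \<pi>_mult quotient_algebra_simps)

lemma induced_hom:
  assumes C: "vspace C" and f: "f \<in> algebra_hom F C" and ker: "\<And>p. p \<in> N \<Longrightarrow> f p = \<zero>\<^bsub>C\<^esub>"
  shows "(\<lambda>t. f (SOME q. q \<in> t)) \<in> algebra_hom (quotient_algebra F N) C"
proof (rule algebra_homI)
  note lin = algebra_homD(1)[OF f]
  show "(\<lambda>t. f (SOME q. q \<in> t)) \<in> lin (quotient_algebra F N) C"
    by (rule induced_lin[OF C lin ker])
  show "f (SOME q. q \<in> \<one>\<^bsub>quotient_algebra F N\<^esub>) = \<one>\<^bsub>C\<^esub>"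
    by (simp add: quotient_algebra_simps induced_apply[OF C lin ker] algebra_homD(2)[OF f])
  fix s t assume "s \<in> carrier (quotient_algebra F N)" "t \<in> carrier (quotient_algebra F N)"
  then show "f (SOME q. q \<in> s \<otimes>\<^bsub>quotient_algebra F N\<^esub> t) = f (SOME q. q \<in> s) \<otimes>\<^bsub>C\<^esub> f (SOME q. q \<in> t)"
    by (auto simp: carrier_Q \<pi>_mult[symmetric] induced_apply[OF C lin ker] algebra_homD(3)[OF f])
qed

end

subsection \<open>Spans\<close>

abbreviation lspan :: "('k::field, 'a, 'm) module_scheme \<Rightarrow> 'a set \<Rightarrow> 'a set"
  where "lspan V S \<equiv> LinearCombinations.module.span (class_ring :: 'k ring) V S"

lemma submoduleI:
  assumes "vspace V" "N \<subseteq> carrier V" "\<zero>\<^bsub>V\<^esub> \<in> N"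
    "\<And>v w. v \<in> N \<Longrightarrow> w \<in> N \<Longrightarrow> v \<oplus>\<^bsub>V\<^esub> w \<in> N" "\<And>c v. v \<in> N \<Longrightarrow> c \<odot>\<^bsub>V\<^esub> v \<in> N"
  shows "submodule class_ring N V"
  using assms vspaceD(2)[OF assms(1)] by (auto simp: submodule_def)

lemma submoduleD:
  assumes "submodule (class_ring :: 'k::field ring) N V"
  shows "N \<subseteq> carrier V" "\<zero>\<^bsub>V\<^esub> \<in> N"
    "\<And>v w. v \<in> N \<Longrightarrow> w \<in> N \<Longrightarrow> v \<oplus>\<^bsub>V\<^esub> w \<in> N" "\<And>c v. v \<in> N \<Longrightarrow> c \<odot>\<^bsub>V\<^esub> v \<in> N"
  using assms by (auto simp: submodule_def)

lemma span_facts: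
  assumes "vspace V" "S \<subseteq> carrier V"
  shows "submodule class_ring (lspan V S) V" "S \<subseteq> lspan V S" "lspan V S \<subseteq> carrier V"
proof -
  interpret vectorspace class_ring V by fact
  show "submodule class_ring (lspan V S) V" "S \<subseteq> lspan V S" "lspan V S \<subseteq> carrier V"
    using span_is_submodule in_own_span span_is_subset2 assms by blast+
qed

lemma span_least:
  assumes "submodule class_ring N V" "S \<subseteq> N"
  shows "lspan V S \<subseteq> N"
proof -
  interpret Module.module class_ring V using assms by (simp add: submodule_def)
  show ?thesis using span_is_subset assms by blast
qed

lemma span_kernel:
  assumes "vspace V" "vspace W" "f \<in> lin V W" "S \<subseteq> carrier V" "\<And>v. v \<in> S \<Longrightarrow> f v = \<zero>\<^bsub>W\<^esub>" "v \<in> lspan V S"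
  shows "f v = \<zero>\<^bsub>W\<^esub>"
proof -
  interpret W: abelian_group W using assms vspaceD by blast
  have "submodule class_ring {v \<in> carrier V. f v = \<zero>\<^bsub>W\<^esub>} V"
    by (rule submoduleI)
      (use assms lin_zero[OF assms(1-3)] linD[OF assms(3)] vspaceD[OF assms(1)] vspaceD(9)[OF assms(2)] in auto)
  from span_least[OF this, of S] show ?thesis using assms by auto
qed

subsection \<open>Monoid algebras\<close>

text \<open>Monoid algebra of \<open>X\<close> under \<open>bop\<close>. Pairs under componentwise
  multiplication give the formal tensors, words under concatenation the free algebra; the ring
  structure of both is established here at once.\<close>

locale free_alg = free_space F X for F :: "('k::field, 'x \<Rightarrow>\<^sub>0 'k) module" and X +
  fixes bop :: "'x \<Rightarrow> 'x \<Rightarrow> 'x" and e :: 'x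
  assumes op_in: "x \<in> X \<Longrightarrow> y \<in> X \<Longrightarrow> bop x y \<in> X"
    and op_assoc: "x \<in> X \<Longrightarrow> y \<in> X \<Longrightarrow> z \<in> X \<Longrightarrow> bop (bop x y) z = bop x (bop y z)"
    and e_in: "e \<in> X" and e_op: "x \<in> X \<Longrightarrow> bop e x = x" and op_e: "x \<in> X \<Longrightarrow> bop x e = x"
    and one_F: "\<one>\<^bsub>F\<^esub> = Poly_Mapping.single e 1"
    and mult_F: "\<And>p q. p \<otimes>\<^bsub>F\<^esub> q = (\<Sum>x\<in>Poly_Mapping.keys p. \<Sum>y\<in>Poly_Mapping.keys q.
      Poly_Mapping.single (bop x y) (Poly_Mapping.lookup p x * Poly_Mapping.lookup q y))"
begin

lemma map_mult_zero [simp]: "Poly_Mapping.map ((*) (c::'k)) 0 = (0 :: 'x \<Rightarrow>\<^sub>0 'k)"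
  by (rule poly_mapping_eqI) simp

lemma mult_add_left: "(p + p') \<otimes>\<^bsub>F\<^esub> q = p \<otimes>\<^bsub>F\<^esub> q + p' \<otimes>\<^bsub>F\<^esub> q"
  unfolding mult_F
  by (rule setsum_keys_plus_distrib) (auto simp: distrib_right single_add sum.distrib)

lemma mult_add_right: "p \<otimes>\<^bsub>F\<^esub> (q + q') = p \<otimes>\<^bsub>F\<^esub> q + p \<otimes>\<^bsub>F\<^esub> q'"
  unfolding mult_F sum.swap[of _ _ "Poly_Mapping.keys p"]
  by (rule setsum_keys_plus_distrib) (auto simp: distrib_left single_add sum.distrib)

lemma mult_single: "Poly_Mapping.single x c \<otimes>\<^bsub>F\<^esub> Poly_Mapping.single y d = Poly_Mapping.single (bop x y) (c * d)"
  by (simp add: mult_F)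

lemma mult_zero [simp]: "0 \<otimes>\<^bsub>F\<^esub> q = 0" "q \<otimes>\<^bsub>F\<^esub> 0 = 0" by (simp_all add: mult_F)

lemma mult_closed:
  assumes "p \<in> carrier F" "q \<in> carrier F"
  shows "p \<otimes>\<^bsub>F\<^esub> q \<in> carrier F"
proof -
  have "Poly_Mapping.keys (p \<otimes>\<^bsub>F\<^esub> q) \<subseteq> X"
    unfolding mult_F using assms op_in
    by (fastforce simp: carrier_F dest!: subsetD[OF keys_sum] split: if_splits)
  then show ?thesis by (simp add: carrier_F)
qed

lemma smult_single: "c \<odot>\<^bsub>F\<^esub> Poly_Mapping.single x d = Poly_Mapping.single x (c * d)"
  by (simp add: smult_F)

lemma add_closed: "p \<in> carrier F \<Longrightarrow> q \<in> carrier F \<Longrightarrow> p + q \<in> carrier F"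
  using vspaceD(10)[OF vspace_F] by (simp add: add_F)

lemma mult_smult_left: "(c \<odot>\<^bsub>F\<^esub> p) \<otimes>\<^bsub>F\<^esub> q = c \<odot>\<^bsub>F\<^esub> (p \<otimes>\<^bsub>F\<^esub> q)"
proof -
  have *: "Poly_Mapping.keys p \<subseteq> UNIV" "Poly_Mapping.keys q \<subseteq> UNIV" by auto
  from *(1) show ?thesis
  proof (induction p rule: poly_mapping_induct_on)
    case (add p x d)
    from *(2) have "(c \<odot>\<^bsub>F\<^esub> Poly_Mapping.single x d) \<otimes>\<^bsub>F\<^esub> q = c \<odot>\<^bsub>F\<^esub> (Poly_Mapping.single x d \<otimes>\<^bsub>F\<^esub> q)"
      by (induction q rule: poly_mapping_induct_on)
        (auto simp: mult_add_right smult_single mult_single smult_F map_mult_plus mult.assoc)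
    then show ?case using add by (simp add: smult_F map_mult_plus mult_add_left)
  qed (simp add: smult_F)
qed

lemma mult_smult_right: "p \<otimes>\<^bsub>F\<^esub> (c \<odot>\<^bsub>F\<^esub> q) = c \<odot>\<^bsub>F\<^esub> (p \<otimes>\<^bsub>F\<^esub> q)"
proof -
  have *: "Poly_Mapping.keys p \<subseteq> UNIV" "Poly_Mapping.keys q \<subseteq> UNIV" by auto
  from *(1) show ?thesis
  proof (induction p rule: poly_mapping_induct_on)
    case (add p x d)
    from *(2) have "Poly_Mapping.single x d \<otimes>\<^bsub>F\<^esub> (c \<odot>\<^bsub>F\<^esub> q) = c \<odot>\<^bsub>F\<^esub> (Poly_Mapping.single x d \<otimes>\<^bsub>F\<^esub> q)"
      by (induction q rule: poly_mapping_induct_on)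
        (auto simp: mult_add_right smult_single mult_single smult_F map_mult_plus mult.left_commute)
    then show ?case using add by (simp add: smult_F map_mult_plus mult_add_left)
  qed (simp add: smult_F)
qed

lemma mult_lin_left: "q \<in> carrier F \<Longrightarrow> (\<lambda>p. p \<otimes>\<^bsub>F\<^esub> q) \<in> lin F F"
  by (rule linI) (auto simp: mult_closed mult_smult_left mult_add_left add_F)

lemma mult_lin_right: "q \<in> carrier F \<Longrightarrow> (\<lambda>p. q \<otimes>\<^bsub>F\<^esub> p) \<in> lin F F"
  by (rule linI) (auto simp: mult_closed mult_smult_right mult_add_right add_F)

lemma unital_algebra_F: "unital_algebra F"
proof (rule unital_algebraI[OF vspace_F])
  have id: "(\<lambda>p. p) \<in> lin F F" by (rule linI) auto
  have one: "\<one>\<^bsub>F\<^esub> \<in> carrier F" by (simp add: one_F single_in e_in)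
  show "Group.monoid F"
  proof (rule monoidI)
    \<comment> \<open>Both sides are linear in each of \<open>p\<close>, \<open>q\<close> and
      \<open>r\<close>, so the variables are replaced by monomials one after the other; on monomials
      the claim is associativity of \<open>bop\<close>.\<close>
    fix p q r assume p: "p \<in> carrier F" and q: "q \<in> carrier F" and r: "r \<in> carrier F"
    show "p \<otimes>\<^bsub>F\<^esub> q \<otimes>\<^bsub>F\<^esub> r = p \<otimes>\<^bsub>F\<^esub> (q \<otimes>\<^bsub>F\<^esub> r)"
    proof (rule lin_eqI[OF vspace_F lin_comp[OF mult_lin_left[OF q] mult_lin_left[OF r]]
          mult_lin_left[OF mult_closed[OF q r]] _ p])
      fix x assume x: "x \<in> X"
      note X = single_in[OF x, of 1]
      show "Poly_Mapping.single x 1 \<otimes>\<^bsub>F\<^esub> q \<otimes>\<^bsub>F\<^esub> r = Poly_Mapping.single x 1 \<otimes>\<^bsub>F\<^esub> (q \<otimes>\<^bsub>F\<^esub> r)"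
      proof (rule lin_eqI[OF vspace_F lin_comp[OF mult_lin_right[OF X] mult_lin_left[OF r]]
            lin_comp[OF mult_lin_left[OF r] mult_lin_right[OF X]] _ q])
        fix y assume y: "y \<in> X"
        note Y = single_in[OF y, of 1]
        show "Poly_Mapping.single x 1 \<otimes>\<^bsub>F\<^esub> Poly_Mapping.single y 1 \<otimes>\<^bsub>F\<^esub> r
          = Poly_Mapping.single x 1 \<otimes>\<^bsub>F\<^esub> (Poly_Mapping.single y 1 \<otimes>\<^bsub>F\<^esub> r)"
          by (rule lin_eqI[OF vspace_F mult_lin_right[OF mult_closed[OF X Y]]
                lin_comp[OF mult_lin_right[OF Y] mult_lin_right[OF X]] _ r])
            (simp add: mult_single op_assoc x y)
      qed
    qed
  next
    fix p assume p: "p \<in> carrier F"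
    show "\<one>\<^bsub>F\<^esub> \<otimes>\<^bsub>F\<^esub> p = p"
      by (rule lin_eqI[OF vspace_F mult_lin_right[OF one] id _ p]) (simp add: one_F mult_single e_op)
    show "p \<otimes>\<^bsub>F\<^esub> \<one>\<^bsub>F\<^esub> = p"
      by (rule lin_eqI[OF vspace_F mult_lin_left[OF one] id _ p]) (simp add: one_F mult_single op_e)
  qed (simp_all add: one mult_closed)
qed (simp_all add: mult_add_left mult_add_right add_F mult_smult_left mult_smult_right)

text \<open>Both sides of multiplicativity are bilinear, so only products of two monomials matter,
  and these are covered by the hypothesis on \<beta>.\<close>

lemma lin_ext_hom:
  assumes C: "unital_algebra C" and \<beta>: "\<And>x. x \<in> X \<Longrightarrow> \<beta> x \<in> carrier C"
    and one: "\<beta> e = \<one>\<^bsub>C\<^esub>" and mult: "\<And>x y. x \<in> X \<Longrightarrow> y \<in> X \<Longrightarrow> \<beta> (bop x y) = \<beta> x \<otimes>\<^bsub>C\<^esub> \<beta> y"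
  shows "lin_ext C \<beta> \<in> algebra_hom F C"
proof (rule algebra_homI)
  note vC = unital_algebraD(2)[OF C]
  note L = lin_ext_in[OF vC \<beta>]
  have single: "lin_ext C \<beta> (Poly_Mapping.single x 1) = \<beta> x" if "x \<in> X" for x
    using lin_ext_single[of C \<beta> x, OF vC \<beta>[OF that]] vspaceD(7)[OF vC \<beta>[OF that]] by simp
  have mr: "c \<in> carrier C \<Longrightarrow> (\<lambda>d. c \<otimes>\<^bsub>C\<^esub> d) \<in> lin C C" for c
    by (rule linI) (auto simp: unital_algebraD[OF C])
  have ml: "c \<in> carrier C \<Longrightarrow> (\<lambda>d. d \<otimes>\<^bsub>C\<^esub> c) \<in> lin C C" for c
    by (rule linI) (auto simp: unital_algebraD[OF C])
  show "lin_ext C \<beta> \<in> lin F C" by (rule L)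
  show "lin_ext C \<beta> \<one>\<^bsub>F\<^esub> = \<one>\<^bsub>C\<^esub>" by (simp add: one_F single e_in one)
  fix p q assume p: "p \<in> carrier F" and q: "q \<in> carrier F"
  note Lq = linD(1)[OF L q]
  show "lin_ext C \<beta> (p \<otimes>\<^bsub>F\<^esub> q) = lin_ext C \<beta> p \<otimes>\<^bsub>C\<^esub> lin_ext C \<beta> q"
  proof (rule lin_eqI[OF vC lin_comp[OF mult_lin_left[OF q] L] lin_comp[OF L ml[OF Lq]] _ p])
    fix x assume x: "x \<in> X"
    show "lin_ext C \<beta> (Poly_Mapping.single x 1 \<otimes>\<^bsub>F\<^esub> q) = lin_ext C \<beta> (Poly_Mapping.single x 1) \<otimes>\<^bsub>C\<^esub> lin_ext C \<beta> q"
    proof (rule lin_eqI[OF vC lin_comp[OF mult_lin_right[OF single_in[OF x]] L]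
          lin_comp[OF L mr] _ q])
      fix y assume y: "y \<in> X"
      show "lin_ext C \<beta> (Poly_Mapping.single x 1 \<otimes>\<^bsub>F\<^esub> Poly_Mapping.single y 1) =
        lin_ext C \<beta> (Poly_Mapping.single x 1) \<otimes>\<^bsub>C\<^esub> lin_ext C \<beta> (Poly_Mapping.single y 1)"
        by (simp add: mult_single single op_in x y mult)
    qed (use x single \<beta> in auto)
  qed auto
qed

text \<open>Products are bilinear, so the span of \<open>R\<close> is a two-sided ideal as soon as
  it absorbs products of single relators with single monomials.\<close>

lemma span_quotient_alg:
  assumes R: "R \<subseteq> carrier F"
    and left: "\<And>r x. r \<in> R \<Longrightarrow> x \<in> X \<Longrightarrow> r \<otimes>\<^bsub>F\<^esub> Poly_Mapping.single x 1 \<in> lspan F R"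
    and right: "\<And>r x. r \<in> R \<Longrightarrow> x \<in> X \<Longrightarrow> Poly_Mapping.single x 1 \<otimes>\<^bsub>F\<^esub> r \<in> lspan F R"
  shows "quotient_alg F (lspan F R)"
proof -
  note sp = span_facts[OF vspace_F R] and D = submoduleD[OF span_facts(1)[OF vspace_F R]]
  interpret A: unital_algebra F by (rule unital_algebra_F)
  have single: "Poly_Mapping.single x c = c \<odot>\<^bsub>F\<^esub> Poly_Mapping.single x 1" for x c by (simp add: smult_F)
  have comb: "f p \<in> lspan F R" if f: "f \<in> lin F F" and x: "\<And>x. x \<in> X \<Longrightarrow> f (Poly_Mapping.single x 1) \<in> lspan F R"
    and p: "p \<in> carrier F" for f p
  proof -
    have "Poly_Mapping.keys p \<subseteq> X" using p by (simp add: carrier_F)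
    then show ?thesis
    proof (induction rule: poly_mapping_induct_on)
      case zero
      show ?case using lin_zero[OF vspace_F vspace_F f] D(2) by (simp add: zero_F)
    next
      case (add p y c)
      have "f (Poly_Mapping.single y c \<oplus>\<^bsub>F\<^esub> p) = c \<odot>\<^bsub>F\<^esub> f (Poly_Mapping.single y 1) \<oplus>\<^bsub>F\<^esub> f p"
        using linD(2)[OF f single_in[OF add.hyps(2)], of p c] linD(3)[OF f single_in[OF add.hyps(2)], of c 1] add.hyps(1)
        by (simp add: smult_single carrier_F)
      then show ?case using add x D(3,4) by (simp add: add_F)
    qed
  qed
  have "r \<otimes>\<^bsub>F\<^esub> p \<in> lspan F R \<and> p \<otimes>\<^bsub>F\<^esub> r \<in> lspan F R" if r: "r \<in> lspan F R" and p: "p \<in> carrier F" for r p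
  proof -
    have "submodule class_ring {r \<in> carrier F. r \<otimes>\<^bsub>F\<^esub> p \<in> lspan F R \<and> p \<otimes>\<^bsub>F\<^esub> r \<in> lspan F R} F"
      by (rule submoduleI[OF vspace_F])
        (use D p in \<open>auto simp: mult_add_left mult_add_right mult_smult_left mult_smult_right add_F
          add_closed vspaceD[OF vspace_F] zero_F\<close>)
    moreover have "R \<subseteq> {r \<in> carrier F. r \<otimes>\<^bsub>F\<^esub> p \<in> lspan F R \<and> p \<otimes>\<^bsub>F\<^esub> r \<in> lspan F R}"
      using R comb[OF mult_lin_left _ p] comb[OF mult_lin_right _ p] left right by auto
    ultimately show ?thesis using span_least r by blast
  qed
  note * = this
  show ?thesis
  proof (intro quotient_alg.intro unital_algebra_F quotient_alg_axioms.intro)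
    interpret Q: quotient_space F "lspan F R" by (intro quotient_space.intro vspace_F sp)
    show "ideal (lspan F R) F"
    proof (rule idealI)
      show "ring F" by (rule unital_algebraD(1)[OF unital_algebra_F])
      show "subgroup (lspan F R) (add_monoid F)"
        using Q.N.a_subgroup .
    qed (use * in auto)
  qed (rule D(4))
qed

end

subsection \<open>Tensor products\<close>

definition bilin :: "('k::field, 'a, 'm) module_scheme \<Rightarrow> ('k, 'b, 'l) module_scheme \<Rightarrow>
    ('k, 'c, 'n) module_scheme \<Rightarrow> ('a \<Rightarrow> 'b \<Rightarrow> 'c) \<Rightarrow> bool"
  where "bilin A B C \<beta> \<longleftrightarrow> (\<forall>a\<in>carrier A. \<beta> a \<in> lin B C) \<and> (\<forall>b\<in>carrier B. (\<lambda>a. \<beta> a b) \<in> lin A C)"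

lemma bilinI:
  assumes "\<And>a b. a \<in> carrier A \<Longrightarrow> b \<in> carrier B \<Longrightarrow> \<beta> a b \<in> carrier C"
    and "\<And>a a' b. a \<in> carrier A \<Longrightarrow> a' \<in> carrier A \<Longrightarrow> b \<in> carrier B \<Longrightarrow> \<beta> (a \<oplus>\<^bsub>A\<^esub> a') b = \<beta> a b \<oplus>\<^bsub>C\<^esub> \<beta> a' b"
    and "\<And>a b b'. a \<in> carrier A \<Longrightarrow> b \<in> carrier B \<Longrightarrow> b' \<in> carrier B \<Longrightarrow> \<beta> a (b \<oplus>\<^bsub>B\<^esub> b') = \<beta> a b \<oplus>\<^bsub>C\<^esub> \<beta> a b'"
    and "\<And>c a b. a \<in> carrier A \<Longrightarrow> b \<in> carrier B \<Longrightarrow> \<beta> (c \<odot>\<^bsub>A\<^esub> a) b = c \<odot>\<^bsub>C\<^esub> \<beta> a b"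
    and "\<And>c a b. a \<in> carrier A \<Longrightarrow> b \<in> carrier B \<Longrightarrow> \<beta> a (c \<odot>\<^bsub>B\<^esub> b) = c \<odot>\<^bsub>C\<^esub> \<beta> a b"
  shows "bilin A B C \<beta>"
  unfolding bilin_def using assms by (auto intro!: linI)

lemma bilinD:
  assumes "bilin A B C \<beta>"
  shows "\<And>a b. a \<in> carrier A \<Longrightarrow> b \<in> carrier B \<Longrightarrow> \<beta> a b \<in> carrier C"
    and "\<And>a a' b. a \<in> carrier A \<Longrightarrow> a' \<in> carrier A \<Longrightarrow> b \<in> carrier B \<Longrightarrow> \<beta> (a \<oplus>\<^bsub>A\<^esub> a') b = \<beta> a b \<oplus>\<^bsub>C\<^esub> \<beta> a' b"
    and "\<And>a b b'. a \<in> carrier A \<Longrightarrow> b \<in> carrier B \<Longrightarrow> b' \<in> carrier B \<Longrightarrow> \<beta> a (b \<oplus>\<^bsub>B\<^esub> b') = \<beta> a b \<oplus>\<^bsub>C\<^esub> \<beta> a b'"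
    and "\<And>c a b. a \<in> carrier A \<Longrightarrow> b \<in> carrier B \<Longrightarrow> \<beta> (c \<odot>\<^bsub>A\<^esub> a) b = c \<odot>\<^bsub>C\<^esub> \<beta> a b"
    and "\<And>c a b. a \<in> carrier A \<Longrightarrow> b \<in> carrier B \<Longrightarrow> \<beta> a (c \<odot>\<^bsub>B\<^esub> b) = c \<odot>\<^bsub>C\<^esub> \<beta> a b"
    and "\<And>a. a \<in> carrier A \<Longrightarrow> \<beta> a \<in> lin B C" "\<And>b. b \<in> carrier B \<Longrightarrow> (\<lambda>a. \<beta> a b) \<in> lin A C"
proof -
  show 1: "\<And>a. a \<in> carrier A \<Longrightarrow> \<beta> a \<in> lin B C" "\<And>b. b \<in> carrier B \<Longrightarrow> (\<lambda>a. \<beta> a b) \<in> lin A C"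
    using assms by (auto simp: bilin_def)
  show "\<And>a b. a \<in> carrier A \<Longrightarrow> b \<in> carrier B \<Longrightarrow> \<beta> a b \<in> carrier C"
    "\<And>a b b'. a \<in> carrier A \<Longrightarrow> b \<in> carrier B \<Longrightarrow> b' \<in> carrier B \<Longrightarrow> \<beta> a (b \<oplus>\<^bsub>B\<^esub> b') = \<beta> a b \<oplus>\<^bsub>C\<^esub> \<beta> a b'"
    "\<And>c a b. a \<in> carrier A \<Longrightarrow> b \<in> carrier B \<Longrightarrow> \<beta> a (c \<odot>\<^bsub>B\<^esub> b) = c \<odot>\<^bsub>C\<^esub> \<beta> a b"
    using linD[OF 1(1)] by auto
  show "\<And>a a' b. a \<in> carrier A \<Longrightarrow> a' \<in> carrier A \<Longrightarrow> b \<in> carrier B \<Longrightarrow> \<beta> (a \<oplus>\<^bsub>A\<^esub> a') b = \<beta> a b \<oplus>\<^bsub>C\<^esub> \<beta> a' b"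
    "\<And>c a b. a \<in> carrier A \<Longrightarrow> b \<in> carrier B \<Longrightarrow> \<beta> (c \<odot>\<^bsub>A\<^esub> a) b = c \<odot>\<^bsub>C\<^esub> \<beta> a b"
    using linD[OF 1(2)] by auto
qed

lemma formal_tensors_simps:
  "carrier (formal_tensors A B) = {p. Poly_Mapping.keys p \<subseteq> carrier A \<times> carrier B}"
  "\<zero>\<^bsub>formal_tensors A B\<^esub> = 0" "add (formal_tensors A B) = (+)"
  "smult (formal_tensors A B) = (\<lambda>c. Poly_Mapping.map ((*) c))"
  "\<one>\<^bsub>formal_tensors A B\<^esub> = Poly_Mapping.single (\<one>\<^bsub>A\<^esub>, \<one>\<^bsub>B\<^esub>) 1"
  by (simp_all add: formal_tensors_def)

lemma free_space_tensors: "free_space (formal_tensors A B) (carrier A \<times> carrier B)"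
  by (simp add: free_space_def formal_tensors_simps)

locale tensor_pair =
  fixes A :: "('k::field, 'a, 'm) module_scheme" and B :: "('k, 'b, 'l) module_scheme"
  assumes vA: "vspace A" and vB: "vspace B"
begin

sublocale FT: free_space "formal_tensors A B" "carrier A \<times> carrier B"
  by (rule free_space_tensors)

lemma relators_in: "tensor_relators A B \<subseteq> carrier (formal_tensors A B)"
proof
  fix r assume "r \<in> tensor_relators A B"
  moreover have s: "Poly_Mapping.single (a, b) c \<in> carrier (formal_tensors A B)"
    if "a \<in> carrier A" "b \<in> carrier B" for a b c
    by (rule FT.single_in) (use that in auto)
  moreover have d: "p - q \<in> carrier (formal_tensors A B)"
    if "p \<in> carrier (formal_tensors A B)" "q \<in> carrier (formal_tensors A B)" for p q
    using abelian_group.minus_closed[OF vspaceD(1)[OF FT.vspace_F] that] that by (simp add: FT.minus_F)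
  ultimately show "r \<in> carrier (formal_tensors A B)"
    unfolding tensor_relators_def using vspaceD(3,10)[OF vA] vspaceD(3,10)[OF vB]
    by (auto intro!: d s)
qed

sublocale Q: quotient_space "formal_tensors A B" "tensor_null A B"
  unfolding tensor_null_def
  by (intro quotient_space.intro FT.vspace_F span_facts(1) relators_in)

lemma tensor_Q: "tensor A B = quotient_algebra (formal_tensors A B) (tensor_null A B)"
  by (simp add: tensor_def)

lemma vspace_tensor: "vspace (tensor A B)"
  unfolding tensor_Q by (rule Q.vspace_Q)

lemma tens_\<pi>: "tens A B a b = Q.\<pi> (Poly_Mapping.single (a, b) 1)" by (simp add: tens_def)

lemma relator_in_null: "r \<in> tensor_relators A B \<Longrightarrow> r \<in> tensor_null A B"
  unfolding tensor_null_def using span_facts(2)[OF FT.vspace_F relators_in] by blast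

lemma tens_closed: "a \<in> carrier A \<Longrightarrow> b \<in> carrier B \<Longrightarrow> tens A B a b \<in> carrier (tensor A B)"
  unfolding tensor_Q Q.carrier_Q tens_\<pi> by (auto intro!: FT.single_in)

lemma smult_tens_single:
  "a \<in> carrier A \<Longrightarrow> b \<in> carrier B \<Longrightarrow> c \<odot>\<^bsub>tensor A B\<^esub> tens A B a b = Q.\<pi> (Poly_Mapping.single (a, b) c)"
  unfolding tensor_Q tens_\<pi>
  by (subst Q.\<pi>_smult[symmetric]) (auto simp: FT.single_in FT.smult_F)

text \<open>Two formal sums have the same class when their difference is a relator, and the four
  families of relators are the four bilinearity laws.\<close>

lemma tens_bilin: "bilin A B (tensor A B) (tens A B)"
proof (rule bilinI)
  note S = FT.single_in
  note sum = Q.\<pi>_add[folded tensor_Q]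
  have eq: "Q.\<pi> p = Q.\<pi> q" if "p \<in> carrier (formal_tensors A B)" "q \<in> carrier (formal_tensors A B)"
    "p - q \<in> tensor_relators A B" for p q
    using that relator_in_null by (simp add: Q.\<pi>_eq_iff FT.minus_F)
  have add: "p + q \<in> carrier (formal_tensors A B)"
    if "p \<in> carrier (formal_tensors A B)" "q \<in> carrier (formal_tensors A B)" for p q
    using vspaceD(10)[OF FT.vspace_F that] by (simp add: FT.add_F)
  {
    fix a a' b assume *: "a \<in> carrier A" "a' \<in> carrier A" "b \<in> carrier B"
    have "tens A B (a \<oplus>\<^bsub>A\<^esub> a') b = Q.\<pi> (Poly_Mapping.single (a, b) 1 + Poly_Mapping.single (a', b) 1)"
      unfolding tens_\<pi> by (rule eq)
        (use * vspaceD(10)[OF vA] in \<open>auto intro!: S add simp: tensor_relators_def diff_diff_eq\<close>)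
    then show "tens A B (a \<oplus>\<^bsub>A\<^esub> a') b = tens A B a b \<oplus>\<^bsub>tensor A B\<^esub> tens A B a' b"
      unfolding tens_\<pi> using sum[OF S S, of "(a, b)" "(a', b)" 1 1] * by (simp add: FT.add_F)
  }
  {
    fix a b b' assume *: "a \<in> carrier A" "b \<in> carrier B" "b' \<in> carrier B"
    have "tens A B a (b \<oplus>\<^bsub>B\<^esub> b') = Q.\<pi> (Poly_Mapping.single (a, b) 1 + Poly_Mapping.single (a, b') 1)"
      unfolding tens_\<pi> by (rule eq)
        (use * vspaceD(10)[OF vB] in \<open>auto intro!: S add simp: tensor_relators_def diff_diff_eq\<close>)
    then show "tens A B a (b \<oplus>\<^bsub>B\<^esub> b') = tens A B a b \<oplus>\<^bsub>tensor A B\<^esub> tens A B a b'"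
      unfolding tens_\<pi> using sum[OF S S, of "(a, b)" "(a, b')" 1 1] * by (simp add: FT.add_F)
  }
  fix c a b assume *: "a \<in> carrier A" "b \<in> carrier B"
  show "tens A B a b \<in> carrier (tensor A B)" using * by (rule tens_closed)
  show "tens A B (c \<odot>\<^bsub>A\<^esub> a) b = c \<odot>\<^bsub>tensor A B\<^esub> tens A B a b"
    unfolding smult_tens_single[OF *] unfolding tens_\<pi>
    by (rule eq) (use * vspaceD(3)[OF vA] in \<open>auto intro!: S simp: tensor_relators_def\<close>)
  show "tens A B a (c \<odot>\<^bsub>B\<^esub> b) = c \<odot>\<^bsub>tensor A B\<^esub> tens A B a b"
    unfolding smult_tens_single[OF *] unfolding tens_\<pi>
    by (rule eq) (use * vspaceD(3)[OF vB] in \<open>auto intro!: S simp: tensor_relators_def\<close>)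
qed

text \<open>There is no case for scalar multiples or for zero: a scalar moves into the left factor
  of a pure tensor, and zero is itself a pure tensor.\<close>

lemma tensor_induct [consumes 1, case_names tens add]:
  assumes t: "t \<in> carrier (tensor A B)"
    and tens: "\<And>a b. a \<in> carrier A \<Longrightarrow> b \<in> carrier B \<Longrightarrow> P (tens A B a b)"
    and add: "\<And>s t. s \<in> carrier (tensor A B) \<Longrightarrow> t \<in> carrier (tensor A B) \<Longrightarrow> P s \<Longrightarrow> P t \<Longrightarrow> P (s \<oplus>\<^bsub>tensor A B\<^esub> t)"
  shows "P t"
proof -
  note bil = bilinD[OF tens_bilin]
  obtain p where p: "p \<in> carrier (formal_tensors A B)" "t = Q.\<pi> p"
    using t by (auto simp: tensor_Q Q.carrier_Q)
  have "Poly_Mapping.keys p \<subseteq> carrier A \<times> carrier B" using p by (simp add: FT.carrier_F)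
  then have "P (Q.\<pi> p)"
  proof (induction rule: poly_mapping_induct_on)
    case zero
    have "Q.\<pi> 0 = \<zero>\<^bsub>tensor A B\<^esub>"
      using lin_zero[OF FT.vspace_F Q.vspace_Q Q.\<pi>_lin] by (simp add: FT.zero_F tensor_Q)
    also have "\<dots> = 0 \<odot>\<^bsub>tensor A B\<^esub> tens A B \<zero>\<^bsub>A\<^esub> \<zero>\<^bsub>B\<^esub>"
      using vspaceD(8)[OF vspace_tensor tens_closed] vspaceD(12)[OF vA] vspaceD(12)[OF vB] by simp
    also have "\<dots> = tens A B (0 \<odot>\<^bsub>A\<^esub> \<zero>\<^bsub>A\<^esub>) \<zero>\<^bsub>B\<^esub>"
      using bil(4) vspaceD(12)[OF vA] vspaceD(12)[OF vB] by simp
    finally show ?case using tens vspaceD(3,12)[OF vA] vspaceD(12)[OF vB] by simp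
  next
    case (add p x c)
    obtain a b where x: "x = (a, b)" "a \<in> carrier A" "b \<in> carrier B" using add.hyps(2) by auto
    have "Q.\<pi> (Poly_Mapping.single x c) = tens A B (c \<odot>\<^bsub>A\<^esub> a) b"
      using x smult_tens_single bil(4) by simp
    then have "P (Q.\<pi> (Poly_Mapping.single x c))" using tens x vspaceD(3)[OF vA] by simp
    moreover have "p \<in> carrier (formal_tensors A B)" "Poly_Mapping.single x c \<in> carrier (formal_tensors A B)"
      using add.hyps by (auto simp: FT.carrier_F FT.single_in)
    moreover have "Q.\<pi> (Poly_Mapping.single x c + p) = Q.\<pi> (Poly_Mapping.single x c) \<oplus>\<^bsub>tensor A B\<^esub> Q.\<pi> p"
      using Q.\<pi>_add[of "Poly_Mapping.single x c" p] calculation by (simp add: tensor_Q FT.add_F)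
    ultimately show ?case using assms(3) add.IH by (simp add: tensor_Q Q.carrier_Q)
  qed
  then show ?thesis by (simp add: p)
qed

lemma tensor_lin_eqI:
  assumes "f \<in> lin (tensor A B) C" "g \<in> lin (tensor A B) C"
    and "\<And>a b. a \<in> carrier A \<Longrightarrow> b \<in> carrier B \<Longrightarrow> f (tens A B a b) = g (tens A B a b)"
    and "t \<in> carrier (tensor A B)"
  shows "f t = g t"
  using assms(4) by (induction rule: tensor_induct) (auto simp: assms(3) linD(2)[OF assms(1)] linD(2)[OF assms(2)])

lemma tensor_lift_ext: "tensor_lift C \<beta> t = lin_ext C (\<lambda>x. \<beta> (fst x) (snd x)) (SOME p. p \<in> t)"
  by (simp add: tensor_lift_def lin_ext_def Let_def)

context
  fixes C :: "('k, 'c, 'n) module_scheme" and \<beta>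
  assumes vC: "vspace C" and \<beta>: "bilin A B C \<beta>"
begin

lemma ext_lin: "lin_ext C (\<lambda>x. \<beta> (fst x) (snd x)) \<in> lin (formal_tensors A B) C"
  by (rule FT.lin_ext_in[OF vC]) (auto simp: bilinD(1)[OF \<beta>])

lemma ext_single:
  "a \<in> carrier A \<Longrightarrow> b \<in> carrier B \<Longrightarrow>
    lin_ext C (\<lambda>x. \<beta> (fst x) (snd x)) (Poly_Mapping.single (a, b) c) = c \<odot>\<^bsub>C\<^esub> \<beta> a b"
  using FT.lin_ext_single[OF vC, of "\<lambda>x. \<beta> (fst x) (snd x)" "(a, b)"] bilinD(1)[OF \<beta>] by simp

text \<open>Each relator is mapped to an instance of a bilinearity law of \<beta>, written as a
  difference; hence the linear extension kills the span of the relators.\<close>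

lemma ext_null:
  assumes "p \<in> tensor_null A B"
  shows "lin_ext C (\<lambda>x. \<beta> (fst x) (snd x)) p = \<zero>\<^bsub>C\<^esub>"
proof (rule span_kernel[OF FT.vspace_F vC ext_lin relators_in _ assms[unfolded tensor_null_def]])
  interpret C: abelian_group C using vC vspaceD by blast
  let ?L = "lin_ext C (\<lambda>x. \<beta> (fst x) (snd x))"
  have minus: "?L (p - q) = ?L p \<ominus>\<^bsub>C\<^esub> ?L q" and closed: "p - q \<in> carrier (formal_tensors A B)"
    if "p \<in> carrier (formal_tensors A B)" "q \<in> carrier (formal_tensors A B)" for p q
  proof -
    show closed: "p - q \<in> carrier (formal_tensors A B)"
      using abelian_group.minus_closed[OF vspaceD(1)[OF FT.vspace_F] that] that by (simp add: FT.minus_F)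
    have "?L p = ?L (p - q) \<oplus>\<^bsub>C\<^esub> ?L q"
      using linD(2)[OF ext_lin closed that(2)] by (simp add: FT.add_F)
    then show "?L (p - q) = ?L p \<ominus>\<^bsub>C\<^esub> ?L q"
      using linD(1)[OF ext_lin closed] linD(1)[OF ext_lin that(2)]
      by (simp add: a_minus_def C.a_assoc C.r_neg)
  qed
  have s: "Poly_Mapping.single (a, b) c \<in> carrier (formal_tensors A B)"
    if "a \<in> carrier A" "b \<in> carrier B" for a b c
    by (rule FT.single_in) (use that in auto)
  note simps = minus closed s ext_single vspaceD(3,10)[OF vA] vspaceD(3,10)[OF vB] bilinD(1-5)[OF \<beta>] vspaceD(7)[OF vC]
  fix r assume "r \<in> tensor_relators A B"
  then show "?L r = \<zero>\<^bsub>C\<^esub>"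
  proof (unfold tensor_relators_def, elim UnE CollectE exE conjE)
    fix a a' b
    assume r: "r = Poly_Mapping.single (a \<oplus>\<^bsub>A\<^esub> a', b) 1 - Poly_Mapping.single (a, b) 1 - Poly_Mapping.single (a', b) 1"
      and *: "a \<in> carrier A" "a' \<in> carrier A" "b \<in> carrier B"
    have "?L r = (\<beta> a b \<oplus>\<^bsub>C\<^esub> \<beta> a' b) \<ominus>\<^bsub>C\<^esub> \<beta> a b \<ominus>\<^bsub>C\<^esub> \<beta> a' b"
      unfolding r using * by (simp add: simps)
    also have "\<dots> = \<zero>\<^bsub>C\<^esub>" using * simps(13)
      by (simp add: bilinD(1)[OF \<beta>] a_minus_def C.a_ac C.r_neg C.r_neg2 C.r_neg1)
    finally show ?thesis .
  next
    fix a b b'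
    assume r: "r = Poly_Mapping.single (a, b \<oplus>\<^bsub>B\<^esub> b') 1 - Poly_Mapping.single (a, b) 1 - Poly_Mapping.single (a, b') 1"
      and *: "a \<in> carrier A" "b \<in> carrier B" "b' \<in> carrier B"
    have "?L r = (\<beta> a b \<oplus>\<^bsub>C\<^esub> \<beta> a b') \<ominus>\<^bsub>C\<^esub> \<beta> a b \<ominus>\<^bsub>C\<^esub> \<beta> a b'"
      unfolding r using * by (simp add: simps)
    also have "\<dots> = \<zero>\<^bsub>C\<^esub>" using *
      by (simp add: bilinD(1)[OF \<beta>] a_minus_def C.a_ac C.r_neg C.r_neg2 C.r_neg1)
    finally show ?thesis .
  next
    fix c a b
    assume r: "r = Poly_Mapping.single (c \<odot>\<^bsub>A\<^esub> a, b) 1 - Poly_Mapping.single (a, b) c"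
      and *: "a \<in> carrier A" "b \<in> carrier B"
    show ?thesis unfolding r using * vspaceD(3)[OF vC] by (simp add: simps a_minus_def C.r_neg)
  next
    fix c a b
    assume r: "r = Poly_Mapping.single (a, c \<odot>\<^bsub>B\<^esub> b) 1 - Poly_Mapping.single (a, b) c"
      and *: "a \<in> carrier A" "b \<in> carrier B"
    show ?thesis unfolding r using * vspaceD(3)[OF vC] by (simp add: simps a_minus_def C.r_neg)
  qed
qed

lemma tensor_lift_lin: "tensor_lift C \<beta> \<in> lin (tensor A B) C"
  unfolding tensor_lift_ext[abs_def] tensor_Q
  by (rule Q.induced_lin[OF vC ext_lin ext_null])

lemma tensor_lift_tens:
  assumes "a \<in> carrier A" "b \<in> carrier B"
  shows "tensor_lift C \<beta> (tens A B a b) = \<beta> a b"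
  unfolding tensor_lift_ext tens_\<pi> using assms
  by (subst Q.induced_apply[OF vC ext_lin ext_null])
    (auto intro!: FT.single_in simp: ext_single bilinD(1)[OF \<beta>] vspaceD(7)[OF vC])

lemma tensor_lift_finsum:
  assumes "finite I" "\<And>i. i \<in> I \<Longrightarrow> x i \<in> carrier A" "\<And>i. i \<in> I \<Longrightarrow> y i \<in> carrier B"
  shows "tensor_lift C \<beta> (\<Oplus>\<^bsub>tensor A B\<^esub>i\<in>I. tens A B (x i) (y i)) = (\<Oplus>\<^bsub>C\<^esub>i\<in>I. \<beta> (x i) (y i))"
proof -
  interpret C: abelian_group C using vC vspaceD by blast
  have "tensor_lift C \<beta> (\<Oplus>\<^bsub>tensor A B\<^esub>i\<in>I. tens A B (x i) (y i))
    = (\<Oplus>\<^bsub>C\<^esub>i\<in>I. tensor_lift C \<beta> (tens A B (x i) (y i)))"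
    by (rule lin_finsum[OF vspace_tensor vC tensor_lift_lin assms(1)]) (simp add: assms tens_closed)
  also have "\<dots> = (\<Oplus>\<^bsub>C\<^esub>i\<in>I. \<beta> (x i) (y i))"
    by (rule C.add.finprod_cong') (auto simp: assms tensor_lift_tens bilinD(1)[OF \<beta>])
  finally show ?thesis .
qed

end

end

section \<open>Induced maps between tensor products and the associator\<close>

lemma bilin_comp:
  assumes "bilin A B C \<beta>" "f \<in> lin A' A" "g \<in> lin B' B"
  shows "bilin A' B' C (\<lambda>a b. \<beta> (f a) (g b))"
  by (rule bilinI) (simp_all add: linD[OF assms(2)] linD[OF assms(3)] bilinD(1-5)[OF assms(1)])

lemma lin_id: "id \<in> lin V V" by (rule linI) auto

lemma tensor_map_facts:
  assumes "vspace A" "vspace B" "vspace A'" "vspace B'" "f \<in> lin A A'" "g \<in> lin B B'"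
  shows "tensor_map A' B' f g \<in> lin (tensor A B) (tensor A' B')"
    and "\<And>a b. a \<in> carrier A \<Longrightarrow> b \<in> carrier B \<Longrightarrow> tensor_map A' B' f g (tens A B a b) = tens A' B' (f a) (g b)"
    and "\<And>I x y. finite I \<Longrightarrow> (\<And>i. i \<in> I \<Longrightarrow> x i \<in> carrier A) \<Longrightarrow> (\<And>i. i \<in> I \<Longrightarrow> y i \<in> carrier B) \<Longrightarrow>
      tensor_map A' B' f g (\<Oplus>\<^bsub>tensor A B\<^esub>i\<in>I. tens A B (x i) (y i)) = (\<Oplus>\<^bsub>tensor A' B'\<^esub>i\<in>I. tens A' B' (f (x i)) (g (y i)))"
proof -
  interpret T: tensor_pair A B by (rule tensor_pair.intro) fact+
  interpret T': tensor_pair A' B' by (rule tensor_pair.intro) fact+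
  note b = bilin_comp[OF T'.tens_bilin assms(5,6)]
  show "tensor_map A' B' f g \<in> lin (tensor A B) (tensor A' B')"
    unfolding tensor_map_def by (rule T.tensor_lift_lin[OF T'.vspace_tensor b])
  show "\<And>a b. a \<in> carrier A \<Longrightarrow> b \<in> carrier B \<Longrightarrow> tensor_map A' B' f g (tens A B a b) = tens A' B' (f a) (g b)"
    unfolding tensor_map_def by (rule T.tensor_lift_tens[OF T'.vspace_tensor b])
  show "\<And>I x y. finite I \<Longrightarrow> (\<And>i. i \<in> I \<Longrightarrow> x i \<in> carrier A) \<Longrightarrow> (\<And>i. i \<in> I \<Longrightarrow> y i \<in> carrier B) \<Longrightarrow>
      tensor_map A' B' f g (\<Oplus>\<^bsub>tensor A B\<^esub>i\<in>I. tens A B (x i) (y i)) = (\<Oplus>\<^bsub>tensor A' B'\<^esub>i\<in>I. tens A' B' (f (x i)) (g (y i)))"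
    unfolding tensor_map_def by (rule T.tensor_lift_finsum[OF T'.vspace_tensor b])
qed

lemma tensor_assoc_facts:
  assumes "vspace A" "vspace B" "vspace C"
  shows "tensor_assoc A B C \<in> lin (tensor (tensor A B) C) (tensor A (tensor B C))"
    and "\<And>a b c. a \<in> carrier A \<Longrightarrow> b \<in> carrier B \<Longrightarrow> c \<in> carrier C \<Longrightarrow>
      tensor_assoc A B C (tens (tensor A B) C (tens A B a b) c) = tens A (tensor B C) a (tens B C b c)"
proof -
  interpret AB: tensor_pair A B by (rule tensor_pair.intro) fact+
  interpret BC: tensor_pair B C by (rule tensor_pair.intro) fact+
  interpret AB_C: tensor_pair "tensor A B" C by (intro tensor_pair.intro AB.vspace_tensor assms)
  interpret A_BC: tensor_pair A "tensor B C" by (intro tensor_pair.intro BC.vspace_tensor assms)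
  let ?T = "tensor A (tensor B C)"
  let ?\<gamma> = "\<lambda>c a b. tens A (tensor B C) a (tens B C b c)"
  note b1 = bilinD[OF A_BC.tens_bilin] and b2 = bilinD[OF BC.tens_bilin]
  have 1: "bilin A B ?T (?\<gamma> c)" if "c \<in> carrier C" for c
    by (rule bilinI) (simp_all add: b1(1-5) b2(1-5) that)
  have 2: "bilin (tensor A B) C ?T (\<lambda>t c. tensor_lift ?T (?\<gamma> c) t)"
    unfolding bilin_def
  proof safe
    fix c assume c: "c \<in> carrier C"
    show "(\<lambda>t. tensor_lift ?T (?\<gamma> c) t) \<in> lin (tensor A B) ?T"
      by (rule AB.tensor_lift_lin[OF A_BC.vspace_tensor 1[OF c]])
  next
    \<comment> \<open>The lift at \<open>t\<close> involves a different bilinear map for every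
      \<open>c\<close>, so its linearity in \<open>c\<close> is not an instance of
      \<open>tensor_lift_lin\<close>; it is proved by induction on \<open>t\<close>.\<close>
    fix t assume "t \<in> carrier (tensor A B)"
    then show "(\<lambda>c. tensor_lift ?T (?\<gamma> c) t) \<in> lin C ?T"
    proof (induction rule: AB.tensor_induct)
      case (tens a b)
      show ?case
        by (rule linI)
          (simp_all add: AB.tensor_lift_tens[OF A_BC.vspace_tensor 1] tens b1(1-5) b2(1-5) vspaceD(3,10)[OF assms(3)])
    next
      case (add s t)
      interpret T: abelian_group ?T using A_BC.vspace_tensor vspaceD by blast
      note L = linD[OF AB.tensor_lift_lin[OF A_BC.vspace_tensor 1]]
      note vT = vspaceD[OF A_BC.vspace_tensor]
      show ?case
        by (rule linI)
          (simp_all add: add L(1,2) vspaceD(3,10)[OF assms(3)] linD[OF add.IH(1)] linD[OF add.IH(2)] vT(3,5) T.a_ac)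
    qed
  qed
  show "tensor_assoc A B C \<in> lin (tensor (tensor A B) C) ?T"
    unfolding tensor_assoc_def by (rule AB_C.tensor_lift_lin[OF A_BC.vspace_tensor 2])
  fix a b c assume *: "a \<in> carrier A" "b \<in> carrier B" "c \<in> carrier C"
  show "tensor_assoc A B C (tens (tensor A B) C (tens A B a b) c) = tens A (tensor B C) a (tens B C b c)"
    unfolding tensor_assoc_def
    using AB_C.tensor_lift_tens[OF A_BC.vspace_tensor 2 AB.tens_closed[OF *(1,2)] *(3)]
      AB.tensor_lift_tens[OF A_BC.vspace_tensor 1[OF *(3)] *(1,2)] by simp
qed

subsection \<open>Tensor products of algebras\<close>

locale tensor_algebras =
  fixes A :: "('k::field, 'a, 'm) module_scheme" and B :: "('k, 'b, 'l) module_scheme"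
  assumes A: "unital_algebra A" and B: "unital_algebra B"
begin

sublocale tensor_pair A B by (intro tensor_pair.intro unital_algebraD(2) A B)

sublocale FA: free_alg "formal_tensors A B" "carrier A \<times> carrier B"
  "\<lambda>x y. (fst x \<otimes>\<^bsub>A\<^esub> fst y, snd x \<otimes>\<^bsub>B\<^esub> snd y)" "(\<one>\<^bsub>A\<^esub>, \<one>\<^bsub>B\<^esub>)"
proof
  fix p q :: "'a \<times> 'b \<Rightarrow>\<^sub>0 'k"
  show "p \<otimes>\<^bsub>formal_tensors A B\<^esub> q = (\<Sum>x\<in>Poly_Mapping.keys p. \<Sum>y\<in>Poly_Mapping.keys q.
      Poly_Mapping.single (fst x \<otimes>\<^bsub>A\<^esub> fst y, snd x \<otimes>\<^bsub>B\<^esub> snd y)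
        (Poly_Mapping.lookup p x * Poly_Mapping.lookup q y))"
    by (simp add: formal_tensors_def case_prod_unfold)
qed (auto simp: formal_tensors_simps unital_algebraD[OF A] unital_algebraD[OF B])

sublocale QA: quotient_alg "formal_tensors A B" "tensor_null A B"
  unfolding tensor_null_def
proof (rule FA.span_quotient_alg[OF relators_in])
  note mA = unital_algebraD[OF A] and mB = unital_algebraD[OF B]
  have d1: "(p - q) \<otimes>\<^bsub>formal_tensors A B\<^esub> r = p \<otimes>\<^bsub>formal_tensors A B\<^esub> r - q \<otimes>\<^bsub>formal_tensors A B\<^esub> r" for p q r
    using FA.mult_add_left[of "p - q" q r] by simp
  have d2: "r \<otimes>\<^bsub>formal_tensors A B\<^esub> (p - q) = r \<otimes>\<^bsub>formal_tensors A B\<^esub> p - r \<otimes>\<^bsub>formal_tensors A B\<^esub> q" for p q r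
    using FA.mult_add_right[of r "p - q" q] by simp
  have in_span: "r \<in> tensor_relators A B \<Longrightarrow> r \<in> lspan (formal_tensors A B) (tensor_relators A B)" for r
    using span_facts(2)[OF FT.vspace_F relators_in] by blast
  fix r x assume r: "r \<in> tensor_relators A B" and x: "x \<in> carrier A \<times> carrier B"
  obtain a b where ab: "x = (a, b)" "a \<in> carrier A" "b \<in> carrier B" using x by auto
  \<comment> \<open>Multiplying a relator by a pure pair multiplies its entries, and by
    distributivity the result is a relator of the same kind.\<close>
  have "r \<otimes>\<^bsub>formal_tensors A B\<^esub> Poly_Mapping.single x 1 \<in> tensor_relators A B"
    using r unfolding tensor_relators_def
    by (elim UnE CollectE exE conjE; simp add: d1 FA.mult_single ab mA(8,10) mB(8,10); insert ab mA(4) mB(4)) blast+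
  then show "r \<otimes>\<^bsub>formal_tensors A B\<^esub> Poly_Mapping.single x 1 \<in> lspan (formal_tensors A B) (tensor_relators A B)"
    by (rule in_span)
  have "Poly_Mapping.single x 1 \<otimes>\<^bsub>formal_tensors A B\<^esub> r \<in> tensor_relators A B"
    using r unfolding tensor_relators_def
    by (elim UnE CollectE exE conjE; simp add: d2 FA.mult_single ab mA(9,11) mB(9,11); insert ab mA(4) mB(4)) blast+
  then show "Poly_Mapping.single x 1 \<otimes>\<^bsub>formal_tensors A B\<^esub> r \<in> lspan (formal_tensors A B) (tensor_relators A B)"
    by (rule in_span)
qed

lemma unital_algebra_tensor: "unital_algebra (tensor A B)"
  unfolding tensor_Q by (rule QA.unital_algebra_Q)

lemma tens_one: "\<one>\<^bsub>tensor A B\<^esub> = tens A B \<one>\<^bsub>A\<^esub> \<one>\<^bsub>B\<^esub>"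
  using algebra_homD(2)[OF QA.\<pi>_hom] by (simp add: tens_\<pi> tensor_Q FA.one_F)

lemma tens_mult:
  assumes "a \<in> carrier A" "b \<in> carrier B" "a' \<in> carrier A" "b' \<in> carrier B"
  shows "tens A B a b \<otimes>\<^bsub>tensor A B\<^esub> tens A B a' b' = tens A B (a \<otimes>\<^bsub>A\<^esub> a') (b \<otimes>\<^bsub>B\<^esub> b')"
  using QA.\<pi>_mult[of "Poly_Mapping.single (a, b) 1" "Poly_Mapping.single (a', b') 1"] assms
  by (simp add: tens_\<pi> tensor_Q FT.single_in FA.mult_single)

text \<open>Multiplicativity is an additive condition in each of the two arguments, so pure tensors
  suffice.\<close>

lemma tensor_hom_lin:
  assumes C: "unital_algebra C" and f: "f \<in> lin (tensor A B) C"
    and one: "f (tens A B \<one>\<^bsub>A\<^esub> \<one>\<^bsub>B\<^esub>) = \<one>\<^bsub>C\<^esub>"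
    and mult: "\<And>a b a' b'. a \<in> carrier A \<Longrightarrow> b \<in> carrier B \<Longrightarrow> a' \<in> carrier A \<Longrightarrow> b' \<in> carrier B \<Longrightarrow>
      f (tens A B (a \<otimes>\<^bsub>A\<^esub> a') (b \<otimes>\<^bsub>B\<^esub> b')) = f (tens A B a b) \<otimes>\<^bsub>C\<^esub> f (tens A B a' b')"
  shows "f \<in> algebra_hom (tensor A B) C"
proof (rule algebra_homI[OF f])
  show "f \<one>\<^bsub>tensor A B\<^esub> = \<one>\<^bsub>C\<^esub>" by (simp add: tens_one one)
  note mT = unital_algebraD[OF unital_algebra_tensor] and mC = unital_algebraD[OF C]
  fix s t assume s: "s \<in> carrier (tensor A B)" and t: "t \<in> carrier (tensor A B)"
  from s show "f (s \<otimes>\<^bsub>tensor A B\<^esub> t) = f s \<otimes>\<^bsub>C\<^esub> f t"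
  proof (induction rule: tensor_induct)
    case (tens a b)
    from t show ?case
      by (induction rule: tensor_induct)
        (simp_all add: tens_mult tens mult mT(4,9) mC(9) linD[OF f] tens_closed)
  qed (simp add: t mT(4,8) mC(8) linD[OF f])
qed

end

lemma tensor_map_hom:
  assumes "unital_algebra A" "unital_algebra B" "unital_algebra A'" "unital_algebra B'"
    "f \<in> algebra_hom A A'" "g \<in> algebra_hom B B'"
  shows "tensor_map A' B' f g \<in> algebra_hom (tensor A B) (tensor A' B')"
proof -
  interpret T: tensor_algebras A B by (rule tensor_algebras.intro) fact+
  interpret T': tensor_algebras A' B' by (rule tensor_algebras.intro) fact+
  note F = algebra_homD[OF assms(5)] and G = algebra_homD[OF assms(6)]
  note M = tensor_map_facts[OF T.vA T.vB T'.vA T'.vB F(1) G(1)]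
  show ?thesis
    by (rule T.tensor_hom_lin[OF T'.unital_algebra_tensor M(1)])
      (simp_all add: M(2) F G T'.tens_one T'.tens_mult unital_algebraD[OF assms(1)] unital_algebraD[OF assms(2)])
qed

subsection \<open>Presented algebras\<close>

text \<open>\<open>As\<close> and \<open>free_product\<close> are records that extend a presented
  algebra by Hopf fields. They have another type than that algebra, so its structure is carried over
  field by field.\<close>

lemma unital_algebra_cong:
  fixes A :: "('k::field, 'a, 'm) module_scheme" and B :: "('k, 'a, 'l) module_scheme"
  assumes A: "unital_algebra A" and eq: "carrier B = carrier A" "add B = add A" "mult B = mult A"
    "one B = one A" "zero B = zero A" "smult B = smult A"
  shows "unital_algebra B"
proof -
  note D = unital_algebraD[OF A] and V = vspaceD[OF unital_algebraD(2)[OF A]]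
  interpret abelian_group A by (rule V)
  have "abelian_group B"
  proof (rule abelian_groupI)
    fix x assume "x \<in> carrier B"
    then show "\<exists>y\<in>carrier B. y \<oplus>\<^bsub>B\<^esub> x = \<zero>\<^bsub>B\<^esub>"
      by (intro bexI[of _ "\<ominus>\<^bsub>A\<^esub> x"]) (auto simp: eq l_neg)
  qed (auto simp: eq a_ac)
  then have "vspace B" by (rule vspaceI) (simp_all add: eq V)
  moreover have "Group.monoid B" by (rule monoidI) (simp_all add: eq D)
  ultimately show ?thesis by (rule unital_algebraI) (simp_all add: eq D)
qed

lemma algebra_hom_cong_source:
  assumes "carrier B = carrier A" "add B = add A" "mult B = mult A" "one B = one A" "smult B = smult A"
  shows "algebra_hom B C = algebra_hom A C"
  by (simp add: algebra_hom_def Ring.ring_hom_def LinearCombinations.module_hom_def assms)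

lemma algebra_hom_cong_target:
  assumes "carrier B = carrier A" "add B = add A" "mult B = mult A" "one B = one A" "smult B = smult A"
  shows "algebra_hom C B = algebra_hom C A"
  by (simp add: algebra_hom_def Ring.ring_hom_def LinearCombinations.module_hom_def assms)

definition word_val :: "('k::field, 'b, 'm) module_scheme \<Rightarrow> ('x \<Rightarrow> 'b) \<Rightarrow> 'x free_monoid \<Rightarrow> 'b"
  where "word_val B \<phi> w = foldr (\<lambda>x b. \<phi> x \<otimes>\<^bsub>B\<^esub> b) (letters w) \<one>\<^bsub>B\<^esub>"

lemma presented_lift_ext: "presented_lift B \<phi> t = lin_ext B (word_val B \<phi>) (SOME p. p \<in> t)"
  by (simp add: presented_lift_def lin_ext_def Let_def word_val_def)

lemma free_algebra_simps:
  "carrier (free_algebra X) = {p. Poly_Mapping.keys p \<subseteq> {w. set (letters w) \<subseteq> X}}"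
  "\<zero>\<^bsub>free_algebra X\<^esub> = 0" "add (free_algebra X) = (+)" "mult (free_algebra X) = (*)"
  "smult (free_algebra X) = (\<lambda>c. Poly_Mapping.map ((*) c))" "\<one>\<^bsub>free_algebra X\<^esub> = 1"
  by (auto simp: free_algebra_def)

lemma letters_plus [simp]: "letters (v + w) = letters v @ letters w" and letters_zero [simp]: "letters 0 = []"
  by (simp_all add: plus_free_monoid_def zero_free_monoid_def)

lemma free_alg_words:
  "free_alg (free_algebra X :: ('k::field, 'x free_monoid \<Rightarrow>\<^sub>0 'k) module) {w. set (letters w) \<subseteq> X} (+) 0"
proof
  fix p q :: "'x free_monoid \<Rightarrow>\<^sub>0 'k"
  have "p * q = (\<Sum>x\<in>Poly_Mapping.keys p. Poly_Mapping.single x (Poly_Mapping.lookup p x)) *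
    (\<Sum>y\<in>Poly_Mapping.keys q. Poly_Mapping.single y (Poly_Mapping.lookup q y))"
    by (simp add: poly_mapping_sum_single)
  then show "p \<otimes>\<^bsub>free_algebra X\<^esub> q = (\<Sum>x\<in>Poly_Mapping.keys p. \<Sum>y\<in>Poly_Mapping.keys q.
      Poly_Mapping.single (x + y) (Poly_Mapping.lookup p x * Poly_Mapping.lookup q y))"
    by (simp add: free_algebra_simps sum_product mult_single)
qed (auto simp: free_algebra_simps add.assoc)

lemma word_val_in:
  assumes "unital_algebra B" "\<And>x. x \<in> X \<Longrightarrow> \<phi> x \<in> carrier B" "set xs \<subseteq> X"
  shows "foldr (\<lambda>x b. \<phi> x \<otimes>\<^bsub>B\<^esub> b) xs \<one>\<^bsub>B\<^esub> \<in> carrier B"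
  using assms(3) by (induction xs) (auto simp: unital_algebraD[OF assms(1)] assms(2))

lemma word_val_append:
  assumes "unital_algebra B" "\<And>x. x \<in> X \<Longrightarrow> \<phi> x \<in> carrier B" "set xs \<subseteq> X" "set ys \<subseteq> X"
  shows "foldr (\<lambda>x b. \<phi> x \<otimes>\<^bsub>B\<^esub> b) (xs @ ys) \<one>\<^bsub>B\<^esub>
    = foldr (\<lambda>x b. \<phi> x \<otimes>\<^bsub>B\<^esub> b) xs \<one>\<^bsub>B\<^esub> \<otimes>\<^bsub>B\<^esub> foldr (\<lambda>x b. \<phi> x \<otimes>\<^bsub>B\<^esub> b) ys \<one>\<^bsub>B\<^esub>"
  using assms(3)
proof (induction xs)
  case Nil
  have "foldr (\<lambda>x b. \<phi> x \<otimes>\<^bsub>B\<^esub> b) ys \<one>\<^bsub>B\<^esub> \<in> carrier B"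
    by (rule word_val_in[where X = X]) (use assms in auto)
  then show ?case by (simp add: unital_algebraD(6)[OF assms(1)])
next
  case (Cons x xs)
  have "foldr (\<lambda>x b. \<phi> x \<otimes>\<^bsub>B\<^esub> b) zs \<one>\<^bsub>B\<^esub> \<in> carrier B" if "set zs \<subseteq> X" for zs
    by (rule word_val_in[where X = X]) (use assms that in auto)
  with Cons assms(2,4) show ?case
    by (simp add: unital_algebraD(5)[OF assms(1)] del: foldr_append)
qed

locale presentation =
  fixes X :: "'x set" and R :: "('x free_monoid \<Rightarrow>\<^sub>0 'k::field) set"
  assumes R: "R \<subseteq> carrier (free_algebra X)"
begin

sublocale W: free_alg "free_algebra X :: ('k, 'x free_monoid \<Rightarrow>\<^sub>0 'k) module" "{w. set (letters w) \<subseteq> X}" "(+)" 0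
  by (rule free_alg_words)

abbreviation "F \<equiv> free_algebra X :: ('k, 'x free_monoid \<Rightarrow>\<^sub>0 'k) module"
abbreviation "P \<equiv> presented_algebra X R"
abbreviation "gen \<equiv> presented_gen X R"

sublocale Q: quotient_alg F "genideal F R"
proof (intro quotient_alg.intro quotient_alg_axioms.intro W.unital_algebra_F)
  show I: "ideal (genideal F R) F"
    by (rule ring.genideal_ideal[OF unital_algebraD(1)[OF W.unital_algebra_F] R])
  fix c p assume p: "p \<in> genideal F R"
  have "p \<in> carrier F" using ideal.Icarr[OF I p] .
  \<comment> \<open>Scaling by \<open>c\<close> is left multiplication by \<open>c\<close> times the
    unit, so ideals absorb scalars.\<close>
  then have "c \<odot>\<^bsub>F\<^esub> p = (c \<odot>\<^bsub>F\<^esub> \<one>\<^bsub>F\<^esub>) \<otimes>\<^bsub>F\<^esub> p"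
    by (simp add: W.mult_smult_left unital_algebraD(6)[OF W.unital_algebra_F])
  also have "\<dots> \<in> genideal F R"
    by (rule ideal.I_l_closed[OF I p vspaceD(3)[OF W.vspace_F unital_algebraD(3)[OF W.unital_algebra_F]]])
  finally show "c \<odot>\<^bsub>F\<^esub> p \<in> genideal F R" .
qed

lemma P_Q: "P = quotient_algebra F (genideal F R)" by (simp add: presented_algebra_def)

lemma unital_algebra_P: "unital_algebra P" unfolding P_Q by (rule Q.unital_algebra_Q)

lemma gen_\<pi>: "gen x = Q.\<pi> (letter x)" by (simp add: presented_gen_def)

lemma letter_in: "x \<in> X \<Longrightarrow> letter x \<in> carrier F" by (auto simp: free_algebra_simps)

lemma gen_in: "x \<in> X \<Longrightarrow> gen x \<in> carrier P"
  unfolding P_Q gen_\<pi> Q.carrier_Q using letter_in by blast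

lemma \<pi>_relator: "p - q \<in> R \<Longrightarrow> p \<in> carrier F \<Longrightarrow> q \<in> carrier F \<Longrightarrow> Q.\<pi> p = Q.\<pi> q"
  using ring.genideal_self[OF unital_algebraD(1)[OF W.unital_algebra_F] R]
  by (auto simp: Q.\<pi>_eq_iff W.minus_F)

lemmas \<pi>_P_hom = algebra_homD[OF Q.\<pi>_hom, folded P_Q]

lemma single_Cons: "Poly_Mapping.single (Word (x # xs)) 1 = letter x * Poly_Mapping.single (Word xs) 1"
  by (simp add: mult_single plus_free_monoid_def)

text \<open>Both maps agree on every word, by induction on its letters. The compatibility of a
  morphism with comultiplication, counit and antipode is reduced to generators in this way.\<close>

lemma hom_eqI:
  assumes C: "vspace C" and f: "f \<in> algebra_hom P C" and g: "g \<in> algebra_hom P C"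
    and eq: "\<And>x. x \<in> X \<Longrightarrow> f (gen x) = g (gen x)" and t: "t \<in> carrier P"
  shows "f t = g t"
proof -
  obtain p where p: "p \<in> carrier F" "t = Q.\<pi> p" using t by (auto simp: P_Q Q.carrier_Q)
  note f' = algebra_hom_comp[OF Q.\<pi>_hom f[unfolded P_Q]] and g' = algebra_hom_comp[OF Q.\<pi>_hom g[unfolded P_Q]]
  have "f (Q.\<pi> p) = g (Q.\<pi> p)"
  proof (rule W.lin_eqI[OF C algebra_homD(1)[OF f'] algebra_homD(1)[OF g'] _ p(1)])
    fix w assume w: "w \<in> {w. set (letters w) \<subseteq> X}"
    have "set xs \<subseteq> X \<Longrightarrow> f (Q.\<pi> (Poly_Mapping.single (Word xs) 1)) = g (Q.\<pi> (Poly_Mapping.single (Word xs) 1))" for xs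
    proof (induction xs)
      case Nil
      have "Poly_Mapping.single (Word []) 1 = \<one>\<^bsub>F\<^esub>"
        by (simp add: free_algebra_simps zero_free_monoid_def[symmetric])
      then show ?case using algebra_homD(2)[OF f'] algebra_homD(2)[OF g'] by simp
    next
      case (Cons x xs)
      have s: "Poly_Mapping.single (Word xs) 1 \<in> carrier F" using Cons by (auto simp: free_algebra_simps)
      have x: "x \<in> X" and xs: "set xs \<subseteq> X" using Cons.prems by auto
      have "f (Q.\<pi> (letter x \<otimes>\<^bsub>F\<^esub> Poly_Mapping.single (Word xs) 1)) = g (Q.\<pi> (letter x \<otimes>\<^bsub>F\<^esub> Poly_Mapping.single (Word xs) 1))"
        unfolding algebra_homD(3)[OF f' letter_in[OF x] s] algebra_homD(3)[OF g' letter_in[OF x] s]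
          Cons.IH[OF xs] eq[OF x, unfolded gen_\<pi>] by (rule refl)
      then show ?case by (simp only: free_algebra_simps(4) single_Cons[symmetric])
    qed
    from this[of "letters w"] w show "f (Q.\<pi> (Poly_Mapping.single w 1)) = g (Q.\<pi> (Poly_Mapping.single w 1))" by simp
  qed
  then show ?thesis by (simp add: p)
qed

context
  fixes B :: "('k, 'b, 'm) module_scheme" and \<phi>
  assumes B: "unital_algebra B" and \<phi>: "\<And>x. x \<in> X \<Longrightarrow> \<phi> x \<in> carrier B"
begin

abbreviation "ev \<equiv> lin_ext B (word_val B \<phi>)"

lemma ev_hom: "ev \<in> algebra_hom F B"
  by (rule W.lin_ext_hom[OF B])
    (auto simp: word_val_def word_val_in[OF B \<phi>] word_val_append[OF B \<phi>] simp del: foldr_append)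

lemma ev_letter: "x \<in> X \<Longrightarrow> ev (Poly_Mapping.single (Word [x]) c) = c \<odot>\<^bsub>B\<^esub> \<phi> x"
  using W.lin_ext_single[OF unital_algebraD(2)[OF B], of "word_val B \<phi>" "Word [x]" c] \<phi>
  by (simp add: word_val_def unital_algebraD[OF B])

text \<open>Relators are differences, so a relation can be checked as an equation between two
  evaluated polynomials.\<close>

lemma ev_eq:
  assumes "p \<in> carrier F" "q \<in> carrier F" "ev p = ev q"
  shows "ev (p - q) = \<zero>\<^bsub>B\<^esub>"
proof -
  note vB = unital_algebraD(2)[OF B]
  note ab = vspaceD(1)[OF vB]
  note h = algebra_homD[OF ev_hom]
  have c: "p - q \<in> carrier F" using abelian_group.minus_closed[OF vspaceD(1)[OF W.vspace_F] assms(1,2)] assms by (simp add: W.minus_F)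
  have "ev p = ev (p - q) \<oplus>\<^bsub>B\<^esub> ev q" using h(5)[OF c assms(2)] by (simp add: free_algebra_simps)
  then have "ev q \<oplus>\<^bsub>B\<^esub> ev (p - q) = ev q"
    using assms h(4) c vspaceD(11)[OF vB] by simp
  then show ?thesis
    using abelian_group.r_neg1[OF ab h(4)[OF assms(2)] h(4)[OF c]] abelian_group.l_neg[OF ab h(4)[OF assms(2)]] by simp
qed

context
  assumes rel: "\<And>r. r \<in> R \<Longrightarrow> ev r = \<zero>\<^bsub>B\<^esub>"
begin

text \<open>The kernel of the evaluation is an ideal that contains \<open>R\<close>.\<close>

lemma ev_genideal:
  assumes "p \<in> genideal F R"
  shows "ev p = \<zero>\<^bsub>B\<^esub>"
proof -
  note rings = unital_algebraD(1)[OF W.unital_algebra_F] unital_algebraD(1)[OF B]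
  have "ring_hom_ring F B ev"
    using ev_hom by (intro ring_hom_ringI2 rings) (simp add: algebra_hom_def)
  then have "ideal (a_kernel F B ev) F" by (rule ring_hom_ring.kernel_is_ideal)
  moreover have "R \<subseteq> a_kernel F B ev" using R rel by (auto simp: a_kernel_def')
  ultimately have "genideal F R \<subseteq> a_kernel F B ev" by (rule ring.genideal_minimal[OF rings(1)])
  with assms show ?thesis by (auto simp: a_kernel_def')
qed

lemma presented_lift_hom: "presented_lift B \<phi> \<in> algebra_hom P B"
  unfolding presented_lift_ext[abs_def] P_Q
  by (rule Q.induced_hom[OF unital_algebraD(2)[OF B] ev_hom ev_genideal])

lemma presented_lift_gen: "x \<in> X \<Longrightarrow> presented_lift B \<phi> (gen x) = \<phi> x"
  unfolding presented_lift_ext gen_\<pi>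
  by (subst Q.induced_apply[OF unital_algebraD(2)[OF B] algebra_homD(1)[OF ev_hom] ev_genideal])
    (simp_all add: letter_in ev_letter \<phi> vspaceD(7)[OF unital_algebraD(2)[OF B]])

end

end

end

subsection \<open>Base and opposite algebras\<close>

lemma base_algebra_simps:
  "carrier base_algebra = UNIV" "mult base_algebra = (*)" "add base_algebra = (+)"
  "\<one>\<^bsub>base_algebra\<^esub> = 1" "\<zero>\<^bsub>base_algebra\<^esub> = 0" "smult base_algebra = (*)"
  by (simp_all add: base_algebra_def)

lemma unital_algebra_base: "unital_algebra base_algebra"
proof (rule unital_algebraI)
  show "vspace (base_algebra :: ('k::field, 'k) module)"
  proof (rule vspaceI)
    show "abelian_group (base_algebra :: ('k::field, 'k) module)"
    proof (rule abelian_groupI)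
      fix x :: 'k
      show "\<exists>y\<in>carrier base_algebra. y \<oplus>\<^bsub>base_algebra\<^esub> x = \<zero>\<^bsub>base_algebra\<^esub>"
        by (rule bexI[of _ "- x"]) (simp_all add: base_algebra_simps)
    qed (simp_all add: base_algebra_simps ac_simps)
  qed (simp_all add: base_algebra_simps algebra_simps)
  show "Group.monoid base_algebra" by (rule monoidI) (simp_all add: base_algebra_simps)
qed (simp_all add: base_algebra_simps algebra_simps)

lemma opposite_algebra_simps:
  "carrier (opposite_algebra A) = carrier A" "mult (opposite_algebra A) = (\<lambda>x y. y \<otimes>\<^bsub>A\<^esub> x)"
  "add (opposite_algebra A) = add A" "\<one>\<^bsub>opposite_algebra A\<^esub> = \<one>\<^bsub>A\<^esub>" "\<zero>\<^bsub>opposite_algebra A\<^esub> = \<zero>\<^bsub>A\<^esub>"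
  "smult (opposite_algebra A) = smult A" "finsum (opposite_algebra A) = finsum A"
proof -
  show *: "carrier (opposite_algebra A) = carrier A" "mult (opposite_algebra A) = (\<lambda>x y. y \<otimes>\<^bsub>A\<^esub> x)"
  "add (opposite_algebra A) = add A" "\<one>\<^bsub>opposite_algebra A\<^esub> = \<one>\<^bsub>A\<^esub>" "\<zero>\<^bsub>opposite_algebra A\<^esub> = \<zero>\<^bsub>A\<^esub>"
  "smult (opposite_algebra A) = smult A"
    by (simp_all add: opposite_algebra_def)
  show "finsum (opposite_algebra A) = finsum A" by (intro ext) (simp add: finsum_def *)
qed

lemma unital_algebra_opposite:
  assumes A: "unital_algebra A"
  shows "unital_algebra (opposite_algebra A)"
proof -
  note D = unital_algebraD[OF A] and V = vspaceD[OF unital_algebraD(2)[OF A]]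
  interpret abelian_group A by (rule V)
  have "abelian_group (opposite_algebra A)"
  proof (rule abelian_groupI)
    fix x assume "x \<in> carrier (opposite_algebra A)"
    then show "\<exists>y\<in>carrier (opposite_algebra A). y \<oplus>\<^bsub>opposite_algebra A\<^esub> x = \<zero>\<^bsub>opposite_algebra A\<^esub>"
      by (intro bexI[of _ "\<ominus>\<^bsub>A\<^esub> x"]) (auto simp: opposite_algebra_simps l_neg)
  qed (auto simp: opposite_algebra_simps a_ac)
  then have "vspace (opposite_algebra A)" by (rule vspaceI) (simp_all add: opposite_algebra_simps V)
  moreover have "Group.monoid (opposite_algebra A)" by (rule monoidI) (simp_all add: opposite_algebra_simps D)
  ultimately show ?thesis by (rule unital_algebraI) (simp_all add: opposite_algebra_simps D)
qed

lemma algebra_hom_opposite: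
  "f \<in> algebra_hom A B \<Longrightarrow> f \<in> algebra_hom (opposite_algebra A) (opposite_algebra B)"
  by (intro algebra_homI linI) (simp_all add: opposite_algebra_simps algebra_homD)

subsection \<open>Finite sums\<close>

lemma vfinsum_cong:
  assumes "vspace V" "\<And>i. i \<in> I \<Longrightarrow> f i = g i" "\<And>i. i \<in> I \<Longrightarrow> g i \<in> carrier V"
  shows "finsum V f I = finsum V g I"
proof -
  interpret V: abelian_group V using assms vspaceD by blast
  show ?thesis by (rule V.add.finprod_cong') (use assms in auto)
qed

lemma vfinsum_closed:
  assumes "vspace V" "\<And>i. i \<in> I \<Longrightarrow> g i \<in> carrier V"
  shows "finsum V g I \<in> carrier V"
proof -
  interpret V: abelian_group V using assms vspaceD by blast
  show ?thesis by (rule V.add.finprod_closed) (use assms in auto)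
qed

lemma vfinsum_zero:
  assumes "vspace V"
  shows "finsum V (\<lambda>i. \<zero>\<^bsub>V\<^esub>) I = \<zero>\<^bsub>V\<^esub>"
proof -
  interpret V: abelian_group V using assms vspaceD by blast
  show ?thesis by simp
qed

lemma vfinsum_delta:
  assumes "vspace V" "finite I" "j \<in> I" "g j \<in> carrier V"
  shows "(\<Oplus>\<^bsub>V\<^esub>i\<in>I. if i = j then g i else \<zero>\<^bsub>V\<^esub>) = g j"
    "(\<Oplus>\<^bsub>V\<^esub>i\<in>I. if j = i then g i else \<zero>\<^bsub>V\<^esub>) = g j"
proof -
  interpret V: abelian_group V using assms vspaceD by blast
  have "(\<Oplus>\<^bsub>V\<^esub>i\<in>I. if j = i then g j else \<zero>\<^bsub>V\<^esub>) = g j"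
    using V.add.finprod_singleton[OF assms(3,2), of "\<lambda>_. g j"] assms(4) by simp
  moreover have "(\<lambda>i. if j = i then g j else \<zero>\<^bsub>V\<^esub>) = (\<lambda>i. if j = i then g i else \<zero>\<^bsub>V\<^esub>)"
    "(\<lambda>i. if j = i then g j else \<zero>\<^bsub>V\<^esub>) = (\<lambda>i. if i = j then g i else \<zero>\<^bsub>V\<^esub>)" by auto
  ultimately show "(\<Oplus>\<^bsub>V\<^esub>i\<in>I. if i = j then g i else \<zero>\<^bsub>V\<^esub>) = g j"
    "(\<Oplus>\<^bsub>V\<^esub>i\<in>I. if j = i then g i else \<zero>\<^bsub>V\<^esub>) = g j" by simp_all
qed

lemma vfinsum_swap:
  assumes "vspace V" "finite I" "finite J" "\<And>i j. i \<in> I \<Longrightarrow> j \<in> J \<Longrightarrow> g i j \<in> carrier V"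
  shows "(\<Oplus>\<^bsub>V\<^esub>i\<in>I. \<Oplus>\<^bsub>V\<^esub>j\<in>J. g i j) = (\<Oplus>\<^bsub>V\<^esub>j\<in>J. \<Oplus>\<^bsub>V\<^esub>i\<in>I. g i j)"
  using assms(2,4)
proof (induction I)
  case empty
  interpret V: abelian_group V using assms vspaceD by blast
  show ?case by simp
next
  case (insert i I)
  interpret V: abelian_group V using assms vspaceD by blast
  have "(\<Oplus>\<^bsub>V\<^esub>i\<in>insert i I. \<Oplus>\<^bsub>V\<^esub>j\<in>J. g i j) = (\<Oplus>\<^bsub>V\<^esub>j\<in>J. g i j) \<oplus>\<^bsub>V\<^esub> (\<Oplus>\<^bsub>V\<^esub>j\<in>J. \<Oplus>\<^bsub>V\<^esub>i\<in>I. g i j)"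
    using insert by (subst V.finsum_insert) (auto intro!: V.finsum_closed)
  also have "\<dots> = (\<Oplus>\<^bsub>V\<^esub>j\<in>J. g i j \<oplus>\<^bsub>V\<^esub> (\<Oplus>\<^bsub>V\<^esub>i\<in>I. g i j))"
    using insert by (intro V.finsum_addf[symmetric]) (auto intro!: V.finsum_closed)
  also have "\<dots> = (\<Oplus>\<^bsub>V\<^esub>j\<in>J. \<Oplus>\<^bsub>V\<^esub>i\<in>insert i I. g i j)"
    using insert by (intro V.finsum_cong') (auto intro!: V.finsum_closed V.finsum_insert[symmetric])
  finally show ?case .
qed

lemma afinsum_mult:
  assumes A: "unital_algebra A" and "finite I" "\<And>i. i \<in> I \<Longrightarrow> g i \<in> carrier A" "a \<in> carrier A"
  shows "finsum A g I \<otimes>\<^bsub>A\<^esub> a = (\<Oplus>\<^bsub>A\<^esub>i\<in>I. g i \<otimes>\<^bsub>A\<^esub> a)"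
    and "a \<otimes>\<^bsub>A\<^esub> finsum A g I = (\<Oplus>\<^bsub>A\<^esub>i\<in>I. a \<otimes>\<^bsub>A\<^esub> g i)"
proof -
  note D = unital_algebraD[OF A]
  have 1: "(\<lambda>x. x \<otimes>\<^bsub>A\<^esub> a) \<in> lin A A" and 2: "(\<lambda>x. a \<otimes>\<^bsub>A\<^esub> x) \<in> lin A A"
    by (rule linI; simp add: D assms)+
  show "finsum A g I \<otimes>\<^bsub>A\<^esub> a = (\<Oplus>\<^bsub>A\<^esub>i\<in>I. g i \<otimes>\<^bsub>A\<^esub> a)"
    by (rule lin_finsum[OF D(2,2) 1]) (use assms in auto)
  show "a \<otimes>\<^bsub>A\<^esub> finsum A g I = (\<Oplus>\<^bsub>A\<^esub>i\<in>I. a \<otimes>\<^bsub>A\<^esub> g i)"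
    by (rule lin_finsum[OF D(2,2) 2]) (use assms in auto)
qed

lemma orthogonal_sums_mult:
  assumes A: "unital_algebra A" and I: "finite I"
    and closed: "\<And>i. i \<in> I \<Longrightarrow> x i \<in> carrier A" "\<And>i. i \<in> I \<Longrightarrow> y i \<in> carrier A"
    and orth: "\<And>i j. i \<in> I \<Longrightarrow> j \<in> I \<Longrightarrow> i \<noteq> j \<Longrightarrow> x i \<otimes>\<^bsub>A\<^esub> y j = \<zero>\<^bsub>A\<^esub>"
  shows "finsum A x I \<otimes>\<^bsub>A\<^esub> finsum A y I = (\<Oplus>\<^bsub>A\<^esub>i\<in>I. x i \<otimes>\<^bsub>A\<^esub> y i)"
proof -
  note D = unital_algebraD[OF A] and V = unital_algebraD(2)[OF A]
  have "finsum A x I \<otimes>\<^bsub>A\<^esub> finsum A y I = (\<Oplus>\<^bsub>A\<^esub>i\<in>I. x i \<otimes>\<^bsub>A\<^esub> finsum A y I)"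
    by (rule afinsum_mult[OF A I closed(1)]) (auto intro!: vfinsum_closed[OF V] closed)
  also have "\<dots> = (\<Oplus>\<^bsub>A\<^esub>i\<in>I. x i \<otimes>\<^bsub>A\<^esub> y i)"
  proof (rule vfinsum_cong[OF V])
    fix i assume i: "i \<in> I"
    have "x i \<otimes>\<^bsub>A\<^esub> finsum A y I = (\<Oplus>\<^bsub>A\<^esub>j\<in>I. x i \<otimes>\<^bsub>A\<^esub> y j)"
      by (rule afinsum_mult[OF A I closed(2) closed(1)[OF i]])
    also have "\<dots> = (\<Oplus>\<^bsub>A\<^esub>j\<in>I. if i = j then x i \<otimes>\<^bsub>A\<^esub> y j else \<zero>\<^bsub>A\<^esub>)"
      by (rule vfinsum_cong[OF V]) (use i orth closed D(4) vspaceD(12)[OF V] in auto)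
    also have "\<dots> = x i \<otimes>\<^bsub>A\<^esub> y i"
      by (rule vfinsum_delta[OF V I i]) (use i closed D(4) in auto)
    finally show "x i \<otimes>\<^bsub>A\<^esub> finsum A y I = x i \<otimes>\<^bsub>A\<^esub> y i" .
  qed (use closed D(4) in auto)
  finally show ?thesis .
qed

lemma (in free_space) finsum_F:
  assumes "finite I" "\<And>i. i \<in> I \<Longrightarrow> g i \<in> carrier F"
  shows "finsum F g I = (\<Sum>i\<in>I. g i)"
  using assms
proof (induction I)
  case empty
  interpret abelian_group F using vspace_F vspaceD by blast
  show ?case by (simp add: zero_F)
next
  case (insert i I)
  interpret abelian_group F using vspace_F vspaceD by blast
  show ?case using insert by (subst finsum_insert) (auto simp: add_F)
qed

lemma (in free_space) sum_closed:
  assumes "finite I" "\<And>i. i \<in> I \<Longrightarrow> g i \<in> carrier F"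
  shows "(\<Sum>i\<in>I. g i) \<in> carrier F"
  using vfinsum_closed[of F I g, OF vspace_F assms(2)] finsum_F[of I g, OF assms] by simp

subsection \<open>Magic matrices\<close>

text \<open>The algebraic form of a magic unitary: every row and every column is a partition of
  unity into orthogonal idempotents. Algebra maps from \<open>As m\<close> to \<open>B\<close>
  correspond to such matrices; compare \<open>As_lift\<close> and \<open>magic_As\<close>.\<close>

definition magic :: "('k::field, 'b, 'm) module_scheme \<Rightarrow> nat \<Rightarrow> (nat \<Rightarrow> nat \<Rightarrow> 'b) \<Rightarrow> bool"
  where "magic B m U \<longleftrightarrow>
    (\<forall>i<m. \<forall>j<m. U i j \<in> carrier B) \<and>
    (\<forall>k<m. \<forall>i<m. \<forall>j<m. U k i \<otimes>\<^bsub>B\<^esub> U k j = (if i = j then U k i else \<zero>\<^bsub>B\<^esub>)) \<and>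
    (\<forall>i<m. (\<Oplus>\<^bsub>B\<^esub>l\<in>{..<m}. U i l) = \<one>\<^bsub>B\<^esub>) \<and>
    (\<forall>k<m. \<forall>i<m. \<forall>j<m. U i k \<otimes>\<^bsub>B\<^esub> U j k = (if i = j then U i k else \<zero>\<^bsub>B\<^esub>)) \<and>
    (\<forall>i<m. (\<Oplus>\<^bsub>B\<^esub>l\<in>{..<m}. U l i) = \<one>\<^bsub>B\<^esub>)"

lemma magicI:
  assumes "\<And>i j. i < m \<Longrightarrow> j < m \<Longrightarrow> U i j \<in> carrier B"
    "\<And>k i j. k < m \<Longrightarrow> i < m \<Longrightarrow> j < m \<Longrightarrow> U k i \<otimes>\<^bsub>B\<^esub> U k j = (if i = j then U k i else \<zero>\<^bsub>B\<^esub>)"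
    "\<And>i. i < m \<Longrightarrow> (\<Oplus>\<^bsub>B\<^esub>l\<in>{..<m}. U i l) = \<one>\<^bsub>B\<^esub>"
    "\<And>k i j. k < m \<Longrightarrow> i < m \<Longrightarrow> j < m \<Longrightarrow> U i k \<otimes>\<^bsub>B\<^esub> U j k = (if i = j then U i k else \<zero>\<^bsub>B\<^esub>)"
    "\<And>i. i < m \<Longrightarrow> (\<Oplus>\<^bsub>B\<^esub>l\<in>{..<m}. U l i) = \<one>\<^bsub>B\<^esub>"
  shows "magic B m U"
  using assms by (simp add: magic_def)

lemma magicD:
  assumes "magic B m U"
  shows "\<And>i j. i < m \<Longrightarrow> j < m \<Longrightarrow> U i j \<in> carrier B"
    "\<And>k i j. k < m \<Longrightarrow> i < m \<Longrightarrow> j < m \<Longrightarrow> U k i \<otimes>\<^bsub>B\<^esub> U k j = (if i = j then U k i else \<zero>\<^bsub>B\<^esub>)"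
    "\<And>i. i < m \<Longrightarrow> (\<Oplus>\<^bsub>B\<^esub>l\<in>{..<m}. U i l) = \<one>\<^bsub>B\<^esub>"
    "\<And>k i j. k < m \<Longrightarrow> i < m \<Longrightarrow> j < m \<Longrightarrow> U i k \<otimes>\<^bsub>B\<^esub> U j k = (if i = j then U i k else \<zero>\<^bsub>B\<^esub>)"
    "\<And>i. i < m \<Longrightarrow> (\<Oplus>\<^bsub>B\<^esub>l\<in>{..<m}. U l i) = \<one>\<^bsub>B\<^esub>"
  using assms by (simp_all add: magic_def)

text \<open>Source of the antipode of \<open>As m\<close>: transposition exchanges the relations for
  rows and columns, and orthogonality survives the reversal of products, so the transposed
  generators define an algebra map into the opposite algebra.\<close>

lemma magic_transpose: "magic B m U \<Longrightarrow> magic (opposite_algebra B) m (\<lambda>i j. U j i)"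
  by (rule magicI) (auto simp: magicD opposite_algebra_simps)

text \<open>Source of the counit of \<open>As m\<close>.\<close>

lemma magic_identity: "magic base_algebra m (\<lambda>i j. if i = j then 1 else 0)"
proof (rule magicI)
  note V = unital_algebraD(2)[OF unital_algebra_base]
  fix i assume "i < m"
  then show "(\<Oplus>\<^bsub>base_algebra\<^esub>l\<in>{..<m}. if i = l then 1 else 0) = \<one>\<^bsub>base_algebra\<^esub>"
    "(\<Oplus>\<^bsub>base_algebra\<^esub>l\<in>{..<m}. if l = i then 1 else 0) = \<one>\<^bsub>base_algebra\<^esub>"
    using vfinsum_delta[OF V, of "{..<m}" i "\<lambda>_. 1"] unfolding base_algebra_simps by simp_all
qed (auto simp: base_algebra_simps)

text \<open>Source of the comultiplication of \<open>As m\<close>. In a product of two sums from one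
  row, orthogonality in the left factors removes all terms with different inner indices, and
  orthogonality in the right factors then gives the relation; for columns the roles are
  exchanged.\<close>

lemma magic_tensor:
  assumes A: "unital_algebra A" and B: "unital_algebra B" and U: "magic A m U" and V: "magic B m V"
  shows "magic (tensor A B) m (\<lambda>i j. \<Oplus>\<^bsub>tensor A B\<^esub>k\<in>{..<m}. tens A B (U i k) (V k j))"
proof (rule magicI)
  interpret T: tensor_algebras A B by (rule tensor_algebras.intro) fact+
  note u = magicD[OF U] and v = magicD[OF V]
  note T = T.unital_algebra_tensor and VT = T.vspace_tensor and bl = bilinD[OF T.tens_bilin]
  have zl: "tens A B \<zero>\<^bsub>A\<^esub> b = \<zero>\<^bsub>tensor A B\<^esub>" if "b \<in> carrier B" for b
    using lin_zero[OF T.vA VT bl(7)[OF that]] .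
  have zr: "tens A B a \<zero>\<^bsub>B\<^esub> = \<zero>\<^bsub>tensor A B\<^esub>" if "a \<in> carrier A" for a
    using lin_zero[OF T.vB VT bl(6)[OF that]] .
  have c: "tens A B (U i k) (V k' j) \<in> carrier (tensor A B)" if "i < m" "k < m" "k' < m" "j < m" for i k k' j
    using that by (simp add: T.tens_closed u v)
  fix i j assume ij: "i < m" "j < m"
  show "(\<Oplus>\<^bsub>tensor A B\<^esub>k\<in>{..<m}. tens A B (U i k) (V k j)) \<in> carrier (tensor A B)"
    by (rule vfinsum_closed[OF VT]) (simp add: c ij)
  fix k assume k: "k < m"
  have "(\<Oplus>\<^bsub>tensor A B\<^esub>l\<in>{..<m}. tens A B (U k l) (V l i)) \<otimes>\<^bsub>tensor A B\<^esub> (\<Oplus>\<^bsub>tensor A B\<^esub>l\<in>{..<m}. tens A B (U k l) (V l j))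
    = (\<Oplus>\<^bsub>tensor A B\<^esub>l\<in>{..<m}. tens A B (U k l) (V l i) \<otimes>\<^bsub>tensor A B\<^esub> tens A B (U k l) (V l j))"
    by (rule orthogonal_sums_mult[OF T])
      (use ij k in \<open>auto simp: c T.tens_mult u v zl unital_algebraD(4)[OF B]\<close>)
  also have "\<dots> = (\<Oplus>\<^bsub>tensor A B\<^esub>l\<in>{..<m}. if i = j then tens A B (U k l) (V l i) else \<zero>\<^bsub>tensor A B\<^esub>)"
    by (rule vfinsum_cong[OF VT])
      (use ij k in \<open>auto simp: c T.tens_mult u v zr vspaceD(12)[OF VT]\<close>)
  also have "\<dots> = (if i = j then \<Oplus>\<^bsub>tensor A B\<^esub>l\<in>{..<m}. tens A B (U k l) (V l i) else \<zero>\<^bsub>tensor A B\<^esub>)"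
    by (simp add: vfinsum_zero[OF VT])
  finally show "(\<Oplus>\<^bsub>tensor A B\<^esub>l\<in>{..<m}. tens A B (U k l) (V l i)) \<otimes>\<^bsub>tensor A B\<^esub> (\<Oplus>\<^bsub>tensor A B\<^esub>l\<in>{..<m}. tens A B (U k l) (V l j))
    = (if i = j then \<Oplus>\<^bsub>tensor A B\<^esub>l\<in>{..<m}. tens A B (U k l) (V l i) else \<zero>\<^bsub>tensor A B\<^esub>)" .
  have "(\<Oplus>\<^bsub>tensor A B\<^esub>l\<in>{..<m}. tens A B (U i l) (V l k)) \<otimes>\<^bsub>tensor A B\<^esub> (\<Oplus>\<^bsub>tensor A B\<^esub>l\<in>{..<m}. tens A B (U j l) (V l k))
    = (\<Oplus>\<^bsub>tensor A B\<^esub>l\<in>{..<m}. tens A B (U i l) (V l k) \<otimes>\<^bsub>tensor A B\<^esub> tens A B (U j l) (V l k))"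
    by (rule orthogonal_sums_mult[OF T])
      (use ij k in \<open>auto simp: c T.tens_mult u v zr unital_algebraD(4)[OF A]\<close>)
  also have "\<dots> = (\<Oplus>\<^bsub>tensor A B\<^esub>l\<in>{..<m}. if i = j then tens A B (U i l) (V l k) else \<zero>\<^bsub>tensor A B\<^esub>)"
    by (rule vfinsum_cong[OF VT])
      (use ij k in \<open>auto simp: c T.tens_mult u v zl vspaceD(12)[OF VT]\<close>)
  also have "\<dots> = (if i = j then \<Oplus>\<^bsub>tensor A B\<^esub>l\<in>{..<m}. tens A B (U i l) (V l k) else \<zero>\<^bsub>tensor A B\<^esub>)"
    by (simp add: vfinsum_zero[OF VT])
  finally show "(\<Oplus>\<^bsub>tensor A B\<^esub>l\<in>{..<m}. tens A B (U i l) (V l k)) \<otimes>\<^bsub>tensor A B\<^esub> (\<Oplus>\<^bsub>tensor A B\<^esub>l\<in>{..<m}. tens A B (U j l) (V l k))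
    = (if i = j then \<Oplus>\<^bsub>tensor A B\<^esub>l\<in>{..<m}. tens A B (U i l) (V l k) else \<zero>\<^bsub>tensor A B\<^esub>)" .
next
  interpret T: tensor_algebras A B by (rule tensor_algebras.intro) fact+
  note u = magicD[OF U] and v = magicD[OF V]
  note VT = T.vspace_tensor and bl = bilinD[OF T.tens_bilin]
  note one = unital_algebraD(3)[OF A] unital_algebraD(3)[OF B]
  fix i assume i: "i < m"
  have "(\<Oplus>\<^bsub>tensor A B\<^esub>l\<in>{..<m}. \<Oplus>\<^bsub>tensor A B\<^esub>k\<in>{..<m}. tens A B (U i k) (V k l))
    = (\<Oplus>\<^bsub>tensor A B\<^esub>k\<in>{..<m}. \<Oplus>\<^bsub>tensor A B\<^esub>l\<in>{..<m}. tens A B (U i k) (V k l))"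
    by (rule vfinsum_swap[OF VT]) (auto simp: T.tens_closed u v i)
  also have "\<dots> = (\<Oplus>\<^bsub>tensor A B\<^esub>k\<in>{..<m}. tens A B (U i k) \<one>\<^bsub>B\<^esub>)"
  proof (rule vfinsum_cong[OF VT])
    fix k assume k: "k \<in> {..<m}"
    then show "(\<Oplus>\<^bsub>tensor A B\<^esub>l\<in>{..<m}. tens A B (U i k) (V k l)) = tens A B (U i k) \<one>\<^bsub>B\<^esub>"
      using lin_finsum[OF T.vB VT bl(6)[OF u(1)[OF i]], of k "{..<m}" "V k"] v(1,3) by simp
  qed (auto simp: T.tens_closed u i one)
  also have "\<dots> = tens A B (\<Oplus>\<^bsub>A\<^esub>k\<in>{..<m}. U i k) \<one>\<^bsub>B\<^esub>"
    by (rule lin_finsum[OF T.vA VT bl(7)[OF one(2)], symmetric]) (auto simp: u i)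
  finally show "(\<Oplus>\<^bsub>tensor A B\<^esub>l\<in>{..<m}. \<Oplus>\<^bsub>tensor A B\<^esub>k\<in>{..<m}. tens A B (U i k) (V k l)) = \<one>\<^bsub>tensor A B\<^esub>"
    by (simp add: u i T.tens_one)
  have "(\<Oplus>\<^bsub>tensor A B\<^esub>l\<in>{..<m}. \<Oplus>\<^bsub>tensor A B\<^esub>k\<in>{..<m}. tens A B (U l k) (V k i))
    = (\<Oplus>\<^bsub>tensor A B\<^esub>k\<in>{..<m}. \<Oplus>\<^bsub>tensor A B\<^esub>l\<in>{..<m}. tens A B (U l k) (V k i))"
    by (rule vfinsum_swap[OF VT]) (auto simp: T.tens_closed u v i)
  also have "\<dots> = (\<Oplus>\<^bsub>tensor A B\<^esub>k\<in>{..<m}. tens A B \<one>\<^bsub>A\<^esub> (V k i))"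
  proof (rule vfinsum_cong[OF VT])
    fix k assume k: "k \<in> {..<m}"
    then show "(\<Oplus>\<^bsub>tensor A B\<^esub>l\<in>{..<m}. tens A B (U l k) (V k i)) = tens A B \<one>\<^bsub>A\<^esub> (V k i)"
      using lin_finsum[OF T.vA VT bl(7)[OF v(1)[OF _ i]], of k "{..<m}" "\<lambda>l. U l k"] u(1,5) by simp
  qed (auto simp: T.tens_closed v i one)
  also have "\<dots> = tens A B \<one>\<^bsub>A\<^esub> (\<Oplus>\<^bsub>B\<^esub>k\<in>{..<m}. V k i)"
    by (rule lin_finsum[OF T.vB VT bl(6)[OF one(1)], symmetric]) (auto simp: v i)
  finally show "(\<Oplus>\<^bsub>tensor A B\<^esub>l\<in>{..<m}. \<Oplus>\<^bsub>tensor A B\<^esub>k\<in>{..<m}. tens A B (U l k) (V k i)) = \<one>\<^bsub>tensor A B\<^esub>"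
    by (simp add: v i T.tens_one)
qed

subsection \<open>The universal property of \<open>A\<^sub>s(m)\<close>\<close>

lemma As_relators_in: "As_relators m \<subseteq> carrier (free_algebra (As_generators m) :: ('k::field, (nat \<times> nat) free_monoid \<Rightarrow>\<^sub>0 'k) module)"
proof -
  interpret presentation "As_generators m" "{} :: ((nat \<times> nat) free_monoid \<Rightarrow>\<^sub>0 'k) set"
    by (rule presentation.intro) simp
  have d: "p - q \<in> carrier F" if "p \<in> carrier F" "q \<in> carrier F" for p q
    using abelian_group.minus_closed[OF vspaceD(1)[OF W.vspace_F] that] that by (simp add: W.minus_F)
  have t: "p * q \<in> carrier F" if "p \<in> carrier F" "q \<in> carrier F" for p q
    using W.mult_closed[OF that] by (simp add: free_algebra_simps)
  have s: "(\<Sum>l<m. g l) \<in> carrier F" if "\<And>l. l < m \<Longrightarrow> g l \<in> carrier F" for g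
    by (rule W.sum_closed) (simp_all add: that)
  have z: "0 \<in> carrier F" "1 \<in> carrier F" by (auto simp: free_algebra_simps zero_free_monoid_def)
  have l: "letter (i, j) \<in> carrier F" if "i < m" "j < m" for i j
    by (rule letter_in) (use that in \<open>auto simp: As_generators_def\<close>)
  show ?thesis
    unfolding As_relators_def by (auto intro!: d t s z l)
qed

abbreviation "As_alg m \<equiv> presented_algebra (As_generators m) (As_relators m)"
abbreviation "As_gen m i j \<equiv> presented_gen (As_generators m) (As_relators m) (i, j)"

lemma As_relator_mem:
  "i < m \<Longrightarrow> j < m \<Longrightarrow> k < m \<Longrightarrow> letter (k, i) * letter (k, j) - (if i = j then letter (k, i) else 0) \<in> As_relators m"
  "i < m \<Longrightarrow> (\<Sum>l<m. letter (i, l)) - 1 \<in> As_relators m"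
  "i < m \<Longrightarrow> j < m \<Longrightarrow> k < m \<Longrightarrow> letter (i, k) * letter (j, k) - (if i = j then letter (i, k) else 0) \<in> As_relators m"
  "i < m \<Longrightarrow> (\<Sum>l<m. letter (l, i)) - 1 \<in> As_relators m"
  unfolding As_relators_def by blast+

lemma As_presentation: "presentation (As_generators m) (As_relators m)"
  by (rule presentation.intro) (rule As_relators_in)

lemma As_gen_in: "i < m \<Longrightarrow> j < m \<Longrightarrow> As_gen m i j \<in> carrier (As_alg m)"
  by (rule presentation.gen_in[OF As_presentation]) (auto simp: As_generators_def)

text \<open>Relator by relator, the conditions in \<open>magic\<close> are what makes the evaluation
  at \<open>U\<close> vanish on the defining relations.\<close>

lemma As_lift:
  fixes B :: "('k::field, 'b, 'm) module_scheme"
  assumes B: "unital_algebra B" and U: "magic B m U"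
  shows "presented_lift B (\<lambda>(i, j). U i j) \<in> algebra_hom (As_alg m) B"
    "\<And>i j. i < m \<Longrightarrow> j < m \<Longrightarrow> presented_lift B (\<lambda>(i, j). U i j) (As_gen m i j) = U i j"
proof -
  interpret As: presentation "As_generators m" "As_relators m :: (_ \<Rightarrow>\<^sub>0 'k) set" by (rule As_presentation)
  let ?\<phi> = "\<lambda>(i, j). U i j" and ?F = "As.F"
  note u = magicD[OF U] and vB = unital_algebraD(2)[OF B]
  have \<phi>: "?\<phi> x \<in> carrier B" if "x \<in> As_generators m" for x
    using that u by (auto simp: As_generators_def)
  let ?ev = "lin_ext B (word_val B ?\<phi>)"
  have "?ev \<in> algebra_hom ?F B" by (rule As.ev_hom[OF B \<phi>])
  note ev = algebra_homD[OF this]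
  have evl: "?ev (letter x) = ?\<phi> x" if x: "x \<in> As_generators m" for x
  proof -
    have "?ev (letter x) = 1 \<odot>\<^bsub>B\<^esub> ?\<phi> x" by (rule As.ev_letter[OF B \<phi> x])
    then show ?thesis using vspaceD(7)[OF vB \<phi>[OF x]] by simp
  qed
  have l: "letter (i, j) \<in> carrier ?F" "?ev (letter (i, j)) = U i j" if "i < m" "j < m" for i j
  proof -
    have x: "(i, j) \<in> As_generators m" using that by (auto simp: As_generators_def)
    show "letter (i, j) \<in> carrier ?F" by (rule As.letter_in[OF x])
    show "?ev (letter (i, j)) = U i j"
      using evl[OF x] by simp
  qed
  have t: "p * q \<in> carrier ?F" "?ev (p * q) = ?ev p \<otimes>\<^bsub>B\<^esub> ?ev q" if "p \<in> carrier ?F" "q \<in> carrier ?F" for p q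
    using As.W.mult_closed[OF that] ev(3)[OF that] by (simp_all add: free_algebra_simps)
  have z: "0 \<in> carrier ?F" "1 \<in> carrier ?F" "?ev 0 = \<zero>\<^bsub>B\<^esub>" "?ev 1 = \<one>\<^bsub>B\<^esub>"
    using ev(2) lin_zero[OF As.W.vspace_F vB ev(1)]
    by (auto simp: free_algebra_simps zero_free_monoid_def)
  have s: "(\<Sum>k<m. letter (g k)) \<in> carrier ?F" "?ev (\<Sum>k<m. letter (g k)) = (\<Oplus>\<^bsub>B\<^esub>k\<in>{..<m}. ?\<phi> (g k))"
    if "\<And>k. k < m \<Longrightarrow> g k \<in> As_generators m" for g
  proof -
    have c: "letter (g k) \<in> carrier ?F" if "k \<in> {..<m}" for k
      using As.letter_in \<open>\<And>k. k < m \<Longrightarrow> g k \<in> As_generators m\<close> that by blast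
    show "(\<Sum>k<m. letter (g k)) \<in> carrier ?F"
      by (rule As.W.sum_closed) (use c in simp_all)
    have "?ev (\<Sum>k<m. letter (g k)) = ?ev (finsum ?F (\<lambda>k. letter (g k)) {..<m})"
      by (subst As.W.finsum_F) (auto intro: c)
    also have "\<dots> = (\<Oplus>\<^bsub>B\<^esub>k\<in>{..<m}. ?ev (letter (g k)))"
      by (rule lin_finsum[OF As.W.vspace_F vB ev(1)]) (auto intro: c)
    also have "\<dots> = (\<Oplus>\<^bsub>B\<^esub>k\<in>{..<m}. ?\<phi> (g k))"
      by (rule vfinsum_cong[OF vB])
        (use that evl \<phi> in auto)
    finally show "?ev (\<Sum>k<m. letter (g k)) = (\<Oplus>\<^bsub>B\<^esub>k\<in>{..<m}. ?\<phi> (g k))" .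
  qed
  have rel: "?ev r = \<zero>\<^bsub>B\<^esub>" if "r \<in> As_relators m" for r
    using that unfolding As_relators_def
  proof (elim UnE CollectE exE conjE)
    fix i j k assume r: "r = letter (k, i) * letter (k, j) - (if i = j then letter (k, i) else 0)" "i < m" "j < m" "k < m"
    show ?thesis unfolding r(1)
      by (rule As.ev_eq[of B ?\<phi>, OF B \<phi>]) (use r in \<open>auto simp: t l z u split: if_splits\<close>)
  next
    fix i j k assume r: "r = letter (i, k) * letter (j, k) - (if i = j then letter (i, k) else 0)" "i < m" "j < m" "k < m"
    show ?thesis unfolding r(1)
      by (rule As.ev_eq[of B ?\<phi>, OF B \<phi>]) (use r in \<open>auto simp: t l z u split: if_splits\<close>)
  next
    fix i assume r: "r = (\<Sum>l<m. letter (i, l)) - 1" "i < m"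
    have g: "\<And>l. l < m \<Longrightarrow> (i, l) \<in> As_generators m" using r by (auto simp: As_generators_def)
    show ?thesis unfolding r(1)
      by (rule As.ev_eq[of B ?\<phi>, OF B \<phi>]) (use r s[of "Pair i", OF g] in \<open>auto simp: z u\<close>)
  next
    fix i assume r: "r = (\<Sum>l<m. letter (l, i)) - 1" "i < m"
    have g: "\<And>l. l < m \<Longrightarrow> (l, i) \<in> As_generators m" using r by (auto simp: As_generators_def)
    show ?thesis unfolding r(1)
      by (rule As.ev_eq[of B ?\<phi>, OF B \<phi>]) (use r s[of "\<lambda>l. (l, i)", OF g] in \<open>auto simp: z u\<close>)
  qed
  show "presented_lift B ?\<phi> \<in> algebra_hom (As_alg m) B"
    by (rule As.presented_lift_hom[of B ?\<phi>, OF B \<phi> rel])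
  show "\<And>i j. i < m \<Longrightarrow> j < m \<Longrightarrow> presented_lift B (\<lambda>(i, j). U i j) (As_gen m i j) = U i j"
    using As.presented_lift_gen[of B ?\<phi>, OF B] \<phi> rel by (auto simp: As_generators_def)
qed

lemma magic_As: "magic (As_alg m :: ('k::field, _) module) m (As_gen m)"
proof (rule magicI)
  interpret As: presentation "As_generators m" "As_relators m :: (_ \<Rightarrow>\<^sub>0 'k) set" by (rule As_presentation)
  let ?F = "As.F"
  note \<pi> = As.\<pi>_P_hom
  have l: "letter (i, j) \<in> carrier ?F" if "i < m" "j < m" for i j
    by (rule As.letter_in) (use that in \<open>auto simp: As_generators_def\<close>)
  have t: "p * q \<in> carrier ?F" if "p \<in> carrier ?F" "q \<in> carrier ?F" for p q
    using As.W.mult_closed[OF that] by (simp_all add: free_algebra_simps)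
  have z: "0 \<in> carrier ?F" "1 \<in> carrier ?F" by (auto simp: free_algebra_simps zero_free_monoid_def)
  have \<pi>0: "As.Q.\<pi> 0 = \<zero>\<^bsub>As.P\<^esub>" and \<pi>1: "As.Q.\<pi> 1 = \<one>\<^bsub>As.P\<^esub>"
    using \<pi>(2) lin_zero[OF As.W.vspace_F unital_algebraD(2)[OF As.unital_algebra_P] \<pi>(1)] by (simp_all add: free_algebra_simps)
  fix i assume i: "i < m"
  {
    fix g assume g: "\<And>k. k < m \<Longrightarrow> g k \<in> As_generators m" and r: "(\<Sum>k<m. letter (g k)) - 1 \<in> (As_relators m :: (_ \<Rightarrow>\<^sub>0 'k) set)"
    have c: "letter (g k) \<in> carrier ?F" if "k \<in> {..<m}" for k
      using As.letter_in g that by blast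
    have s: "finsum ?F (\<lambda>k. letter (g k)) {..<m} = (\<Sum>k<m. letter (g k))"
      by (rule As.W.finsum_F) (auto intro: c)
    have "(\<Oplus>\<^bsub>As.P\<^esub>k\<in>{..<m}. As.Q.\<pi> (letter (g k))) = As.Q.\<pi> (finsum ?F (\<lambda>k. letter (g k)) {..<m})"
      by (rule lin_finsum[OF As.W.vspace_F unital_algebraD(2)[OF As.unital_algebra_P] \<pi>(1), symmetric]) (auto intro: c)
    also have "\<dots> = As.Q.\<pi> 1" unfolding s
      by (rule As.\<pi>_relator[OF r]) (use z in \<open>auto intro!: As.W.sum_closed c\<close>)
    finally have "(\<Oplus>\<^bsub>As.P\<^esub>k\<in>{..<m}. As.gen (g k)) = \<one>\<^bsub>As.P\<^esub>"
      by (simp add: \<pi>1 presented_gen_def)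
  }
  note * = this
  show "(\<Oplus>\<^bsub>As.P\<^esub>l\<in>{..<m}. As.gen (i, l)) = \<one>\<^bsub>As.P\<^esub>"
    by (rule *[of "\<lambda>l. (i, l)", OF _ As_relator_mem(2)[OF i]]) (simp add: As_generators_def i)
  show "(\<Oplus>\<^bsub>As.P\<^esub>l\<in>{..<m}. As.gen (l, i)) = \<one>\<^bsub>As.P\<^esub>"
    by (rule *[of "\<lambda>l. (l, i)", OF _ As_relator_mem(4)[OF i]]) (simp add: As_generators_def i)
  fix j assume j: "j < m"
  show "As.gen (i, j) \<in> carrier (As.P)" by (rule As_gen_in) fact+
  fix k assume k: "k < m"
  have "As.Q.\<pi> (letter (k, i) * letter (k, j)) = As.Q.\<pi> (if i = j then letter (k, i) else 0)"
    by (rule As.\<pi>_relator[OF As_relator_mem(1)[OF i j k]]) (use i j k in \<open>auto simp: l t z simp del: mult_single\<close>)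
  then show "As.gen (k, i) \<otimes>\<^bsub>As.P\<^esub> As.gen (k, j) = (if i = j then As.gen (k, i) else \<zero>\<^bsub>As.P\<^esub>)"
    using \<pi>(3)[OF l[OF k i] l[OF k j]] by (simp add: free_algebra_simps presented_gen_def \<pi>0 split: if_splits)
  have "As.Q.\<pi> (letter (i, k) * letter (j, k)) = As.Q.\<pi> (if i = j then letter (i, k) else 0)"
    by (rule As.\<pi>_relator[OF As_relator_mem(3)[OF i j k]]) (use i j k in \<open>auto simp: l t z simp del: mult_single\<close>)
  then show "As.gen (i, k) \<otimes>\<^bsub>As.P\<^esub> As.gen (j, k) = (if i = j then As.gen (i, k) else \<zero>\<^bsub>As.P\<^esub>)"
    using \<pi>(3)[OF l[OF i k] l[OF j k]] by (simp add: free_algebra_simps presented_gen_def \<pi>0 split: if_splits)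
qed

subsection \<open>Hopf algebra structure of \<open>A\<^sub>s(m)\<close>\<close>

text \<open>Lets \<open>As m\<close> and its underlying presented algebra share one and the same
  tensor product, which ignores the Hopf fields.\<close>

lemma tensor_cong:
  fixes A :: "('k::field, 'a, 'm) module_scheme" and A' :: "('k, 'a, 'm') module_scheme"
    and B :: "('k, 'b, 'l) module_scheme" and B' :: "('k, 'b, 'l') module_scheme"
  assumes "carrier A' = carrier A" "add A' = add A" "mult A' = mult A" "one A' = one A" "smult A' = smult A"
    and "carrier B' = carrier B" "add B' = add B" "mult B' = mult B" "one B' = one B" "smult B' = smult B"
  shows "tensor A' B' = tensor A B" "tens A' B' = tens A B"
proof -
  have 1: "formal_tensors A' B' = formal_tensors A B" by (simp add: formal_tensors_def assms)
  moreover have "tensor_relators A' B' = tensor_relators A B" unfolding tensor_relators_def assms ..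
  ultimately have 2: "tensor_null A' B' = tensor_null A B" by (simp add: tensor_null_def)
  show "tensor A' B' = tensor A B" by (simp add: tensor_def 1 2)
  show "tens A' B' = tens A B" by (intro ext) (simp add: tens_def 1 2)
qed

text \<open>The part of the Hopf algebra axioms that presented algebras satisfy by construction; it suffices
  for building morphisms.\<close>

definition prehopf :: "('k::field, 'a, 'm) hopf_scheme \<Rightarrow> bool"
  where "prehopf H \<longleftrightarrow> unital_algebra H \<and> comult H \<in> algebra_hom H (tensor H H) \<and>
    counit H \<in> algebra_hom H base_algebra \<and> antipode H \<in> algebra_hom H (opposite_algebra H)"

lemma prehopfD:
  assumes "prehopf H"
  shows "unital_algebra H" "comult H \<in> algebra_hom H (tensor H H)"
    "counit H \<in> algebra_hom H base_algebra" "antipode H \<in> algebra_hom H (opposite_algebra H)"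
  using assms by (simp_all add: prehopf_def)

lemma hopf_homI:
  assumes "f \<in> algebra_hom H L"
    and "\<And>h. h \<in> carrier H \<Longrightarrow> comult L (f h) = tensor_map L L f f (comult H h)"
    and "\<And>h. h \<in> carrier H \<Longrightarrow> counit L (f h) = counit H h"
    and "\<And>h. h \<in> carrier H \<Longrightarrow> antipode L (f h) = f (antipode H h)"
  shows "f \<in> hopf_hom H L"
  using assms by (simp add: hopf_hom_def)

lemma hopf_homD:
  assumes "f \<in> hopf_hom H L"
  shows "f \<in> algebra_hom H L"
    and "\<And>h. h \<in> carrier H \<Longrightarrow> comult L (f h) = tensor_map L L f f (comult H h)"
    and "\<And>h. h \<in> carrier H \<Longrightarrow> counit L (f h) = counit H h"
    and "\<And>h. h \<in> carrier H \<Longrightarrow> antipode L (f h) = f (antipode H h)"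
  using assms by (simp_all add: hopf_hom_def)

lemma As_simps:
  "carrier (As m) = carrier (As_alg m)" "add (As m) = add (As_alg m)" "mult (As m) = mult (As_alg m)"
  "one (As m) = one (As_alg m)" "zero (As m) = zero (As_alg m)" "smult (As m) = smult (As_alg m)"
  "comult (As m) = presented_lift (tensor (As_alg m) (As_alg m))
    (\<lambda>(i, j). \<Oplus>\<^bsub>tensor (As_alg m) (As_alg m)\<^esub>k\<in>{..<m}. tens (As_alg m) (As_alg m) (As_gen m i k) (As_gen m k j))"
  "counit (As m) = presented_lift base_algebra (\<lambda>(i, j). if i = j then 1 else 0)"
  "antipode (As m) = presented_lift (opposite_algebra (As_alg m)) (\<lambda>(i, j). As_gen m j i)"
  by (simp_all add: As_def Let_def module.extend_def hopf.fields_def)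

lemma unital_algebra_As_alg: "unital_algebra (As_alg m)"
  by (rule presentation.unital_algebra_P[OF As_presentation])

lemma unital_algebra_As: "unital_algebra (As m)"
  by (rule unital_algebra_cong[OF unital_algebra_As_alg As_simps(1-6)])

text \<open>Each structure map is an instance of \<open>As_lift\<close>: for the matrix product of
  the generators with themselves inside the tensor square, for the identity matrix, and for the
  transposed generators.\<close>

lemma As_structure_maps:
  shows "comult (As m) \<in> algebra_hom (As_alg m) (tensor (As_alg m) (As_alg m))"
    and "\<And>i j. i < m \<Longrightarrow> j < m \<Longrightarrow> comult (As m) (As_gen m i j) =
      (\<Oplus>\<^bsub>tensor (As_alg m) (As_alg m)\<^esub>k\<in>{..<m}. tens (As_alg m) (As_alg m) (As_gen m i k) (As_gen m k j))"
    and "counit (As m) \<in> algebra_hom (As_alg m) base_algebra"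
    and "\<And>i j. i < m \<Longrightarrow> j < m \<Longrightarrow> counit (As m) (As_gen m i j) = (if i = j then 1 else 0)"
    and "antipode (As m) \<in> algebra_hom (As_alg m) (opposite_algebra (As_alg m))"
    and "\<And>i j. i < m \<Longrightarrow> j < m \<Longrightarrow> antipode (As m) (As_gen m i j) = As_gen m j i"
proof -
  note T = As_lift[OF tensor_algebras.unital_algebra_tensor[OF tensor_algebras.intro[OF unital_algebra_As_alg unital_algebra_As_alg]]
      magic_tensor[OF unital_algebra_As_alg unital_algebra_As_alg magic_As magic_As]]
  show "comult (As m) \<in> algebra_hom (As_alg m) (tensor (As_alg m) (As_alg m))"
    unfolding As_simps by (rule T)
  show "\<And>i j. i < m \<Longrightarrow> j < m \<Longrightarrow> comult (As m) (As_gen m i j) =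
      (\<Oplus>\<^bsub>tensor (As_alg m) (As_alg m)\<^esub>k\<in>{..<m}. tens (As_alg m) (As_alg m) (As_gen m i k) (As_gen m k j))"
    unfolding As_simps by (rule T)
  note C = As_lift[OF unital_algebra_base magic_identity]
  show "counit (As m) \<in> algebra_hom (As_alg m) base_algebra" unfolding As_simps by (rule C)
  show "\<And>i j. i < m \<Longrightarrow> j < m \<Longrightarrow> counit (As m) (As_gen m i j) = (if i = j then 1 else 0)"
    unfolding As_simps by (rule C)
  note S = As_lift[OF unital_algebra_opposite[OF unital_algebra_As_alg] magic_transpose[OF magic_As]]
  show "antipode (As m) \<in> algebra_hom (As_alg m) (opposite_algebra (As_alg m))" unfolding As_simps by (rule S)
  show "\<And>i j. i < m \<Longrightarrow> j < m \<Longrightarrow> antipode (As m) (As_gen m i j) = As_gen m j i"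
    unfolding As_simps by (rule S)
qed

lemma prehopf_As: "prehopf (As m)"
  unfolding prehopf_def
proof (intro conjI unital_algebra_As)
  have src: "algebra_hom (As m) C = algebra_hom (As_alg m) C" for C
    by (rule algebra_hom_cong_source) (rule As_simps)+
  have T: "tensor (As m) (As m) = tensor (As_alg m) (As_alg m)"
    by (rule tensor_cong) (rule As_simps)+
  have O: "algebra_hom C (opposite_algebra (As m)) = algebra_hom C (opposite_algebra (As_alg m))" for C
    by (rule algebra_hom_cong_target) (simp_all add: opposite_algebra_simps As_simps)
  show "comult (As m) \<in> algebra_hom (As m) (tensor (As m) (As m))"
    "counit (As m) \<in> algebra_hom (As m) base_algebra"
    "antipode (As m) \<in> algebra_hom (As m) (opposite_algebra (As m))"
    unfolding src T O by (rule As_structure_maps)+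
qed

text \<open>Each compatibility is an equality between algebra maps out of \<open>As m\<close>, with
  values in the opposite algebra in the case of the antipode. The hypotheses on \<open>U\<close>
  copy the formulas for the generators and settle the question there.\<close>

lemma As_hopf_hom:
  fixes L :: "('k::field, 'b, 'm) hopf_scheme"
  assumes L: "prehopf L" and U: "magic L m U"
    and comult: "\<And>i j. i < m \<Longrightarrow> j < m \<Longrightarrow> comult L (U i j) = (\<Oplus>\<^bsub>tensor L L\<^esub>k\<in>{..<m}. tens L L (U i k) (U k j))"
    and counit: "\<And>i j. i < m \<Longrightarrow> j < m \<Longrightarrow> counit L (U i j) = (if i = j then 1 else 0)"
    and antipode: "\<And>i j. i < m \<Longrightarrow> j < m \<Longrightarrow> antipode L (U i j) = U j i"
  shows "presented_lift L (\<lambda>(i, j). U i j) \<in> hopf_hom (As m) L"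
proof (rule hopf_homI)
  interpret As: presentation "As_generators m" "As_relators m :: (_ \<Rightarrow>\<^sub>0 'k) set" by (rule As_presentation)
  note D = prehopfD[OF L]
  let ?f = "presented_lift L (\<lambda>(i, j). U i j)"
  note f = As_lift[OF D(1) U] and S = As_structure_maps
  have src: "algebra_hom (As m) C = algebra_hom As.P C" for C :: "('k, 'z, 'y) module_scheme"
    by (rule algebra_hom_cong_source) (rule As_simps)+
  show "?f \<in> algebra_hom (As m) L" unfolding src by (rule f)
  interpret TL: tensor_algebras L L by (intro tensor_algebras.intro D)
  interpret TA: tensor_algebras As.P As.P by (intro tensor_algebras.intro As.unital_algebra_P)
  note M = tensor_map_hom[OF As.unital_algebra_P As.unital_algebra_P D(1,1) f(1,1)]
  fix h :: "((nat \<times> nat) free_monoid \<Rightarrow>\<^sub>0 'k) set" assume "h \<in> carrier (As m)"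
  then have h: "h \<in> carrier As.P" by (simp add: As_simps)
  show "comult L (?f h) = tensor_map L L ?f ?f (comult (As m) h)"
  proof (rule As.hom_eqI[OF TL.vspace_tensor algebra_hom_comp[OF f(1) D(2)] algebra_hom_comp[OF S(1) M] _ h])
    fix x assume "x \<in> As_generators m"
    then obtain i j where x: "x = (i, j)" "i < m" "j < m" by (auto simp: As_generators_def)
    have "tensor_map L L ?f ?f (comult (As m) (As.gen x)) = (\<Oplus>\<^bsub>tensor L L\<^esub>k\<in>{..<m}. tens L L (?f (As.gen (i, k))) (?f (As.gen (k, j))))"
      unfolding x S(2)[OF x(2,3)]
      by (rule tensor_map_facts(3)[OF TA.vA TA.vB TL.vA TL.vB algebra_homD(1)[OF f(1)] algebra_homD(1)[OF f(1)]])
        (auto intro!: As_gen_in simp: x)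
    also have "\<dots> = (\<Oplus>\<^bsub>tensor L L\<^esub>k\<in>{..<m}. tens L L (U i k) (U k j))"
      by (rule vfinsum_cong[OF TL.vspace_tensor]) (auto simp: f(2) x TL.tens_closed magicD(1)[OF U])
    also have "\<dots> = comult L (?f (As.gen x))" by (simp add: x f(2) comult)
    finally show "comult L (?f (As.gen x)) = tensor_map L L ?f ?f (comult (As m) (As.gen x))" ..
  qed
  show "counit L (?f h) = counit (As m) h"
  proof (rule As.hom_eqI[OF unital_algebraD(2)[OF unital_algebra_base] algebra_hom_comp[OF f(1) D(3)] S(3) _ h])
    fix x assume "x \<in> As_generators m"
    then obtain i j where x: "x = (i, j)" "i < m" "j < m" by (auto simp: As_generators_def)
    then show "counit L (?f (As.gen x)) = counit (As m) (As.gen x)" by (simp add: f(2) S(4) counit)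
  qed
  show "antipode L (?f h) = ?f (antipode (As m) h)"
  proof (rule As.hom_eqI[OF unital_algebraD(2)[OF unital_algebra_opposite[OF D(1)]]
        algebra_hom_comp[OF f(1) D(4)] algebra_hom_comp[OF S(5) algebra_hom_opposite[OF f(1)]] _ h])
    fix x assume "x \<in> As_generators m"
    then obtain i j where x: "x = (i, j)" "i < m" "j < m" by (auto simp: As_generators_def)
    then show "antipode L (?f (As.gen x)) = ?f (antipode (As m) (As.gen x))" by (simp add: f(2) S(6) antipode)
  qed
qed

subsection \<open>Free products\<close>

locale free_product_family =
  fixes I :: "'i set" and A :: "'i \<Rightarrow> ('k::field, 'a, 'm) hopf_scheme"
  assumes A: "\<And>i. i \<in> I \<Longrightarrow> prehopf (A i)"
begin

abbreviation "X \<equiv> Sigma I (\<lambda>i. carrier (A i))"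
abbreviation "R \<equiv> free_product_relators I A"

lemma relators_in: "R \<subseteq> carrier (free_algebra X)"
proof -
  interpret P: presentation X "{} :: (('i \<times> 'a) free_monoid \<Rightarrow>\<^sub>0 'k) set"
    by (rule presentation.intro) simp
  have d: "p - q \<in> carrier P.F" if "p \<in> carrier P.F" "q \<in> carrier P.F" for p q
    using abelian_group.minus_closed[OF vspaceD(1)[OF P.W.vspace_F] that] that by (simp add: P.W.minus_F)
  have t: "p * q \<in> carrier P.F" if "p \<in> carrier P.F" "q \<in> carrier P.F" for p q
    using P.W.mult_closed[OF that] by (simp add: free_algebra_simps)
  have z: "1 \<in> carrier P.F" by (auto simp: free_algebra_simps zero_free_monoid_def)
  have l: "Poly_Mapping.single (Word [(i, a)]) c \<in> carrier P.F" if "i \<in> I" "a \<in> carrier (A i)" for i a c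
    by (rule P.W.single_in) (use that in auto)
  show ?thesis
    unfolding free_product_relators_def
    using unital_algebraD[OF prehopfD(1)[OF A]] vspaceD[OF unital_algebraD(2)[OF prehopfD(1)[OF A]]]
    by (auto intro!: d t z l simp del: mult_single)
qed

sublocale P: presentation X R
  by (rule presentation.intro) (rule relators_in)

abbreviation "emb i a \<equiv> P.gen (i, a)"

text \<open>Relators are used as differences of two terms; the additive one, given as p - q - r, is
  therefore brought into the form p - (q + r).\<close>

lemma relator_mem:
  "i \<in> I \<Longrightarrow> a \<in> carrier (A i) \<Longrightarrow> b \<in> carrier (A i) \<Longrightarrow> letter (i, a \<oplus>\<^bsub>A i\<^esub> b) - (letter (i, a) + letter (i, b)) \<in> R"
  "i \<in> I \<Longrightarrow> a \<in> carrier (A i) \<Longrightarrow> letter (i, c \<odot>\<^bsub>A i\<^esub> a) - Poly_Mapping.single (Word [(i, a)]) c \<in> R"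
  "i \<in> I \<Longrightarrow> a \<in> carrier (A i) \<Longrightarrow> b \<in> carrier (A i) \<Longrightarrow> letter (i, a \<otimes>\<^bsub>A i\<^esub> b) - letter (i, a) * letter (i, b) \<in> R"
  "i \<in> I \<Longrightarrow> letter (i, \<one>\<^bsub>A i\<^esub>) - 1 \<in> R"
  unfolding free_product_relators_def diff_diff_eq[symmetric] by blast+

lemma emb_hom:
  assumes i: "i \<in> I"
  shows "emb i \<in> algebra_hom (A i) P.P"
proof (rule algebra_homI[OF linI])
  note \<pi> = P.\<pi>_P_hom and D = unital_algebraD[OF prehopfD(1)[OF A[OF i]]]
  note V = vspaceD[OF D(2)]
  have l: "Poly_Mapping.single (Word [(i, a)]) c \<in> carrier P.F" if "a \<in> carrier (A i)" for a c
    by (rule P.W.single_in) (use that i in auto)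
  have t: "p * q \<in> carrier P.F" if "p \<in> carrier P.F" "q \<in> carrier P.F" for p q
    using P.W.mult_closed[OF that] by (simp add: free_algebra_simps)
  have z: "1 \<in> carrier P.F" by (auto simp: free_algebra_simps zero_free_monoid_def)
  have p: "p + q \<in> carrier P.F" if "p \<in> carrier P.F" "q \<in> carrier P.F" for p q
    by (rule P.W.add_closed[OF that])
  show "emb i \<one>\<^bsub>A i\<^esub> = \<one>\<^bsub>P.P\<^esub>"
    unfolding P.gen_\<pi> using P.\<pi>_relator[OF relator_mem(4)[OF i] l[OF D(3)] z] \<pi>(2)
    by (simp add: free_algebra_simps)
  fix a assume a: "a \<in> carrier (A i)"
  show "emb i a \<in> carrier P.P" by (rule P.gen_in) (use i a in auto)
  show "emb i (c \<odot>\<^bsub>A i\<^esub> a) = c \<odot>\<^bsub>P.P\<^esub> emb i a" for c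
  proof -
    have "P.Q.\<pi> (letter (i, c \<odot>\<^bsub>A i\<^esub> a)) = P.Q.\<pi> (Poly_Mapping.single (Word [(i, a)]) c)"
      by (rule P.\<pi>_relator[OF relator_mem(2)[OF i a]]) (auto intro!: l a V)
    also have "\<dots> = c \<odot>\<^bsub>P.P\<^esub> P.Q.\<pi> (letter (i, a))"
      using \<pi>(6)[OF l[OF a], of c 1] by (simp add: P.W.smult_single)
    finally show ?thesis by (simp add: P.gen_\<pi>)
  qed
  fix b assume b: "b \<in> carrier (A i)"
  have "P.Q.\<pi> (letter (i, a \<oplus>\<^bsub>A i\<^esub> b)) = P.Q.\<pi> (letter (i, a) + letter (i, b))"
    by (rule P.\<pi>_relator[OF relator_mem(1)[OF i a b]]) (auto intro!: l a b V p)
  then show "emb i (a \<oplus>\<^bsub>A i\<^esub> b) = emb i a \<oplus>\<^bsub>P.P\<^esub> emb i b"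
    using \<pi>(5)[OF l[OF a] l[OF b], of 1 1] by (simp add: P.gen_\<pi> free_algebra_simps)
  have "P.Q.\<pi> (letter (i, a \<otimes>\<^bsub>A i\<^esub> b)) = P.Q.\<pi> (letter (i, a) * letter (i, b))"
    by (rule P.\<pi>_relator[OF relator_mem(3)[OF i a b]]) (auto intro!: l a b t D simp del: mult_single)
  then show "emb i (a \<otimes>\<^bsub>A i\<^esub> b) = emb i a \<otimes>\<^bsub>P.P\<^esub> emb i b"
    using \<pi>(3)[OF l[OF a] l[OF b], of 1 1] by (simp add: P.gen_\<pi> free_algebra_simps)
qed

text \<open>Universal property of the free product as an algebra: the evaluation kills the relators
  because every \<open>g i\<close> is a unital algebra map.\<close>

lemma lift:
  fixes B :: "('k, 'b, 'l) module_scheme"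
  assumes B: "unital_algebra B" and "\<forall>i\<in>I. g i \<in> algebra_hom (A i) B"
  shows "presented_lift B (\<lambda>(i, a). g i a) \<in> algebra_hom P.P B"
    "\<And>i a. i \<in> I \<Longrightarrow> a \<in> carrier (A i) \<Longrightarrow> presented_lift B (\<lambda>(i, a). g i a) (emb i a) = g i a"
proof -
  have g: "\<And>i. i \<in> I \<Longrightarrow> g i \<in> algebra_hom (A i) B" using assms(2) by blast
  let ?\<phi> = "\<lambda>(i, a). g i a"
  let ?ev = "lin_ext B (word_val B ?\<phi>)"
  note vB = unital_algebraD(2)[OF B]
  have \<phi>: "?\<phi> x \<in> carrier B" if "x \<in> X" for x using that algebra_homD(4)[OF g] by auto
  have "?ev \<in> algebra_hom P.F B" by (rule P.ev_hom[OF B \<phi>])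
  note ev = algebra_homD[OF this]
  have l: "Poly_Mapping.single (Word [(i, a)]) c \<in> carrier P.F"
    "?ev (Poly_Mapping.single (Word [(i, a)]) c) = c \<odot>\<^bsub>B\<^esub> g i a" if "i \<in> I" "a \<in> carrier (A i)" for i a c
  proof -
    have x: "(i, a) \<in> X" using that by auto
    show "Poly_Mapping.single (Word [(i, a)]) c \<in> carrier P.F" by (rule P.W.single_in) (use that in auto)
    have "?ev (Poly_Mapping.single (Word [(i, a)]) c) = c \<odot>\<^bsub>B\<^esub> ?\<phi> (i, a)" by (rule P.ev_letter[OF B \<phi> x])
    then show "?ev (Poly_Mapping.single (Word [(i, a)]) c) = c \<odot>\<^bsub>B\<^esub> g i a" by simp
  qed
  have l1: "?ev (letter (i, a)) = g i a" if "i \<in> I" "a \<in> carrier (A i)" for i a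
    using l(2)[OF that, of 1] vspaceD(7)[OF vB algebra_homD(4)[OF g[OF that(1)] that(2)]] by simp
  have t: "p * q \<in> carrier P.F" "?ev (p * q) = ?ev p \<otimes>\<^bsub>B\<^esub> ?ev q" if "p \<in> carrier P.F" "q \<in> carrier P.F" for p q
    using P.W.mult_closed[OF that] ev(3)[OF that] by (simp_all add: free_algebra_simps)
  have p: "p + q \<in> carrier P.F" "?ev (p + q) = ?ev p \<oplus>\<^bsub>B\<^esub> ?ev q" if "p \<in> carrier P.F" "q \<in> carrier P.F" for p q
    using P.W.add_closed[OF that] ev(5)[OF that] by (simp_all add: free_algebra_simps)
  have z: "1 \<in> carrier P.F" "?ev 1 = \<one>\<^bsub>B\<^esub>"
    using ev(2) by (auto simp: free_algebra_simps zero_free_monoid_def)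
  have rel: "?ev r = \<zero>\<^bsub>B\<^esub>" if "r \<in> R" for r
    using that unfolding free_product_relators_def diff_diff_eq
  proof (elim UnE CollectE exE conjE)
    fix i a b assume r: "r = letter (i, a \<oplus>\<^bsub>A i\<^esub> b) - (letter (i, a) + letter (i, b))" "i \<in> I" "a \<in> carrier (A i)" "b \<in> carrier (A i)"
    have c: "a \<oplus>\<^bsub>A i\<^esub> b \<in> carrier (A i)"
      using r vspaceD(10)[OF unital_algebraD(2)[OF prehopfD(1)[OF A]]] by simp
    show ?thesis unfolding r(1)
      by (rule P.ev_eq[OF B \<phi>]) (simp_all add: r c p l(1) l1 algebra_homD(5)[OF g])
  next
    fix i c a assume r: "r = letter (i, c \<odot>\<^bsub>A i\<^esub> a) - Poly_Mapping.single (Word [(i, a)]) c" "i \<in> I" "a \<in> carrier (A i)"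
    have c: "c \<odot>\<^bsub>A i\<^esub> a \<in> carrier (A i)"
      using r vspaceD(3)[OF unital_algebraD(2)[OF prehopfD(1)[OF A]]] by simp
    show ?thesis unfolding r(1)
      by (rule P.ev_eq[OF B \<phi>]) (simp_all add: r c l(1) l(2)[of i a c] l1 algebra_homD(6)[OF g])
  next
    fix i a b assume r: "r = letter (i, a \<otimes>\<^bsub>A i\<^esub> b) - letter (i, a) * letter (i, b)" "i \<in> I" "a \<in> carrier (A i)" "b \<in> carrier (A i)"
    have c: "a \<otimes>\<^bsub>A i\<^esub> b \<in> carrier (A i)"
      using r unital_algebraD(4)[OF prehopfD(1)[OF A]] by simp
    show ?thesis unfolding r(1)
      by (rule P.ev_eq[OF B \<phi>]) (simp_all add: r c t l(1) l1 algebra_homD(3)[OF g] del: mult_single)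
  next
    fix i assume r: "r = letter (i, \<one>\<^bsub>A i\<^esub>) - 1" "i \<in> I"
    have c: "\<one>\<^bsub>A i\<^esub> \<in> carrier (A i)"
      using r unital_algebraD(3)[OF prehopfD(1)[OF A]] by simp
    show ?thesis unfolding r(1)
      by (rule P.ev_eq[OF B \<phi>]) (simp_all add: r c z l(1) l1 algebra_homD(2)[OF g])
  qed
  show "presented_lift B ?\<phi> \<in> algebra_hom P.P B"
    by (rule P.presented_lift_hom[OF B \<phi> rel])
  show "\<And>i a. i \<in> I \<Longrightarrow> a \<in> carrier (A i) \<Longrightarrow> presented_lift B (\<lambda>(i, a). g i a) (emb i a) = g i a"
    using P.presented_lift_gen[of B ?\<phi>, OF B] \<phi> rel by fastforce
qed

lemma free_product_simps:
  "carrier (free_product I A) = carrier P.P" "add (free_product I A) = add P.P" "mult (free_product I A) = mult P.P"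
  "one (free_product I A) = one P.P" "zero (free_product I A) = zero P.P" "smult (free_product I A) = smult P.P"
  "comult (free_product I A) = presented_lift (tensor P.P P.P) (\<lambda>(i, a). tensor_map P.P P.P (emb i) (emb i) (comult (A i) a))"
  "counit (free_product I A) = presented_lift base_algebra (\<lambda>(i, a). counit (A i) a)"
  "antipode (free_product I A) = presented_lift (opposite_algebra P.P) (\<lambda>(i, a). emb i (antipode (A i) a))"
  by (simp_all add: free_product_def Let_def module.extend_def hopf.fields_def)

text \<open>The Hopf structure of the free product is defined so that the maps \<open>emb i\<close>
  respect it. On generators, compatibility of the induced map is therefore compatibility of the
  single maps \<open>g i\<close>.\<close>

lemma free_product_hopf_hom:
  fixes L :: "('k, 'b, 'l) hopf_scheme"
  assumes L: "prehopf L" and g: "\<And>i. i \<in> I \<Longrightarrow> g i \<in> hopf_hom (A i) L"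
  shows "presented_lift L (\<lambda>(i, a). g i a) \<in> hopf_hom (free_product I A) L"
    "\<And>i a. i \<in> I \<Longrightarrow> a \<in> carrier (A i) \<Longrightarrow> presented_lift L (\<lambda>(i, a). g i a) (emb i a) = g i a"
proof -
  note D = prehopfD[OF L]
  note g' = hopf_homD[OF g]
  let ?f = "presented_lift L (\<lambda>(i, a). g i a)"
  have "\<forall>i\<in>I. g i \<in> algebra_hom (A i) L" using g'(1) by blast
  note f = lift[OF D(1) this]
  show "\<And>i a. i \<in> I \<Longrightarrow> a \<in> carrier (A i) \<Longrightarrow> ?f (emb i a) = g i a" by (rule f)
  interpret TL: tensor_algebras L L by (intro tensor_algebras.intro D)
  interpret TP: tensor_algebras P.P P.P by (intro tensor_algebras.intro P.unital_algebra_P)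
  have TM: "tensor_map P.P P.P (emb i) (emb i) \<in> algebra_hom (tensor (A i) (A i)) (tensor P.P P.P)" if i: "i \<in> I" for i
    by (rule tensor_map_hom[OF prehopfD(1)[OF A[OF i]] prehopfD(1)[OF A[OF i]] P.unital_algebra_P P.unital_algebra_P emb_hom[OF i] emb_hom[OF i]])
  have "\<forall>i\<in>I. (\<lambda>a. tensor_map P.P P.P (emb i) (emb i) (comult (A i) a)) \<in> algebra_hom (A i) (tensor P.P P.P)"
    using algebra_hom_comp[OF prehopfD(2)[OF A] TM] by blast
  note C = lift[OF TP.unital_algebra_tensor this, folded free_product_simps(7)]
  have "\<forall>i\<in>I. counit (A i) \<in> algebra_hom (A i) base_algebra" using prehopfD(3)[OF A] by blast
  note E = lift[OF unital_algebra_base this, folded free_product_simps(8)]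
  have "\<forall>i\<in>I. (\<lambda>a. emb i (antipode (A i) a)) \<in> algebra_hom (A i) (opposite_algebra P.P)"
    using algebra_hom_comp[OF prehopfD(4)[OF A] algebra_hom_opposite[OF emb_hom]] by blast
  note S = lift[OF unital_algebra_opposite[OF P.unital_algebra_P] this, folded free_product_simps(9)]
  note M = tensor_map_hom[OF P.unital_algebra_P P.unital_algebra_P D(1,1) f(1,1)]
  show "?f \<in> hopf_hom (free_product I A) L"
  proof (rule hopf_homI)
    have src: "algebra_hom (free_product I A) L = algebra_hom P.P L"
      by (rule algebra_hom_cong_source) (rule free_product_simps)+
    show "?f \<in> algebra_hom (free_product I A) L" unfolding src by (rule f)
    fix h assume "h \<in> carrier (free_product I A)"
    then have h: "h \<in> carrier P.P" by (simp add: free_product_simps)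
    show "comult L (?f h) = tensor_map L L ?f ?f (comult (free_product I A) h)"
    proof (rule P.hom_eqI[OF TL.vspace_tensor algebra_hom_comp[OF f(1) D(2)] algebra_hom_comp[OF C(1) M] _ h])
      fix x assume "x \<in> X"
      then obtain i a where x: "x = (i, a)" and i: "i \<in> I" and a: "a \<in> carrier (A i)" by auto
      interpret TA: tensor_algebras "A i" "A i" by (intro tensor_algebras.intro prehopfD(1) A i)
      note lins = algebra_homD(1)[OF f(1)] algebra_homD(1)[OF emb_hom[OF i]] algebra_homD(1)[OF g'(1)[OF i]]
      note mf = tensor_map_facts[OF TP.vA TP.vB TL.vA TL.vB lins(1,1)]
      note mi = tensor_map_facts[OF TA.vA TA.vB TP.vA TP.vB lins(2,2)]
      note mg = tensor_map_facts[OF TA.vA TA.vB TL.vA TL.vB lins(3,3)]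
      have "comult L (?f (P.gen x)) = tensor_map L L (g i) (g i) (comult (A i) a)"
        by (simp add: x f(2)[OF i a] g'(2)[OF i a])
      \<comment> \<open>Both sides are linear in the tensor \<open>comult (A i) a\<close>. On pure
        tensors they agree because \<open>?f\<close> after \<open>emb i\<close> is
        \<open>g i\<close>.\<close>
      also have "\<dots> = tensor_map L L ?f ?f (tensor_map P.P P.P (emb i) (emb i) (comult (A i) a))"
      proof (rule TA.tensor_lin_eqI[OF mg(1) lin_comp[OF mi(1) mf(1)]])
        show "comult (A i) a \<in> carrier (tensor (A i) (A i))"
          by (rule algebra_homD(4)[OF prehopfD(2)[OF A[OF i]] a])
        fix b c assume bc: "b \<in> carrier (A i)" "c \<in> carrier (A i)"
        have "emb i b \<in> carrier P.P" "emb i c \<in> carrier P.P" using linD(1)[OF lins(2)] bc by auto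
        with bc show "tensor_map L L (g i) (g i) (tens (A i) (A i) b c)
          = tensor_map L L ?f ?f (tensor_map P.P P.P (emb i) (emb i) (tens (A i) (A i) b c))"
          by (simp add: mg(2) mi(2) mf(2) f(2) i)
      qed
      also have "\<dots> = tensor_map L L ?f ?f (comult (free_product I A) (P.gen x))"
        by (simp add: x C(2)[OF i a])
      finally show "comult L (?f (P.gen x)) = tensor_map L L ?f ?f (comult (free_product I A) (P.gen x))" .
    qed
    show "counit L (?f h) = counit (free_product I A) h"
    proof (rule P.hom_eqI[OF unital_algebraD(2)[OF unital_algebra_base] algebra_hom_comp[OF f(1) D(3)] E(1) _ h])
      fix x assume "x \<in> X"
      then show "counit L (?f (P.gen x)) = counit (free_product I A) (P.gen x)"
        by (auto simp: f(2) E(2) g'(3))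
    qed
    show "antipode L (?f h) = ?f (antipode (free_product I A) h)"
    proof (rule P.hom_eqI[OF unital_algebraD(2)[OF unital_algebra_opposite[OF D(1)]]
        algebra_hom_comp[OF f(1) D(4)] algebra_hom_comp[OF S(1) algebra_hom_opposite[OF f(1)]] _ h])
      fix x assume "x \<in> X"
      then obtain i a where x: "x = (i, a)" and i: "i \<in> I" and a: "a \<in> carrier (A i)" by auto
      have "antipode (A i) a \<in> carrier (A i)"
        using algebra_homD(4)[OF prehopfD(4)[OF A[OF i]] a] by (simp add: opposite_algebra_simps)
      then show "antipode L (?f (P.gen x)) = ?f (antipode (free_product I A) (P.gen x))"
        by (simp add: x f(2)[OF i] S(2)[OF i a] g'(4)[OF i a] a)
    qed
  qed
qed

end

subsection \<open>Comodules with a finite basis\<close>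

text \<open>A basis together with its coordinate functionals: \<open>\<phi>_b\<close> and
  \<open>expand\<close> do the work of independence and spanning. Instances are K^n, its copy inside
  \<open>nat \<Rightarrow> 'a\<close>, and the space of coinvariants.\<close>

locale fin_basis =
  fixes V :: "('k::field, 'v, 'l) module_scheme" and n :: nat and b :: "nat \<Rightarrow> 'v" and \<phi> :: "nat \<Rightarrow> 'v \<Rightarrow> 'k"
  assumes vV: "vspace V" and b_in: "\<And>i. i < n \<Longrightarrow> b i \<in> carrier V"
    and \<phi>_lin: "\<And>i. i < n \<Longrightarrow> \<phi> i \<in> lin V base_algebra"
    and \<phi>_b: "\<And>i j. i < n \<Longrightarrow> j < n \<Longrightarrow> \<phi> i (b j) = (if i = j then 1 else 0)"
    and expand: "\<And>v. v \<in> carrier V \<Longrightarrow> v = (\<Oplus>\<^bsub>V\<^esub>i\<in>{..<n}. \<phi> i v \<odot>\<^bsub>V\<^esub> b i)"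
begin

lemma \<phi>_simps:
  assumes "i < n"
  shows "v \<in> carrier V \<Longrightarrow> w \<in> carrier V \<Longrightarrow> \<phi> i (v \<oplus>\<^bsub>V\<^esub> w) = \<phi> i v + \<phi> i w"
    "v \<in> carrier V \<Longrightarrow> \<phi> i (c \<odot>\<^bsub>V\<^esub> v) = c * \<phi> i v"
  using linD[OF \<phi>_lin[OF assms]] by (simp_all add: base_algebra_simps)

lemma lin_basis_eqI:
  assumes "vspace W" "f \<in> lin V W" "g \<in> lin V W" "\<And>i. i < n \<Longrightarrow> f (b i) = g (b i)" "v \<in> carrier V"
  shows "f v = g v"
proof -
  have c: "\<phi> i v \<odot>\<^bsub>V\<^esub> b i \<in> carrier V" if "i \<in> {..<n}" for i
    using that b_in vspaceD(3)[OF vV] by simp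
  have "h v = (\<Oplus>\<^bsub>W\<^esub>i\<in>{..<n}. \<phi> i v \<odot>\<^bsub>W\<^esub> h (b i))" if h: "h \<in> lin V W" for h
  proof -
    have "h v = h (\<Oplus>\<^bsub>V\<^esub>i\<in>{..<n}. \<phi> i v \<odot>\<^bsub>V\<^esub> b i)" using expand[OF assms(5)] by (rule arg_cong)
    also have "\<dots> = (\<Oplus>\<^bsub>W\<^esub>i\<in>{..<n}. h (\<phi> i v \<odot>\<^bsub>V\<^esub> b i))" by (rule lin_finsum[OF vV assms(1) h]) (use c in auto)
    also have "\<dots> = (\<Oplus>\<^bsub>W\<^esub>i\<in>{..<n}. \<phi> i v \<odot>\<^bsub>W\<^esub> h (b i))"
      by (rule vfinsum_cong[OF assms(1)]) (use b_in linD[OF h] vspaceD(3)[OF assms(1)] in auto)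
    finally show ?thesis .
  qed
  note this[OF assms(2)]
  also have "(\<Oplus>\<^bsub>W\<^esub>i\<in>{..<n}. \<phi> i v \<odot>\<^bsub>W\<^esub> f (b i)) = (\<Oplus>\<^bsub>W\<^esub>i\<in>{..<n}. \<phi> i v \<odot>\<^bsub>W\<^esub> g (b i))"
    by (rule vfinsum_cong[OF assms(1)]) (use b_in assms(4) linD[OF assms(3)] vspaceD(3)[OF assms(1)] in auto)
  finally show ?thesis using \<open>\<And>h. h \<in> lin V W \<Longrightarrow> h v = _ h\<close>[OF assms(3)] by simp
qed

end

text \<open>The map \<chi> \<otimes> id, followed by the identification of K \<otimes> H with H. The
  \<open>coefficients\<close> of a coaction are the slices of its values.\<close>

definition slice :: "('k::field, 'a, 'm) module_scheme \<Rightarrow> ('v \<Rightarrow> 'k) \<Rightarrow> ('v \<times> 'a \<Rightarrow>\<^sub>0 'k) set \<Rightarrow> 'a"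
  where "slice H \<chi> = tensor_lift H (\<lambda>v h. \<chi> v \<odot>\<^bsub>H\<^esub> h)"

context
  fixes V :: "('k::field, 'v, 'l) module_scheme" and H :: "('k, 'a, 'm) module_scheme"
  assumes vV: "vspace V" and vH: "vspace H"
begin

interpretation T: tensor_pair V H by (intro tensor_pair.intro vV vH)

lemma slice_bilin: "\<chi> \<in> lin V base_algebra \<Longrightarrow> bilin V H H (\<lambda>v h. \<chi> v \<odot>\<^bsub>H\<^esub> h)"
  by (rule bilinI)
    (use vspaceD(3-6)[OF vH] in \<open>simp_all add: linD base_algebra_simps mult.commute flip: vspaceD(6)[OF vH]\<close>)

lemma slice_lin: "\<chi> \<in> lin V base_algebra \<Longrightarrow> slice H \<chi> \<in> lin (tensor V H) H"
  unfolding slice_def by (rule T.tensor_lift_lin[OF vH slice_bilin])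

lemma slice_tens:
  "\<chi> \<in> lin V base_algebra \<Longrightarrow> v \<in> carrier V \<Longrightarrow> h \<in> carrier H \<Longrightarrow> slice H \<chi> (tens V H v h) = \<chi> v \<odot>\<^bsub>H\<^esub> h"
  unfolding slice_def by (rule T.tensor_lift_tens[OF vH slice_bilin])

lemma slice_finsum:
  assumes "\<chi> \<in> lin V base_algebra" "finite I" "\<And>i. i \<in> I \<Longrightarrow> x i \<in> carrier V" "\<And>i. i \<in> I \<Longrightarrow> y i \<in> carrier H"
  shows "slice H \<chi> (\<Oplus>\<^bsub>tensor V H\<^esub>i\<in>I. tens V H (x i) (y i)) = (\<Oplus>\<^bsub>H\<^esub>i\<in>I. \<chi> (x i) \<odot>\<^bsub>H\<^esub> y i)"
  unfolding slice_def by (rule T.tensor_lift_finsum[OF vH slice_bilin[OF assms(1)] assms(2-4)])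

end

context fin_basis
begin

context
  fixes H :: "('k, 'a, 'm) module_scheme"
  assumes vH: "vspace H"
begin

interpretation T: tensor_pair V H by (intro tensor_pair.intro vV vH)

text \<open>Coordinates of a tensor: a basis of \<open>V\<close> identifies the tensor product with
  \<open>n\<close> copies of \<open>H\<close>, through the slices along the coordinate
  functionals.\<close>

lemma tensor_expand:
  assumes "t \<in> carrier (tensor V H)"
  shows "t = (\<Oplus>\<^bsub>tensor V H\<^esub>i\<in>{..<n}. tens V H (b i) (slice H (\<phi> i) t))"
  using assms
proof (induction rule: T.tensor_induct)
  case (tens v h)
  note bl = bilinD[OF T.tens_bilin]
  have "tens V H v h = tens V H (\<Oplus>\<^bsub>V\<^esub>i\<in>{..<n}. \<phi> i v \<odot>\<^bsub>V\<^esub> b i) h"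
    by (rule arg_cong[OF expand[OF tens(1)]])
  also have "\<dots> = (\<Oplus>\<^bsub>tensor V H\<^esub>i\<in>{..<n}. tens V H (\<phi> i v \<odot>\<^bsub>V\<^esub> b i) h)"
    by (rule lin_finsum[OF vV T.vspace_tensor bl(7)[OF tens(2)]]) (auto simp: b_in vspaceD(3)[OF vV])
  also have "\<dots> = (\<Oplus>\<^bsub>tensor V H\<^esub>i\<in>{..<n}. tens V H (b i) (slice H (\<phi> i) (tens V H v h)))"
    by (rule vfinsum_cong[OF T.vspace_tensor])
      (auto simp: b_in vspaceD(3)[OF vH] vspaceD(3)[OF vV] bl(4,5) tens slice_tens[OF vV vH \<phi>_lin] T.tens_closed vspaceD(3)[OF T.vspace_tensor])
  finally show ?case .
next
  case (add s t)
  interpret TG: abelian_group "tensor V H" using T.vspace_tensor vspaceD by blast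
  note S = linD[OF slice_lin[OF vV vH \<phi>_lin]] and bl = bilinD[OF T.tens_bilin]
  have "s \<oplus>\<^bsub>tensor V H\<^esub> t = (\<Oplus>\<^bsub>tensor V H\<^esub>i\<in>{..<n}. tens V H (b i) (slice H (\<phi> i) s)) \<oplus>\<^bsub>tensor V H\<^esub>
    (\<Oplus>\<^bsub>tensor V H\<^esub>i\<in>{..<n}. tens V H (b i) (slice H (\<phi> i) t))"
    by (rule arg_cong2[OF add.IH])
  also have "\<dots> = (\<Oplus>\<^bsub>tensor V H\<^esub>i\<in>{..<n}. tens V H (b i) (slice H (\<phi> i) s) \<oplus>\<^bsub>tensor V H\<^esub> tens V H (b i) (slice H (\<phi> i) t))"
    by (rule TG.finsum_addf[symmetric]) (auto simp: T.tens_closed b_in S(1) add.hyps)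
  also have "\<dots> = (\<Oplus>\<^bsub>tensor V H\<^esub>i\<in>{..<n}. tens V H (b i) (slice H (\<phi> i) (s \<oplus>\<^bsub>tensor V H\<^esub> t)))"
    by (rule vfinsum_cong[OF T.vspace_tensor])
      (auto simp: T.tens_closed b_in S(1,2) add.hyps bl(3) vspaceD(10)[OF vH])
  finally show ?case .
qed

lemma slice_basis:
  assumes "j < n" "\<And>i. i < n \<Longrightarrow> y i \<in> carrier H"
  shows "slice H (\<phi> j) (\<Oplus>\<^bsub>tensor V H\<^esub>i\<in>{..<n}. tens V H (b i) (y i)) = y j"
proof -
  have "slice H (\<phi> j) (\<Oplus>\<^bsub>tensor V H\<^esub>i\<in>{..<n}. tens V H (b i) (y i)) = (\<Oplus>\<^bsub>H\<^esub>i\<in>{..<n}. \<phi> j (b i) \<odot>\<^bsub>H\<^esub> y i)"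
    by (rule slice_finsum[OF vV vH \<phi>_lin[OF assms(1)]]) (auto simp: b_in assms)
  also have "\<dots> = (\<Oplus>\<^bsub>H\<^esub>i\<in>{..<n}. if j = i then y i else \<zero>\<^bsub>H\<^esub>)"
    by (rule vfinsum_cong[OF vH]) (use assms vspaceD[OF vH] in \<open>auto simp: \<phi>_b\<close>)
  also have "\<dots> = y j" by (rule vfinsum_delta[OF vH]) (use assms in auto)
  finally show ?thesis .
qed

lemma tensor_eqI:
  assumes "s \<in> carrier (tensor V H)" "t \<in> carrier (tensor V H)"
    "\<And>i. i < n \<Longrightarrow> slice H (\<phi> i) s = slice H (\<phi> i) t"
  shows "s = t"
proof -
  have "s = (\<Oplus>\<^bsub>tensor V H\<^esub>i\<in>{..<n}. tens V H (b i) (slice H (\<phi> i) s))" by (rule tensor_expand) fact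
  also have "\<dots> = (\<Oplus>\<^bsub>tensor V H\<^esub>i\<in>{..<n}. tens V H (b i) (slice H (\<phi> i) t))"
    by (rule vfinsum_cong[OF T.vspace_tensor])
      (use assms linD(1)[OF slice_lin[OF vV vH \<phi>_lin]] in \<open>auto simp: T.tens_closed b_in\<close>)
  also have "\<dots> = t" by (rule tensor_expand[symmetric]) fact
  finally show ?thesis .
qed

end

end

text \<open>A corepresentation matrix. The index set is kept arbitrary so that Kronecker products
  can be indexed by pairs.\<close>

definition comatrix :: "('k::field, 'a, 'm) hopf_scheme \<Rightarrow> 'i set \<Rightarrow> ('i \<Rightarrow> 'i \<Rightarrow> 'a) \<Rightarrow> bool"
  where "comatrix H I a \<longleftrightarrow> finite I \<and> (\<forall>i\<in>I. \<forall>j\<in>I. a i j \<in> carrier H \<and>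
    comult H (a i j) = (\<Oplus>\<^bsub>tensor H H\<^esub>k\<in>I. tens H H (a i k) (a k j)) \<and>
    counit H (a i j) = (if i = j then 1 else 0))"

lemma comatrixD:
  assumes "comatrix H I a"
  shows "finite I" "\<And>i j. i \<in> I \<Longrightarrow> j \<in> I \<Longrightarrow> a i j \<in> carrier H"
    "\<And>i j. i \<in> I \<Longrightarrow> j \<in> I \<Longrightarrow> comult H (a i j) = (\<Oplus>\<^bsub>tensor H H\<^esub>k\<in>I. tens H H (a i k) (a k j))"
    "\<And>i j. i \<in> I \<Longrightarrow> j \<in> I \<Longrightarrow> counit H (a i j) = (if i = j then 1 else 0)"
  using assms by (auto simp: comatrix_def)

text \<open>Only linearity and the matrix of \<open>\<rho>\<close> are fixed, with column
  \<open>i\<close> describing the image of \<open>b i\<close>. Being a comodule becomes a property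
  of the matrix, so that the matrix can be read off from a given coaction as well as used to
  construct one.\<close>

locale matrix_coaction = fin_basis V n b \<phi>
  for V :: "('k::field, 'v, 'l) module_scheme" and n b \<phi> +
  fixes H :: "('k, 'a, 'm) hopf_scheme" and \<rho> :: "'v \<Rightarrow> ('v \<times> 'a \<Rightarrow>\<^sub>0 'k) set" and a :: "nat \<Rightarrow> nat \<Rightarrow> 'a"
  assumes hopf: "hopf_algebra H" and \<rho>: "\<rho> \<in> lin V (tensor V H)"
    and a_in: "\<And>i j. i < n \<Longrightarrow> j < n \<Longrightarrow> a i j \<in> carrier H"
    and \<rho>_b: "\<And>i. i < n \<Longrightarrow> \<rho> (b i) = (\<Oplus>\<^bsub>tensor V H\<^esub>j\<in>{..<n}. tens V H (b j) (a j i))"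
begin

lemma uH: "unital_algebra H" using hopf by (simp add: hopf_algebra_def)

lemma vH: "vspace H" by (rule unital_algebraD(2)[OF uH])

lemma comult_lin: "comult H \<in> lin H (tensor H H)" and counit_lin: "counit H \<in> lin H base_algebra"
  using hopf_algebra.comult_hom[OF hopf] hopf_algebra.counit_hom[OF hopf] by (auto intro: algebra_homD(1))

sublocale TVH: tensor_pair V H by (intro tensor_pair.intro vV vH)
sublocale THH: tensor_pair H H by (intro tensor_pair.intro vH)
sublocale T1: tensor_pair "tensor V H" H by (intro tensor_pair.intro vH TVH.vspace_tensor)
sublocale T2: tensor_pair V "tensor H H" by (intro tensor_pair.intro vV THH.vspace_tensor)

lemma coassoc_left_lin:
  "(\<lambda>v. tensor_assoc V H H (tensor_map (tensor V H) H \<rho> id (\<rho> v))) \<in> lin V (tensor V (tensor H H))"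
  by (intro lin_comp[OF lin_comp[OF \<rho> tensor_map_facts(1)[OF vV vH TVH.vspace_tensor vH \<rho> lin_id]] tensor_assoc_facts(1)] vV vH)

lemma coassoc_right_lin:
  "(\<lambda>v. tensor_map V (tensor H H) id (comult H) (\<rho> v)) \<in> lin V (tensor V (tensor H H))"
  by (rule lin_comp[OF \<rho> tensor_map_facts(1)[OF vV vH vV THH.vspace_tensor lin_id comult_lin]])

lemma coassoc_left:
  assumes i: "i < n"
  shows "tensor_assoc V H H (tensor_map (tensor V H) H \<rho> id (\<rho> (b i))) =
    (\<Oplus>\<^bsub>tensor V (tensor H H)\<^esub>k\<in>{..<n}. tens V (tensor H H) (b k) (\<Oplus>\<^bsub>tensor H H\<^esub>j\<in>{..<n}. tens H H (a k j) (a j i)))"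
proof -
  note v2 = T2.vspace_tensor and as = tensor_assoc_facts[OF vV vH vH]
  have "tensor_map (tensor V H) H \<rho> id (\<rho> (b i)) =
      (\<Oplus>\<^bsub>tensor (tensor V H) H\<^esub>j\<in>{..<n}. tens (tensor V H) H (\<rho> (b j)) (id (a j i)))"
    unfolding \<rho>_b[OF i]
    by (rule tensor_map_facts(3)[OF vV vH TVH.vspace_tensor vH \<rho> lin_id]) (auto simp: b_in a_in i)
  then have "tensor_assoc V H H (tensor_map (tensor V H) H \<rho> id (\<rho> (b i))) =
      tensor_assoc V H H (\<Oplus>\<^bsub>tensor (tensor V H) H\<^esub>j\<in>{..<n}. tens (tensor V H) H (\<rho> (b j)) (a j i))" by simp
  also have "\<dots> = (\<Oplus>\<^bsub>tensor V (tensor H H)\<^esub>j\<in>{..<n}. tensor_assoc V H H (tens (tensor V H) H (\<rho> (b j)) (a j i)))"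
    by (rule lin_finsum[OF T1.vspace_tensor v2 as(1)]) (auto intro!: T1.tens_closed linD(1)[OF \<rho>] b_in a_in i)
  also have "\<dots> = (\<Oplus>\<^bsub>tensor V (tensor H H)\<^esub>j\<in>{..<n}. \<Oplus>\<^bsub>tensor V (tensor H H)\<^esub>k\<in>{..<n}. tens V (tensor H H) (b k) (tens H H (a k j) (a j i)))"
  proof (rule vfinsum_cong[OF v2])
    fix j assume "j \<in> {..<n}"
    then have j: "j < n" by simp
    have "tens (tensor V H) H (\<rho> (b j)) (a j i) =
      (\<Oplus>\<^bsub>tensor (tensor V H) H\<^esub>k\<in>{..<n}. tens (tensor V H) H (tens V H (b k) (a k j)) (a j i))"
      unfolding \<rho>_b[OF j]
      by (rule lin_finsum[OF TVH.vspace_tensor T1.vspace_tensor bilinD(7)[OF T1.tens_bilin a_in[OF j i]]])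
        (auto intro!: TVH.tens_closed b_in a_in j)
    then have "tensor_assoc V H H (tens (tensor V H) H (\<rho> (b j)) (a j i)) =
      tensor_assoc V H H (\<Oplus>\<^bsub>tensor (tensor V H) H\<^esub>k\<in>{..<n}. tens (tensor V H) H (tens V H (b k) (a k j)) (a j i))" by simp
    also have "\<dots> = (\<Oplus>\<^bsub>tensor V (tensor H H)\<^esub>k\<in>{..<n}. tensor_assoc V H H (tens (tensor V H) H (tens V H (b k) (a k j)) (a j i)))"
      by (rule lin_finsum[OF T1.vspace_tensor v2 as(1)])
        (auto intro!: T1.tens_closed TVH.tens_closed b_in a_in i j)
    also have "\<dots> = (\<Oplus>\<^bsub>tensor V (tensor H H)\<^esub>k\<in>{..<n}. tens V (tensor H H) (b k) (tens H H (a k j) (a j i)))"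
      by (rule vfinsum_cong[OF v2]) (auto simp: as(2) b_in a_in i j T2.tens_closed THH.tens_closed)
    finally show "tensor_assoc V H H (tens (tensor V H) H (\<rho> (b j)) (a j i)) =
      (\<Oplus>\<^bsub>tensor V (tensor H H)\<^esub>k\<in>{..<n}. tens V (tensor H H) (b k) (tens H H (a k j) (a j i)))" .
  qed (auto intro!: vfinsum_closed[OF v2] T2.tens_closed THH.tens_closed b_in a_in i)
  also have "\<dots> = (\<Oplus>\<^bsub>tensor V (tensor H H)\<^esub>k\<in>{..<n}. \<Oplus>\<^bsub>tensor V (tensor H H)\<^esub>j\<in>{..<n}. tens V (tensor H H) (b k) (tens H H (a k j) (a j i)))"
    by (rule vfinsum_swap[OF v2]) (auto intro!: T2.tens_closed THH.tens_closed b_in a_in i)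
  also have "\<dots> = (\<Oplus>\<^bsub>tensor V (tensor H H)\<^esub>k\<in>{..<n}. tens V (tensor H H) (b k) (\<Oplus>\<^bsub>tensor H H\<^esub>j\<in>{..<n}. tens H H (a k j) (a j i)))"
  proof (rule vfinsum_cong[OF v2])
    fix k assume k: "k \<in> {..<n}"
    then show "(\<Oplus>\<^bsub>tensor V (tensor H H)\<^esub>j\<in>{..<n}. tens V (tensor H H) (b k) (tens H H (a k j) (a j i))) =
      tens V (tensor H H) (b k) (\<Oplus>\<^bsub>tensor H H\<^esub>j\<in>{..<n}. tens H H (a k j) (a j i))"
      by (intro lin_finsum[OF THH.vspace_tensor v2 bilinD(6)[OF T2.tens_bilin b_in], symmetric])
        (auto intro!: THH.tens_closed a_in i)
  qed (auto intro!: vfinsum_closed[OF THH.vspace_tensor] T2.tens_closed THH.tens_closed b_in a_in i)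
  finally show ?thesis .
qed

lemma coassoc_right:
  assumes i: "i < n"
  shows "tensor_map V (tensor H H) id (comult H) (\<rho> (b i)) =
    (\<Oplus>\<^bsub>tensor V (tensor H H)\<^esub>k\<in>{..<n}. tens V (tensor H H) (b k) (comult H (a k i)))"
  unfolding \<rho>_b[OF i]
  using tensor_map_facts(3)[OF vV vH vV THH.vspace_tensor lin_id comult_lin, of "{..<n}" b "\<lambda>k. a k i"] b_in a_in i
  by simp

lemma counit_bilin: "bilin V H V (\<lambda>w h. counit H h \<odot>\<^bsub>V\<^esub> w)"
  by (rule bilinI)
    (use vspaceD(3-6)[OF vV] in \<open>simp_all add: linD[OF counit_lin] base_algebra_simps mult.commute flip: vspaceD(6)[OF vV]\<close>)

lemma counit_lin': "(\<lambda>v. tensor_lift V (\<lambda>w h. counit H h \<odot>\<^bsub>V\<^esub> w) (\<rho> v)) \<in> lin V V"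
  by (rule lin_comp[OF \<rho> TVH.tensor_lift_lin[OF vV counit_bilin]])

lemma counit_value:
  assumes i: "i < n"
  shows "tensor_lift V (\<lambda>w h. counit H h \<odot>\<^bsub>V\<^esub> w) (\<rho> (b i)) = (\<Oplus>\<^bsub>V\<^esub>j\<in>{..<n}. counit H (a j i) \<odot>\<^bsub>V\<^esub> b j)"
  unfolding \<rho>_b[OF i]
  by (rule TVH.tensor_lift_finsum[OF vV counit_bilin]) (auto simp: b_in a_in i)

text \<open>At \<open>b i\<close> and in the coefficient of \<open>b k\<close>, coassociativity
  compares the sum over j of \<open>a k j\<close> \<otimes> \<open>a j i\<close> with the
  comultiplication of \<open>a k i\<close>, and the counit axiom compares the counit of
  \<open>a k i\<close> with a Kronecker delta.\<close>

lemma comodule_iff: "comodule H V \<rho> \<longleftrightarrow> comatrix H {..<n} a"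
proof
  assume co: "comodule H V \<rho>"
  show "comatrix H {..<n} a"
    unfolding comatrix_def
  proof (intro conjI ballI)
    fix k i assume "k \<in> {..<n}" "i \<in> {..<n}"
    then have k: "k < n" and i: "i < n" by auto
    show "a k i \<in> carrier H" by (rule a_in) fact+
    have "(\<Oplus>\<^bsub>tensor V (tensor H H)\<^esub>k\<in>{..<n}. tens V (tensor H H) (b k) (\<Oplus>\<^bsub>tensor H H\<^esub>j\<in>{..<n}. tens H H (a k j) (a j i)))
      = (\<Oplus>\<^bsub>tensor V (tensor H H)\<^esub>k\<in>{..<n}. tens V (tensor H H) (b k) (comult H (a k i)))"
      using comodule.coact_coassoc[OF co b_in[OF i]] coassoc_left[OF i] coassoc_right[OF i] by simp
    then have "slice (tensor H H) (\<phi> k) (\<Oplus>\<^bsub>tensor V (tensor H H)\<^esub>k\<in>{..<n}. tens V (tensor H H) (b k) (comult H (a k i)))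
      = slice (tensor H H) (\<phi> k) (\<Oplus>\<^bsub>tensor V (tensor H H)\<^esub>k\<in>{..<n}. tens V (tensor H H) (b k) (\<Oplus>\<^bsub>tensor H H\<^esub>j\<in>{..<n}. tens H H (a k j) (a j i)))"
      by simp
    then show "comult H (a k i) = (\<Oplus>\<^bsub>tensor H H\<^esub>j\<in>{..<n}. tens H H (a k j) (a j i))"
      by (subst (asm) (1 2) slice_basis[OF THH.vspace_tensor k])
        (auto intro!: vfinsum_closed[OF THH.vspace_tensor] THH.tens_closed a_in i linD(1)[OF comult_lin])
    have "\<phi> k (b i) = \<phi> k (\<Oplus>\<^bsub>V\<^esub>j\<in>{..<n}. counit H (a j i) \<odot>\<^bsub>V\<^esub> b j)"
      using comodule.coact_counit[OF co b_in[OF i]] counit_value[OF i] by simp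
    also have "\<dots> = (\<Oplus>\<^bsub>base_algebra\<^esub>j\<in>{..<n}. \<phi> k (counit H (a j i) \<odot>\<^bsub>V\<^esub> b j))"
      by (rule lin_finsum[OF vV unital_algebraD(2)[OF unital_algebra_base] \<phi>_lin[OF k]]) (auto simp: vspaceD(3)[OF vV] b_in)
    also have "\<dots> = (\<Oplus>\<^bsub>base_algebra\<^esub>j\<in>{..<n}. if k = j then counit H (a j i) else \<zero>\<^bsub>base_algebra\<^esub>)"
      by (rule vfinsum_cong[OF unital_algebraD(2)[OF unital_algebra_base]])
        (auto simp: \<phi>_simps(2)[OF k] b_in \<phi>_b k base_algebra_simps)
    also have "\<dots> = counit H (a k i)"
      by (rule vfinsum_delta[OF unital_algebraD(2)[OF unital_algebra_base]]) (auto simp: k base_algebra_simps)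
    finally show "counit H (a k i) = (if k = i then 1 else 0)" by (simp add: \<phi>_b i k)
  qed simp
next
  assume "comatrix H {..<n} a"
  note c = comatrixD[OF this]
  show "comodule H V \<rho>"
  proof (intro comodule.intro comodule_axioms.intro vV \<rho>)
    fix v assume v: "v \<in> carrier V"
    show "tensor_assoc V H H (tensor_map (tensor V H) H \<rho> id (\<rho> v)) = tensor_map V (tensor H H) id (comult H) (\<rho> v)"
    proof (rule lin_basis_eqI[OF T2.vspace_tensor coassoc_left_lin coassoc_right_lin _ v])
      fix i assume i: "i < n"
      show "tensor_assoc V H H (tensor_map (tensor V H) H \<rho> id (\<rho> (b i))) = tensor_map V (tensor H H) id (comult H) (\<rho> (b i))"
        unfolding coassoc_left[OF i] coassoc_right[OF i]
        by (rule vfinsum_cong[OF T2.vspace_tensor])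
          (auto simp: c(3) i intro!: T2.tens_closed vfinsum_closed[OF THH.vspace_tensor] THH.tens_closed b_in a_in)
    qed
    have id: "(\<lambda>v. v) \<in> lin V V" by (rule linI) auto
    show "tensor_lift V (\<lambda>w h. counit H h \<odot>\<^bsub>V\<^esub> w) (\<rho> v) = v"
    proof (rule lin_basis_eqI[OF vV counit_lin' id _ v])
      fix i assume i: "i < n"
      have "(\<Oplus>\<^bsub>V\<^esub>j\<in>{..<n}. counit H (a j i) \<odot>\<^bsub>V\<^esub> b j) = (\<Oplus>\<^bsub>V\<^esub>j\<in>{..<n}. if j = i then b j else \<zero>\<^bsub>V\<^esub>)"
        by (rule vfinsum_cong[OF vV]) (auto simp: c(4) i b_in vspaceD[OF vV])
      also have "\<dots> = b i" by (rule vfinsum_delta[OF vV]) (auto simp: i b_in)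
      finally show "tensor_lift V (\<lambda>w h. counit H h \<odot>\<^bsub>V\<^esub> w) (\<rho> (b i)) = b i" unfolding counit_value[OF i] .
    qed
  qed
qed

lemma slice_\<rho>:
  assumes "\<chi> \<in> lin V base_algebra" "i < n"
  shows "slice H \<chi> (\<rho> (b i)) = (\<Oplus>\<^bsub>H\<^esub>j\<in>{..<n}. \<chi> (b j) \<odot>\<^bsub>H\<^esub> a j i)"
  unfolding \<rho>_b[OF assms(2)]
  by (rule slice_finsum[OF vV vH assms(1)]) (auto simp: b_in a_in assms)

lemma slice_\<phi>_\<rho>:
  assumes "j < n" "v \<in> carrier V"
  shows "slice H (\<phi> j) (\<rho> v) = (\<Oplus>\<^bsub>H\<^esub>i\<in>{..<n}. \<phi> i v \<odot>\<^bsub>H\<^esub> a j i)"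
proof -
  have "slice H (\<phi> j) (\<rho> v) = slice H (\<phi> j) (\<rho> (\<Oplus>\<^bsub>V\<^esub>i\<in>{..<n}. \<phi> i v \<odot>\<^bsub>V\<^esub> b i))"
    by (rule arg_cong[OF expand[OF assms(2)]])
  also have "\<dots> = (\<Oplus>\<^bsub>H\<^esub>i\<in>{..<n}. slice H (\<phi> j) (\<rho> (\<phi> i v \<odot>\<^bsub>V\<^esub> b i)))"
    by (rule lin_finsum[OF vV vH lin_comp[OF \<rho> slice_lin[OF vV vH \<phi>_lin[OF assms(1)]]]])
      (auto simp: b_in vspaceD(3)[OF vV])
  also have "\<dots> = (\<Oplus>\<^bsub>H\<^esub>i\<in>{..<n}. \<phi> i v \<odot>\<^bsub>H\<^esub> a j i)"
  proof (rule vfinsum_cong[OF vH])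
    fix i assume "i \<in> {..<n}"
    then have i: "i < n" by simp
    have "slice H (\<phi> j) (\<rho> (b i)) = a j i"
      unfolding \<rho>_b[OF i] by (rule slice_basis[OF vH assms(1)]) (simp add: a_in i)
    then show "slice H (\<phi> j) (\<rho> (\<phi> i v \<odot>\<^bsub>V\<^esub> b i)) = \<phi> i v \<odot>\<^bsub>H\<^esub> a j i"
      using linD(3)[OF lin_comp[OF \<rho> slice_lin[OF vV vH \<phi>_lin[OF assms(1)]]] b_in[OF i]] by simp
  qed (auto simp: a_in assms vspaceD(3)[OF vH])
  finally show ?thesis .
qed

text \<open>The two tensors are compared slice by slice along the coordinate functionals.\<close>

lemma coinvariant_iff:
  assumes v: "v \<in> carrier V"
  shows "\<rho> v = tens V H v \<one>\<^bsub>H\<^esub> \<longleftrightarrow> (\<forall>j<n. (\<Oplus>\<^bsub>H\<^esub>i\<in>{..<n}. \<phi> i v \<odot>\<^bsub>H\<^esub> a j i) = \<phi> j v \<odot>\<^bsub>H\<^esub> \<one>\<^bsub>H\<^esub>)"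
proof -
  note one = unital_algebraD(3)[OF uH]
  have sl: "slice H (\<phi> j) (tens V H v \<one>\<^bsub>H\<^esub>) = \<phi> j v \<odot>\<^bsub>H\<^esub> \<one>\<^bsub>H\<^esub>" if "j < n" for j
    by (rule slice_tens[OF vV vH \<phi>_lin[OF that] v one])
  show ?thesis
  proof
    assume eq: "\<rho> v = tens V H v \<one>\<^bsub>H\<^esub>"
    show "\<forall>j<n. (\<Oplus>\<^bsub>H\<^esub>i\<in>{..<n}. \<phi> i v \<odot>\<^bsub>H\<^esub> a j i) = \<phi> j v \<odot>\<^bsub>H\<^esub> \<one>\<^bsub>H\<^esub>"
    proof (intro allI impI)
      fix j assume j: "j < n"
      show "(\<Oplus>\<^bsub>H\<^esub>i\<in>{..<n}. \<phi> i v \<odot>\<^bsub>H\<^esub> a j i) = \<phi> j v \<odot>\<^bsub>H\<^esub> \<one>\<^bsub>H\<^esub>"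
        unfolding slice_\<phi>_\<rho>[OF j v, symmetric] eq by (rule sl[OF j])
    qed
  next
    assume eq: "\<forall>j<n. (\<Oplus>\<^bsub>H\<^esub>i\<in>{..<n}. \<phi> i v \<odot>\<^bsub>H\<^esub> a j i) = \<phi> j v \<odot>\<^bsub>H\<^esub> \<one>\<^bsub>H\<^esub>"
    show "\<rho> v = tens V H v \<one>\<^bsub>H\<^esub>"
    proof (rule tensor_eqI[OF vH linD(1)[OF \<rho> v] TVH.tens_closed[OF v one]])
      fix j assume j: "j < n"
      show "slice H (\<phi> j) (\<rho> v) = slice H (\<phi> j) (tens V H v \<one>\<^bsub>H\<^esub>)"
        unfolding slice_\<phi>_\<rho>[OF j v] sl[OF j] using eq j by blast
    qed
  qed
qed

end

section \<open>Linear maps with a prescribed matrix\<close>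

definition matrix_map where
  "matrix_map V H n b \<phi> a v = (\<Oplus>\<^bsub>tensor V H\<^esub>j\<in>{..<n}. tens V H (b j) (\<Oplus>\<^bsub>H\<^esub>i\<in>{..<n}. \<phi> i v \<odot>\<^bsub>H\<^esub> a j i))"

lemma (in fin_basis) matrix_coaction_map:
  fixes H :: "('k, 'a, 'm) hopf_scheme"
  assumes hopf: "hopf_algebra H" and a: "\<And>i j. i < n \<Longrightarrow> j < n \<Longrightarrow> a i j \<in> carrier H"
  shows "matrix_coaction V n b \<phi> H (matrix_map V H n b \<phi> a) a"
proof (intro matrix_coaction.intro matrix_coaction_axioms.intro fin_basis_axioms hopf a)
  have vH: "vspace H" using hopf unital_algebraD(2) by (auto simp: hopf_algebra_def)
  interpret T: tensor_pair V H by (intro tensor_pair.intro vV vH)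
  interpret HG: abelian_group H using vH vspaceD by blast
  interpret TG: abelian_group "tensor V H" using T.vspace_tensor vspaceD by blast
  note VH = vspaceD[OF vH] and bl = bilinD[OF T.tens_bilin]
  let ?g = "\<lambda>v j. \<Oplus>\<^bsub>H\<^esub>i\<in>{..<n}. \<phi> i v \<odot>\<^bsub>H\<^esub> a j i"
  have c: "?g v j \<in> carrier H" if "j < n" for v j
    by (rule vfinsum_closed[OF vH]) (use that a VH in auto)
  show "matrix_map V H n b \<phi> a \<in> lin V (tensor V H)"
  proof (rule linI)
    fix v assume v: "v \<in> carrier V"
    show "matrix_map V H n b \<phi> a v \<in> carrier (tensor V H)"
      unfolding matrix_map_def by (rule vfinsum_closed[OF T.vspace_tensor]) (auto intro!: T.tens_closed b_in c)
    {
      fix w assume w: "w \<in> carrier V"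
      have *: "?g (v \<oplus>\<^bsub>V\<^esub> w) j = ?g v j \<oplus>\<^bsub>H\<^esub> ?g w j" if j: "j < n" for j
      proof -
        have "?g (v \<oplus>\<^bsub>V\<^esub> w) j = (\<Oplus>\<^bsub>H\<^esub>i\<in>{..<n}. \<phi> i v \<odot>\<^bsub>H\<^esub> a j i \<oplus>\<^bsub>H\<^esub> \<phi> i w \<odot>\<^bsub>H\<^esub> a j i)"
          by (rule vfinsum_cong[OF vH]) (auto simp: \<phi>_simps v w VH a j)
        also have "\<dots> = ?g v j \<oplus>\<^bsub>H\<^esub> ?g w j" by (rule HG.finsum_addf) (auto simp: VH a j)
        finally show ?thesis .
      qed
      have "matrix_map V H n b \<phi> a (v \<oplus>\<^bsub>V\<^esub> w) = (\<Oplus>\<^bsub>tensor V H\<^esub>j\<in>{..<n}. tens V H (b j) (?g v j) \<oplus>\<^bsub>tensor V H\<^esub> tens V H (b j) (?g w j))"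
        unfolding matrix_map_def by (rule vfinsum_cong[OF T.vspace_tensor]) (auto simp: * bl(3) b_in c T.tens_closed)
      also have "\<dots> = matrix_map V H n b \<phi> a v \<oplus>\<^bsub>tensor V H\<^esub> matrix_map V H n b \<phi> a w"
        unfolding matrix_map_def by (rule TG.finsum_addf) (auto simp: b_in c T.tens_closed)
      finally show "matrix_map V H n b \<phi> a (v \<oplus>\<^bsub>V\<^esub> w) = matrix_map V H n b \<phi> a v \<oplus>\<^bsub>tensor V H\<^esub> matrix_map V H n b \<phi> a w" .
    }
    fix r
    have *: "?g (r \<odot>\<^bsub>V\<^esub> v) j = r \<odot>\<^bsub>H\<^esub> ?g v j" if j: "j < n" for j
    proof -
      have "?g (r \<odot>\<^bsub>V\<^esub> v) j = (\<Oplus>\<^bsub>H\<^esub>i\<in>{..<n}. r \<odot>\<^bsub>H\<^esub> (\<phi> i v \<odot>\<^bsub>H\<^esub> a j i))"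
        by (rule vfinsum_cong[OF vH]) (auto simp: \<phi>_simps v VH(3,6) a j)
      also have "\<dots> = r \<odot>\<^bsub>H\<^esub> ?g v j" by (rule finsum_smult_right[OF vH, symmetric]) (auto simp: VH a j)
      finally show ?thesis .
    qed
    have "matrix_map V H n b \<phi> a (r \<odot>\<^bsub>V\<^esub> v) = (\<Oplus>\<^bsub>tensor V H\<^esub>j\<in>{..<n}. r \<odot>\<^bsub>tensor V H\<^esub> tens V H (b j) (?g v j))"
      unfolding matrix_map_def
      by (rule vfinsum_cong[OF T.vspace_tensor]) (auto simp: * bl(5) b_in c T.tens_closed vspaceD(3)[OF T.vspace_tensor])
    also have "\<dots> = r \<odot>\<^bsub>tensor V H\<^esub> matrix_map V H n b \<phi> a v"
      unfolding matrix_map_def by (rule finsum_smult_right[OF T.vspace_tensor, symmetric]) (auto simp: b_in c T.tens_closed)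
    finally show "matrix_map V H n b \<phi> a (r \<odot>\<^bsub>V\<^esub> v) = r \<odot>\<^bsub>tensor V H\<^esub> matrix_map V H n b \<phi> a v" .
  qed
  fix i assume i: "i < n"
  have *: "?g (b i) j = a j i" if j: "j < n" for j
  proof -
    have "?g (b i) j = (\<Oplus>\<^bsub>H\<^esub>k\<in>{..<n}. if k = i then a j k else \<zero>\<^bsub>H\<^esub>)"
      by (rule vfinsum_cong[OF vH]) (auto simp: \<phi>_b i j VH a)
    also have "\<dots> = a j i" by (rule vfinsum_delta[OF vH]) (auto simp: i j a)
    finally show ?thesis .
  qed
  show "matrix_map V H n b \<phi> a (b i) = (\<Oplus>\<^bsub>tensor V H\<^esub>j\<in>{..<n}. tens V H (b j) (a j i))"
    unfolding matrix_map_def by (rule vfinsum_cong[OF T.vspace_tensor]) (auto simp: * b_in a i T.tens_closed)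
qed

subsection \<open>Invariant functionals on semisimple comodules\<close>

lemma finsum_base:
  fixes g :: "'i \<Rightarrow> 'k::field"
  shows "finite I \<Longrightarrow> finsum base_algebra g I = sum g I"
proof (induction I rule: finite_induct)
  case empty
  interpret abelian_group "base_algebra :: ('k, 'k) module"
    using unital_algebraD(2)[OF unital_algebra_base] vspaceD by blast
  show ?case by (simp add: base_algebra_simps)
next
  case (insert i I)
  interpret abelian_group "base_algebra :: ('k, 'k) module"
    using unital_algebraD(2)[OF unital_algebra_base] vspaceD by blast
  show ?case using insert by (subst finsum_insert) (auto simp: base_algebra_simps)
qed

section \<open>Components of a vector in a sum of subspaces\<close>

lemma span_Un_split:
  assumes vV: "vspace V" and W: "submodule class_ring W V" and S: "S \<subseteq> carrier V" and v: "v \<in> lspan V (W \<union> S)"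
  shows "\<exists>w\<in>W. \<exists>u\<in>lspan V S. v = w \<oplus>\<^bsub>V\<^esub> u"
proof -
  interpret G: abelian_group V using vV vspaceD by blast
  note w = submoduleD[OF W] and s = submoduleD[OF span_facts(1)[OF vV S]]
  let ?N = "{w \<oplus>\<^bsub>V\<^esub> u | w u. w \<in> W \<and> u \<in> lspan V S}"
  have "submodule class_ring ?N V"
  proof (rule submoduleI[OF vV])
    show "?N \<subseteq> carrier V" using w(1) s(1) by auto
    show "\<zero>\<^bsub>V\<^esub> \<in> ?N" using w(2) s(2) by force
    fix x assume "x \<in> ?N"
    then obtain p q where x: "x = p \<oplus>\<^bsub>V\<^esub> q" "p \<in> W" "q \<in> lspan V S" by blast
    have "c \<odot>\<^bsub>V\<^esub> x = c \<odot>\<^bsub>V\<^esub> p \<oplus>\<^bsub>V\<^esub> c \<odot>\<^bsub>V\<^esub> q" for c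
      unfolding x by (rule vspaceD(5)[OF vV]) (use x w(1) s(1) in auto)
    then show "c \<odot>\<^bsub>V\<^esub> x \<in> ?N" for c using w(4) s(4) x by blast
    fix y assume "y \<in> ?N"
    then obtain p' q' where y: "y = p' \<oplus>\<^bsub>V\<^esub> q'" "p' \<in> W" "q' \<in> lspan V S" by blast
    have "p \<in> carrier V" "q \<in> carrier V" "p' \<in> carrier V" "q' \<in> carrier V" using x y w(1) s(1) by auto
    then have "x \<oplus>\<^bsub>V\<^esub> y = (p \<oplus>\<^bsub>V\<^esub> p') \<oplus>\<^bsub>V\<^esub> (q \<oplus>\<^bsub>V\<^esub> q')" unfolding x y by (simp add: G.a_ac)
    then show "x \<oplus>\<^bsub>V\<^esub> y \<in> ?N" using w(3) s(3) x y by blast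
  qed
  moreover have "W \<union> S \<subseteq> ?N"
  proof
    fix x assume x: "x \<in> W \<union> S"
    then have "x \<in> carrier V" using w(1) S by auto
    then have "x = x \<oplus>\<^bsub>V\<^esub> \<zero>\<^bsub>V\<^esub>" "x = \<zero>\<^bsub>V\<^esub> \<oplus>\<^bsub>V\<^esub> x" by simp_all
    then show "x \<in> ?N" using x w(2) s(2) span_facts(2)[OF vV S] by blast
  qed
  ultimately have "lspan V (W \<union> S) \<subseteq> ?N" by (rule span_least)
  with v show ?thesis by blast
qed

text \<open>The trivial intersection makes the decomposition unique, so the component in
  \<open>W\<close> is a well-defined function; it is linear because sums and multiples of
  decompositions are again decompositions.\<close>

lemma complement_projection:
  assumes vV: "vspace V" and W: "submodule class_ring W V" and U: "submodule class_ring U V"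
    and int: "W \<inter> U = {\<zero>\<^bsub>V\<^esub>}" and sum: "\<And>v. v \<in> carrier V \<Longrightarrow> \<exists>w\<in>W. \<exists>u\<in>U. v = w \<oplus>\<^bsub>V\<^esub> u"
  shows "\<exists>\<pi>\<in>lin V V. (\<forall>w\<in>W. \<pi> w = w) \<and> (\<forall>u\<in>U. \<pi> u = \<zero>\<^bsub>V\<^esub>)"
proof -
  interpret G: abelian_group V using vV vspaceD by blast
  note w = submoduleD[OF W] and u = submoduleD[OF U]
  define P where "P v x \<longleftrightarrow> x \<in> W \<and> (\<exists>y\<in>U. v = x \<oplus>\<^bsub>V\<^esub> y)" for v x
  define \<pi> where "\<pi> v = (THE x. P v x)" for v
  have unique: "x = x'" if P1: "P v x" and P2: "P v x'" for v x x'
  proof -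
    obtain z where z: "z \<in> U" "x \<in> W" "v = x \<oplus>\<^bsub>V\<^esub> z" using P1 unfolding P_def by blast
    obtain y' where y': "y' \<in> U" "x' \<in> W" "v = x' \<oplus>\<^bsub>V\<^esub> y'" using P2 unfolding P_def by blast
    obtain y where y: "y \<in> U" "y' \<in> U" "x \<in> W" "x' \<in> W" "x \<oplus>\<^bsub>V\<^esub> y = x' \<oplus>\<^bsub>V\<^esub> y'"
      using z y' by metis
    have c: "x \<in> carrier V" "x' \<in> carrier V" "y \<in> carrier V" "y' \<in> carrier V" using y w(1) u(1) by auto
    have "x \<ominus>\<^bsub>V\<^esub> x' = (x \<oplus>\<^bsub>V\<^esub> y) \<oplus>\<^bsub>V\<^esub> \<ominus>\<^bsub>V\<^esub> y \<oplus>\<^bsub>V\<^esub> \<ominus>\<^bsub>V\<^esub> x'"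
      using c by (simp add: a_minus_def G.a_assoc G.r_neg)
    also have "\<dots> = (x' \<oplus>\<^bsub>V\<^esub> \<ominus>\<^bsub>V\<^esub> x') \<oplus>\<^bsub>V\<^esub> (y' \<oplus>\<^bsub>V\<^esub> \<ominus>\<^bsub>V\<^esub> y)" unfolding y(5)
      using c by (simp add: G.a_ac)
    also have "\<dots> = y' \<ominus>\<^bsub>V\<^esub> y" using c by (simp add: a_minus_def G.r_neg)
    finally have eq: "x \<ominus>\<^bsub>V\<^esub> x' = y' \<ominus>\<^bsub>V\<^esub> y" .
    have "x \<ominus>\<^bsub>V\<^esub> x' \<in> W" using w(3,4) y c vspaceD(13)[OF vV] by (metis a_minus_def)
    moreover have "y' \<ominus>\<^bsub>V\<^esub> y \<in> U" using u(3,4) y c vspaceD(13)[OF vV] by (metis a_minus_def)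
    ultimately have "x \<ominus>\<^bsub>V\<^esub> x' = \<zero>\<^bsub>V\<^esub>" using int eq by auto
    then show ?thesis using c by simp
  qed
  have \<pi>: "\<pi> v = x" if "P v x" for v x
    unfolding \<pi>_def using that unique by blast
  have ex: "P v (\<pi> v)" if "v \<in> carrier V" for v
  proof -
    have "\<exists>x. P v x" using sum[OF that] by (auto simp: P_def)
    then show ?thesis using \<pi> by metis
  qed
  have "\<pi> \<in> lin V V"
  proof (rule linI)
    fix v assume v: "v \<in> carrier V"
    obtain y where y: "\<pi> v \<in> W" "y \<in> U" "v = \<pi> v \<oplus>\<^bsub>V\<^esub> y" using ex[OF v] unfolding P_def by auto
    then show c: "\<pi> v \<in> carrier V" using w(1) by auto
    show "\<pi> (c \<odot>\<^bsub>V\<^esub> v) = c \<odot>\<^bsub>V\<^esub> \<pi> v" for c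
    proof (rule \<pi>)
      have "c \<odot>\<^bsub>V\<^esub> (\<pi> v \<oplus>\<^bsub>V\<^esub> y) = c \<odot>\<^bsub>V\<^esub> \<pi> v \<oplus>\<^bsub>V\<^esub> c \<odot>\<^bsub>V\<^esub> y"
        by (rule vspaceD(5)[OF vV]) (use y c u(1) in auto)
      then show "P (c \<odot>\<^bsub>V\<^esub> v) (c \<odot>\<^bsub>V\<^esub> \<pi> v)"
        unfolding P_def using w(4)[OF y(1)] u(4)[OF y(2)] y(3) by auto
    qed
    fix v' assume v': "v' \<in> carrier V"
    obtain y' where y': "\<pi> v' \<in> W" "y' \<in> U" "v' = \<pi> v' \<oplus>\<^bsub>V\<^esub> y'" using ex[OF v'] unfolding P_def by auto
    show "\<pi> (v \<oplus>\<^bsub>V\<^esub> v') = \<pi> v \<oplus>\<^bsub>V\<^esub> \<pi> v'"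
    proof (rule \<pi>)
      have cc: "\<pi> v \<in> carrier V" "y \<in> carrier V" "\<pi> v' \<in> carrier V" "y' \<in> carrier V" using y y' w(1) u(1) by auto
      have "(\<pi> v \<oplus>\<^bsub>V\<^esub> y) \<oplus>\<^bsub>V\<^esub> (\<pi> v' \<oplus>\<^bsub>V\<^esub> y') = (\<pi> v \<oplus>\<^bsub>V\<^esub> \<pi> v') \<oplus>\<^bsub>V\<^esub> (y \<oplus>\<^bsub>V\<^esub> y')"
        using cc by (simp add: G.a_ac)
      then have "v \<oplus>\<^bsub>V\<^esub> v' = (\<pi> v \<oplus>\<^bsub>V\<^esub> \<pi> v') \<oplus>\<^bsub>V\<^esub> (y \<oplus>\<^bsub>V\<^esub> y')" using y(3) y'(3) by argo
      then show "P (v \<oplus>\<^bsub>V\<^esub> v') (\<pi> v \<oplus>\<^bsub>V\<^esub> \<pi> v')"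
        unfolding P_def using w(3)[OF y(1) y'(1)] u(3)[OF y(2) y'(2)] by blast
    qed
  qed
  moreover have "\<pi> x = x" if "x \<in> W" for x
  proof (rule \<pi>)
    have "x = x \<oplus>\<^bsub>V\<^esub> \<zero>\<^bsub>V\<^esub>" using that w(1) by auto
    then show "P x x" unfolding P_def using that u(2) by blast
  qed
  moreover have "\<pi> y = \<zero>\<^bsub>V\<^esub>" if "y \<in> U" for y
  proof (rule \<pi>)
    have "y = \<zero>\<^bsub>V\<^esub> \<oplus>\<^bsub>V\<^esub> y" using that u(1) by auto
    then show "P y \<zero>\<^bsub>V\<^esub>" unfolding P_def using that w(2) by blast
  qed
  ultimately show ?thesis by blast
qed

text \<open>Finitely many members of the family already span a space containing \<open>c\<close>.
  They are split off one at a time: a vanishing component leaves \<open>c\<close> in the span of the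
  remaining ones, and this cannot go on down to the empty family because \<open>c\<close> is
  nonzero.\<close>

lemma nonzero_component:
  assumes vV: "vspace V" and sub: "\<And>W. W \<in> \<F> \<Longrightarrow> submodule class_ring W V"
    and c: "c \<in> lspan V (\<Union>\<F>)" "c \<noteq> \<zero>\<^bsub>V\<^esub>"
  shows "\<exists>W\<in>\<F>. \<exists>w\<in>W. \<exists>u\<in>lspan V (\<Union>(\<F> - {W})). c = w \<oplus>\<^bsub>V\<^esub> u \<and> w \<noteq> \<zero>\<^bsub>V\<^esub>"
proof -
  interpret G: abelian_group V using vV vspaceD by blast
  have car: "\<G> \<subseteq> \<F> \<Longrightarrow> \<Union>\<G> \<subseteq> carrier V" for \<G> using submoduleD(1)[OF sub] by blast
  have mono: "\<G> \<subseteq> \<G>' \<Longrightarrow> \<G>' \<subseteq> \<F> \<Longrightarrow> lspan V (\<Union>\<G>) \<subseteq> lspan V (\<Union>\<G>')" for \<G> \<G>'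
  proof -
    assume *: "\<G> \<subseteq> \<G>'" "\<G>' \<subseteq> \<F>"
    have "\<Union>\<G> \<subseteq> \<Union>\<G>'" using *(1) by (rule Union_mono)
    also have "\<dots> \<subseteq> lspan V (\<Union>\<G>')" by (rule span_facts(2)[OF vV car[OF *(2)]])
    finally show "lspan V (\<Union>\<G>) \<subseteq> lspan V (\<Union>\<G>')" by (rule span_least[OF span_facts(1)[OF vV car[OF *(2)]]])
  qed
  \<comment> \<open>The vectors that lie in the span of some finite subfamily form a subspace, since
    two subfamilies can be united, and it contains every member of the family.\<close>
  have "\<exists>\<G>. finite \<G> \<and> \<G> \<subseteq> \<F> \<and> c \<in> lspan V (\<Union>\<G>)"
  proof -
    let ?N = "{x. \<exists>\<G>. finite \<G> \<and> \<G> \<subseteq> \<F> \<and> x \<in> lspan V (\<Union>\<G>)}"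
    have "submodule class_ring ?N V"
    proof (rule submoduleI[OF vV])
      show "?N \<subseteq> carrier V" using span_facts(3)[OF vV car] by blast
      have "\<zero>\<^bsub>V\<^esub> \<in> lspan V (\<Union>{})" by (rule submoduleD(2)[OF span_facts(1)[OF vV]]) simp
      then show "\<zero>\<^bsub>V\<^esub> \<in> ?N" by blast
      fix x assume "x \<in> ?N"
      then obtain \<G> where G: "finite \<G>" "\<G> \<subseteq> \<F>" "x \<in> lspan V (\<Union>\<G>)" by blast
      show "r \<odot>\<^bsub>V\<^esub> x \<in> ?N" for r using G submoduleD(4)[OF span_facts(1)[OF vV car]] by blast
      fix y assume "y \<in> ?N"
      then obtain \<G>' where G': "finite \<G>'" "\<G>' \<subseteq> \<F>" "y \<in> lspan V (\<Union>\<G>')" by blast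
      have un: "\<G> \<union> \<G>' \<subseteq> \<F>" using G G' by blast
      have "x \<in> lspan V (\<Union>(\<G> \<union> \<G>'))" "y \<in> lspan V (\<Union>(\<G> \<union> \<G>'))"
        using mono[OF _ un, of \<G>] mono[OF _ un, of \<G>'] G G' by auto
      then have "x \<oplus>\<^bsub>V\<^esub> y \<in> lspan V (\<Union>(\<G> \<union> \<G>'))"
        by (rule submoduleD(3)[OF span_facts(1)[OF vV car[OF un]]])
      then show "x \<oplus>\<^bsub>V\<^esub> y \<in> ?N" using un G(1) G'(1) by blast
    qed
    moreover have "\<Union>\<F> \<subseteq> ?N"
    proof
      fix x assume "x \<in> \<Union>\<F>"
      then obtain W where W: "W \<in> \<F>" "x \<in> W" by blast
      have "x \<in> lspan V (\<Union>{W})" using span_facts(2)[OF vV, of "\<Union>{W}"] car[of "{W}"] W by auto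
      then show "x \<in> ?N" using W(1) by blast
    qed
    ultimately have "lspan V (\<Union>\<F>) \<subseteq> ?N" by (rule span_least)
    then show ?thesis using c(1) by blast
  qed
  then obtain \<G> where "finite \<G>" "\<G> \<subseteq> \<F>" "c \<in> lspan V (\<Union>\<G>)" by blast
  then show ?thesis
  proof (induction \<G> rule: finite_induct)
    case empty
    have "lspan V {} \<subseteq> {\<zero>\<^bsub>V\<^esub>}"
      by (rule span_least[OF submoduleI[OF vV]]) (auto simp: vspaceD[OF vV])
    then show ?case using empty c(2) by auto
  next
    case (insert W \<G>)
    have GF: "\<G> \<subseteq> \<F>" and W: "W \<in> \<F>" using insert by auto
    have "c \<in> lspan V (W \<union> \<Union>\<G>)" using insert by simp
    from span_Un_split[OF vV sub[OF W] car[OF GF] this]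
    obtain w u where wu: "w \<in> W" "u \<in> lspan V (\<Union>\<G>)" "c = w \<oplus>\<^bsub>V\<^esub> u" by blast
    show ?case
    proof (cases "w = \<zero>\<^bsub>V\<^esub>")
      case True
      then have "c = u" using wu span_facts(3)[OF vV car[OF GF]] by auto
      then show ?thesis using insert.IH[OF GF] wu by simp
    next
      case False
      have "\<G> \<subseteq> \<F> - {W}" using insert.hyps insert.prems by blast
      then have "u \<in> lspan V (\<Union>(\<F> - {W}))" using mono[of \<G> "\<F> - {W}"] wu(2) by blast
      with False wu W show ?thesis by blast
    qed
  qed
qed

text \<open>Additivity in the functional and not in the tensor; it is checked on pure
  tensors.\<close>

lemma slice_add:
  assumes vV: "vspace V" and vH: "vspace H" and p: "p \<in> lin V base_algebra" and q: "q \<in> lin V base_algebra"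
    and r: "r \<in> lin V base_algebra" and eq: "\<And>v. v \<in> carrier V \<Longrightarrow> r v = p v + q v" and t: "t \<in> carrier (tensor V H)"
  shows "slice H r t = slice H p t \<oplus>\<^bsub>H\<^esub> slice H q t"
proof -
  interpret T: tensor_pair V H by (intro tensor_pair.intro vV vH)
  interpret G: abelian_group H using vH vspaceD by blast
  note L = linD[OF slice_lin[OF vV vH p]] linD[OF slice_lin[OF vV vH q]] linD[OF slice_lin[OF vV vH r]]
  from t show ?thesis
  proof (induction rule: T.tensor_induct)
    case (tens v h)
    then show ?case by (simp add: slice_tens[OF vV vH] p q r eq vspaceD(4)[OF vH])
  next
    case (add s t)
    show ?case using add.hyps by (simp add: L add.IH G.a_ac)
  qed
qed

text \<open>Meant for a subcomodule \<open>W\<close> on which \<chi> vanishes: the coaction maps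
  \<open>W\<close> into a span of this form.\<close>

lemma slice_kill:
  assumes vV: "vspace V" and vH: "vspace H" and \<chi>: "\<chi> \<in> lin V base_algebra"
    and W: "W \<subseteq> carrier V" "\<And>w. w \<in> W \<Longrightarrow> \<chi> w = 0"
    and t: "t \<in> lspan (tensor V H) {tens V H w h | w h. w \<in> W \<and> h \<in> carrier H}"
  shows "slice H \<chi> t = \<zero>\<^bsub>H\<^esub>"
proof -
  interpret T: tensor_pair V H by (intro tensor_pair.intro vV vH)
  show ?thesis
  proof (rule span_kernel[OF T.vspace_tensor vH slice_lin[OF vV vH \<chi>] _ _ t])
    show "{tens V H w h | w h. w \<in> W \<and> h \<in> carrier H} \<subseteq> carrier (tensor V H)"
      using W(1) by (auto intro!: T.tens_closed)
    fix x assume "x \<in> {tens V H w h | w h. w \<in> W \<and> h \<in> carrier H}"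
    then obtain w h where x: "x = tens V H w h" "w \<in> W" "h \<in> carrier H" by blast
    then show "slice H \<chi> x = \<zero>\<^bsub>H\<^esub>"
      using W by (simp add: slice_tens[OF vV vH \<chi>] vspaceD(8)[OF vH] subsetD)
  qed
qed

context matrix_coaction
begin

text \<open>The functional is a coordinate of the projection onto a summand \<open>W\<close> in
  which \<open>c\<close> has a nonzero component \<open>w\<close>. It is invariant because
  \<open>W\<close> turns out to be the line through \<open>w\<close>, where the coaction is trivial,
  and because the complementary summands are subcomodules killed by the projection.\<close>

lemma semisimple_invariant_functional:
  assumes ss: "semisimple_comodule H V \<rho>" and c: "c \<in> carrier V" "\<rho> c = tens V H c \<one>\<^bsub>H\<^esub>" "c \<noteq> \<zero>\<^bsub>V\<^esub>"
  shows "\<exists>\<chi>\<in>lin V base_algebra. \<chi> c \<noteq> 0 \<and> (\<forall>i<n. (\<Oplus>\<^bsub>H\<^esub>j\<in>{..<n}. \<chi> (b j) \<odot>\<^bsub>H\<^esub> a j i) = \<chi> (b i) \<odot>\<^bsub>H\<^esub> \<one>\<^bsub>H\<^esub>)"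
proof -
  interpret G: abelian_group V using vV vspaceD by blast
  interpret GH: abelian_group H using vH vspaceD by blast
  note one = unital_algebraD(3)[OF uH]
  obtain \<F> where F0: "\<forall>W\<in>\<F>. simple_subcomodule H V \<rho> W" "lspan V (\<Union>\<F>) = carrier V"
    "\<forall>W\<in>\<F>. W \<inter> lspan V (\<Union>(\<F> - {W})) = {\<zero>\<^bsub>V\<^esub>}"
    using ss unfolding semisimple_comodule_def by (elim exE conjE)
  have F: "\<And>W. W \<in> \<F> \<Longrightarrow> simple_subcomodule H V \<rho> W" "lspan V (\<Union>\<F>) = carrier V"
    "\<And>W. W \<in> \<F> \<Longrightarrow> W \<inter> lspan V (\<Union>(\<F> - {W})) = {\<zero>\<^bsub>V\<^esub>}"
    using F0 by simp_all
  have sub: "submodule class_ring W V" and co: "\<And>w. w \<in> W \<Longrightarrow> \<rho> w \<in> lspan (tensor V H) {tens V H w' h | w' h. w' \<in> W \<and> h \<in> carrier H}"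
    if "W \<in> \<F>" for W
    using F(1)[OF that] by (auto simp: simple_subcomodule_def subcomodule_def VectorSpace.subspace_def)
  obtain W w u where W: "W \<in> \<F>" "w \<in> W" "u \<in> lspan V (\<Union>(\<F> - {W}))" "c = w \<oplus>\<^bsub>V\<^esub> u" "w \<noteq> \<zero>\<^bsub>V\<^esub>"
    using nonzero_component[OF vV sub, of \<F> c] c F(2) by blast
  define U where "U = lspan V (\<Union>(\<F> - {W}))"
  have Scar: "\<Union>(\<F> - {W}) \<subseteq> carrier V" using submoduleD(1)[OF sub] by blast
  note subU = span_facts(1)[OF vV Scar, folded U_def] and Wcar = submoduleD(1)[OF sub[OF W(1)]]
  note Ucar = submoduleD(1)[OF subU]
  have uU: "u \<in> U" using W(3) by (simp add: U_def)
  have wc: "w \<in> carrier V" and uc: "u \<in> carrier V" using W(2) uU Wcar Ucar by auto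
  have sum: "\<exists>w\<in>W. \<exists>u\<in>U. v = w \<oplus>\<^bsub>V\<^esub> u" if "v \<in> carrier V" for v
  proof -
    have "W \<union> \<Union>(\<F> - {W}) = \<Union>\<F>" using W(1) by blast
    then show ?thesis
      using span_Un_split[OF vV sub[OF W(1)] Scar, of v] that F(2) by (simp add: U_def)
  qed
  obtain \<pi> where \<pi>: "\<pi> \<in> lin V V" "\<And>w. w \<in> W \<Longrightarrow> \<pi> w = w" "\<And>u. u \<in> U \<Longrightarrow> \<pi> u = \<zero>\<^bsub>V\<^esub>"
    using complement_projection[OF vV sub[OF W(1)] subU F(3)[OF W(1), folded U_def] sum] by blast
  have \<phi>0: "\<phi> i \<zero>\<^bsub>V\<^esub> = 0" if "i < n" for i
    using lin_zero[OF vV unital_algebraD(2)[OF unital_algebra_base] \<phi>_lin[OF that]] by (simp add: base_algebra_simps)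
  have p: "(\<lambda>v. \<phi> i (\<pi> v)) \<in> lin V base_algebra" if "i < n" for i
    by (rule lin_comp[OF \<pi>(1) \<phi>_lin[OF that]])
  have q: "(\<lambda>v. \<phi> i v - \<phi> i (\<pi> v)) \<in> lin V base_algebra" if i: "i < n" for i
    by (rule linI) (simp_all add: base_algebra_simps \<phi>_simps[OF i] linD[OF \<pi>(1)] algebra_simps)
  \<comment> \<open>The complement \<open>U\<close> is spanned by subcomodules on which the
    projection vanishes, so the slice is zero on each of them and, by linearity, on
    \<open>U\<close>.\<close>
  have pU: "slice H (\<lambda>v. \<phi> i (\<pi> v)) (\<rho> x) = \<zero>\<^bsub>H\<^esub>" if i: "i < n" and x: "x \<in> U" for i x
  proof (rule span_kernel[OF vV vH lin_comp[OF \<rho> slice_lin[OF vV vH p[OF i]]] Scar _ x[unfolded U_def]])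
    fix s assume "s \<in> \<Union>(\<F> - {W})"
    then obtain W' where W': "W' \<in> \<F>" "W' \<noteq> W" "s \<in> W'" by blast
    have "W' \<subseteq> U" unfolding U_def using span_facts(2)[OF vV Scar] W' by blast
    then have z: "\<phi> i (\<pi> x) = 0" if "x \<in> W'" for x using \<pi>(3)[of x] \<phi>0[OF i] that by auto
    show "slice H (\<lambda>v. \<phi> i (\<pi> v)) (\<rho> s) = \<zero>\<^bsub>H\<^esub>"
      by (rule slice_kill[OF vV vH p[OF i] submoduleD(1)[OF sub[OF W'(1)]] z co[OF W'(1,3)]])
  qed
  \<comment> \<open>The coordinate \<phi> i is split into its composition with \<pi> and the
    remainder. The remainder vanishes on \<open>W\<close>, hence on the coaction of
    \<open>w\<close>; the composition cannot distinguish \<open>w\<close> from \<open>c\<close>,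
    whose coaction is known.\<close>
  have \<rho>w: "\<rho> w = tens V H w \<one>\<^bsub>H\<^esub>"
  proof (rule tensor_eqI[OF vH linD(1)[OF \<rho> wc] TVH.tens_closed[OF wc one]])
    fix i assume i: "i < n"
    note P = linD[OF lin_comp[OF \<rho> slice_lin[OF vV vH p[OF i]]]]
    have "slice H (\<lambda>v. \<phi> i (\<pi> v)) (\<rho> c) = slice H (\<lambda>v. \<phi> i (\<pi> v)) (\<rho> w) \<oplus>\<^bsub>H\<^esub> slice H (\<lambda>v. \<phi> i (\<pi> v)) (\<rho> u)"
      unfolding W(4) by (rule P(2)[OF wc uc])
    also have "\<dots> = slice H (\<lambda>v. \<phi> i (\<pi> v)) (\<rho> w)" using P(1)[OF wc] by (simp add: pU[OF i uU])
    finally have "slice H (\<lambda>v. \<phi> i (\<pi> v)) (\<rho> w) = slice H (\<lambda>v. \<phi> i (\<pi> v)) (\<rho> c)" ..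
    also have "\<dots> = \<phi> i (\<pi> c) \<odot>\<^bsub>H\<^esub> \<one>\<^bsub>H\<^esub>" unfolding c(2) by (rule slice_tens[OF vV vH p[OF i] c(1) one])
    also have "\<pi> c = w" unfolding W(4) using linD(2)[OF \<pi>(1) wc uc] \<pi>(2)[OF W(2)] \<pi>(3)[OF uU] wc by simp
    finally have pw: "slice H (\<lambda>v. \<phi> i (\<pi> v)) (\<rho> w) = \<phi> i w \<odot>\<^bsub>H\<^esub> \<one>\<^bsub>H\<^esub>" .
    have qw: "slice H (\<lambda>v. \<phi> i v - \<phi> i (\<pi> v)) (\<rho> w) = \<zero>\<^bsub>H\<^esub>"
      by (rule slice_kill[OF vV vH q[OF i] Wcar _ co[OF W(1,2)]]) (simp add: \<pi>(2))
    have "slice H (\<phi> i) (\<rho> w) = slice H (\<lambda>v. \<phi> i (\<pi> v)) (\<rho> w) \<oplus>\<^bsub>H\<^esub> slice H (\<lambda>v. \<phi> i v - \<phi> i (\<pi> v)) (\<rho> w)"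
      by (rule slice_add[OF vV vH p[OF i] q[OF i] \<phi>_lin[OF i] _ linD(1)[OF \<rho> wc]]) simp
    also have "\<dots> = \<phi> i w \<odot>\<^bsub>H\<^esub> \<one>\<^bsub>H\<^esub>" unfolding pw qw using vspaceD(3)[OF vH one] by simp
    also have "\<dots> = slice H (\<phi> i) (tens V H w \<one>\<^bsub>H\<^esub>)" by (rule slice_tens[OF vV vH \<phi>_lin[OF i] wc one, symmetric])
    finally show "slice H (\<phi> i) (\<rho> w) = slice H (\<phi> i) (tens V H w \<one>\<^bsub>H\<^esub>)" .
  qed
  \<comment> \<open>As \<open>w\<close> is coinvariant, its multiples form a nonzero subcomodule of
    the simple comodule \<open>W\<close>.\<close>
  have Weq: "W = {r \<odot>\<^bsub>V\<^esub> w | r. True}"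
  proof -
    let ?L = "{r \<odot>\<^bsub>V\<^esub> w | r. True}"
    note bl = bilinD[OF TVH.tens_bilin]
    have w1: "w \<in> ?L" using vspaceD(7)[OF vV wc] by (metis (mono_tags, lifting) mem_Collect_eq)
    have "submodule class_ring ?L V"
    proof (rule submoduleI[OF vV])
      show "?L \<subseteq> carrier V" using vspaceD(3)[OF vV wc] by auto
      show "\<zero>\<^bsub>V\<^esub> \<in> ?L" using vspaceD(8)[OF vV wc] by (metis (mono_tags, lifting) mem_Collect_eq)
      fix x assume "x \<in> ?L"
      then obtain r where x: "x = r \<odot>\<^bsub>V\<^esub> w" by blast
      have "s \<odot>\<^bsub>V\<^esub> x = (s * r) \<odot>\<^bsub>V\<^esub> w" for s unfolding x by (rule vspaceD(6)[OF vV wc, symmetric])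
      then show "s \<odot>\<^bsub>V\<^esub> x \<in> ?L" for s by blast
      fix y assume "y \<in> ?L"
      then obtain s where y: "y = s \<odot>\<^bsub>V\<^esub> w" by blast
      have "x \<oplus>\<^bsub>V\<^esub> y = (r + s) \<odot>\<^bsub>V\<^esub> w" unfolding x y by (rule vspaceD(4)[OF vV wc, symmetric])
      then show "x \<oplus>\<^bsub>V\<^esub> y \<in> ?L" by blast
    qed
    moreover have "\<rho> x \<in> lspan (tensor V H) {tens V H w' h | w' h. w' \<in> ?L \<and> h \<in> carrier H}" if x: "x \<in> ?L" for x
    proof -
      obtain r where r: "x = r \<odot>\<^bsub>V\<^esub> w" using x by blast
      have "\<rho> x = tens V H x \<one>\<^bsub>H\<^esub>" unfolding r using linD(3)[OF \<rho> wc] bl(4)[OF wc one] \<rho>w by simp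
      moreover have "{tens V H w' h | w' h. w' \<in> ?L \<and> h \<in> carrier H} \<subseteq> carrier (tensor V H)"
        using vspaceD(3)[OF vV wc] by (auto intro!: TVH.tens_closed)
      ultimately show ?thesis using span_facts(2)[OF TVH.vspace_tensor] x one by blast
    qed
    ultimately have "subcomodule H V \<rho> ?L" unfolding subcomodule_def VectorSpace.subspace_def using vV by blast
    moreover have "?L \<subseteq> W" using submoduleD(4)[OF sub[OF W(1)] W(2)] by blast
    moreover have "?L \<noteq> {\<zero>\<^bsub>V\<^esub>}" using w1 W(5) by blast
    ultimately show ?thesis using F(1)[OF W(1)] unfolding simple_subcomodule_def by blast
  qed
  have "\<exists>i<n. \<phi> i w \<noteq> 0"
  proof (rule ccontr)
    assume "\<not> (\<exists>i<n. \<phi> i w \<noteq> 0)"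
    then have z: "\<phi> i w = 0" if "i < n" for i using that by blast
    have "w = (\<Oplus>\<^bsub>V\<^esub>i\<in>{..<n}. \<phi> i w \<odot>\<^bsub>V\<^esub> b i)" by (rule expand[OF wc])
    also have "\<dots> = (\<Oplus>\<^bsub>V\<^esub>i\<in>{..<n}. \<zero>\<^bsub>V\<^esub>)" by (rule vfinsum_cong[OF vV]) (auto simp: z b_in vspaceD(8)[OF vV])
    also have "\<dots> = \<zero>\<^bsub>V\<^esub>" by (rule vfinsum_zero[OF vV])
    finally show False using W(5) by simp
  qed
  then obtain i where i: "i < n" "\<phi> i w \<noteq> 0" by blast
  \<comment> \<open>The image of \<pi> is the line through \<open>w\<close>, so a single coordinate
    that does not vanish at \<open>w\<close> carries all the information.\<close>
  define \<chi> where "\<chi> = (\<lambda>v. \<phi> i (\<pi> v))"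
  have \<chi>: "\<chi> \<in> lin V base_algebra" unfolding \<chi>_def by (rule p[OF i(1)])
  note L = linD[OF lin_comp[OF \<rho> slice_lin[OF vV vH \<chi>]]]
  have inv: "slice H \<chi> (\<rho> v) = \<chi> v \<odot>\<^bsub>H\<^esub> \<one>\<^bsub>H\<^esub>" if v: "v \<in> carrier V" for v
  proof -
    obtain x y where xy: "x \<in> W" "y \<in> U" "v = x \<oplus>\<^bsub>V\<^esub> y" using sum[OF v] by blast
    then obtain r where r: "x = r \<odot>\<^bsub>V\<^esub> w" using Weq by blast
    have xc: "x \<in> carrier V" and yc: "y \<in> carrier V" using xy Wcar Ucar by auto
    have "slice H \<chi> (\<rho> x) = r \<odot>\<^bsub>H\<^esub> (\<chi> w \<odot>\<^bsub>H\<^esub> \<one>\<^bsub>H\<^esub>)"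
      unfolding r L(3)[OF wc] \<rho>w slice_tens[OF vV vH \<chi> wc one] ..
    also have "\<dots> = \<chi> x \<odot>\<^bsub>H\<^esub> \<one>\<^bsub>H\<^esub>"
      unfolding r using linD(3)[OF \<chi> wc] vspaceD(6)[OF vH one] by (simp add: base_algebra_simps)
    finally have "slice H \<chi> (\<rho> v) = \<chi> x \<odot>\<^bsub>H\<^esub> \<one>\<^bsub>H\<^esub>"
      unfolding xy(3) L(2)[OF xc yc] using pU[OF i(1) xy(2), folded \<chi>_def] vspaceD(3)[OF vH one] by simp
    moreover have "\<chi> v = \<chi> x"
      unfolding xy(3) using linD(2)[OF \<chi> xc yc] \<pi>(3)[OF xy(2)] \<phi>0[OF i(1)] by (simp add: \<chi>_def base_algebra_simps)
    ultimately show ?thesis by simp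
  qed
  have "\<pi> c = w" unfolding W(4) using linD(2)[OF \<pi>(1) wc uc] \<pi>(2)[OF W(2)] \<pi>(3)[OF uU] wc by simp
  then have "\<chi> c \<noteq> 0" using i(2) by (simp add: \<chi>_def)
  moreover have "(\<Oplus>\<^bsub>H\<^esub>j\<in>{..<n}. \<chi> (b j) \<odot>\<^bsub>H\<^esub> a j i) = \<chi> (b i) \<odot>\<^bsub>H\<^esub> \<one>\<^bsub>H\<^esub>" if "i < n" for i
    using inv[OF b_in[OF that]] slice_\<rho>[OF \<chi> that] by simp
  ultimately show ?thesis using \<chi> by blast
qed

end

text \<open>A copy of \<open>\<K>\<^sup>n\<close> inside \<open>nat \<Rightarrow> 'a\<close>, the type over which \<open>cosemisimple\<close> quantifies.\<close>

definition fun_space :: "('k::field, 'a, 'm) hopf_scheme \<Rightarrow> nat \<Rightarrow> ('k, nat \<Rightarrow> 'a) module"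
  where "fun_space H n =
    \<lparr>carrier = {f. \<forall>i. f i = (if i < n then counit H (f i) \<odot>\<^bsub>H\<^esub> \<one>\<^bsub>H\<^esub> else \<zero>\<^bsub>H\<^esub>)},
     mult = (\<lambda>f g. f), one = (\<lambda>_. \<zero>\<^bsub>H\<^esub>), zero = (\<lambda>_. \<zero>\<^bsub>H\<^esub>),
     add = (\<lambda>f g i. f i \<oplus>\<^bsub>H\<^esub> g i), smult = (\<lambda>c f i. c \<odot>\<^bsub>H\<^esub> f i)\<rparr>"

lemma fun_space_basis:
  fixes H :: "('k::field, 'a, 'm) hopf_scheme"
  assumes hopf: "hopf_algebra H"
  shows "fin_basis (fun_space H n) n (\<lambda>i j. if j = i then \<one>\<^bsub>H\<^esub> else \<zero>\<^bsub>H\<^esub>) (\<lambda>i f. counit H (f i))"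
proof -
  have uH: "unital_algebra H" using hopf by (simp add: hopf_algebra_def)
  note vH = unital_algebraD(2)[OF uH] and one = unital_algebraD(3)[OF uH]
  note VH = vspaceD[OF vH]
  interpret G: abelian_group H by (rule VH)
  note eps = algebra_homD[OF hopf_algebra.counit_hom[OF hopf]]
  let ?V = "fun_space H n"
  let ?C = "carrier ?V"
  have fs: "\<zero>\<^bsub>?V\<^esub> = (\<lambda>_. \<zero>\<^bsub>H\<^esub>)" "f \<oplus>\<^bsub>?V\<^esub> g = (\<lambda>i. f i \<oplus>\<^bsub>H\<^esub> g i)" "c \<odot>\<^bsub>?V\<^esub> f = (\<lambda>i. c \<odot>\<^bsub>H\<^esub> f i)" for f g c
    by (simp_all add: fun_space_def)
  have memD: "i < n \<Longrightarrow> f i = counit H (f i) \<odot>\<^bsub>H\<^esub> \<one>\<^bsub>H\<^esub>" "\<not> i < n \<Longrightarrow> f i = \<zero>\<^bsub>H\<^esub>" if "f \<in> ?C" for f i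
    using that by (simp_all add: fun_space_def split: if_splits) metis+
  \<comment> \<open>The counit recovers a scalar from the corresponding multiple of the unit. It
    thus serves as coordinate on functions whose values are multiples of the unit.\<close>
  have eps1: "counit H (c \<odot>\<^bsub>H\<^esub> \<one>\<^bsub>H\<^esub>) = c" for c
    using eps(6)[OF one] eps(2) by (simp add: base_algebra_simps)
  have memI: "f \<in> ?C" if "\<And>i. i < n \<Longrightarrow> f i = r i \<odot>\<^bsub>H\<^esub> \<one>\<^bsub>H\<^esub>" "\<And>i. \<not> i < n \<Longrightarrow> f i = \<zero>\<^bsub>H\<^esub>" for f r
    using that by (simp add: fun_space_def eps1)
  have val: "f i \<in> carrier H" if "f \<in> ?C" for f i
    using memD[OF that, of i] VH(3)[OF one] VH(12) by (cases "i < n") metis+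
  have add_in: "f \<oplus>\<^bsub>?V\<^esub> g \<in> ?C" if f: "f \<in> ?C" and g: "g \<in> ?C" for f g
  proof (rule memI)
    fix i
    show "(f \<oplus>\<^bsub>?V\<^esub> g) i = (counit H (f i) + counit H (g i)) \<odot>\<^bsub>H\<^esub> \<one>\<^bsub>H\<^esub>" if i: "i < n"
      unfolding fs using memD(1)[OF f i] memD(1)[OF g i] VH(4)[OF one] by metis
    show "(f \<oplus>\<^bsub>?V\<^esub> g) i = \<zero>\<^bsub>H\<^esub>" if i: "\<not> i < n"
      unfolding fs memD(2)[OF f i] memD(2)[OF g i] by simp
  qed
  have smult_in: "c \<odot>\<^bsub>?V\<^esub> f \<in> ?C" if f: "f \<in> ?C" for f c
  proof (rule memI)
    fix i
    show "(c \<odot>\<^bsub>?V\<^esub> f) i = (c * counit H (f i)) \<odot>\<^bsub>H\<^esub> \<one>\<^bsub>H\<^esub>" if i: "i < n"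
      unfolding fs using memD(1)[OF f i] VH(6)[OF one] by metis
    show "(c \<odot>\<^bsub>?V\<^esub> f) i = \<zero>\<^bsub>H\<^esub>" if i: "\<not> i < n"
      unfolding fs memD(2)[OF f i] by (rule VH(9))
  qed
  have zero_in: "\<zero>\<^bsub>?V\<^esub> \<in> ?C" by (rule memI[of _ "\<lambda>_. 0"]) (simp_all add: fs VH(8) one)
  have ab: "abelian_group ?V"
  proof (rule abelian_groupI)
    fix f assume f: "f \<in> ?C"
    show "\<exists>g\<in>?C. g \<oplus>\<^bsub>?V\<^esub> f = \<zero>\<^bsub>?V\<^esub>"
    proof (intro bexI[OF _ smult_in[OF f, of "- 1"]] ext)
      fix i
      have "(- 1) \<odot>\<^bsub>H\<^esub> f i = \<ominus>\<^bsub>H\<^esub> f i" by (rule VH(13)[OF val[OF f]])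
      then show "((- 1) \<odot>\<^bsub>?V\<^esub> f \<oplus>\<^bsub>?V\<^esub> f) i = \<zero>\<^bsub>?V\<^esub> i" using val[OF f] by (simp add: fs G.l_neg)
    qed
    show "\<zero>\<^bsub>?V\<^esub> \<oplus>\<^bsub>?V\<^esub> f = f" using val[OF f] by (simp add: fs)
    fix g assume g: "g \<in> ?C"
    show "f \<oplus>\<^bsub>?V\<^esub> g \<in> ?C" by (rule add_in[OF f g])
    show "f \<oplus>\<^bsub>?V\<^esub> g = g \<oplus>\<^bsub>?V\<^esub> f" using val[OF f] val[OF g] by (simp add: fs G.a_comm)
    fix h assume h: "h \<in> ?C"
    show "f \<oplus>\<^bsub>?V\<^esub> g \<oplus>\<^bsub>?V\<^esub> h = f \<oplus>\<^bsub>?V\<^esub> (g \<oplus>\<^bsub>?V\<^esub> h)"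
      using val[OF f] val[OF g] val[OF h] by (simp add: fs G.a_assoc)
  qed (rule zero_in)
  have vV: "vspace ?V"
    by (rule vspaceI[OF ab smult_in]) (simp_all add: fs VH(4-7) val)
  have ev: "(\<lambda>f. f i) \<in> lin ?V H" for i
    by (rule linI) (simp_all add: fs val)
  show ?thesis
  proof (rule fin_basis.intro)
    show "vspace ?V" by (rule vV)
    show b_in: "(\<lambda>j. if j = i then \<one>\<^bsub>H\<^esub> else \<zero>\<^bsub>H\<^esub>) \<in> ?C" if "i < n" for i
      by (rule memI[of _ "\<lambda>j. if j = i then 1 else 0"]) (use that in \<open>auto simp: VH(7,8) one\<close>)
    show "(\<lambda>f. counit H (f i)) \<in> lin ?V base_algebra" if "i < n" for i
      by (rule lin_comp[OF ev eps(1)])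
    have "counit H \<zero>\<^bsub>H\<^esub> = 0"
      using lin_zero[OF vH unital_algebraD(2)[OF unital_algebra_base] eps(1)] by (simp add: base_algebra_simps)
    then show "counit H (if i = j then \<one>\<^bsub>H\<^esub> else \<zero>\<^bsub>H\<^esub>) = (if i = j then 1 else 0)" for i j :: nat
      using eps(2) by (simp add: base_algebra_simps)
    fix f assume f: "f \<in> ?C"
    show "f = (\<Oplus>\<^bsub>?V\<^esub>i\<in>{..<n}. counit H (f i) \<odot>\<^bsub>?V\<^esub> (\<lambda>j. if j = i then \<one>\<^bsub>H\<^esub> else \<zero>\<^bsub>H\<^esub>))" (is "_ = ?s")
    proof
      fix j
      have "?s j = (\<Oplus>\<^bsub>H\<^esub>i\<in>{..<n}. (counit H (f i) \<odot>\<^bsub>?V\<^esub> (\<lambda>j. if j = i then \<one>\<^bsub>H\<^esub> else \<zero>\<^bsub>H\<^esub>)) j)"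
        by (rule lin_finsum[OF vV vH ev]) (auto intro!: smult_in b_in)
      also have "\<dots> = (\<Oplus>\<^bsub>H\<^esub>i\<in>{..<n}. if j = i then counit H (f i) \<odot>\<^bsub>H\<^esub> \<one>\<^bsub>H\<^esub> else \<zero>\<^bsub>H\<^esub>)"
        by (rule vfinsum_cong[OF vH]) (auto simp: fs VH(3,9,12) one)
      also have "\<dots> = f j"
      proof (cases "j < n")
        case True
        then have "(\<Oplus>\<^bsub>H\<^esub>i\<in>{..<n}. if j = i then counit H (f i) \<odot>\<^bsub>H\<^esub> \<one>\<^bsub>H\<^esub> else \<zero>\<^bsub>H\<^esub>) = counit H (f j) \<odot>\<^bsub>H\<^esub> \<one>\<^bsub>H\<^esub>"
          by (intro vfinsum_delta[OF vH]) (auto intro!: VH(3) one)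
        then show ?thesis using memD(1)[OF f True] by simp
      next
        case False
        have "(\<Oplus>\<^bsub>H\<^esub>i\<in>{..<n}. if j = i then counit H (f i) \<odot>\<^bsub>H\<^esub> \<one>\<^bsub>H\<^esub> else \<zero>\<^bsub>H\<^esub>) = (\<Oplus>\<^bsub>H\<^esub>i\<in>{..<n}. \<zero>\<^bsub>H\<^esub>)"
          by (rule vfinsum_cong[OF vH]) (use False VH(12) in auto)
        then show ?thesis using memD(2)[OF f False] vfinsum_zero[OF vH] by simp
      qed
      finally show "f j = ?s j" ..
    qed
  qed
qed

text \<open>\<open>inv\<close> expresses that the sum of the basis vectors with index in
  \<open>J\<close> is coinvariant for the comodule with matrix \<open>a\<close>, and the sum of
  \<kappa> over \<open>J\<close> is the value of the functional at this vector. The comodule is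
  realised on \<open>fun_space\<close> to fit the type in the definition of
  \<open>cosemisimple\<close>.\<close>

lemma cosemisimple_functional:
  fixes H :: "('k::field, 'a, 'm) hopf_scheme" and n :: nat
  assumes hopf: "hopf_algebra H" and cs: "cosemisimple H" and com: "comatrix H {..<n} a"
    and J: "J \<subseteq> {..<n}" "J \<noteq> {}" and inv: "\<And>j. j < n \<Longrightarrow> (\<Oplus>\<^bsub>H\<^esub>i\<in>J. a j i) = (if j \<in> J then \<one>\<^bsub>H\<^esub> else \<zero>\<^bsub>H\<^esub>)"
  shows "\<exists>\<kappa>. (\<forall>i<n. (\<Oplus>\<^bsub>H\<^esub>j\<in>{..<n}. \<kappa> j \<odot>\<^bsub>H\<^esub> a j i) = \<kappa> i \<odot>\<^bsub>H\<^esub> \<one>\<^bsub>H\<^esub>) \<and> (\<Sum>i\<in>J. \<kappa> i) \<noteq> 0"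
proof -
  let ?V = "fun_space H n"
  define b :: "nat \<Rightarrow> nat \<Rightarrow> 'a" where "b = (\<lambda>i j. if j = i then \<one>\<^bsub>H\<^esub> else \<zero>\<^bsub>H\<^esub>)"
  define \<phi> where "\<phi> = (\<lambda>i (f :: nat \<Rightarrow> 'a). counit H (f i))"
  interpret B: fin_basis ?V n b \<phi>
    unfolding b_def \<phi>_def by (rule fun_space_basis[OF hopf])
  note a = comatrixD[OF com]
  have uH: "unital_algebra H" using hopf by (simp add: hopf_algebra_def)
  note vH = unital_algebraD(2)[OF uH] and one = unital_algebraD(3)[OF uH]
  note VH = vspaceD[OF vH]
  interpret M: matrix_coaction ?V n b \<phi> H "matrix_map ?V H n b \<phi> a" a
    by (rule B.matrix_coaction_map[OF hopf]) (use a(2) in auto)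
  let ?\<rho> = "matrix_map ?V H n b \<phi> a"
  have "comodule H ?V ?\<rho>" using M.comodule_iff com by blast
  then have ss: "semisimple_comodule H ?V ?\<rho>" using cs unfolding cosemisimple_def by blast
  have fJ: "finite J" using J(1) finite_subset by blast
  let ?c = "\<Oplus>\<^bsub>?V\<^esub>i\<in>J. b i"
  have cV: "?c \<in> carrier ?V" by (rule vfinsum_closed[OF B.vV]) (use B.b_in J in auto)
  have vb: "vspace (base_algebra :: ('k, 'k) module)" by (rule unital_algebraD(2)[OF unital_algebra_base])
  have \<chi>c: "\<chi> ?c = (\<Sum>i\<in>J. \<chi> (b i))" if "\<chi> \<in> lin ?V base_algebra" for \<chi>
    using lin_finsum[OF B.vV vb that fJ, of b] B.b_in J by (auto simp: finsum_base[OF fJ])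
  have \<phi>c: "\<phi> j ?c = (if j \<in> J then 1 else 0)" if "j < n" for j
  proof -
    have "\<phi> j ?c = (\<Sum>i\<in>J. if j = i then 1 else 0)"
      unfolding \<chi>c[OF B.\<phi>_lin[OF that]] by (rule sum.cong) (use B.\<phi>_b that J in auto)
    also have "\<dots> = (if j \<in> J then 1 else 0)" using fJ by simp
    finally show ?thesis .
  qed
  have "?\<rho> ?c = tens ?V H ?c \<one>\<^bsub>H\<^esub>"
    unfolding M.coinvariant_iff[OF cV]
  proof (intro allI impI)
    interpret G: abelian_group H by (rule VH)
    fix j assume j: "j < n"
    have "(\<Oplus>\<^bsub>H\<^esub>i\<in>{..<n}. \<phi> i ?c \<odot>\<^bsub>H\<^esub> a j i) = (\<Oplus>\<^bsub>H\<^esub>i\<in>{..<n}. if i \<in> J then a j i else \<zero>\<^bsub>H\<^esub>)"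
      by (rule vfinsum_cong[OF vH]) (use \<phi>c a(2) j VH in auto)
    also have "\<dots> = (\<Oplus>\<^bsub>H\<^esub>i\<in>J. a j i)"
      by (rule G.add.finprod_mono_neutral_cong_right) (use J a(2) j in auto)
    also have "\<dots> = \<phi> j ?c \<odot>\<^bsub>H\<^esub> \<one>\<^bsub>H\<^esub>" using inv[OF j] \<phi>c[OF j] VH(7,8)[OF one] by simp
    finally show "(\<Oplus>\<^bsub>H\<^esub>i\<in>{..<n}. \<phi> i ?c \<odot>\<^bsub>H\<^esub> a j i) = \<phi> j ?c \<odot>\<^bsub>H\<^esub> \<one>\<^bsub>H\<^esub>" .
  qed
  moreover have "?c \<noteq> \<zero>\<^bsub>?V\<^esub>"
  proof
    assume "?c = \<zero>\<^bsub>?V\<^esub>"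
    moreover obtain j where j: "j \<in> J" "j < n" using J by blast
    moreover have "\<phi> j \<zero>\<^bsub>?V\<^esub> = 0" using lin_zero[OF B.vV vb B.\<phi>_lin[OF j(2)]] by (simp add: base_algebra_simps)
    ultimately show False using \<phi>c[OF j(2)] by simp
  qed
  ultimately obtain \<chi> where \<chi>: "\<chi> \<in> lin ?V base_algebra" "\<chi> ?c \<noteq> 0"
    "\<forall>i<n. (\<Oplus>\<^bsub>H\<^esub>j\<in>{..<n}. \<chi> (b j) \<odot>\<^bsub>H\<^esub> a j i) = \<chi> (b i) \<odot>\<^bsub>H\<^esub> \<one>\<^bsub>H\<^esub>"
    using M.semisimple_invariant_functional[OF ss cV] by blast
  show ?thesis by (rule exI[of _ "\<lambda>i. \<chi> (b i)"]) (use \<chi> \<chi>c[OF \<chi>(1)] in auto)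
qed

subsection \<open>The antipode on coefficient matrices\<close>

lemma vfinsum_reindex:
  assumes "vspace V" "inj_on g K" "\<And>k. k \<in> K \<Longrightarrow> f (g k) \<in> carrier V"
  shows "finsum V f (g ` K) = (\<Oplus>\<^bsub>V\<^esub>k\<in>K. f (g k))"
proof -
  interpret V: abelian_group V using assms vspaceD by blast
  show ?thesis by (rule V.finsum_reindex) (use assms in auto)
qed

lemma vfinsum_product:
  assumes vV: "vspace V" and fin: "finite I" "finite J"
    and g: "\<And>i j. i \<in> I \<Longrightarrow> j \<in> J \<Longrightarrow> g i j \<in> carrier V"
  shows "(\<Oplus>\<^bsub>V\<^esub>p\<in>I \<times> J. g (fst p) (snd p)) = (\<Oplus>\<^bsub>V\<^esub>i\<in>I. \<Oplus>\<^bsub>V\<^esub>j\<in>J. g i j)"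
  using fin(1) g
proof (induction I rule: finite_induct)
  case empty
  interpret V: abelian_group V using vV vspaceD by blast
  show ?case by simp
next
  case (insert i I)
  interpret V: abelian_group V using vV vspaceD by blast
  have eq: "insert i I \<times> J = Pair i ` J \<union> I \<times> J" by auto
  have "(\<Oplus>\<^bsub>V\<^esub>p\<in>insert i I \<times> J. g (fst p) (snd p)) =
      (\<Oplus>\<^bsub>V\<^esub>p\<in>Pair i ` J. g (fst p) (snd p)) \<oplus>\<^bsub>V\<^esub> (\<Oplus>\<^bsub>V\<^esub>p\<in>I \<times> J. g (fst p) (snd p))"
    unfolding eq by (rule V.finsum_Un_disjoint) (use insert fin(2) in auto)
  also have "(\<Oplus>\<^bsub>V\<^esub>p\<in>Pair i ` J. g (fst p) (snd p)) = (\<Oplus>\<^bsub>V\<^esub>j\<in>J. g i j)"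
    using vfinsum_reindex[OF vV, of "Pair i" J "\<lambda>p. g (fst p) (snd p)"] insert.prems by (simp add: inj_on_def)
  also have "(\<Oplus>\<^bsub>V\<^esub>p\<in>I \<times> J. g (fst p) (snd p)) = (\<Oplus>\<^bsub>V\<^esub>i\<in>I. \<Oplus>\<^bsub>V\<^esub>j\<in>J. g i j)"
    using insert by simp
  also have "(\<Oplus>\<^bsub>V\<^esub>j\<in>J. g i j) \<oplus>\<^bsub>V\<^esub> (\<Oplus>\<^bsub>V\<^esub>i\<in>I. \<Oplus>\<^bsub>V\<^esub>j\<in>J. g i j) = (\<Oplus>\<^bsub>V\<^esub>i\<in>insert i I. \<Oplus>\<^bsub>V\<^esub>j\<in>J. g i j)"
    using insert by (intro V.finsum_insert[symmetric]) (auto intro!: V.finsum_closed)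
  finally show ?case .
qed

text \<open>The usual computation L = L (X Y) = (L X) Y = Y, with entries in a ring that may be
  noncommutative.\<close>

lemma matrix_inverse_unique:
  assumes A: "unital_algebra A" and fin: "finite I"
    and L: "\<And>i j. i \<in> I \<Longrightarrow> j \<in> I \<Longrightarrow> L i j \<in> carrier A" and X: "\<And>i j. i \<in> I \<Longrightarrow> j \<in> I \<Longrightarrow> X i j \<in> carrier A"
    and Y: "\<And>i j. i \<in> I \<Longrightarrow> j \<in> I \<Longrightarrow> Y i j \<in> carrier A"
    and LX: "\<And>i j. i \<in> I \<Longrightarrow> j \<in> I \<Longrightarrow> (\<Oplus>\<^bsub>A\<^esub>k\<in>I. L i k \<otimes>\<^bsub>A\<^esub> X k j) = (if i = j then \<one>\<^bsub>A\<^esub> else \<zero>\<^bsub>A\<^esub>)"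
    and XY: "\<And>i j. i \<in> I \<Longrightarrow> j \<in> I \<Longrightarrow> (\<Oplus>\<^bsub>A\<^esub>k\<in>I. X i k \<otimes>\<^bsub>A\<^esub> Y k j) = (if i = j then \<one>\<^bsub>A\<^esub> else \<zero>\<^bsub>A\<^esub>)"
    and i: "i \<in> I" and j: "j \<in> I"
  shows "L i j = Y i j"
proof -
  note D = unital_algebraD[OF A] and vA = unital_algebraD(2)[OF A]
  note V = vspaceD[OF vA]
  have "L i j = (\<Oplus>\<^bsub>A\<^esub>k\<in>I. if k = j then L i k else \<zero>\<^bsub>A\<^esub>)"
    by (rule vfinsum_delta(1)[OF vA fin j, symmetric]) (rule L[OF i j])
  also have "\<dots> = (\<Oplus>\<^bsub>A\<^esub>k\<in>I. L i k \<otimes>\<^bsub>A\<^esub> (\<Oplus>\<^bsub>A\<^esub>l\<in>I. X k l \<otimes>\<^bsub>A\<^esub> Y l j))"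
    by (rule vfinsum_cong[OF vA]) (auto simp: XY i j L D V(12) intro!: D(4) vfinsum_closed[OF vA] X Y)
  also have "\<dots> = (\<Oplus>\<^bsub>A\<^esub>k\<in>I. \<Oplus>\<^bsub>A\<^esub>l\<in>I. L i k \<otimes>\<^bsub>A\<^esub> X k l \<otimes>\<^bsub>A\<^esub> Y l j)"
  proof (rule vfinsum_cong[OF vA])
    fix k assume k: "k \<in> I"
    have "L i k \<otimes>\<^bsub>A\<^esub> (\<Oplus>\<^bsub>A\<^esub>l\<in>I. X k l \<otimes>\<^bsub>A\<^esub> Y l j) = (\<Oplus>\<^bsub>A\<^esub>l\<in>I. L i k \<otimes>\<^bsub>A\<^esub> (X k l \<otimes>\<^bsub>A\<^esub> Y l j))"
      by (rule afinsum_mult(2)[OF A fin]) (auto intro!: D(4) X Y L i j k)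
    also have "\<dots> = (\<Oplus>\<^bsub>A\<^esub>l\<in>I. L i k \<otimes>\<^bsub>A\<^esub> X k l \<otimes>\<^bsub>A\<^esub> Y l j)"
      by (rule vfinsum_cong[OF vA]) (auto simp: D(4,5) X Y L i j k)
    finally show "L i k \<otimes>\<^bsub>A\<^esub> (\<Oplus>\<^bsub>A\<^esub>l\<in>I. X k l \<otimes>\<^bsub>A\<^esub> Y l j) = (\<Oplus>\<^bsub>A\<^esub>l\<in>I. L i k \<otimes>\<^bsub>A\<^esub> X k l \<otimes>\<^bsub>A\<^esub> Y l j)" .
  qed (auto intro!: vfinsum_closed[OF vA] D(4) X Y L i j)
  also have "\<dots> = (\<Oplus>\<^bsub>A\<^esub>l\<in>I. \<Oplus>\<^bsub>A\<^esub>k\<in>I. L i k \<otimes>\<^bsub>A\<^esub> X k l \<otimes>\<^bsub>A\<^esub> Y l j)"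
    by (rule vfinsum_swap[OF vA fin fin]) (auto intro!: D(4) X Y L i j)
  also have "\<dots> = (\<Oplus>\<^bsub>A\<^esub>l\<in>I. if l = i then Y l j else \<zero>\<^bsub>A\<^esub>)"
  proof (rule vfinsum_cong[OF vA])
    fix l assume l: "l \<in> I"
    have "(\<Oplus>\<^bsub>A\<^esub>k\<in>I. L i k \<otimes>\<^bsub>A\<^esub> X k l \<otimes>\<^bsub>A\<^esub> Y l j) = (\<Oplus>\<^bsub>A\<^esub>k\<in>I. L i k \<otimes>\<^bsub>A\<^esub> X k l) \<otimes>\<^bsub>A\<^esub> Y l j"
      by (rule afinsum_mult(1)[OF A fin, symmetric]) (auto intro!: D(4) X Y L i j l)
    then show "(\<Oplus>\<^bsub>A\<^esub>k\<in>I. L i k \<otimes>\<^bsub>A\<^esub> X k l \<otimes>\<^bsub>A\<^esub> Y l j) = (if l = i then Y l j else \<zero>\<^bsub>A\<^esub>)"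
      by (auto simp: LX i l D Y j)
  qed (auto simp: Y j V)
  also have "\<dots> = Y i j" by (rule vfinsum_delta(1)[OF vA fin i]) (rule Y[OF i j])
  finally show ?thesis .
qed

section \<open>Anti-multiplicativity of the antipode\<close>

locale hopf_context =
  fixes H :: "('k::field, 'a, 'm) hopf_scheme"
  assumes hopf: "hopf_algebra H"
begin

lemma uH: "unital_algebra H" using hopf by (simp add: hopf_algebra_def)

lemmas D = unital_algebraD[OF uH]
lemmas vH = D(2)
lemmas VH = vspaceD[OF vH]

sublocale HG: abelian_group H by (rule VH(1))
sublocale T: tensor_algebras H H by (intro tensor_algebras.intro uH)

lemmas comult_hom = algebra_homD[OF hopf_algebra.comult_hom[OF hopf]]
lemmas counit_hom = algebra_homD[OF hopf_algebra.counit_hom[OF hopf]]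
lemmas antipode_lin = hopf_algebra.antipode_linear[OF hopf]
lemmas S = linD[OF antipode_lin]

lemma antipode_bilin:
  "bilin H H H (\<lambda>x y. antipode H x \<otimes>\<^bsub>H\<^esub> y)" "bilin H H H (\<lambda>x y. x \<otimes>\<^bsub>H\<^esub> antipode H y)"
  by (rule bilinI; simp add: S D(4,8-11))+

text \<open>The antipode axioms, evaluated on a comultiplicative matrix: applying the antipode
  entrywise yields a two-sided inverse.\<close>

lemma antipode_comatrix:
  assumes X: "comatrix H I X" and ij: "i \<in> I" "j \<in> I"
  shows "(\<Oplus>\<^bsub>H\<^esub>k\<in>I. antipode H (X i k) \<otimes>\<^bsub>H\<^esub> X k j) = (if i = j then \<one>\<^bsub>H\<^esub> else \<zero>\<^bsub>H\<^esub>)"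
    "(\<Oplus>\<^bsub>H\<^esub>k\<in>I. X i k \<otimes>\<^bsub>H\<^esub> antipode H (X k j)) = (if i = j then \<one>\<^bsub>H\<^esub> else \<zero>\<^bsub>H\<^esub>)"
proof -
  note x = comatrixD[OF X]
  have eps: "counit H (X i j) \<odot>\<^bsub>H\<^esub> \<one>\<^bsub>H\<^esub> = (if i = j then \<one>\<^bsub>H\<^esub> else \<zero>\<^bsub>H\<^esub>)"
    by (simp add: x(4) ij VH(7,8) D(3))
  have "(\<Oplus>\<^bsub>H\<^esub>k\<in>I. antipode H (X i k) \<otimes>\<^bsub>H\<^esub> X k j) = tensor_lift H (\<lambda>x y. antipode H x \<otimes>\<^bsub>H\<^esub> y) (comult H (X i j))"
    unfolding x(3)[OF ij] by (rule T.tensor_lift_finsum[OF vH antipode_bilin(1) x(1), symmetric]) (auto simp: x(2) ij)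
  then show "(\<Oplus>\<^bsub>H\<^esub>k\<in>I. antipode H (X i k) \<otimes>\<^bsub>H\<^esub> X k j) = (if i = j then \<one>\<^bsub>H\<^esub> else \<zero>\<^bsub>H\<^esub>)"
    using hopf_algebra.antipode_left[OF hopf x(2)[OF ij]] eps by simp
  have "(\<Oplus>\<^bsub>H\<^esub>k\<in>I. X i k \<otimes>\<^bsub>H\<^esub> antipode H (X k j)) = tensor_lift H (\<lambda>x y. x \<otimes>\<^bsub>H\<^esub> antipode H y) (comult H (X i j))"
    unfolding x(3)[OF ij] by (rule T.tensor_lift_finsum[OF vH antipode_bilin(2) x(1), symmetric]) (auto simp: x(2) ij)
  then show "(\<Oplus>\<^bsub>H\<^esub>k\<in>I. X i k \<otimes>\<^bsub>H\<^esub> antipode H (X k j)) = (if i = j then \<one>\<^bsub>H\<^esub> else \<zero>\<^bsub>H\<^esub>)"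
    using hopf_algebra.antipode_right[OF hopf x(2)[OF ij]] eps by simp
qed

text \<open>The unit is group-like; as a matrix of size one it gives the value of the antipode at
  the unit.\<close>

lemma comatrix_one: "comatrix H {i} (\<lambda>_ _. \<one>\<^bsub>H\<^esub>)"
  unfolding comatrix_def
  using comult_hom(2) counit_hom(2) T.tens_closed[OF D(3,3)]
    vspaceD(1)[OF T.vspace_tensor, THEN abelian_group.axioms(1)]
  by (auto simp: D(3) base_algebra_simps T.tens_one abelian_monoid.finsum_insert abelian_monoid.finsum_empty
      abelian_monoid.r_zero)

lemma antipode_one: "antipode H \<one>\<^bsub>H\<^esub> = \<one>\<^bsub>H\<^esub>"
  using antipode_comatrix(1)[OF comatrix_one, of 0 0 0] S(1)[OF D(3)] D(3) by (simp add: D(7))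

lemma comatrix_reindex:
  assumes X: "comatrix H (g ` K) X" and K: "finite K" "inj_on g K"
  shows "comatrix H K (\<lambda>u v. X (g u) (g v))"
proof -
  note x = comatrixD[OF X]
  show ?thesis
    unfolding comatrix_def
  proof (intro conjI ballI K(1))
    fix u v assume uv: "u \<in> K" "v \<in> K"
    then show "X (g u) (g v) \<in> carrier H" by (simp add: x(2))
    show "counit H (X (g u) (g v)) = (if u = v then 1 else 0)" using uv K(2) by (auto simp: x(4) inj_on_def)
    show "comult H (X (g u) (g v)) = (\<Oplus>\<^bsub>tensor H H\<^esub>k\<in>K. tens H H (X (g u) (g k)) (X (g k) (g v)))"
      using x(3)[of "g u" "g v"] uv
        vfinsum_reindex[OF T.vspace_tensor K(2), of "\<lambda>k. tens H H (X (g u) k) (X k (g v))"]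
      by (simp add: x(2) T.tens_closed)
  qed
qed

text \<open>The matrix of a tensor product of comodules. Comultiplication and counit are
  multiplicative, so the two sums over inner indices merge into one sum over pairs.\<close>

lemma comatrix_kronecker:
  assumes X: "comatrix H I X" and Y: "comatrix H J Y"
  shows "comatrix H (I \<times> J) (\<lambda>p q. X (fst p) (fst q) \<otimes>\<^bsub>H\<^esub> Y (snd p) (snd q))"
proof -
  note x = comatrixD[OF X] and y = comatrixD[OF Y]
  note uT = T.unital_algebra_tensor and vT = T.vspace_tensor
  show ?thesis
    unfolding comatrix_def
  proof (intro conjI ballI finite_cartesian_product x(1) y(1))
    fix p q assume "p \<in> I \<times> J" "q \<in> I \<times> J"
    then have p: "fst p \<in> I" "snd p \<in> J" and q: "fst q \<in> I" "snd q \<in> J" by auto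
    let ?x = "X (fst p) (fst q)" and ?y = "Y (snd p) (snd q)"
    let ?s = "\<lambda>k. tens H H (X (fst p) k) (X k (fst q))" and ?t = "\<lambda>r. tens H H (Y (snd p) r) (Y r (snd q))"
    have st: "?s k \<in> carrier (tensor H H)" "?t r \<in> carrier (tensor H H)" if "k \<in> I" "r \<in> J" for k r
      using that p q by (auto simp: x(2) y(2) T.tens_closed)
    have sc: "?s k \<in> carrier (tensor H H)" if "k \<in> I" for k using that p q by (simp add: x(2) T.tens_closed)
    have tc: "?t r \<in> carrier (tensor H H)" if "r \<in> J" for r using that p q by (simp add: y(2) T.tens_closed)
    show "?x \<otimes>\<^bsub>H\<^esub> ?y \<in> carrier H" by (intro D(4) x(2) y(2) p q)
    show "counit H (?x \<otimes>\<^bsub>H\<^esub> ?y) = (if p = q then 1 else 0)"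
      using counit_hom(3)[OF x(2)[OF p(1) q(1)] y(2)[OF p(2) q(2)]] p q
      by (auto simp: x(4) y(4) base_algebra_simps prod_eq_iff)
    have "comult H (?x \<otimes>\<^bsub>H\<^esub> ?y) = (\<Oplus>\<^bsub>tensor H H\<^esub>k\<in>I. ?s k) \<otimes>\<^bsub>tensor H H\<^esub> (\<Oplus>\<^bsub>tensor H H\<^esub>r\<in>J. ?t r)"
      using comult_hom(3)[OF x(2)[OF p(1) q(1)] y(2)[OF p(2) q(2)]] x(3)[OF p(1) q(1)] y(3)[OF p(2) q(2)] by simp
    also have "\<dots> = (\<Oplus>\<^bsub>tensor H H\<^esub>k\<in>I. ?s k \<otimes>\<^bsub>tensor H H\<^esub> (\<Oplus>\<^bsub>tensor H H\<^esub>r\<in>J. ?t r))"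
      by (rule afinsum_mult(1)[OF uT x(1) sc]) (auto intro!: vfinsum_closed[OF vT] tc)
    also have "\<dots> = (\<Oplus>\<^bsub>tensor H H\<^esub>k\<in>I. \<Oplus>\<^bsub>tensor H H\<^esub>r\<in>J. tens H H (X (fst p) k \<otimes>\<^bsub>H\<^esub> Y (snd p) r) (X k (fst q) \<otimes>\<^bsub>H\<^esub> Y r (snd q)))"
    proof (rule vfinsum_cong[OF vT])
      fix k assume k: "k \<in> I"
      have "?s k \<otimes>\<^bsub>tensor H H\<^esub> (\<Oplus>\<^bsub>tensor H H\<^esub>r\<in>J. ?t r) = (\<Oplus>\<^bsub>tensor H H\<^esub>r\<in>J. ?s k \<otimes>\<^bsub>tensor H H\<^esub> ?t r)"
        by (rule afinsum_mult(2)[OF uT y(1) tc sc[OF k]])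
      also have "\<dots> = (\<Oplus>\<^bsub>tensor H H\<^esub>r\<in>J. tens H H (X (fst p) k \<otimes>\<^bsub>H\<^esub> Y (snd p) r) (X k (fst q) \<otimes>\<^bsub>H\<^esub> Y r (snd q)))"
        by (rule vfinsum_cong[OF vT]) (simp_all add: T.tens_mult T.tens_closed D(4) x(2) y(2) p q k)
      finally show "?s k \<otimes>\<^bsub>tensor H H\<^esub> (\<Oplus>\<^bsub>tensor H H\<^esub>r\<in>J. ?t r) =
        (\<Oplus>\<^bsub>tensor H H\<^esub>r\<in>J. tens H H (X (fst p) k \<otimes>\<^bsub>H\<^esub> Y (snd p) r) (X k (fst q) \<otimes>\<^bsub>H\<^esub> Y r (snd q)))" .
    qed (auto intro!: vfinsum_closed[OF vT] T.tens_closed D(4) x(2) y(2) p q)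
    also have "\<dots> = (\<Oplus>\<^bsub>tensor H H\<^esub>k\<in>I \<times> J. tens H H (X (fst p) (fst k) \<otimes>\<^bsub>H\<^esub> Y (snd p) (snd k)) (X (fst k) (fst q) \<otimes>\<^bsub>H\<^esub> Y (snd k) (snd q)))"
      by (rule vfinsum_product[OF vT x(1) y(1), symmetric]) (auto intro!: T.tens_closed D(4) x(2) y(2) p q)
    finally show "comult H (?x \<otimes>\<^bsub>H\<^esub> ?y) =
      (\<Oplus>\<^bsub>tensor H H\<^esub>k\<in>I \<times> J. tens H H (X (fst p) (fst k) \<otimes>\<^bsub>H\<^esub> Y (snd p) (snd k)) (X (fst k) (fst q) \<otimes>\<^bsub>H\<^esub> Y (snd k) (snd q)))" .
  qed
qed

text \<open>Both sides are the inverse of the Kronecker product of the two matrices.\<close>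

lemma antipode_mult_comatrix:
  assumes X: "comatrix H I X" and Y: "comatrix H J Y" and ij: "i \<in> I" "j \<in> I" "p \<in> J" "q \<in> J"
  shows "antipode H (X i j \<otimes>\<^bsub>H\<^esub> Y p q) = antipode H (Y p q) \<otimes>\<^bsub>H\<^esub> antipode H (X i j)"
proof -
  note x = comatrixD[OF X] and y = comatrixD[OF Y]
  let ?Z = "\<lambda>p q. X (fst p) (fst q) \<otimes>\<^bsub>H\<^esub> Y (snd p) (snd q)"
  let ?R = "\<lambda>p q. antipode H (Y (snd p) (snd q)) \<otimes>\<^bsub>H\<^esub> antipode H (X (fst p) (fst q))"
  note Z = comatrix_kronecker[OF X Y]
  have "antipode H (?Z (i, p) (j, q)) = ?R (i, p) (j, q)"
  proof (rule matrix_inverse_unique[OF uH, where I = "I \<times> J" and L = "\<lambda>u v. antipode H (?Z u v)" and X = ?Z])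
    fix u v assume "u \<in> I \<times> J" "v \<in> I \<times> J"
    then have u: "fst u \<in> I" "snd u \<in> J" and v: "fst v \<in> I" "snd v \<in> J" by auto
    show "(\<Oplus>\<^bsub>H\<^esub>k\<in>I \<times> J. antipode H (?Z u k) \<otimes>\<^bsub>H\<^esub> ?Z k v) = (if u = v then \<one>\<^bsub>H\<^esub> else \<zero>\<^bsub>H\<^esub>)"
      by (rule antipode_comatrix(1)[OF Z]) fact+
    have "(\<Oplus>\<^bsub>H\<^esub>k\<in>I \<times> J. ?Z u k \<otimes>\<^bsub>H\<^esub> ?R k v) = (\<Oplus>\<^bsub>H\<^esub>k\<in>I. \<Oplus>\<^bsub>H\<^esub>r\<in>J.
        (X (fst u) k \<otimes>\<^bsub>H\<^esub> Y (snd u) r) \<otimes>\<^bsub>H\<^esub> (antipode H (Y r (snd v)) \<otimes>\<^bsub>H\<^esub> antipode H (X k (fst v))))"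
      by (rule vfinsum_product[OF vH x(1) y(1)]) (auto intro!: D(4) S(1) x(2) y(2) u v)
    also have "\<dots> = (\<Oplus>\<^bsub>H\<^esub>k\<in>I. if snd u = snd v then X (fst u) k \<otimes>\<^bsub>H\<^esub> antipode H (X k (fst v)) else \<zero>\<^bsub>H\<^esub>)"
    proof (rule vfinsum_cong[OF vH])
      fix k assume k: "k \<in> I"
      let ?x = "X (fst u) k" and ?x' = "antipode H (X k (fst v))"
      have xx: "?x \<in> carrier H" "?x' \<in> carrier H" by (auto intro!: S(1) x(2) u v k)
      have yc: "Y (snd u) r \<in> carrier H" "antipode H (Y r (snd v)) \<in> carrier H" if "r \<in> J" for r
        using that by (auto intro!: S(1) y(2) u v)
      \<comment> \<open>The inner sum contracts first: between \<open>?x\<close> and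
        \<open>?x'\<close> stands a row of \<open>Y\<close> times a column of its inverse.\<close>
      have "(\<Oplus>\<^bsub>H\<^esub>r\<in>J. (?x \<otimes>\<^bsub>H\<^esub> Y (snd u) r) \<otimes>\<^bsub>H\<^esub> (antipode H (Y r (snd v)) \<otimes>\<^bsub>H\<^esub> ?x')) =
        (\<Oplus>\<^bsub>H\<^esub>r\<in>J. ?x \<otimes>\<^bsub>H\<^esub> ((Y (snd u) r \<otimes>\<^bsub>H\<^esub> antipode H (Y r (snd v))) \<otimes>\<^bsub>H\<^esub> ?x'))"
        by (rule vfinsum_cong[OF vH]) (simp_all add: D(4,5) xx yc)
      also have "\<dots> = ?x \<otimes>\<^bsub>H\<^esub> (\<Oplus>\<^bsub>H\<^esub>r\<in>J. (Y (snd u) r \<otimes>\<^bsub>H\<^esub> antipode H (Y r (snd v))) \<otimes>\<^bsub>H\<^esub> ?x')"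
        by (rule afinsum_mult(2)[OF uH y(1), symmetric]) (simp_all add: D(4) xx yc)
      also have "(\<Oplus>\<^bsub>H\<^esub>r\<in>J. (Y (snd u) r \<otimes>\<^bsub>H\<^esub> antipode H (Y r (snd v))) \<otimes>\<^bsub>H\<^esub> ?x') =
        (\<Oplus>\<^bsub>H\<^esub>r\<in>J. Y (snd u) r \<otimes>\<^bsub>H\<^esub> antipode H (Y r (snd v))) \<otimes>\<^bsub>H\<^esub> ?x'"
        by (rule afinsum_mult(1)[OF uH y(1), symmetric]) (simp_all add: D(4) xx yc)
      also have "(\<Oplus>\<^bsub>H\<^esub>r\<in>J. Y (snd u) r \<otimes>\<^bsub>H\<^esub> antipode H (Y r (snd v))) = (if snd u = snd v then \<one>\<^bsub>H\<^esub> else \<zero>\<^bsub>H\<^esub>)"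
        by (rule antipode_comatrix(2)[OF Y u(2) v(2)])
      finally show "(\<Oplus>\<^bsub>H\<^esub>r\<in>J. (?x \<otimes>\<^bsub>H\<^esub> Y (snd u) r) \<otimes>\<^bsub>H\<^esub> (antipode H (Y r (snd v)) \<otimes>\<^bsub>H\<^esub> ?x')) =
        (if snd u = snd v then ?x \<otimes>\<^bsub>H\<^esub> ?x' else \<zero>\<^bsub>H\<^esub>)" using xx by (simp add: D split: if_splits)
    qed (auto simp: VH intro!: D(4) S(1) x(2) y(2) u v)
    also have "\<dots> = (if u = v then \<one>\<^bsub>H\<^esub> else \<zero>\<^bsub>H\<^esub>)"
      using antipode_comatrix(2)[OF X u(1) v(1)]
      by (cases "snd u = snd v") (simp_all add: prod_eq_iff vfinsum_zero[OF vH])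
    finally show "(\<Oplus>\<^bsub>H\<^esub>k\<in>I \<times> J. ?Z u k \<otimes>\<^bsub>H\<^esub> ?R k v) = (if u = v then \<one>\<^bsub>H\<^esub> else \<zero>\<^bsub>H\<^esub>)" .
  qed (use x(1) y(1) ij in \<open>auto intro!: D(4) S(1) x(2) y(2)\<close>)
  then show ?thesis by simp
qed

text \<open>The index sets are subsets of \<open>nat\<close> in order to have them all in one type.\<close>

definition entries :: "'a set" where
  "entries = {X i j | X (I :: nat set) i j. comatrix H I X \<and> i \<in> I \<and> j \<in> I}"

lemma entries_carrier: "entries \<subseteq> carrier H" by (auto simp: entries_def comatrixD)

lemma entriesI: "comatrix H (I :: nat set) X \<Longrightarrow> i \<in> I \<Longrightarrow> j \<in> I \<Longrightarrow> X i j \<in> entries"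
  by (auto simp: entries_def)

lemma entries_one: "\<one>\<^bsub>H\<^esub> \<in> entries" using entriesI[OF comatrix_one, of 0 0 0] by simp

lemma entries_mult:
  assumes "x \<in> entries" "y \<in> entries"
  shows "x \<otimes>\<^bsub>H\<^esub> y \<in> entries"
proof -
  obtain X I i j where X: "comatrix H (I :: nat set) X" "i \<in> I" "j \<in> I" "x = X i j" using assms(1) by (auto simp: entries_def)
  obtain Y J p q where Y: "comatrix H (J :: nat set) Y" "p \<in> J" "q \<in> J" "y = Y p q" using assms(2) by (auto simp: entries_def)
  let ?Z = "\<lambda>p q. X (fst p) (fst q) \<otimes>\<^bsub>H\<^esub> Y (snd p) (snd q)"
  \<comment> \<open>Pairs are coded as numbers because \<open>entries\<close> admits only index sets
    inside \<open>nat\<close>.\<close>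
  let ?K = "prod_encode ` (I \<times> J)"
  have "prod_decode ` ?K = I \<times> J" by (simp add: image_image)
  then have "comatrix H ?K (\<lambda>u v. ?Z (prod_decode u) (prod_decode v))"
    using comatrix_reindex[of prod_decode ?K ?Z] comatrix_kronecker[OF X(1) Y(1)] comatrixD(1)[OF X(1)] comatrixD(1)[OF Y(1)]
    by (simp add: inj_on_def)
  from entriesI[OF this, of "prod_encode (i, p)" "prod_encode (j, q)"] X Y show ?thesis by simp
qed

lemma span_entries_mult:
  assumes x: "x \<in> lspan H entries" and y: "y \<in> lspan H entries"
  shows "x \<otimes>\<^bsub>H\<^esub> y \<in> lspan H entries"
proof -
  note sp = span_facts[OF vH entries_carrier]
  note s = submoduleD[OF sp(1)]
  have 1: "x \<otimes>\<^bsub>H\<^esub> y \<in> lspan H entries" if x: "x \<in> lspan H entries" and y: "y \<in> entries" for x y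
  proof -
    have yc: "y \<in> carrier H" using y entries_carrier by blast
    have "submodule class_ring {x \<in> carrier H. x \<otimes>\<^bsub>H\<^esub> y \<in> lspan H entries} H"
      by (rule submoduleI[OF vH]) (auto simp: VH D yc s)
    moreover have "entries \<subseteq> {x \<in> carrier H. x \<otimes>\<^bsub>H\<^esub> y \<in> lspan H entries}"
      using entries_mult y sp(2) entries_carrier by blast
    ultimately show ?thesis using span_least x by blast
  qed
  have xc: "x \<in> carrier H" using x sp(3) by blast
  have "submodule class_ring {y \<in> carrier H. x \<otimes>\<^bsub>H\<^esub> y \<in> lspan H entries} H"
    by (rule submoduleI[OF vH]) (auto simp: VH D xc s)
  moreover have "entries \<subseteq> {y \<in> carrier H. x \<otimes>\<^bsub>H\<^esub> y \<in> lspan H entries}"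
    using 1 x sp(2) entries_carrier by blast
  ultimately show ?thesis using span_least y by blast
qed

lemma generated_in_span_entries:
  assumes "G \<subseteq> lspan H entries" "x \<in> generated_subalgebra H G"
  shows "x \<in> lspan H entries"
  using assms(2)
proof induction
  note sp = span_facts[OF vH entries_carrier]
  note s = submoduleD[OF sp(1)]
  case one
  show ?case using sp(2) entries_one by blast
next
  case (incl a)
  then show ?case using assms(1) by blast
qed (use span_entries_mult submoduleD(3,4)[OF span_facts(1)[OF vH entries_carrier]] in auto)

text \<open>Both sides are bilinear, so \<open>antipode_mult_comatrix\<close> extends from entries
  to their span, first in \<open>x\<close> and then in \<open>y\<close>.\<close>

lemma antipode_mult:
  assumes x: "x \<in> lspan H entries" and y: "y \<in> lspan H entries"
  shows "antipode H (x \<otimes>\<^bsub>H\<^esub> y) = antipode H y \<otimes>\<^bsub>H\<^esub> antipode H x"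
proof -
  note sp = span_facts[OF vH entries_carrier]
  have 0: "antipode H \<zero>\<^bsub>H\<^esub> = \<zero>\<^bsub>H\<^esub>" by (rule lin_zero[OF vH vH antipode_lin])
  have base: "antipode H (x \<otimes>\<^bsub>H\<^esub> y) = antipode H y \<otimes>\<^bsub>H\<^esub> antipode H x" if "x \<in> entries" "y \<in> entries" for x y
    using that antipode_mult_comatrix by (auto simp: entries_def)
  have 1: "antipode H (x \<otimes>\<^bsub>H\<^esub> y) = antipode H y \<otimes>\<^bsub>H\<^esub> antipode H x" if x: "x \<in> lspan H entries" and y: "y \<in> entries" for x y
  proof -
    have yc: "y \<in> carrier H" using y entries_carrier by blast
    have "submodule class_ring {x \<in> carrier H. antipode H (x \<otimes>\<^bsub>H\<^esub> y) = antipode H y \<otimes>\<^bsub>H\<^esub> antipode H x} H"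
      by (rule submoduleI[OF vH]) (auto simp: VH D yc S 0)
    moreover have "entries \<subseteq> {x \<in> carrier H. antipode H (x \<otimes>\<^bsub>H\<^esub> y) = antipode H y \<otimes>\<^bsub>H\<^esub> antipode H x}"
      using base y entries_carrier by blast
    ultimately show ?thesis using span_least x by blast
  qed
  have xc: "x \<in> carrier H" using x sp(3) by blast
  have "submodule class_ring {y \<in> carrier H. antipode H (x \<otimes>\<^bsub>H\<^esub> y) = antipode H y \<otimes>\<^bsub>H\<^esub> antipode H x} H"
    by (rule submoduleI[OF vH]) (auto simp: VH D xc S 0)
  moreover have "entries \<subseteq> {y \<in> carrier H. antipode H (x \<otimes>\<^bsub>H\<^esub> y) = antipode H y \<otimes>\<^bsub>H\<^esub> antipode H x}"
    using 1 x entries_carrier by blast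
  ultimately show ?thesis using span_least y by blast
qed

text \<open>The span of all entries is a subalgebra. If it contains generators of \<open>H\<close>,
  as it does for a faithful coaction, it is everything, and the antipode is anti-multiplicative on
  all of \<open>H\<close>.\<close>

lemma prehopf_if_generated:
  assumes "G \<subseteq> lspan H entries" "generated_subalgebra H G = carrier H"
  shows "prehopf H"
proof -
  have all: "x \<in> lspan H entries" if "x \<in> carrier H" for x
    using generated_in_span_entries[OF assms(1)] that assms(2) by blast
  have "antipode H \<in> algebra_hom H (opposite_algebra H)"
    by (intro algebra_homI linI) (simp_all add: opposite_algebra_simps S antipode_one antipode_mult all)
  then show ?thesis
    unfolding prehopf_def using uH hopf_algebra.comult_hom[OF hopf] hopf_algebra.counit_hom[OF hopf] by blast
qed

end

subsection \<open>Coefficient matrices of coactions on the diagonal algebra\<close>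

lemma smult_cancel:
  assumes "vspace V" "c \<noteq> 0" "x \<in> carrier V" "y \<in> carrier V" "c \<odot>\<^bsub>V\<^esub> x = c \<odot>\<^bsub>V\<^esub> y"
  shows "x = y"
proof -
  have "inverse c \<odot>\<^bsub>V\<^esub> (c \<odot>\<^bsub>V\<^esub> z) = z" if "z \<in> carrier V" for z
    unfolding vspaceD(6)[OF assms(1) that, symmetric] using assms(2) vspaceD(7)[OF assms(1) that] by simp
  from trans[OF this[OF assms(3), unfolded assms(5), symmetric] this[OF assms(4)]] show ?thesis .
qed

lemma smult_eq_imp_zero:
  assumes V: "vspace V" and v: "v \<in> carrier V" and eq: "c \<odot>\<^bsub>V\<^esub> v = d \<odot>\<^bsub>V\<^esub> v" and "c \<noteq> d"
  shows "v = \<zero>\<^bsub>V\<^esub>"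
proof -
  have "(c - d) \<odot>\<^bsub>V\<^esub> v = c \<odot>\<^bsub>V\<^esub> v \<oplus>\<^bsub>V\<^esub> (- d) \<odot>\<^bsub>V\<^esub> v"
    using vspaceD(4)[OF V v, of c "- d"] by simp
  also have "\<dots> = \<zero>\<^bsub>V\<^esub>" using vspaceD(4)[OF V v, of d "- d"] vspaceD(8)[OF V v] eq by simp
  finally have eq0: "(c - d) \<odot>\<^bsub>V\<^esub> v = (c - d) \<odot>\<^bsub>V\<^esub> \<zero>\<^bsub>V\<^esub>" by (simp add: vspaceD(9)[OF V])
  have "c - d \<noteq> 0" using assms(4) by simp
  from smult_cancel[OF V this v vspaceD(12)[OF V] eq0] show ?thesis .
qed

text \<open>Only one of the \<open>x k\<close> survives multiplication by \<open>c\<close>. A row of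
  orthogonal idempotents is used in this way to isolate a single summand of a matrix
  identity.\<close>

lemma select_left:
  assumes A: "unital_algebra A" and I: "finite I" "l \<in> I" and c: "c \<in> carrier A" "d \<in> carrier A"
    and x: "\<And>k. k \<in> I \<Longrightarrow> x k \<in> carrier A" and y: "\<And>k. k \<in> I \<Longrightarrow> y k \<in> carrier A"
    and cx: "\<And>k. k \<in> I \<Longrightarrow> c \<otimes>\<^bsub>A\<^esub> x k = (if k = l then d else \<zero>\<^bsub>A\<^esub>)"
  shows "c \<otimes>\<^bsub>A\<^esub> (\<Oplus>\<^bsub>A\<^esub>k\<in>I. x k \<otimes>\<^bsub>A\<^esub> y k) = d \<otimes>\<^bsub>A\<^esub> y l"
proof -
  note D = unital_algebraD[OF A]
  have "c \<otimes>\<^bsub>A\<^esub> (\<Oplus>\<^bsub>A\<^esub>k\<in>I. x k \<otimes>\<^bsub>A\<^esub> y k) = (\<Oplus>\<^bsub>A\<^esub>k\<in>I. c \<otimes>\<^bsub>A\<^esub> (x k \<otimes>\<^bsub>A\<^esub> y k))"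
    by (rule afinsum_mult(2)[OF A I(1)]) (auto intro!: D(4) x y c)
  also have "\<dots> = (\<Oplus>\<^bsub>A\<^esub>k\<in>I. if k = l then d \<otimes>\<^bsub>A\<^esub> y k else \<zero>\<^bsub>A\<^esub>)"
    by (rule vfinsum_cong[OF D(2)])
      (auto simp: D(5)[OF c(1) x y, symmetric] cx D(12) y vspaceD(12)[OF D(2)] intro!: D(4) c)
  also have "\<dots> = d \<otimes>\<^bsub>A\<^esub> y l" by (rule vfinsum_delta[OF D(2) I]) (intro D(4) c y I)
  finally show ?thesis .
qed

lemma select_right:
  assumes A: "unital_algebra A" and I: "finite I" "l \<in> I" and c: "c \<in> carrier A" "d \<in> carrier A"
    and x: "\<And>k. k \<in> I \<Longrightarrow> x k \<in> carrier A" and y: "\<And>k. k \<in> I \<Longrightarrow> y k \<in> carrier A"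
    and yc: "\<And>k. k \<in> I \<Longrightarrow> y k \<otimes>\<^bsub>A\<^esub> c = (if k = l then d else \<zero>\<^bsub>A\<^esub>)"
  shows "(\<Oplus>\<^bsub>A\<^esub>k\<in>I. x k \<otimes>\<^bsub>A\<^esub> y k) \<otimes>\<^bsub>A\<^esub> c = x l \<otimes>\<^bsub>A\<^esub> d"
proof -
  note D = unital_algebraD[OF A]
  have "(\<Oplus>\<^bsub>A\<^esub>k\<in>I. x k \<otimes>\<^bsub>A\<^esub> y k) \<otimes>\<^bsub>A\<^esub> c = (\<Oplus>\<^bsub>A\<^esub>k\<in>I. (x k \<otimes>\<^bsub>A\<^esub> y k) \<otimes>\<^bsub>A\<^esub> c)"
    by (rule afinsum_mult(1)[OF A I(1)]) (auto intro!: D(4) x y c)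
  also have "\<dots> = (\<Oplus>\<^bsub>A\<^esub>k\<in>I. if k = l then x k \<otimes>\<^bsub>A\<^esub> d else \<zero>\<^bsub>A\<^esub>)"
    by (rule vfinsum_cong[OF D(2)])
      (auto simp: D(5)[OF x y c(1)] yc D(13) x vspaceD(12)[OF D(2)] intro!: D(4) c)
  also have "\<dots> = x l \<otimes>\<^bsub>A\<^esub> d" by (rule vfinsum_delta[OF D(2) I]) (intro D(4) c x I)
  finally show ?thesis .
qed

text \<open>What a coaction on the diagonal algebra means for its matrix: \<open>com\<close> is the
  comodule property, \<open>row\<close> is multiplicativity on the canonical idempotents, and
  \<open>row_sum\<close> is preservation of the unit.\<close>

locale diag_comatrix = hopf_context H for H :: "('k::field, 'a, 'm) hopf_scheme" +
  fixes n :: nat and a :: "nat \<Rightarrow> nat \<Rightarrow> 'a"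
  assumes com: "comatrix H {..<n} a"
    and row: "\<And>k i j. k < n \<Longrightarrow> i < n \<Longrightarrow> j < n \<Longrightarrow> a k i \<otimes>\<^bsub>H\<^esub> a k j = (if i = j then a k i else \<zero>\<^bsub>H\<^esub>)"
    and row_sum: "\<And>i. i < n \<Longrightarrow> (\<Oplus>\<^bsub>H\<^esub>j\<in>{..<n}. a i j) = \<one>\<^bsub>H\<^esub>"
begin

lemma a_in: "i < n \<Longrightarrow> j < n \<Longrightarrow> a i j \<in> carrier H"
  using comatrixD(2)[OF com] by simp

abbreviation "b i j \<equiv> antipode H (a i j)"

lemma b_in: "i < n \<Longrightarrow> j < n \<Longrightarrow> b i j \<in> carrier H" by (rule S(1)[OF a_in])

text \<open>The relation A S(A) = 1 is multiplied from the left by an entry of the row concerned;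
  orthogonality of the row leaves one summand.\<close>

lemma a_b:
  assumes i: "i < n" and l: "l < n" and j: "j < n"
  shows "a i l \<otimes>\<^bsub>H\<^esub> b l j = (if i = j then a i l else \<zero>\<^bsub>H\<^esub>)"
proof -
  have "a i l \<otimes>\<^bsub>H\<^esub> b l j = a i l \<otimes>\<^bsub>H\<^esub> (\<Oplus>\<^bsub>H\<^esub>k\<in>{..<n}. a i k \<otimes>\<^bsub>H\<^esub> b k j)"
    by (rule select_left[OF uH, symmetric]) (use i j l in \<open>auto simp: a_in b_in row\<close>)
  also have "(\<Oplus>\<^bsub>H\<^esub>k\<in>{..<n}. a i k \<otimes>\<^bsub>H\<^esub> b k j) = (if i = j then \<one>\<^bsub>H\<^esub> else \<zero>\<^bsub>H\<^esub>)"
    by (rule antipode_comatrix(2)[OF com]) (use i j in auto)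
  finally show ?thesis using i l by (auto simp: a_in D(7,13))
qed

lemma transpose_if_invariant:
  assumes inv: "\<And>i. i < n \<Longrightarrow> (\<Oplus>\<^bsub>H\<^esub>j\<in>{..<n}. \<kappa> j \<odot>\<^bsub>H\<^esub> a j i) = \<kappa> i \<odot>\<^bsub>H\<^esub> \<one>\<^bsub>H\<^esub>"
    and i: "i < n" and j: "j < n"
  shows "\<kappa> i \<odot>\<^bsub>H\<^esub> a j i = \<kappa> j \<odot>\<^bsub>H\<^esub> a j i" and "\<kappa> i \<noteq> 0 \<Longrightarrow> b i j = a j i"
proof -
  have "\<kappa> i \<odot>\<^bsub>H\<^esub> b i j = (\<kappa> i \<odot>\<^bsub>H\<^esub> \<one>\<^bsub>H\<^esub>) \<otimes>\<^bsub>H\<^esub> b i j"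
    by (simp add: D(6,10) b_in i j D(3))
  also have "\<dots> = (\<Oplus>\<^bsub>H\<^esub>k\<in>{..<n}. \<kappa> k \<odot>\<^bsub>H\<^esub> a k i) \<otimes>\<^bsub>H\<^esub> b i j" using inv[OF i] by simp
  also have "\<dots> = (\<Oplus>\<^bsub>H\<^esub>k\<in>{..<n}. (\<kappa> k \<odot>\<^bsub>H\<^esub> a k i) \<otimes>\<^bsub>H\<^esub> b i j)"
    by (rule afinsum_mult(1)[OF uH]) (auto simp: VH(3) a_in b_in i j)
  also have "\<dots> = (\<Oplus>\<^bsub>H\<^esub>k\<in>{..<n}. if k = j then \<kappa> k \<odot>\<^bsub>H\<^esub> a k i else \<zero>\<^bsub>H\<^esub>)"
    by (rule vfinsum_cong[OF vH]) (auto simp: D(10) a_b VH(3,9,12) a_in b_in i j)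
  also have "\<dots> = \<kappa> j \<odot>\<^bsub>H\<^esub> a j i" by (rule vfinsum_delta[OF vH]) (auto simp: VH(3) a_in i j)
  finally have eq: "\<kappa> i \<odot>\<^bsub>H\<^esub> b i j = \<kappa> j \<odot>\<^bsub>H\<^esub> a j i" .
  then have "a j i \<otimes>\<^bsub>H\<^esub> (\<kappa> i \<odot>\<^bsub>H\<^esub> b i j) = a j i \<otimes>\<^bsub>H\<^esub> (\<kappa> j \<odot>\<^bsub>H\<^esub> a j i)" by simp
  then show 1: "\<kappa> i \<odot>\<^bsub>H\<^esub> a j i = \<kappa> j \<odot>\<^bsub>H\<^esub> a j i"
    by (simp add: D(11) a_in b_in i j a_b row)
  assume "\<kappa> i \<noteq> 0"
  then show "b i j = a j i"
    by (rule smult_cancel[OF vH]) (use i j eq 1 in \<open>simp_all add: a_in b_in\<close>)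
qed

text \<open>Both sides equal the product of \<open>b l i\<close> and \<open>a i l\<close>.
  Anti-multiplicativity makes the rows of \<open>b\<close> orthogonal, so multiplying S(A) A = 1
  from the left by \<open>b l i\<close> gives one equation; the image of S(A) A = 1 under the
  antipode, multiplied from the right by \<open>a i l\<close>, gives the other.\<close>

lemma transpose_if_involutive:
  assumes pre: "prehopf H" and inv: "\<And>h. h \<in> carrier H \<Longrightarrow> antipode H (antipode H h) = h"
    and i: "i < n" and l: "l < n"
  shows "b l i = a i l"
proof -
  have anti: "antipode H (x \<otimes>\<^bsub>H\<^esub> y) = antipode H y \<otimes>\<^bsub>H\<^esub> antipode H x" if "x \<in> carrier H" "y \<in> carrier H" for x y
    using algebra_homD(3)[OF prehopfD(4)[OF pre] that] by (simp add: opposite_algebra_simps)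
  have bb: "b l i \<otimes>\<^bsub>H\<^esub> b l k = (if k = i then b l i else \<zero>\<^bsub>H\<^esub>)" if k: "k < n" for k
    using anti[OF a_in[OF l k] a_in[OF l i]] row[OF l k i] lin_zero[OF vH vH antipode_lin] by (simp split: if_splits)
  have "b l i \<otimes>\<^bsub>H\<^esub> a i l = b l i \<otimes>\<^bsub>H\<^esub> (\<Oplus>\<^bsub>H\<^esub>k\<in>{..<n}. b l k \<otimes>\<^bsub>H\<^esub> a k l)"
    by (rule select_left[OF uH, symmetric]) (use i l in \<open>auto simp: a_in b_in bb\<close>)
  also have "(\<Oplus>\<^bsub>H\<^esub>k\<in>{..<n}. b l k \<otimes>\<^bsub>H\<^esub> a k l) = (if l = l then \<one>\<^bsub>H\<^esub> else \<zero>\<^bsub>H\<^esub>)"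
    by (rule antipode_comatrix(1)[OF com]) (use l in auto)
  finally have 1: "b l i \<otimes>\<^bsub>H\<^esub> a i l = b l i" using i l by (simp add: b_in D(7))
  \<comment> \<open>The antipode reverses each product, and involutivity turns the antipode of
    \<open>b i k\<close> back into \<open>a i k\<close>.\<close>
  have "\<one>\<^bsub>H\<^esub> = antipode H (\<Oplus>\<^bsub>H\<^esub>k\<in>{..<n}. b i k \<otimes>\<^bsub>H\<^esub> a k i)"
    using antipode_comatrix(1)[OF com, of i i] i antipode_one by simp
  also have "\<dots> = (\<Oplus>\<^bsub>H\<^esub>k\<in>{..<n}. antipode H (b i k \<otimes>\<^bsub>H\<^esub> a k i))"
    by (rule lin_finsum[OF vH vH antipode_lin]) (use i in \<open>auto simp: a_in b_in D(4)\<close>)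
  also have "\<dots> = (\<Oplus>\<^bsub>H\<^esub>k\<in>{..<n}. b k i \<otimes>\<^bsub>H\<^esub> a i k)"
    by (rule vfinsum_cong[OF vH]) (use i in \<open>auto simp: a_in b_in D(4) anti inv\<close>)
  finally have "\<one>\<^bsub>H\<^esub> \<otimes>\<^bsub>H\<^esub> a i l = (\<Oplus>\<^bsub>H\<^esub>k\<in>{..<n}. b k i \<otimes>\<^bsub>H\<^esub> a i k) \<otimes>\<^bsub>H\<^esub> a i l" by simp
  also have "\<dots> = b l i \<otimes>\<^bsub>H\<^esub> a i l"
    by (rule select_right[OF uH]) (use i l in \<open>auto simp: a_in b_in row\<close>)
  finally show ?thesis using 1 i l by (simp add: a_in D(6))
qed

text \<open>Were all invariant functionals to vanish on \<open>e\<^sub>i\<close>, the sum of all such \<open>e\<^sub>i\<close> would be a nonzero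
  coinvariant on which every invariant functional vanishes.\<close>

lemma transpose_if_cosemisimple:
  assumes cs: "cosemisimple H" and i: "i < n" and l: "l < n"
  shows "b i l = a l i"
proof -
  define invf where "invf \<kappa> \<longleftrightarrow> (\<forall>i<n. (\<Oplus>\<^bsub>H\<^esub>j\<in>{..<n}. \<kappa> j \<odot>\<^bsub>H\<^esub> a j i) = \<kappa> i \<odot>\<^bsub>H\<^esub> \<one>\<^bsub>H\<^esub>)" for \<kappa> :: "nat \<Rightarrow> 'k"
  define J where "J = {i. i < n \<and> (\<forall>\<kappa>. invf \<kappa> \<longrightarrow> \<kappa> i = 0)}"
  \<comment> \<open>If exactly one of the two indices lies in \<open>J\<close>, every invariant
    functional vanishes at it while some invariant functional does not vanish at the other.
    Different values at \<open>i\<close> and \<open>j\<close> force the entry to be zero.\<close>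
  have zero: "a j i = \<zero>\<^bsub>H\<^esub>" if ij: "i < n" "j < n" "(i \<in> J) \<noteq> (j \<in> J)" for i j
  proof -
    have "\<exists>\<kappa>. invf \<kappa> \<and> \<kappa> i \<noteq> \<kappa> j" using ij unfolding J_def mem_Collect_eq by metis
    then obtain \<kappa> where \<kappa>: "invf \<kappa>" "\<kappa> i \<noteq> \<kappa> j" by blast
    then have eq: "\<kappa> i \<odot>\<^bsub>H\<^esub> a j i = \<kappa> j \<odot>\<^bsub>H\<^esub> a j i"
      using transpose_if_invariant(1)[of \<kappa> i j] ij by (simp add: invf_def)
    show ?thesis by (rule smult_eq_imp_zero[OF vH a_in[OF ij(2,1)] eq \<kappa>(2)])
  qed
  have "J = {}"
  proof (rule ccontr)
    assume "J \<noteq> {}"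
    have sub: "J \<subseteq> {..<n}" by (auto simp: J_def)
    have "(\<Oplus>\<^bsub>H\<^esub>i\<in>J. a j i) = (if j \<in> J then \<one>\<^bsub>H\<^esub> else \<zero>\<^bsub>H\<^esub>)" if j: "j < n" for j
    proof (cases "j \<in> J")
      case True
      \<comment> \<open>In a row with index in \<open>J\<close> the entries outside \<open>J\<close>
        vanish, so nothing of the row sum is lost.\<close>
      have "(\<Oplus>\<^bsub>H\<^esub>i\<in>J. a j i) = (\<Oplus>\<^bsub>H\<^esub>i\<in>{..<n}. a j i)"
        by (rule HG.add.finprod_mono_neutral_cong_left) (use sub True j a_in zero in auto)
      then show ?thesis using row_sum[OF j] True by simp
    next
      case False
      have "(\<Oplus>\<^bsub>H\<^esub>i\<in>J. a j i) = (\<Oplus>\<^bsub>H\<^esub>i\<in>J. \<zero>\<^bsub>H\<^esub>)"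
        by (rule vfinsum_cong[OF vH]) (use sub False j zero VH(12) in auto)
      then show ?thesis using False by (simp add: vfinsum_zero[OF vH])
    qed
    from cosemisimple_functional[OF hopf cs com sub \<open>J \<noteq> {}\<close> this]
    obtain \<kappa> where \<kappa>: "invf \<kappa>" "(\<Sum>i\<in>J. \<kappa> i) \<noteq> 0" unfolding invf_def by blast
    have "(\<Sum>i\<in>J. \<kappa> i) = 0" by (rule sum.neutral) (use \<kappa>(1) J_def in auto)
    with \<kappa>(2) show False by simp
  qed
  then obtain \<kappa> where "invf \<kappa>" "\<kappa> i \<noteq> 0" using i unfolding J_def by blast
  then show ?thesis using transpose_if_invariant(2)[of \<kappa> i l] i l by (simp add: invf_def)
qed

text \<open>The first alternative is invariance of the functional with all \<kappa> equal to 1; the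
  other two are the cases of an involutive antipode and of cosemisimplicity.\<close>

lemma antipode_transpose:
  assumes "prehopf H"
    and "(\<forall>i<n. (\<Oplus>\<^bsub>H\<^esub>j\<in>{..<n}. a j i) = \<one>\<^bsub>H\<^esub>) \<or> (\<forall>h\<in>carrier H. antipode H (antipode H h) = h) \<or> cosemisimple H"
    and i: "i < n" and j: "j < n"
  shows "antipode H (a i j) = a j i"
  using assms(2)
proof (elim disjE)
  assume sum: "\<forall>i<n. (\<Oplus>\<^bsub>H\<^esub>j\<in>{..<n}. a j i) = \<one>\<^bsub>H\<^esub>"
  have "(\<Oplus>\<^bsub>H\<^esub>j\<in>{..<n}. 1 \<odot>\<^bsub>H\<^esub> a j i) = 1 \<odot>\<^bsub>H\<^esub> \<one>\<^bsub>H\<^esub>" if i: "i < n" for i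
  proof -
    have "(\<Oplus>\<^bsub>H\<^esub>j\<in>{..<n}. 1 \<odot>\<^bsub>H\<^esub> a j i) = (\<Oplus>\<^bsub>H\<^esub>j\<in>{..<n}. a j i)"
      by (rule vfinsum_cong[OF vH]) (use i in \<open>auto simp: VH(7) a_in\<close>)
    then show ?thesis using sum i VH(7) D(3) by simp
  qed
  from transpose_if_invariant(2)[of "\<lambda>_. 1", OF this i j] show ?thesis by simp
next
  assume "\<forall>h\<in>carrier H. antipode H (antipode H h) = h"
  then show ?thesis using transpose_if_involutive[OF assms(1) _ j i] by blast
next
  assume "cosemisimple H"
  then show ?thesis by (rule transpose_if_cosemisimple[OF _ i j])
qed

lemma magic_if_transpose:
  assumes tr: "\<And>i j. i < n \<Longrightarrow> j < n \<Longrightarrow> antipode H (a i j) = a j i"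
  shows "magic H n a"
proof (rule magicI)
  fix i assume i: "i < n"
  show "(\<Oplus>\<^bsub>H\<^esub>l\<in>{..<n}. a i l) = \<one>\<^bsub>H\<^esub>" by (rule row_sum[OF i])
  have "(\<Oplus>\<^bsub>H\<^esub>l\<in>{..<n}. a l i) = (\<Oplus>\<^bsub>H\<^esub>l\<in>{..<n}. b i l)"
    by (rule vfinsum_cong[OF vH]) (use i in \<open>auto simp: tr a_in\<close>)
  also have "\<dots> = antipode H (\<Oplus>\<^bsub>H\<^esub>l\<in>{..<n}. a i l)"
    by (rule lin_finsum[OF vH vH antipode_lin, symmetric]) (use i in \<open>auto simp: a_in\<close>)
  finally show "(\<Oplus>\<^bsub>H\<^esub>l\<in>{..<n}. a l i) = \<one>\<^bsub>H\<^esub>" by (simp add: row_sum[OF i] antipode_one)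
next
  \<comment> \<open>With \<open>b\<close> equal to the transpose of \<open>a\<close>, the relation
    \<open>a_b\<close> is orthogonality within a column.\<close>
  fix k i j assume "k < n" "i < n" "j < n"
  then show "a i k \<otimes>\<^bsub>H\<^esub> a j k = (if i = j then a i k else \<zero>\<^bsub>H\<^esub>)"
    using a_b[of i k j] tr[of k j] by simp
qed (auto simp: a_in row)

end

subsection \<open>The diagonal algebra\<close>

lemma submodule_finsum:
  assumes N: "submodule class_ring N V" and vV: "vspace V" and "finite I" "\<And>i. i \<in> I \<Longrightarrow> g i \<in> N"
  shows "finsum V g I \<in> N"
  using assms(3,4)
proof (induction I rule: finite_induct)
  case empty
  interpret abelian_group V using vV vspaceD by blast
  show ?case using submoduleD(2)[OF N] by simp
next
  case (insert i I)
  interpret abelian_group V using vV vspaceD by blast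
  have "finsum V g (insert i I) = g i \<oplus>\<^bsub>V\<^esub> finsum V g I"
    by (rule finsum_insert) (use insert submoduleD(1)[OF N] in auto)
  then show ?case using insert submoduleD(3)[OF N] by simp
qed

lemma (in fin_basis) dim_eq: "vectorspace.dim class_ring V = n"
proof -
  interpret vectorspace class_ring V by (rule vV)
  let ?B = "b ` {..<n}"
  have sub: "?B \<subseteq> carrier V" using b_in by auto
  have inj: "inj_on b {..<n}"
  proof (rule inj_onI)
    fix i j assume "i \<in> {..<n}" "j \<in> {..<n}" "b i = b j"
    then show "i = j" using \<phi>_b[of i i] \<phi>_b[of i j] by (simp split: if_splits)
  qed
  have gen: "v \<in> lspan V ?B" if v: "v \<in> carrier V" for v
  proof -
    note sp = span_facts[OF vV sub]
    have "(\<Oplus>\<^bsub>V\<^esub>i\<in>{..<n}. \<phi> i v \<odot>\<^bsub>V\<^esub> b i) \<in> lspan V ?B"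
      by (rule submodule_finsum[OF sp(1) vV]) (use sp(2) submoduleD(4)[OF sp(1)] in auto)
    then show ?thesis by (subst expand[OF v])
  qed
  have "lin_indpt ?B"
  proof
    assume "lin_dep ?B"
    then obtain A c v where A: "finite A" "A \<subseteq> ?B" "lincomb c A = \<zero>\<^bsub>V\<^esub>" "v \<in> A" "c v \<noteq> 0"
      unfolding lin_dep_def by auto
    obtain i where i: "i < n" "v = b i" using A by auto
    note vb = unital_algebraD(2)[OF unital_algebra_base]
    \<comment> \<open>The coordinate functional that belongs to \<open>v\<close> extracts the
      coefficient \<open>c v\<close> from the supposed dependence.\<close>
    have "(\<Sum>u\<in>A. c u * \<phi> i u) = \<phi> i (lincomb c A)"
      unfolding lincomb_def using lin_finsum[OF vV vb \<phi>_lin[OF i(1)] A(1), of "\<lambda>u. c u \<odot>\<^bsub>V\<^esub> u"] A(2) sub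
        vspaceD(3)[OF vV]
      by (subst lin_finsum[OF vV vb \<phi>_lin[OF i(1)] A(1)]) (auto simp: finsum_base[OF A(1)] \<phi>_simps(2)[OF i(1)] subset_iff intro!: sum.cong)
    also have "\<dots> = 0" using A(3) lin_zero[OF vV vb \<phi>_lin[OF i(1)]] by (simp add: base_algebra_simps)
    also have "(\<Sum>u\<in>A. c u * \<phi> i u) = (\<Sum>u\<in>A. if u = v then c u else 0)"
    proof (rule sum.cong)
      fix u assume "u \<in> A"
      then obtain j where "j < n" "u = b j" using A(2) by auto
      then show "c u * \<phi> i u = (if u = v then c u else 0)"
        using i \<phi>_b[of i j] inj by (auto simp: inj_on_def)
    qed simp
    also have "\<dots> = c v" using A(1,4) by simp
    finally show False using A(5) by simp
  qed
  moreover have "span ?B = carrier V" using gen span_facts(3)[OF vV sub] by auto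
  ultimately have "basis ?B" unfolding basis_def using sub by blast
  then have "dim = card ?B" by (intro dim_basis) auto
  also have "\<dots> = n" using card_image[OF inj] by simp
  finally show ?thesis .
qed

lemma diag_simps:
  "carrier (diag_algebra n) = carrier_vec n" "mult (diag_algebra n) = (\<lambda>v w. vec n (\<lambda>i. v $ i * w $ i))"
  "\<one>\<^bsub>diag_algebra n\<^esub> = vec n (\<lambda>i. 1)" "\<zero>\<^bsub>diag_algebra n\<^esub> = 0\<^sub>v n" "add (diag_algebra n) = (+)"
  "smult (diag_algebra n) = (\<cdot>\<^sub>v)"
  by (simp_all add: diag_algebra_def)

lemma unital_algebra_diag: "unital_algebra (diag_algebra n :: ('k::field, 'k vec) module)"
proof (rule unital_algebraI)
  show "vspace (diag_algebra n :: ('k::field, 'k vec) module)"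
  proof (rule vspaceI)
    show "abelian_group (diag_algebra n :: ('k::field, 'k vec) module)"
    proof (rule abelian_groupI)
      fix x :: "'k vec" assume "x \<in> carrier (diag_algebra n)"
      then show "\<exists>y\<in>carrier (diag_algebra n). y \<oplus>\<^bsub>diag_algebra n\<^esub> x = \<zero>\<^bsub>diag_algebra n\<^esub>"
        by (intro bexI[of _ "- x"]) (auto simp: diag_simps)
    qed (auto simp: diag_simps comm_add_vec assoc_add_vec)
  qed (auto simp: diag_simps add_smult_distrib_vec smult_add_distrib_vec smult_smult_assoc)
  show "Group.monoid (diag_algebra n)"
    by (rule monoidI) (auto simp: diag_simps intro!: eq_vecI)
qed (auto simp: diag_simps algebra_simps intro!: eq_vecI)

lemma diag_coordinate: "i < n \<Longrightarrow> (\<lambda>v. v $ i) \<in> algebra_hom (diag_algebra n) base_algebra"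
  by (intro algebra_homI linI) (auto simp: diag_simps base_algebra_simps)

lemma diag_basis: "fin_basis (diag_algebra n :: ('k::field, 'k vec) module) n (unit_vec n) (\<lambda>i v. v $ i)"
proof (rule fin_basis.intro)
  note vA = unital_algebraD(2)[OF unital_algebra_diag]
  show "vspace (diag_algebra n :: ('k::field, 'k vec) module)" by (rule vA)
  show "i < n \<Longrightarrow> unit_vec n i \<in> carrier (diag_algebra n :: ('k::field, 'k vec) module)" for i by (simp add: diag_simps)
  show "i < n \<Longrightarrow> (\<lambda>v. v $ i) \<in> lin (diag_algebra n :: ('k::field, 'k vec) module) base_algebra" for i
    by (rule algebra_homD(1)[OF diag_coordinate])
  show "i < n \<Longrightarrow> j < n \<Longrightarrow> unit_vec n j $ i = (if i = j then 1 else 0 :: 'k)" for i j by auto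
  fix v :: "'k vec" assume v: "v \<in> carrier (diag_algebra n)"
  let ?s = "\<Oplus>\<^bsub>diag_algebra n\<^esub>i\<in>{..<n}. v $ i \<odot>\<^bsub>diag_algebra n\<^esub> unit_vec n i"
  have s: "?s \<in> carrier (diag_algebra n)" by (rule vfinsum_closed[OF vA]) (auto simp: diag_simps)
  show "v = ?s"
  proof (rule eq_vecI)
    fix j assume "j < dim_vec ?s"
    then have j: "j < n" using s by (auto simp: diag_simps)
    have "?s $ j = (\<Oplus>\<^bsub>base_algebra\<^esub>i\<in>{..<n}. (v $ i \<odot>\<^bsub>diag_algebra n\<^esub> unit_vec n i) $ j)"
      by (rule lin_finsum[OF vA unital_algebraD(2)[OF unital_algebra_base] algebra_homD(1)[OF diag_coordinate[OF j]]])
        (auto simp: diag_simps)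
    also have "\<dots> = (\<Sum>i<n. if j = i then v $ i else 0)"
      by (subst finsum_base, simp, rule sum.cong) (use j in \<open>simp_all add: diag_simps\<close>)
    also have "\<dots> = v $ j" using j by simp
    finally show "v $ j = ?s $ j" ..
  qed (use v s in \<open>auto simp: diag_simps\<close>)
qed

text \<open>Slicing along a character is an algebra map. With the coordinates of the diagonal
  algebra as characters, multiplicativity of a coaction can be examined row by row.\<close>

lemma slice_hom:
  assumes A: "unital_algebra A" and H: "unital_algebra H" and \<chi>: "\<chi> \<in> algebra_hom A base_algebra"
  shows "slice H \<chi> \<in> algebra_hom (tensor A H) H"
proof -
  interpret T: tensor_algebras A H by (intro tensor_algebras.intro A H)
  note DA = unital_algebraD[OF A] and DH = unital_algebraD[OF H]
  note c = algebra_homD[OF \<chi>] and sl = slice_tens[OF T.vA T.vB algebra_homD(1)[OF \<chi>]]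
  show ?thesis
  proof (rule T.tensor_hom_lin[OF H slice_lin[OF T.vA T.vB c(1)]])
    show "slice H \<chi> (tens A H \<one>\<^bsub>A\<^esub> \<one>\<^bsub>H\<^esub>) = \<one>\<^bsub>H\<^esub>"
      by (simp add: sl DA(3) DH(3) c(2) base_algebra_simps vspaceD(7)[OF T.vB])
    fix x y x' y' assume "x \<in> carrier A" "y \<in> carrier H" "x' \<in> carrier A" "y' \<in> carrier H"
    then show "slice H \<chi> (tens A H (x \<otimes>\<^bsub>A\<^esub> x') (y \<otimes>\<^bsub>H\<^esub> y')) = slice H \<chi> (tens A H x y) \<otimes>\<^bsub>H\<^esub> slice H \<chi> (tens A H x' y')"
      using vspaceD(6)[OF T.vB, of _ "\<chi> x'" "\<chi> x", unfolded mult.commute[of "\<chi> x'"]]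
      by (simp add: sl DA(4) DH(4,10,11) c(3) base_algebra_simps vspaceD(3)[OF T.vB])
  qed
qed

text \<open>The subspace \<open>N\<close> is left open for two applications: to the span of
  \<open>entries\<close>, where it leads to anti-multiplicativity of the antipode, and to the image
  of the final morphism, where it leads to surjectivity.\<close>

lemma (in matrix_coaction) coefficient_in:
  assumes N: "submodule class_ring N H" and a: "\<And>i j. i < n \<Longrightarrow> j < n \<Longrightarrow> a i j \<in> N"
    and \<chi>: "\<chi> \<in> lin V base_algebra" and v: "v \<in> carrier V"
  shows "slice H \<chi> (\<rho> v) \<in> N"
proof -
  note L = lin_comp[OF \<rho> slice_lin[OF vV vH \<chi>]]
  have "slice H \<chi> (\<rho> v) = slice H \<chi> (\<rho> (\<Oplus>\<^bsub>V\<^esub>i\<in>{..<n}. \<phi> i v \<odot>\<^bsub>V\<^esub> b i))"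
    by (rule arg_cong[OF expand[OF v]])
  also have "\<dots> = (\<Oplus>\<^bsub>H\<^esub>i\<in>{..<n}. slice H \<chi> (\<rho> (\<phi> i v \<odot>\<^bsub>V\<^esub> b i)))"
    by (rule lin_finsum[OF vV vH L]) (auto simp: b_in vspaceD(3)[OF vV])
  also have "\<dots> \<in> N"
  proof (rule submodule_finsum[OF N vH])
    fix i assume "i \<in> {..<n}"
    then have i: "i < n" by simp
    have "slice H \<chi> (\<rho> (b i)) \<in> N"
      unfolding slice_\<rho>[OF \<chi> i] by (rule submodule_finsum[OF N vH]) (use i a submoduleD(4)[OF N] in auto)
    then show "slice H \<chi> (\<rho> (\<phi> i v \<odot>\<^bsub>V\<^esub> b i)) \<in> N"
      using linD(3)[OF L b_in[OF i]] submoduleD(4)[OF N] by simp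
  qed simp
  finally show ?thesis .
qed

text \<open>Row \<open>k\<close> is the image of the canonical idempotents under an algebra map,
  namely the coaction followed by the slice along coordinate \<open>k\<close>; this yields
  orthogonality and the sum 1. Columns do not arise in this way, so their relations have to come
  from the antipode.\<close>

lemma coaction_matrix:
  fixes H :: "('k::field, 'a, 'm) hopf_scheme" and n :: nat
  defines "a \<equiv> \<lambda>\<alpha> j i. slice H (\<lambda>v :: 'k vec. v $ j) (\<alpha> (unit_vec n i))"
  assumes hopf: "hopf_algebra H" and co: "coaction H (diag_algebra n) \<alpha>"
  shows "matrix_coaction (diag_algebra n) n (unit_vec n) (\<lambda>i v. v $ i) H \<alpha> (a \<alpha>)" "diag_comatrix H n (a \<alpha>)"
proof -
  let ?A = "diag_algebra n :: ('k, 'k vec) module"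
  interpret B: fin_basis ?A n "unit_vec n" "\<lambda>i v. v $ i" by (rule diag_basis)
  interpret HC: hopf_context H by (rule hopf_context.intro) (rule hopf)
  note vH = HC.vH and uH = HC.uH
  interpret T: tensor_algebras ?A H by (intro tensor_algebras.intro unital_algebra_diag uH)
  note al = algebra_homD[OF coaction.coaction_hom[OF co]]
  note sh = slice_hom[OF unital_algebra_diag uH diag_coordinate]
  have e: "unit_vec n i \<in> carrier ?A" for i by (simp add: diag_simps)
  show mc: "matrix_coaction ?A n (unit_vec n) (\<lambda>i v. v $ i) H \<alpha> (a \<alpha>)"
  proof (intro matrix_coaction.intro matrix_coaction_axioms.intro B.fin_basis_axioms hopf al(1))
    show "i < n \<Longrightarrow> j < n \<Longrightarrow> a \<alpha> i j \<in> carrier H" for i j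
      unfolding a_def by (rule algebra_homD(4)[OF sh al(4)[OF e]])
    show "\<alpha> (unit_vec n i) = (\<Oplus>\<^bsub>tensor ?A H\<^esub>j\<in>{..<n}. tens ?A H (unit_vec n j) (a \<alpha> j i))" if "i < n" for i
      unfolding a_def by (rule B.tensor_expand[OF vH al(4)[OF e]])
  qed
  then interpret M: matrix_coaction ?A n "unit_vec n" "\<lambda>i v. v $ i" H \<alpha> "a \<alpha>" .
  show "diag_comatrix H n (a \<alpha>)"
  proof (intro diag_comatrix.intro diag_comatrix_axioms.intro HC.hopf_context_axioms)
    show "comatrix H {..<n} (a \<alpha>)" using M.comodule_iff co by (simp add: coaction_def)
    fix k assume k: "k < n"
    note ks = algebra_homD[OF sh[OF k]]
    have "(\<Oplus>\<^bsub>?A\<^esub>i\<in>{..<n}. unit_vec n i) = \<one>\<^bsub>?A\<^esub>"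
    proof -
      have "\<one>\<^bsub>?A\<^esub> = (\<Oplus>\<^bsub>?A\<^esub>i\<in>{..<n}. \<one>\<^bsub>?A\<^esub> $ i \<odot>\<^bsub>?A\<^esub> unit_vec n i)"
        by (rule B.expand) (simp add: diag_simps)
      also have "\<dots> = (\<Oplus>\<^bsub>?A\<^esub>i\<in>{..<n}. unit_vec n i)"
        by (rule vfinsum_cong[OF B.vV]) (auto simp: diag_simps)
      finally show ?thesis ..
    qed
    then have "\<one>\<^bsub>H\<^esub> = slice H (\<lambda>v. v $ k) (\<alpha> (\<Oplus>\<^bsub>?A\<^esub>i\<in>{..<n}. unit_vec n i))"
      by (simp add: al(2) ks(2))
    also have "\<dots> = (\<Oplus>\<^bsub>H\<^esub>i\<in>{..<n}. a \<alpha> k i)"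
      unfolding a_def by (rule lin_finsum[OF B.vV vH lin_comp[OF al(1) ks(1)]]) (auto simp: e)
    finally show "(\<Oplus>\<^bsub>H\<^esub>i\<in>{..<n}. a \<alpha> k i) = \<one>\<^bsub>H\<^esub>" ..
    fix i j assume i: "i < n" and j: "j < n"
    have "a \<alpha> k i \<otimes>\<^bsub>H\<^esub> a \<alpha> k j = slice H (\<lambda>v. v $ k) (\<alpha> (unit_vec n i \<otimes>\<^bsub>?A\<^esub> unit_vec n j))"
      unfolding a_def al(3)[OF e e] by (rule ks(3)[OF al(4)[OF e] al(4)[OF e], symmetric])
    also have "unit_vec n i \<otimes>\<^bsub>?A\<^esub> unit_vec n j = (if i = j then unit_vec n i else \<zero>\<^bsub>?A\<^esub>)"
      using i j by (auto simp: diag_simps intro!: eq_vecI)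
    finally show "a \<alpha> k i \<otimes>\<^bsub>H\<^esub> a \<alpha> k j = (if i = j then a \<alpha> k i else \<zero>\<^bsub>H\<^esub>)"
      using lin_zero[OF B.vV vH lin_comp[OF al(1) ks(1)]] by (simp add: a_def split: if_splits)
  qed
qed

section \<open>Coinvariants in matrix form, and the coaction defined by a matrix\<close>

context diag_comatrix
begin

sublocale B: fin_basis "diag_algebra n :: ('k, 'k vec) module" n "unit_vec n" "\<lambda>i v. v $ i"
  by (rule diag_basis)

text \<open>Multiplied by \<open>a j i\<close>, the equation with index \<open>j\<close> reduces by
  row orthogonality to an equality between the multiples of \<open>a j i\<close> by
  \<open>v $ i\<close> and \<open>v $ j\<close>. Conversely, \<open>v $ i\<close> may be replaced by
  \<open>v $ j\<close> in every nonzero term, and the row sum is 1.\<close>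

lemma coinvariant_criterion:
  assumes v: "v \<in> carrier_vec n"
  shows "(\<forall>j<n. (\<Oplus>\<^bsub>H\<^esub>i\<in>{..<n}. v $ i \<odot>\<^bsub>H\<^esub> a j i) = v $ j \<odot>\<^bsub>H\<^esub> \<one>\<^bsub>H\<^esub>) \<longleftrightarrow>
    (\<forall>i<n. \<forall>j<n. a j i \<noteq> \<zero>\<^bsub>H\<^esub> \<longrightarrow> v $ i = v $ j)"
proof (intro iffI allI impI)
  fix i j assume eq: "\<forall>j<n. (\<Oplus>\<^bsub>H\<^esub>i\<in>{..<n}. v $ i \<odot>\<^bsub>H\<^esub> a j i) = v $ j \<odot>\<^bsub>H\<^esub> \<one>\<^bsub>H\<^esub>"
    and i: "i < n" and j: "j < n" and ne: "a j i \<noteq> \<zero>\<^bsub>H\<^esub>"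
  note aji = a_in[OF j i]
  have "v $ j \<odot>\<^bsub>H\<^esub> a j i = (v $ j \<odot>\<^bsub>H\<^esub> \<one>\<^bsub>H\<^esub>) \<otimes>\<^bsub>H\<^esub> a j i" by (simp add: D(3,6,10) aji)
  also have "\<dots> = (\<Oplus>\<^bsub>H\<^esub>k\<in>{..<n}. v $ k \<odot>\<^bsub>H\<^esub> a j k) \<otimes>\<^bsub>H\<^esub> a j i" using eq j by simp
  also have "\<dots> = (\<Oplus>\<^bsub>H\<^esub>k\<in>{..<n}. (v $ k \<odot>\<^bsub>H\<^esub> a j k) \<otimes>\<^bsub>H\<^esub> a j i)"
    by (rule afinsum_mult(1)[OF uH]) (auto simp: VH(3) a_in i j)
  also have "\<dots> = (\<Oplus>\<^bsub>H\<^esub>k\<in>{..<n}. if k = i then v $ k \<odot>\<^bsub>H\<^esub> a j k else \<zero>\<^bsub>H\<^esub>)"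
    by (rule vfinsum_cong[OF vH]) (auto simp: D(10) row VH(3,9,12) a_in i j)
  also have "\<dots> = v $ i \<odot>\<^bsub>H\<^esub> a j i" by (rule vfinsum_delta[OF vH]) (auto simp: VH(3) a_in i j)
  finally have "v $ j \<odot>\<^bsub>H\<^esub> a j i = v $ i \<odot>\<^bsub>H\<^esub> a j i" .
  then show "v $ i = v $ j" using smult_eq_imp_zero[OF vH aji] ne by metis
next
  fix j assume eq: "\<forall>i<n. \<forall>j<n. a j i \<noteq> \<zero>\<^bsub>H\<^esub> \<longrightarrow> v $ i = v $ j" and j: "j < n"
  have "(\<Oplus>\<^bsub>H\<^esub>i\<in>{..<n}. v $ i \<odot>\<^bsub>H\<^esub> a j i) = (\<Oplus>\<^bsub>H\<^esub>i\<in>{..<n}. v $ j \<odot>\<^bsub>H\<^esub> a j i)"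
  proof (rule vfinsum_cong[OF vH])
    fix i assume "i \<in> {..<n}"
    then show "v $ i \<odot>\<^bsub>H\<^esub> a j i = v $ j \<odot>\<^bsub>H\<^esub> a j i" using eq j VH(9) by (cases "a j i = \<zero>\<^bsub>H\<^esub>") auto
  qed (use j a_in VH(3) in auto)
  also have "\<dots> = v $ j \<odot>\<^bsub>H\<^esub> (\<Oplus>\<^bsub>H\<^esub>i\<in>{..<n}. a j i)"
    by (rule finsum_smult_right[OF vH, symmetric]) (auto simp: a_in j)
  finally show "(\<Oplus>\<^bsub>H\<^esub>i\<in>{..<n}. v $ i \<odot>\<^bsub>H\<^esub> a j i) = v $ j \<odot>\<^bsub>H\<^esub> \<one>\<^bsub>H\<^esub>" by (simp add: row_sum[OF j])
qed

lemma coinvariants_iff: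
  assumes "matrix_coaction (diag_algebra n) n (unit_vec n) (\<lambda>i v. v $ i) H \<rho> a"
  shows "v \<in> coinvariants H (diag_algebra n) \<rho> \<longleftrightarrow>
    v \<in> carrier_vec n \<and> (\<forall>i<n. \<forall>j<n. a j i \<noteq> \<zero>\<^bsub>H\<^esub> \<longrightarrow> v $ i = v $ j)"
proof -
  interpret M: matrix_coaction "diag_algebra n" n "unit_vec n" "\<lambda>i v. v $ i" H \<rho> a by fact
  show ?thesis
    unfolding coinvariants_def using coinvariant_criterion[of v] M.coinvariant_iff[of v] by (auto simp: diag_simps)
qed

text \<open>Converse of \<open>coaction_matrix\<close>; it provides the coactions on the
  blocks.\<close>

lemma coaction_of_matrix:
  obtains \<rho> where "coaction H (diag_algebra n) \<rho>"
    "matrix_coaction (diag_algebra n) n (unit_vec n) (\<lambda>i v. v $ i) H \<rho> a"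
proof
  let ?A = "diag_algebra n :: ('k, 'k vec) module"
  let ?\<rho> = "matrix_map ?A H n (unit_vec n) (\<lambda>i v. v $ i) a"
  show mc: "matrix_coaction ?A n (unit_vec n) (\<lambda>i v. v $ i) H ?\<rho> a"
    by (rule B.matrix_coaction_map[OF hopf a_in])
  then interpret M: matrix_coaction ?A n "unit_vec n" "\<lambda>i v. v $ i" H ?\<rho> a .
  interpret TA: tensor_algebras ?A H by (intro tensor_algebras.intro unital_algebra_diag uH)
  note sh = slice_hom[OF unital_algebra_diag uH diag_coordinate]
  note DA = unital_algebraD[OF unital_algebra_diag[where n = n and 'k = 'k]]
  note DT = unital_algebraD[OF TA.unital_algebra_tensor]
  show "coaction H ?A ?\<rho>"
  proof (intro coaction.intro coaction_axioms.intro unital_algebra_diag)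
    show "comodule H ?A ?\<rho>" using M.comodule_iff com by blast
    show "?\<rho> \<in> algebra_hom ?A (tensor ?A H)"
    proof (rule algebra_homI[OF M.\<rho>])
      \<comment> \<open>Constant vectors satisfy the criterion for coinvariants; for the unit of the
        algebra this says that \<open>?\<rho>\<close> preserves the unit.\<close>
      have "(\<one>\<^bsub>?A\<^esub>) \<in> coinvariants H ?A ?\<rho>"
        unfolding coinvariants_iff[OF mc] by (simp add: diag_simps)
      then show "?\<rho> \<one>\<^bsub>?A\<^esub> = \<one>\<^bsub>tensor ?A H\<^esub>" by (simp add: coinvariants_def TA.tens_one)
      fix v w assume v: "v \<in> carrier ?A" and w: "w \<in> carrier ?A"
      note \<rho>v = linD(1)[OF M.\<rho> v] and \<rho>w = linD(1)[OF M.\<rho> w]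
      have vw: "v \<otimes>\<^bsub>?A\<^esub> w \<in> carrier ?A" by (rule DA(4)[OF v w])
      show "?\<rho> (v \<otimes>\<^bsub>?A\<^esub> w) = ?\<rho> v \<otimes>\<^bsub>tensor ?A H\<^esub> ?\<rho> w"
      proof (rule B.tensor_eqI[OF vH linD(1)[OF M.\<rho> vw] DT(4)[OF \<rho>v \<rho>w]])
        \<comment> \<open>Slices along coordinates are algebra maps, so the claim concerns the
          product of two combinations of one row, where orthogonality leaves the diagonal
          terms.\<close>
        fix j assume j: "j < n"
        have z: "(v $ i \<odot>\<^bsub>H\<^esub> a j i) \<otimes>\<^bsub>H\<^esub> (w $ k \<odot>\<^bsub>H\<^esub> a j k) = (if i = k then (v $ i * w $ i) \<odot>\<^bsub>H\<^esub> a j i else \<zero>\<^bsub>H\<^esub>)"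
          if "i < n" "k < n" for i k
        proof -
          have "w $ i \<odot>\<^bsub>H\<^esub> (v $ i \<odot>\<^bsub>H\<^esub> a j i) = (v $ i * w $ i) \<odot>\<^bsub>H\<^esub> a j i"
            by (simp add: VH(6)[OF a_in[OF j that(1)], symmetric] mult.commute)
          then show ?thesis by (cases "i = k") (simp_all add: D(10,11) VH(3,9) a_in j that row)
        qed
        have "slice H (\<lambda>v. v $ j) (?\<rho> v \<otimes>\<^bsub>tensor ?A H\<^esub> ?\<rho> w) =
          (\<Oplus>\<^bsub>H\<^esub>i\<in>{..<n}. v $ i \<odot>\<^bsub>H\<^esub> a j i) \<otimes>\<^bsub>H\<^esub> (\<Oplus>\<^bsub>H\<^esub>i\<in>{..<n}. w $ i \<odot>\<^bsub>H\<^esub> a j i)"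
          unfolding algebra_homD(3)[OF sh[OF j] \<rho>v \<rho>w] M.slice_\<phi>_\<rho>[OF j v] M.slice_\<phi>_\<rho>[OF j w] ..
        also have "\<dots> = (\<Oplus>\<^bsub>H\<^esub>i\<in>{..<n}. (v $ i \<odot>\<^bsub>H\<^esub> a j i) \<otimes>\<^bsub>H\<^esub> (w $ i \<odot>\<^bsub>H\<^esub> a j i))"
          by (rule orthogonal_sums_mult[OF uH]) (auto simp: VH(3) a_in j z)
        also have "\<dots> = (\<Oplus>\<^bsub>H\<^esub>i\<in>{..<n}. (v \<otimes>\<^bsub>?A\<^esub> w) $ i \<odot>\<^bsub>H\<^esub> a j i)"
          by (rule vfinsum_cong[OF vH]) (auto simp: z VH(3) a_in j diag_simps)
        also have "\<dots> = slice H (\<lambda>v. v $ j) (?\<rho> (v \<otimes>\<^bsub>?A\<^esub> w))" by (rule M.slice_\<phi>_\<rho>[OF j vw, symmetric])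
        finally show "slice H (\<lambda>v. v $ j) (?\<rho> (v \<otimes>\<^bsub>?A\<^esub> w)) = slice H (\<lambda>v. v $ j) (?\<rho> v \<otimes>\<^bsub>tensor ?A H\<^esub> ?\<rho> w)" ..
      qed
    qed
  qed
qed

end

subsection \<open>Decomposition into blocks\<close>

lemma vfinsum_block:
  fixes m n :: nat
  assumes vV: "vspace V" and B: "B \<subseteq> {..<n}" and \<sigma>: "bij_betw \<sigma> {..<m} B"
    and f: "\<And>i. i < n \<Longrightarrow> f i \<in> carrier V" and off: "\<And>i. i < n \<Longrightarrow> i \<notin> B \<Longrightarrow> f i = \<zero>\<^bsub>V\<^esub>"
  shows "(\<Oplus>\<^bsub>V\<^esub>p\<in>{..<m}. f (\<sigma> p)) = (\<Oplus>\<^bsub>V\<^esub>i\<in>{..<n}. f i)"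
proof -
  interpret abelian_group V using vV vspaceD by blast
  have "(\<Oplus>\<^bsub>V\<^esub>p\<in>{..<m}. f (\<sigma> p)) = finsum V f (\<sigma> ` {..<m})"
    by (rule vfinsum_reindex[OF vV, symmetric]) (use \<sigma> B f in \<open>auto simp: bij_betw_def\<close>)
  also have "\<dots> = finsum V f B" using \<sigma> by (simp add: bij_betw_def)
  also have "\<dots> = (\<Oplus>\<^bsub>V\<^esub>i\<in>{..<n}. f i)"
    by (rule add.finprod_mono_neutral_cong_left) (use B f off in auto)
  finally show ?thesis .
qed

context diag_comatrix
begin

context
  fixes B :: "nat set" and m :: nat and \<sigma> :: "nat \<Rightarrow> nat"
  assumes B: "B \<subseteq> {..<n}" and \<sigma>: "bij_betw \<sigma> {..<m} B"
    and off: "\<And>i j. i < n \<Longrightarrow> j < n \<Longrightarrow> (i \<in> B) \<noteq> (j \<in> B) \<Longrightarrow> a j i = \<zero>\<^bsub>H\<^esub>"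
begin

lemma \<sigma>_in: "p < m \<Longrightarrow> \<sigma> p \<in> B" "p < m \<Longrightarrow> \<sigma> p < n"
  using \<sigma> B by (auto simp: bij_betw_def)

lemma \<sigma>_eq: "p < m \<Longrightarrow> q < m \<Longrightarrow> \<sigma> p = \<sigma> q \<longleftrightarrow> p = q"
  using \<sigma> by (auto simp: bij_betw_def inj_on_def)

text \<open>In the comultiplication and in the row sums the inner index can be restricted to
  \<open>B\<close>, because entries leaving the block vanish by \<open>off\<close>.\<close>

lemma block_comatrix: "diag_comatrix H m (\<lambda>p q. a (\<sigma> p) (\<sigma> q))"
proof (intro diag_comatrix.intro diag_comatrix_axioms.intro hopf_context_axioms)
  show "comatrix H {..<m} (\<lambda>p q. a (\<sigma> p) (\<sigma> q))"
    unfolding comatrix_def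
  proof (intro conjI ballI)
    fix p q assume "p \<in> {..<m}" "q \<in> {..<m}"
    then have p: "p < m" and q: "q < m" by auto
    note pq = \<sigma>_in(2)[OF p] \<sigma>_in(2)[OF q]
    show "a (\<sigma> p) (\<sigma> q) \<in> carrier H" by (intro a_in pq)
    show "counit H (a (\<sigma> p) (\<sigma> q)) = (if p = q then 1 else 0)"
      using comatrixD(4)[OF com, of "\<sigma> p" "\<sigma> q"] pq \<sigma>_eq[OF p q] by simp
    have "comult H (a (\<sigma> p) (\<sigma> q)) = (\<Oplus>\<^bsub>tensor H H\<^esub>k\<in>{..<n}. tens H H (a (\<sigma> p) k) (a k (\<sigma> q)))"
      by (rule comatrixD(3)[OF com]) (use pq in auto)
    also have "\<dots> = (\<Oplus>\<^bsub>tensor H H\<^esub>r\<in>{..<m}. tens H H (a (\<sigma> p) (\<sigma> r)) (a (\<sigma> r) (\<sigma> q)))"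
    proof (rule vfinsum_block[OF T.vspace_tensor B \<sigma>, symmetric])
      fix k assume k: "k < n"
      show "tens H H (a (\<sigma> p) k) (a k (\<sigma> q)) \<in> carrier (tensor H H)"
        by (intro T.tens_closed a_in pq k)
      assume "k \<notin> B"
      then have "a (\<sigma> p) k = \<zero>\<^bsub>H\<^esub>" using off[OF k pq(1)] \<sigma>_in(1)[OF p] by simp
      then show "tens H H (a (\<sigma> p) k) (a k (\<sigma> q)) = \<zero>\<^bsub>tensor H H\<^esub>"
        using lin_zero[OF vH T.vspace_tensor bilinD(7)[OF T.tens_bilin a_in[OF k pq(2)]]] by simp
    qed
    finally show "comult H (a (\<sigma> p) (\<sigma> q)) = (\<Oplus>\<^bsub>tensor H H\<^esub>r\<in>{..<m}. tens H H (a (\<sigma> p) (\<sigma> r)) (a (\<sigma> r) (\<sigma> q)))" .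
  qed simp
  show "a (\<sigma> k) (\<sigma> i) \<otimes>\<^bsub>H\<^esub> a (\<sigma> k) (\<sigma> j) = (if i = j then a (\<sigma> k) (\<sigma> i) else \<zero>\<^bsub>H\<^esub>)"
    if "k < m" "i < m" "j < m" for k i j
    using row[of "\<sigma> k" "\<sigma> i" "\<sigma> j"] \<sigma>_in(2) \<sigma>_eq that by simp
  show "(\<Oplus>\<^bsub>H\<^esub>j\<in>{..<m}. a (\<sigma> i) (\<sigma> j)) = \<one>\<^bsub>H\<^esub>" if i: "i < m" for i
  proof -
    have "(\<Oplus>\<^bsub>H\<^esub>j\<in>{..<m}. a (\<sigma> i) (\<sigma> j)) = (\<Oplus>\<^bsub>H\<^esub>j\<in>{..<n}. a (\<sigma> i) j)"
      by (rule vfinsum_block[OF vH B \<sigma>]) (use i \<sigma>_in a_in off in auto)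
    then show ?thesis using row_sum \<sigma>_in(2)[OF i] by simp
  qed
qed

text \<open>The antipode transposes the block as it does the whole matrix, so the block is magic by
  itself.\<close>

lemma block_hopf_hom:
  assumes pre: "prehopf H" and tr: "\<And>i j. i < n \<Longrightarrow> j < n \<Longrightarrow> antipode H (a i j) = a j i"
  shows "presented_lift H (\<lambda>(p, q). a (\<sigma> p) (\<sigma> q)) \<in> hopf_hom (As m) H"
    "\<And>p q. p < m \<Longrightarrow> q < m \<Longrightarrow> presented_lift H (\<lambda>(p, q). a (\<sigma> p) (\<sigma> q)) (As_gen m p q) = a (\<sigma> p) (\<sigma> q)"
proof -
  interpret BL: diag_comatrix H m "\<lambda>p q. a (\<sigma> p) (\<sigma> q)" by (rule block_comatrix)
  have mg: "magic H m (\<lambda>p q. a (\<sigma> p) (\<sigma> q))"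
    by (rule BL.magic_if_transpose) (simp add: tr \<sigma>_in(2))
  show "presented_lift H (\<lambda>(p, q). a (\<sigma> p) (\<sigma> q)) \<in> hopf_hom (As m) H"
    by (rule As_hopf_hom[OF pre mg])
      (use comatrixD(3,4)[OF BL.com] in \<open>simp_all add: tr \<sigma>_in(2)\<close>)
  show "\<And>p q. p < m \<Longrightarrow> q < m \<Longrightarrow> presented_lift H (\<lambda>(p, q). a (\<sigma> p) (\<sigma> q)) (As_gen m p q) = a (\<sigma> p) (\<sigma> q)"
    by (rule As_lift(2)[OF uH mg])
qed

text \<open>A coinvariant of the block extends by zero to a coinvariant of the whole algebra.\<close>

lemma block_ergodic:
  assumes const: "\<And>v i j. v \<in> carrier_vec n \<Longrightarrow> (\<And>i j. i < n \<Longrightarrow> j < n \<Longrightarrow> a j i \<noteq> \<zero>\<^bsub>H\<^esub> \<Longrightarrow> v $ i = v $ j) \<Longrightarrow>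
      i \<in> B \<Longrightarrow> j \<in> B \<Longrightarrow> v $ i = (v $ j :: 'k)"
    and m: "m > 0"
  shows "\<exists>\<beta>. coaction H (diag_algebra m) \<beta> \<and> ergodic H (diag_algebra m) \<beta>"
proof -
  interpret BL: diag_comatrix H m "\<lambda>p q. a (\<sigma> p) (\<sigma> q)" by (rule block_comatrix)
  obtain \<beta> where \<beta>: "coaction H (diag_algebra m) \<beta>"
    "matrix_coaction (diag_algebra m) m (unit_vec m) (\<lambda>i v. v $ i) H \<beta> (\<lambda>p q. a (\<sigma> p) (\<sigma> q))"
    by (rule BL.coaction_of_matrix)
  define \<tau> where "\<tau> = inv_into {..<m} \<sigma>"
  have \<tau>: "\<tau> i < m" "\<sigma> (\<tau> i) = i" if "i \<in> B" for i
    using bij_betw_imp_surj_on[OF \<sigma>] that unfolding \<tau>_def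
    by (metis inv_into_into lessThan_iff, metis f_inv_into_f)
  have \<tau>\<sigma>: "\<tau> (\<sigma> p) = p" if "p < m" for p
    using \<sigma> that unfolding \<tau>_def by (simp add: bij_betw_def)
  have "coinvariants H (diag_algebra m) \<beta> = {c \<odot>\<^bsub>diag_algebra m\<^esub> \<one>\<^bsub>diag_algebra m\<^esub> | c. True}"
  proof (intro equalityI subsetI)
    fix v :: "'k vec" assume "v \<in> coinvariants H (diag_algebra m) \<beta>"
    then have v: "v \<in> carrier_vec m"
      and eq: "\<And>p q. p < m \<Longrightarrow> q < m \<Longrightarrow> a (\<sigma> q) (\<sigma> p) \<noteq> \<zero>\<^bsub>H\<^esub> \<Longrightarrow> v $ p = v $ q"
      unfolding BL.coinvariants_iff[OF \<beta>(2)] by auto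
    define w where "w = vec n (\<lambda>i. if i \<in> B then v $ \<tau> i else 0)"
    have w: "w \<in> carrier_vec n" by (simp add: w_def)
    have wi: "w $ i = w $ j" if ij: "i < n" "j < n" "a j i \<noteq> \<zero>\<^bsub>H\<^esub>" for i j
    proof -
      have iff: "i \<in> B \<longleftrightarrow> j \<in> B" using off[OF ij(1,2)] ij(3) by blast
      show ?thesis
      proof (cases "i \<in> B")
        case True
        then have "v $ \<tau> i = v $ \<tau> j" using eq[of "\<tau> i" "\<tau> j"] \<tau> iff ij(3) by simp
        then show ?thesis using True iff ij by (simp add: w_def)
      qed (use iff ij in \<open>simp add: w_def\<close>)
    qed
    have v0: "v $ p = v $ 0" if p: "p < m" for p
    proof -
      have "w $ \<sigma> p = w $ \<sigma> 0" by (rule const[OF w wi]) (use p m \<sigma>_in(1) in auto)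
      then show ?thesis using p m \<sigma>_in \<tau>\<sigma> by (simp add: w_def)
    qed
    have "v = (v $ 0) \<cdot>\<^sub>v vec m (\<lambda>i. 1)"
    proof (rule eq_vecI)
      fix p assume "p < dim_vec ((v $ 0) \<cdot>\<^sub>v vec m (\<lambda>i. 1))"
      then have p: "p < m" by simp
      show "v $ p = ((v $ 0) \<cdot>\<^sub>v vec m (\<lambda>i. 1)) $ p" unfolding v0[OF p] using p by simp
    qed (use v in simp)
    then show "v \<in> {c \<odot>\<^bsub>diag_algebra m\<^esub> \<one>\<^bsub>diag_algebra m\<^esub> | c. True}" unfolding diag_simps by blast
  next
    fix v :: "'k vec" assume "v \<in> {c \<odot>\<^bsub>diag_algebra m\<^esub> \<one>\<^bsub>diag_algebra m\<^esub> | c. True}"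
    then obtain c where "v = c \<cdot>\<^sub>v vec m (\<lambda>i. 1)" unfolding diag_simps by blast
    then show "v \<in> coinvariants H (diag_algebra m) \<beta>"
      unfolding BL.coinvariants_iff[OF \<beta>(2)] by simp
  qed
  then show ?thesis unfolding ergodic_def using \<beta>(1) by blast
qed

end

end

section \<open>Images of algebra maps, and colinearity of \<psi> in matrix form\<close>

lemma algebra_hom_image:
  assumes A: "unital_algebra A" and f: "f \<in> algebra_hom A H" and vH: "vspace H"
  shows "submodule class_ring (f ` carrier A) H"
    and "G \<subseteq> f ` carrier A \<Longrightarrow> generated_subalgebra H G \<subseteq> f ` carrier A"
proof -
  note D = unital_algebraD[OF A] and V = vspaceD[OF unital_algebraD(2)[OF A]] and F = algebra_homD[OF f]
  show sub: "submodule class_ring (f ` carrier A) H"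
  proof (rule submoduleI[OF vH])
    show "\<zero>\<^bsub>H\<^esub> \<in> f ` carrier A"
      using lin_zero[OF D(2) vH F(1)] V(12) by (metis imageI)
    show "v \<oplus>\<^bsub>H\<^esub> w \<in> f ` carrier A" if "v \<in> f ` carrier A" "w \<in> f ` carrier A" for v w
      using that F(5) V(10) by (auto simp: image_iff) metis
    show "c \<odot>\<^bsub>H\<^esub> v \<in> f ` carrier A" if "v \<in> f ` carrier A" for c v
      using that F(6) V(3) by (auto simp: image_iff) metis
  qed (use F(4) in auto)
  show "generated_subalgebra H G \<subseteq> f ` carrier A" if G: "G \<subseteq> f ` carrier A"
  proof
    fix x assume "x \<in> generated_subalgebra H G"
    then show "x \<in> f ` carrier A"
    proof induction
      case one
      show ?case using F(2) D(3) by (metis imageI)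
    next
      case (mult x y)
      then obtain p q where "p \<in> carrier A" "q \<in> carrier A" "x = f p" "y = f q" by blast
      then have "x \<otimes>\<^bsub>H\<^esub> y = f (p \<otimes>\<^bsub>A\<^esub> q)" "p \<otimes>\<^bsub>A\<^esub> q \<in> carrier A" using F(3) D(4) by auto
      then show ?case by blast
    qed (use G submoduleD(3,4)[OF sub] in auto)
  qed
qed

text \<open>Colinearity at the idempotent with index \<open>i\<close> becomes a column sum once K
  \<otimes> H is identified with H by slicing along the identity functional of K.\<close>

lemma colinear_column_sums:
  fixes H :: "('k::field, 'a, 'm) hopf_scheme" and n :: nat
  assumes dc: "diag_comatrix H n a"
    and mc: "matrix_coaction (diag_algebra n) n (unit_vec n) (\<lambda>i v. v $ i) H \<alpha> a"
    and col: "colinear H (diag_algebra n) \<alpha> base_algebra (trivial_coaction H) (\<lambda>v. \<Sum>i<n. v $ i)"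
    and i: "i < n"
  shows "(\<Oplus>\<^bsub>H\<^esub>j\<in>{..<n}. a j i) = \<one>\<^bsub>H\<^esub>"
proof -
  interpret diag_comatrix H n a by fact
  interpret M: matrix_coaction "diag_algebra n" n "unit_vec n" "\<lambda>i v. v $ i" H \<alpha> a by fact
  let ?\<psi> = "\<lambda>v :: 'k vec. \<Sum>i<n. v $ i"
  have \<psi>: "?\<psi> \<in> lin (diag_algebra n) base_algebra"
    and eq: "tensor_map base_algebra H ?\<psi> id (\<alpha> v) = trivial_coaction H (?\<psi> v)" if "v \<in> carrier (diag_algebra n)" for v
    using col that by (auto simp: colinear_def)
  have e: "unit_vec n j \<in> carrier (diag_algebra n :: ('k, 'k vec) module)" for j by (simp add: diag_simps)
  note \<psi> = \<psi>[OF e[of 0]]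
  have \<psi>e: "?\<psi> (unit_vec n j) = 1" if "j < n" for j
    using that by (simp add: unit_vec_def)
  note vb = unital_algebraD(2)[OF unital_algebra_base]
  note tm = tensor_map_facts[OF B.vV vH vb vH \<psi> lin_id]
  have id: "(\<lambda>c. c) \<in> lin base_algebra base_algebra" by (rule linI) auto
  have "slice H ?\<psi> (\<alpha> (unit_vec n i)) = slice H (\<lambda>c. c) (tensor_map base_algebra H ?\<psi> id (\<alpha> (unit_vec n i)))"
  proof (rule M.TVH.tensor_lin_eqI[OF slice_lin[OF B.vV vH \<psi>] lin_comp[OF tm(1) slice_lin[OF vb vH id]]])
    show "\<alpha> (unit_vec n i) \<in> carrier (tensor (diag_algebra n) H)" by (rule linD(1)[OF M.\<rho> e])
    fix v h assume "v \<in> carrier (diag_algebra n :: ('k, 'k vec) module)" "h \<in> carrier H"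
    then show "slice H ?\<psi> (tens (diag_algebra n) H v h) = slice H (\<lambda>c. c) (tensor_map base_algebra H ?\<psi> id (tens (diag_algebra n) H v h))"
      by (simp add: tm(2) slice_tens[OF B.vV vH \<psi>] slice_tens[OF vb vH id] base_algebra_simps)
  qed
  also have "\<dots> = \<one>\<^bsub>H\<^esub>"
    unfolding eq[OF e] \<psi>e[OF i] trivial_coaction_def
    by (simp add: slice_tens[OF vb vH id] base_algebra_simps D(3) VH(7))
  finally have "(\<Oplus>\<^bsub>H\<^esub>j\<in>{..<n}. ?\<psi> (unit_vec n j) \<odot>\<^bsub>H\<^esub> a j i) = \<one>\<^bsub>H\<^esub>" by (simp only: M.slice_\<rho>[OF \<psi> i])
  moreover have "(\<Oplus>\<^bsub>H\<^esub>j\<in>{..<n}. ?\<psi> (unit_vec n j) \<odot>\<^bsub>H\<^esub> a j i) = (\<Oplus>\<^bsub>H\<^esub>j\<in>{..<n}. a j i)"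
    by (rule vfinsum_cong[OF vH]) (use \<psi>e i in \<open>auto simp: VH(7) a_in\<close>)
  ultimately show ?thesis by simp
qed

theorem proposition4p1:
  fixes H :: "('k::field, 'a) hopf"
    and n :: nat
    and \<alpha> :: "'k vec \<Rightarrow> ('k vec \<times> 'a \<Rightarrow>\<^sub>0 'k) set"
  assumes "n \<ge> 1"
    and "hopf_algebra H"
    and "faithful_coaction H (diag_algebra n) \<alpha>"
    and "colinear H (diag_algebra n) \<alpha> base_algebra (trivial_coaction H) (\<lambda>v. \<Sum>i<n. v $ i) \<or>
      (\<forall>h\<in>carrier H. antipode H (antipode H h) = h) \<or>
      ((CHAR('k) = 0 \<or> CHAR('k) > n) \<and> cosemisimple H)"
  shows "\<exists>ms :: nat list.
    sorted_wrt (\<ge>) ms \<and> (\<forall>m\<in>set ms. m > 0) \<and> sum_list ms = n \<and>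
    length ms = vectorspace.dim (class_ring :: 'k ring)
      ((diag_algebra n)\<lparr>carrier := coinvariants H (diag_algebra n) \<alpha>\<rparr>) \<and>
    (\<forall>i<length ms. \<exists>\<beta>.
      coaction H (diag_algebra (ms ! i)) \<beta> \<and> ergodic H (diag_algebra (ms ! i)) \<beta>) \<and>
    (\<exists>f \<in> hopf_hom (free_product {..<length ms} (\<lambda>i. As (ms ! i))) H.
      f ` carrier (free_product {..<length ms} (\<lambda>i. As (ms ! i))) = carrier H)"
proof -
  let ?A = "diag_algebra n :: ('k, 'k vec) module"
  note hopf = assms(2)
  have co: "coaction H ?A \<alpha>" and gen: "generated_subalgebra H (coefficients H ?A \<alpha>) = carrier H"
    using assms(3) by (auto simp: faithful_coaction_def)
  define a where "a j i = slice H (\<lambda>v :: 'k vec. v $ j) (\<alpha> (unit_vec n i))" for j i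
  have mc: "matrix_coaction ?A n (unit_vec n) (\<lambda>i v. v $ i) H \<alpha> a" and dc: "diag_comatrix H n a"
    using coaction_matrix[OF hopf co] unfolding a_def[abs_def] by simp_all
  interpret M: matrix_coaction ?A n "unit_vec n" "\<lambda>i v. v $ i" H \<alpha> a by (rule mc)
  interpret C: diag_comatrix H n a by (rule dc)
  have coeff: "coefficients H ?A \<alpha> \<subseteq> N" if "submodule class_ring N H" "\<And>i j. i < n \<Longrightarrow> j < n \<Longrightarrow> a i j \<in> N" for N
    unfolding coefficients_def using M.coefficient_in[OF that] by (auto simp: slice_def)
  \<comment> \<open>The coefficients of the coaction are combinations of the entries of
    \<open>a\<close>, and by faithfulness they generate \<open>H\<close>.\<close>
  have pre: "prehopf H"
  proof (rule C.prehopf_if_generated[OF coeff gen])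
    note sp = span_facts[OF C.vH C.entries_carrier]
    show "submodule class_ring (lspan H C.entries) H" by (rule sp(1))
    show "a i j \<in> lspan H C.entries" if "i < n" "j < n" for i j
      using C.entriesI[OF C.com, of i j] that sp(2) by auto
  qed
  have tr: "antipode H (a i j) = a j i" if "i < n" "j < n" for i j
  proof (rule C.antipode_transpose[OF pre _ that])
    show "(\<forall>i<n. (\<Oplus>\<^bsub>H\<^esub>j\<in>{..<n}. a j i) = \<one>\<^bsub>H\<^esub>) \<or> (\<forall>h\<in>carrier H. antipode H (antipode H h) = h) \<or> cosemisimple H"
      using assms(4) colinear_column_sums[OF dc mc] by blast
  qed

  define Co where "Co = coinvariants H ?A \<alpha>"
  have Co_iff: "v \<in> Co \<longleftrightarrow> v \<in> carrier_vec n \<and> (\<forall>i<n. \<forall>j<n. a j i \<noteq> \<zero>\<^bsub>H\<^esub> \<longrightarrow> v $ i = v $ j)" for v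
    unfolding Co_def by (rule C.coinvariants_iff[OF mc])
  \<comment> \<open>Two indices are equivalent if no coinvariant separates them. Blocks defined
    through the coinvariants, and not through chains of nonzero entries, serve ergodicity and the
    dimension count directly.\<close>
  define cls where "cls i = {j. j < n \<and> (\<forall>v\<in>Co. v $ i = v $ j)}" for i
  have cls_self: "i \<in> cls i" if "i < n" for i using that by (simp add: cls_def)
  have cls_eq: "cls j = cls i" if "j \<in> cls i" for i j using that by (auto simp: cls_def)
  define Q where "Q = cls ` {..<n}"
  have Q_sub: "B \<subseteq> {..<n}" if "B \<in> Q" for B using that by (auto simp: Q_def cls_def)
  have Q_cls: "B = cls i" if "B \<in> Q" "i \<in> B" for B i using that cls_eq by (auto simp: Q_def)
  \<comment> \<open>A nonzero entry forces every coinvariant to take equal values at its two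
    indices, which therefore lie in the same class.\<close>
  have off: "a j i = \<zero>\<^bsub>H\<^esub>" if B: "B \<in> Q" and ij: "i < n" "j < n" "(i \<in> B) \<noteq> (j \<in> B)" for B i j
  proof (rule ccontr)
    assume "a j i \<noteq> \<zero>\<^bsub>H\<^esub>"
    then have "v $ i = v $ j" if "v \<in> Co" for v using that ij Co_iff by blast
    then have "j \<in> cls i" "i \<in> cls j" using ij by (auto simp: cls_def)
    then show False using ij(3) Q_cls[OF B] by blast
  qed
  have finQ: "finite Q" by (simp add: Q_def)
  obtain xs where xs: "set xs = Q" "distinct xs" using finite_distinct_list[OF finQ] by blast
  define Bs where "Bs = rev (sort_key card xs)"
  define ms where "ms = map card Bs"
  define k where "k = length Bs"
  have Bs: "set Bs = Q" "distinct Bs" using xs by (simp_all add: Bs_def)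
  have Bs_Q: "Bs ! t \<in> Q" if "t < k" for t using that Bs(1) nth_mem by (auto simp: k_def)
  have len: "length ms = k" by (simp add: ms_def k_def)
  have ms_nth: "ms ! t = card (Bs ! t)" if "t < k" for t using that by (simp add: ms_def k_def)
  have finB: "finite B" "B \<noteq> {}" if "B \<in> Q" for B
    using finite_subset[OF Q_sub[OF that]] that cls_self by (auto simp: Q_def)
  have index: "\<exists>t<k. i \<in> Bs ! t" if "i < n" for i
  proof -
    have "cls i \<in> set Bs" using that Bs(1) by (simp add: Q_def)
    then obtain t where "t < k" "Bs ! t = cls i" by (auto simp: in_set_conv_nth k_def)
    then show ?thesis using cls_self[OF that] by auto
  qed
  have disj: "s = t" if "s < k" "t < k" "i \<in> Bs ! s" "i \<in> Bs ! t" for s t i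
  proof -
    have "Bs ! s = Bs ! t" using Q_cls[OF Bs_Q[OF that(1)] that(3)] Q_cls[OF Bs_Q[OF that(2)] that(4)] by simp
    then show ?thesis using Bs(2) that by (simp add: nth_eq_iff_index_eq k_def)
  qed

  have sorted: "sorted_wrt (\<ge>) ms"
  proof -
    have "sorted_wrt (\<lambda>x y. card x \<ge> card y) Bs"
      unfolding Bs_def sorted_wrt_rev using sorted_sort_key[of card xs] by (simp add: sorted_wrt_map)
    then show ?thesis by (simp add: ms_def sorted_wrt_map)
  qed
  have pos: "\<forall>m\<in>set ms. m > 0" using finB by (auto simp: ms_def Bs(1) card_gt_0_iff)
  have sum: "sum_list ms = n"
  proof -
    have "sum_list ms = (\<Sum>B\<in>Q. card B)" using sum_list_distinct_conv_sum_set[OF Bs(2), of card] by (simp add: ms_def Bs(1))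
    also have "\<dots> = card (\<Union>Q)"
    proof (rule card_Union_disjoint[symmetric])
      show "pairwise disjnt Q" unfolding pairwise_def disjnt_def using Q_cls by blast
    qed (use finB in auto)
    also have "\<Union>Q = {..<n}" using Q_sub cls_self by (auto simp: Q_def)
    finally show ?thesis by simp
  qed

  have dim: "vectorspace.dim (class_ring :: 'k ring) (?A\<lparr>carrier := Co\<rparr>) = k"
  proof -
    let ?V = "?A\<lparr>carrier := Co\<rparr>"
    \<comment> \<open>The indicator vectors of the blocks will be a basis of the coinvariants; the
      coordinates are the values at one chosen index of each block.\<close>
    define rep where "rep t = (SOME i. i \<in> Bs ! t)" for t
    have rep: "rep t \<in> Bs ! t" if "t < k" for t
      unfolding rep_def using finB(2)[OF Bs_Q[OF that]] by (simp add: some_in_eq)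
    have rep_n: "rep t < n" if "t < k" for t using rep[OF that] Q_sub[OF Bs_Q[OF that]] by blast
    define fb where "fb t = vec n (\<lambda>i. if i \<in> Bs ! t then 1 else 0 :: 'k)" for t
    have subm: "submodule class_ring Co ?A"
      by (rule submoduleI[OF M.vV]) (auto simp: Co_iff diag_simps)
    have vV: "vspace ?V"
      using vectorspace.subspace_is_vs[OF M.vV, of Co] subm M.vV by (simp add: VectorSpace.subspace_def)
    have coord: "(\<lambda>v. v $ i) \<in> lin ?V base_algebra" if "i < n" for i
      by (rule linI) (use that in \<open>auto simp: Co_iff diag_simps base_algebra_simps\<close>)
    \<comment> \<open>Indicator vectors are coinvariant because no nonzero entry connects different
      blocks.\<close>
    have fb_in: "fb t \<in> Co" if "t < k" for t
      unfolding Co_iff fb_def using off[OF Bs_Q[OF that]] by auto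
    have "fin_basis ?V k fb (\<lambda>t v. v $ rep t)"
    proof (rule fin_basis.intro[OF vV])
      show "fb t \<in> carrier ?V" if "t < k" for t using fb_in[OF that] by simp
      show "(\<lambda>v. v $ rep t) \<in> lin ?V base_algebra" if "t < k" for t by (rule coord[OF rep_n[OF that]])
      show "fb t $ rep s = (if s = t then 1 else 0)" if "s < k" "t < k" for s t
        using rep_n[OF that(1)] rep[OF that(1)] disj[OF that] by (auto simp: fb_def)
      fix v assume "v \<in> carrier ?V"
      then have v: "v \<in> Co" by simp
      let ?s = "\<Oplus>\<^bsub>?V\<^esub>t\<in>{..<k}. v $ rep t \<odot>\<^bsub>?V\<^esub> fb t"
      have sm: "c \<odot>\<^bsub>?V\<^esub> fb t \<in> carrier ?V" if "t < k" for c t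
        by (rule vspaceD(3)[OF vV]) (simp add: fb_in that)
      have s: "?s \<in> carrier ?V" by (rule vfinsum_closed[OF vV]) (rule sm, simp)
      show "v = ?s"
      proof (rule eq_vecI)
        have d: "dim_vec ?s = n" using s by (simp add: Co_iff)
        show "dim_vec v = dim_vec ?s" unfolding d using v by (simp add: Co_iff)
        fix i assume "i < dim_vec ?s"
        then have i: "i < n" unfolding d .
        obtain t where t: "t < k" "i \<in> Bs ! t" using index[OF i] by blast
        have "?s $ i = (\<Oplus>\<^bsub>base_algebra\<^esub>u\<in>{..<k}. (v $ rep u \<odot>\<^bsub>?V\<^esub> fb u) $ i)"
          by (rule lin_finsum[OF vV unital_algebraD(2)[OF unital_algebra_base] coord[OF i]]) (simp, rule sm, simp)
        also have "\<dots> = (\<Sum>u<k. (v $ rep u \<odot>\<^bsub>?V\<^esub> fb u) $ i)" by (rule finsum_base) simp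
        also have "\<dots> = (\<Sum>u<k. if u = t then v $ rep u else 0)"
        proof (rule sum.cong)
          fix u assume "u \<in> {..<k}"
          then have "i \<in> Bs ! u \<longleftrightarrow> u = t" using disj[of u t i] t by auto
          then show "(v $ rep u \<odot>\<^bsub>?V\<^esub> fb u) $ i = (if u = t then v $ rep u else 0)"
            using i by (simp add: diag_simps fb_def)
        qed simp
        also have "\<dots> = v $ rep t" using t by simp
        also have "\<dots> = v $ i"
        proof -
          have "i \<in> cls (rep t)" using Q_cls[OF Bs_Q[OF t(1)] rep[OF t(1)]] t(2) by simp
          then show ?thesis using v by (simp add: cls_def)
        qed
        finally show "v $ i = ?s $ i" ..
      qed
    qed
    then show ?thesis by (rule fin_basis.dim_eq)
  qed

  define \<sigma> where "\<sigma> t p = sorted_list_of_set (Bs ! t) ! p" for t p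
  have \<sigma>: "bij_betw (\<sigma> t) {..<card (Bs ! t)} (Bs ! t)" if t: "t < k" for t
    unfolding \<sigma>_def[abs_def] by (rule bij_betw_nth) (use finB[OF Bs_Q[OF t]] in auto)

  have erg: "\<exists>\<beta>. coaction H (diag_algebra (ms ! t)) \<beta> \<and> ergodic H (diag_algebra (ms ! t)) \<beta>" if t: "t < k" for t
    unfolding ms_nth[OF t]
  proof (rule C.block_ergodic[OF Q_sub[OF Bs_Q[OF t]] \<sigma>[OF t]])
    show "a j i = \<zero>\<^bsub>H\<^esub>" if "i < n" "j < n" "(i \<in> Bs ! t) \<noteq> (j \<in> Bs ! t)" for i j
      by (rule off[OF Bs_Q[OF t] that])
    show "card (Bs ! t) > 0" using finB[OF Bs_Q[OF t]] by (simp add: card_gt_0_iff)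
    fix v :: "'k vec" and i j
    assume v: "v \<in> carrier_vec n" "\<And>i j. i < n \<Longrightarrow> j < n \<Longrightarrow> a j i \<noteq> \<zero>\<^bsub>H\<^esub> \<Longrightarrow> v $ i = v $ j"
      and ij: "i \<in> Bs ! t" "j \<in> Bs ! t"
    have "v \<in> Co" unfolding Co_iff using v by blast
    moreover have "j \<in> cls i" using Q_cls[OF Bs_Q[OF t] ij(1)] ij(2) by simp
    ultimately show "v $ i = v $ j" by (simp add: cls_def)
  qed

  interpret FP: free_product_family "{..<k}" "\<lambda>t. As (ms ! t) :: ('k, _) hopf"
    by (rule free_product_family.intro) (rule prehopf_As)
  let ?FP = "free_product {..<k} (\<lambda>t. As (ms ! t) :: ('k, _) hopf)"
  define g where "g t = presented_lift H (\<lambda>(p, q). a (\<sigma> t p) (\<sigma> t q))" for t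
  have g: "g t \<in> hopf_hom (As (ms ! t)) H"
    "\<And>p q. p < ms ! t \<Longrightarrow> q < ms ! t \<Longrightarrow> g t (As_gen (ms ! t) p q) = a (\<sigma> t p) (\<sigma> t q)" if t: "t < k" for t
    unfolding g_def ms_nth[OF t]
    by (rule C.block_hopf_hom[OF Q_sub[OF Bs_Q[OF t]] \<sigma>[OF t] off[OF Bs_Q[OF t]] pre tr]; assumption)+
  let ?f = "presented_lift H (\<lambda>(t, x). g t x)"
  have f: "?f \<in> hopf_hom ?FP H"
    by (rule FP.free_product_hopf_hom[OF pre]) (simp add: g)
  have f_gen: "?f (FP.emb t x) = g t x" if "t < k" "x \<in> carrier (As (ms ! t))" for t x
    by (rule FP.free_product_hopf_hom(2)[OF pre]) (use g that in auto)
  have uFP: "unital_algebra ?FP"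
    by (rule unital_algebra_cong[OF FP.P.unital_algebra_P FP.free_product_simps(1-6)])
  note im = algebra_hom_image[OF uFP hopf_homD(1)[OF f] C.vH]
  \<comment> \<open>Entries within a block are images of generators of \<open>As\<close>, and all
    other entries are zero; both belong to the image of the morphism.\<close>
  have "a j i \<in> ?f ` carrier ?FP" if ij: "j < n" "i < n" for j i
  proof -
    obtain t where t: "t < k" "i \<in> Bs ! t" using index[OF ij(2)] by blast
    show ?thesis
    proof (cases "j \<in> Bs ! t")
      case True
      obtain p q where pq: "p < ms ! t" "\<sigma> t p = j" "q < ms ! t" "\<sigma> t q = i"
        using bij_betw_imp_surj_on[OF \<sigma>[OF t(1)]] True t ms_nth[OF t(1)] by (metis imageE lessThan_iff)
      let ?u = "As_gen (ms ! t) p q"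
      have u: "?u \<in> carrier (As (ms ! t))" unfolding As_simps by (rule As_gen_in[OF pq(1,3)])
      have e: "?f (FP.emb t ?u) = a j i" using f_gen[OF t(1) u] g(2)[OF t(1) pq(1,3)] pq by simp
      have "FP.emb t ?u \<in> carrier ?FP"
        unfolding FP.free_product_simps by (rule FP.P.gen_in) (use t u in auto)
      from imageI[OF this, of ?f] show ?thesis unfolding e .
    next
      case False
      then have "a j i = \<zero>\<^bsub>H\<^esub>" using off[OF Bs_Q[OF t(1)] ij(2,1)] t(2) by simp
      then show ?thesis using submoduleD(2)[OF im(1)] by simp
    qed
  qed
  \<comment> \<open>The image is a subspace, so together with the entries it contains the
    coefficients; it is a subalgebra, and the coefficients generate \<open>H\<close>.\<close>
  then have "coefficients H ?A \<alpha> \<subseteq> ?f ` carrier ?FP" by (rule coeff[OF im(1)])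
  then have "carrier H \<subseteq> ?f ` carrier ?FP" using im(2) gen by blast
  then have "?f ` carrier ?FP = carrier H" using algebra_homD(4)[OF hopf_homD(1)[OF f]] by blast
  then have "\<exists>f \<in> hopf_hom (free_product {..<length ms} (\<lambda>i. As (ms ! i))) H.
      f ` carrier (free_product {..<length ms} (\<lambda>i. As (ms ! i))) = carrier H"
    using f unfolding len by blast
  then show ?thesis
    using sorted pos sum dim erg len unfolding Co_def by (intro exI[of _ ms]) simp
qed

end
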